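(* Let $X$ be a complex manifold, $E$ a holomorphic vector bundle over $X$ and $h$ a continuous Hermitian metric on $E$. If $h$ is $L^2$-optimal, then $h$ is Griffiths semi-positive.
   Context: $L^2$-optimal triples. Let $D\subset\mathbb{C}^n$ be a domain, $E$ a trivial holomorphic vector bundle on $D$ and $h$ a Hermitian metric on $E$. The triple $(D,E,h)$ is called $L^2$-optimal if for every $\bar\partial$-closed $E$-valued $(n,1)$-form $f\in L^2_{(n,1)}(D,E;\mathrm{loc})$ (locally square integrable), every smooth strictly plurisubharmonic function $\phi$ on $D$ and every Kähler metric $\omega$ on $D$, the equation $\bar\partial u=f$ admits a solution $u$ (an $E$-valued $(n,0)$-form) satisfying $$\int_D|u|^2_{\omega,h}e^{-\phi}\,dV_\omega\le\int_D\langle B_{\omega,\phi}^{-1}f,f\rangle_{\omega,h}e^{-\phi}\,dV_\omega,$$ provided the right-hand side is finite. Here $B_{\omega,\phi}:=[i\partial\bar\partial\phi\otimes \mathrm{Id}_E,\Lambda_\omega]$ acting on $E$-valued $(n,1)$-forms, $\Lambda_\omega$ is the adjoint of $\omega\wedge\cdot$, $dV_\omega$ is the volume form of $\omega$, and $|\cdot|_{\omega,h}$, $\langle\cdot,\cdot\rangle_{\omega,h}$ are the pointwise norm and inner product induced by $\omega$ and $h$. $L^2$-optimal metrics. A Hermitian metric $h$ on a holomorphic vector bundle $E$ over a complex manifold $X$ is $L^2$-optimal if for every Stein coordinate neighborhood $U\subset X$ with $E|_U$ trivial, the triple $(U,E|_U,h)$ is $L^2$-optimal (identifying $U$ with an open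 subset of $\mathbb{C}^n$ through the coordinates). Griffiths semi-positivity. A (not necessarily smooth) Hermitian metric $h$ on $E$ is Griffiths semi-positive if $\log|u|_{h^*}$ is plurisubharmonic for every local holomorphic section $u$ of the dual bundle $E^*$, where $h^*$ is the dual metric (the function identically $-\infty$ is allowed). *)

theory Defs
  imports "HOL-Analysis.Analysis"
begin

section \<open>Functions on open subsets of \<open>\<complex>\<^sup>n\<close>\<close>

primrec Ck_on :: "nat \<Rightarrow> 'a::real_normed_vector set \<Rightarrow> ('a \<Rightarrow> 'b::real_normed_vector) \<Rightarrow> bool" where
  "Ck_on 0 S f \<longleftrightarrow> continuous_on S f"
| "Ck_on (Suc k) S f \<longleftrightarrow>
     (\<forall>x\<in>S. f differentiable (at x)) \<and> (\<forall>v. Ck_on k S (\<lambda>x. frechet_derivative f (at x) v))"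

definition smooth_on :: "'a::real_normed_vector set \<Rightarrow> ('a \<Rightarrow> 'b::real_normed_vector) \<Rightarrow> bool" where
  "smooth_on S f \<longleftrightarrow> (\<forall>k. Ck_on k S f)"

text \<open>Holomorphy in several variables (on open sets): real differentiability with a
  \<open>\<complex>\<close>-linear derivative.\<close>

definition mholomorphic_on :: "(complex^'n \<Rightarrow> complex) \<Rightarrow> (complex^'n) set \<Rightarrow> bool" where
  "mholomorphic_on f S \<longleftrightarrow>
     (\<forall>z\<in>S. \<exists>f'. (f has_derivative f') (at z) \<and> (\<forall>c v. f' (c *s v) = c * f' v))"

text \<open>Derivative along the (1,0)- and the (0,1)-part of a real tangent vector \<open>v\<close>,
  i.e. \<open>\<Sum>\<^sub>j v\<^sub>j \<partial>f/\<partial>z\<^sub>j\<close> and \<open>\<Sum>\<^sub>j cnj v\<^sub>j \<partial>f/\<partial>(cnj z\<^sub>j)\<close>.\<close>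

definition del_dir :: "complex^'n \<Rightarrow> (complex^'n \<Rightarrow> complex) \<Rightarrow> complex^'n \<Rightarrow> complex" where
  "del_dir v f z =
     (frechet_derivative f (at z) v - \<i> * frechet_derivative f (at z) (\<i> *s v)) / 2"

definition dbar_dir :: "complex^'n \<Rightarrow> (complex^'n \<Rightarrow> complex) \<Rightarrow> complex^'n \<Rightarrow> complex" where
  "dbar_dir v f z =
     (frechet_derivative f (at z) v + \<i> * frechet_derivative f (at z) (\<i> *s v)) / 2"

text \<open>Mean over a circle of an \<open>[-\<infinity>,\<infinity>)\<close>-valued function; the positive part has a finite
  integral whenever the function is upper semicontinuous, so no \<open>\<infinity> - \<infinity>\<close> arises.\<close>

definition circle_mean :: "(complex \<Rightarrow> ereal) \<Rightarrow> ereal" where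
  "circle_mean g =
     ereal (1 / (2 * pi)) *
       (enn2ereal (\<integral>\<^sup>+ t. e2ennreal (g (cis t)) \<partial>lebesgue_on {0..2*pi})
      - enn2ereal (\<integral>\<^sup>+ t. e2ennreal (- g (cis t)) \<partial>lebesgue_on {0..2*pi}))"

text \<open>The constant \<open>-\<infinity>\<close> is allowed.\<close>

definition psh_on :: "(complex^'n) set \<Rightarrow> (complex^'n \<Rightarrow> ereal) \<Rightarrow> bool" where
  "psh_on D \<psi> \<longleftrightarrow>
     (\<forall>z\<in>D. \<psi> z \<noteq> \<infinity>) \<and>
     (\<forall>c. open {z\<in>D. \<psi> z < c}) \<and>
     (\<forall>z w. (\<forall>\<zeta>. cmod \<zeta> \<le> 1 \<longrightarrow> z + \<zeta> *s w \<in> D) \<longrightarrow>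
        \<psi> z \<le> circle_mean (\<lambda>\<zeta>. \<psi> (z + \<zeta> *s w)))"


section \<open>Exterior algebra at a point\<close>

text \<open>A \<open>k\<close>-covector on the real vector space underlying \<open>\<complex>\<^sup>n\<close>, with values in \<open>'b\<close>
  (\<open>\<complex>\<close>, or the fibre \<open>\<complex>\<^sup>r\<close> of a trivial bundle), is a function on sequences of vectors that
  depends only on the entries \<open>0, \<dots>, k-1\<close>.\<close>

type_synonym ('n, 'b) covector = "(nat \<Rightarrow> complex^'n) \<Rightarrow> 'b"

definition alt_form :: "nat \<Rightarrow> ('n::finite, 'b::real_vector) covector \<Rightarrow> bool" where
  "alt_form k \<alpha> \<longleftrightarrow>
     (\<forall>v w. (\<forall>i<k. v i = w i) \<longrightarrow> \<alpha> v = \<alpha> w) \<and>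
     (\<forall>v. \<forall>i<k. linear (\<lambda>x. \<alpha> (v(i := x)))) \<and>
     (\<forall>v i j. i < j \<and> j < k \<and> v i = v j \<longrightarrow> \<alpha> v = 0)"

text \<open>Bidegree: under \<open>v \<mapsto> c v\<close> a \<open>(p,q)\<close>-covector is multiplied by \<open>c\<^sup>p (cnj c)\<^sup>q\<close>;
  for fixed \<open>p + q\<close> these characters of \<open>\<complex>\<^sup>*\<close> are distinct, so this singles out exactly
  the span of the \<open>dz\<^sub>I \<and> dz\<^sup>-\<^sub>J\<close> with \<open>|I| = p\<close> and \<open>|J| = q\<close>.\<close>

definition pq_form :: "nat \<Rightarrow> nat \<Rightarrow> ('n::finite, complex^'r) covector \<Rightarrow> bool" where
  "pq_form p q \<alpha> \<longleftrightarrow>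
     alt_form (p + q) \<alpha> \<and> (\<forall>c v. \<alpha> (\<lambda>i. c *s v i) = (c ^ p * cnj c ^ q) *s \<alpha> v)"

definition wedge :: "nat \<Rightarrow> nat \<Rightarrow> ('n::finite, complex) covector \<Rightarrow>
    ('n, complex^'r) covector \<Rightarrow> ('n, complex^'r) covector" where
  "wedge k l \<alpha> \<beta> v =
     (1 / (fact k * fact l)) *\<^sub>R
       (\<Sum>\<sigma> | \<sigma> permutes {..<k + l}.
          (of_int (sign \<sigma>) * \<alpha> (v \<circ> \<sigma>)) *s \<beta> (\<lambda>i. v (\<sigma> (k + i))))"

definition vpair :: "'a \<Rightarrow> 'a \<Rightarrow> nat \<Rightarrow> 'a" where
  "vpair u v = (\<lambda>i. if i = 0 then u else v)"

text \<open>In the rest of this section \<open>\<omega>\<close> is the value of a Kaehler form at a point, and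
  \<open>h\<close> a Hermitian inner product on \<open>\<complex>\<^sup>r\<close>. The Riemannian metric of \<open>\<omega>\<close> is
  \<open>g(u,v) = \<omega>(u, i v)\<close>; thus \<open>\<omega> = (i/2) \<Sum>\<^sub>j dz\<^sub>j \<and> dz\<^sup>-\<^sub>j\<close> gives the Euclidean metric.\<close>

definition riem :: "('n::finite, complex) covector \<Rightarrow> complex^'n \<Rightarrow> complex^'n \<Rightarrow> real" where
  "riem \<omega> u v = Re (\<omega> (vpair u (\<i> *s v)))"

definition onframe :: "('n::finite, complex) covector \<Rightarrow> nat \<Rightarrow> complex^'n" where
  "onframe \<omega> = (SOME e. \<forall>i<2 * CARD('n). \<forall>j<2 * CARD('n).
      riem \<omega> (e i) (e j) = (if i = j then 1 else 0))"

text \<open>Induced inner product on \<open>k\<close>-covectors, computed in a \<open>g\<close>-orthonormal real frame (it does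
  not depend on the frame). Summing over all \<open>k\<close>-tuples and dividing by \<open>k!\<close> amounts to summing
  over increasing ones.\<close>

definition form_inner :: "('n::finite, complex) covector \<Rightarrow>
    (complex^'r \<Rightarrow> complex^'r \<Rightarrow> complex) \<Rightarrow> nat \<Rightarrow>
    ('n, complex^'r) covector \<Rightarrow> ('n, complex^'r) covector \<Rightarrow> complex" where
  "form_inner \<omega> h k \<alpha> \<beta> =
     (\<Sum>I \<in> {..<k} \<rightarrow>\<^sub>E {..<2 * CARD('n)}.
        h (\<alpha> (onframe \<omega> \<circ> I)) (\<beta> (onframe \<omega> \<circ> I))) / fact k"

text \<open>\<open>\<Lambda>\<^sub>\<omega>\<close>, mapping \<open>(k+2)\<close>-covectors to \<open>k\<close>-covectors.\<close>

definition Lambda_op :: "('n::finite, complex) covector \<Rightarrow>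
    (complex^'r \<Rightarrow> complex^'r \<Rightarrow> complex) \<Rightarrow> nat \<Rightarrow>
    ('n, complex^'r) covector \<Rightarrow> ('n, complex^'r) covector" where
  "Lambda_op \<omega> h k \<beta> =
     (THE \<gamma>. alt_form k \<gamma> \<and>
        (\<forall>\<alpha>. alt_form k \<alpha> \<longrightarrow>
           form_inner \<omega> h (k + 2) (wedge 2 k \<omega> \<alpha>) \<beta> = form_inner \<omega> h k \<alpha> \<gamma>))"

text \<open>The commutator \<open>[\<Phi> \<and> \<cdot>, \<Lambda>\<^sub>\<omega>]\<close> on covectors of degree \<open>n + 1\<close>; since \<open>n \<ge> 1\<close>,
  the subtraction \<open>n - 1\<close> is not truncated.\<close>

definition B_op :: "('n::finite, complex) covector \<Rightarrow>
    (complex^'r \<Rightarrow> complex^'r \<Rightarrow> complex) \<Rightarrow> ('n, complex) covector \<Rightarrow>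
    ('n, complex^'r) covector \<Rightarrow> ('n, complex^'r) covector" where
  "B_op \<omega> h \<Phi> f =
     (\<lambda>v. wedge 2 (CARD('n) - 1) \<Phi> (Lambda_op \<omega> h (CARD('n) - 1) f) v
        - Lambda_op \<omega> h (CARD('n) + 1) (wedge 2 (CARD('n) + 1) \<Phi> f) v)"

definition B_inv :: "('n::finite, complex) covector \<Rightarrow>
    (complex^'r \<Rightarrow> complex^'r \<Rightarrow> complex) \<Rightarrow> ('n, complex) covector \<Rightarrow>
    ('n, complex^'r) covector \<Rightarrow> ('n, complex^'r) covector" where
  "B_inv \<omega> h \<Phi> f = (THE g. pq_form CARD('n) 1 g \<and> B_op \<omega> h \<Phi> g = f)"

text \<open>Density of the Riemannian volume form \<open>dV\<^sub>\<omega>\<close> (equal to \<open>\<omega>\<^sup>n / n!\<close>) with respect to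
  Lebesgue measure: the root of the Gram determinant of the standard real basis.\<close>

definition std_real_basis :: "'n + 'n \<Rightarrow> complex^'n" where
  "std_real_basis s = (case s of Inl j \<Rightarrow> axis j 1 | Inr j \<Rightarrow> axis j \<i>)"

definition vol_density :: "('n::finite, complex) covector \<Rightarrow> real" where
  "vol_density \<omega> =
     sqrt (det (\<chi> (s::'n + 'n) (t::'n + 'n). riem \<omega> (std_real_basis s) (std_real_basis t)))"


section \<open>Differential forms on open subsets of \<open>\<complex>\<^sup>n\<close>\<close>

definition omit :: "nat \<Rightarrow> (nat \<Rightarrow> 'a) \<Rightarrow> nat \<Rightarrow> 'a" where
  "omit i v = (\<lambda>j. if j < i then v j else v (Suc j))"

text \<open>\<open>\<partial>\<close> and \<open>\<partial>\<^sup>-\<close> of a differentiable scalar \<open>k\<close>-form, evaluated on constant vector fields.\<close>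

definition del_form :: "nat \<Rightarrow> (complex^'n \<Rightarrow> ('n::finite, complex) covector) \<Rightarrow>
    complex^'n \<Rightarrow> ('n, complex) covector" where
  "del_form k \<alpha> z v = (\<Sum>i\<le>k. (-1) ^ i * del_dir (v i) (\<lambda>w. \<alpha> w (omit i v)) z)"

definition dbar_form :: "nat \<Rightarrow> (complex^'n \<Rightarrow> ('n::finite, complex) covector) \<Rightarrow>
    complex^'n \<Rightarrow> ('n, complex) covector" where
  "dbar_form k \<alpha> z v = (\<Sum>i\<le>k. (-1) ^ i * dbar_dir (v i) (\<lambda>w. \<alpha> w (omit i v)) z)"

definition i_ddbar :: "(complex^'n \<Rightarrow> real) \<Rightarrow> complex^'n \<Rightarrow> ('n::finite, complex) covector" where
  "i_ddbar \<phi> z v = \<i> * del_form 1 (dbar_form 0 (\<lambda>w _. of_real (\<phi> w))) z v"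

definition smooth_strictly_psh_on :: "(complex^'n::finite) set \<Rightarrow> (complex^'n \<Rightarrow> real) \<Rightarrow> bool" where
  "smooth_strictly_psh_on D \<phi> \<longleftrightarrow>
     smooth_on D \<phi> \<and> (\<forall>z\<in>D. \<forall>u. u \<noteq> 0 \<longrightarrow> Re (i_ddbar \<phi> z (vpair u (\<i> *s u))) > 0)"

text \<open>A Kaehler metric is identified with its Kaehler form: a smooth, real, positive,
  \<open>d\<close>-closed \<open>(1,1)\<close>-form (with \<open>d = \<partial> + \<partial>\<^sup>-\<close>).\<close>

definition kaehler_metric_on ::
    "(complex^'n) set \<Rightarrow> (complex^'n \<Rightarrow> ('n::finite, complex) covector) \<Rightarrow> bool" where
  "kaehler_metric_on D \<omega> \<longleftrightarrow>
     (\<forall>v. smooth_on D (\<lambda>z. \<omega> z v)) \<and>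
     (\<forall>z\<in>D. alt_form 2 (\<omega> z) \<and>
        (\<forall>v. \<omega> z v \<in> \<real>) \<and>
        (\<forall>c v. \<omega> z (\<lambda>i. c *s v i) = c * cnj c * \<omega> z v) \<and>
        (\<forall>u. u \<noteq> 0 \<longrightarrow> riem (\<omega> z) u u > 0) \<and>
        (\<forall>v. del_form 2 \<omega> z v + dbar_form 2 \<omega> z v = 0))"

definition locally_integrable_form :: "(complex^'n) set \<Rightarrow>
    (complex^'n \<Rightarrow> ('n::finite, complex^'r) covector) \<Rightarrow> bool" where
  "locally_integrable_form D u \<longleftrightarrow>
     (\<forall>v. (\<lambda>z. u z v) \<in> borel_measurable (lebesgue_on D) \<and>
        (\<forall>K. compact K \<and> K \<subseteq> D \<longrightarrow> integrable (lebesgue_on K) (\<lambda>z. u z v)))"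

definition locally_L2_form :: "(complex^'n) set \<Rightarrow>
    (complex^'n \<Rightarrow> ('n::finite, complex^'r) covector) \<Rightarrow> bool" where
  "locally_L2_form D f \<longleftrightarrow>
     (\<forall>v. (\<lambda>z. f z v) \<in> borel_measurable (lebesgue_on D) \<and>
        (\<forall>K. compact K \<and> K \<subseteq> D \<longrightarrow>
           (\<integral>\<^sup>+ z. ennreal ((norm (f z v))\<^sup>2) \<partial>lebesgue_on K) < \<infinity>))"

definition test_function :: "(complex^'n) set \<Rightarrow> (complex^'n \<Rightarrow> complex) \<Rightarrow> bool" where
  "test_function D \<eta> \<longleftrightarrow>
     smooth_on UNIV \<eta> \<and> (\<exists>K. compact K \<and> K \<subseteq> D \<and> (\<forall>z. z \<notin> K \<longrightarrow> \<eta> z = 0))"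

text \<open>\<open>\<partial>\<^sup>- u = f\<close> in the sense of distributions, for a \<open>k\<close>-form \<open>u\<close> and a \<open>(k+1)\<close>-form \<open>f\<close> with
  values in the trivial bundle of rank \<open>r\<close>: the formula of \<open>dbar_form\<close> with the derivatives moved
  onto a test function. Both forms are meant to be locally integrable.\<close>

definition weak_dbar :: "(complex^'n) set \<Rightarrow> nat \<Rightarrow>
    (complex^'n \<Rightarrow> ('n::finite, complex^'r) covector) \<Rightarrow>
    (complex^'n \<Rightarrow> ('n, complex^'r) covector) \<Rightarrow> bool" where
  "weak_dbar D k u f \<longleftrightarrow>
     (\<forall>\<eta> v. test_function D \<eta> \<longrightarrow>
        (\<integral>z. \<eta> z *s f z v \<partial>lebesgue_on D) =
        - (\<integral>z. (\<Sum>i\<le>k. ((-1) ^ i * dbar_dir (v i) \<eta> z) *s u z (omit i v)) \<partial>lebesgue_on D))"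

text \<open>The trivial bundle is \<open>D \<times> \<complex>\<^sup>r\<close>, and \<open>h z\<close> is the Hermitian form on the fibre at \<open>z\<close>.
  Finiteness of integrals is expressed in the extended nonnegative reals.\<close>

definition L2_optimal_triple :: "(complex^'n::finite) set \<Rightarrow>
    (complex^'n \<Rightarrow> complex^'r \<Rightarrow> complex^'r \<Rightarrow> complex) \<Rightarrow> bool" where
  "L2_optimal_triple D h \<longleftrightarrow>
     (\<forall>f \<phi> \<omega>.
        (\<forall>z\<in>D. pq_form CARD('n) 1 (f z)) \<and> locally_L2_form D f \<and>
        weak_dbar D (CARD('n) + 1) f (\<lambda>_ _. 0) \<and>
        smooth_strictly_psh_on D \<phi> \<and> kaehler_metric_on D \<omega> \<and>
        (\<integral>\<^sup>+ z. ennreal (Re (form_inner (\<omega> z) (h z) (CARD('n) + 1)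
              (B_inv (\<omega> z) (h z) (i_ddbar \<phi> z) (f z)) (f z)) * exp (- \<phi> z) * vol_density (\<omega> z))
           \<partial>lebesgue_on D) < \<infinity>
        \<longrightarrow>
        (\<exists>u. (\<forall>z\<in>D. pq_form CARD('n) 0 (u z)) \<and> locally_integrable_form D u \<and>
           weak_dbar D CARD('n) u f \<and>
           (\<integral>\<^sup>+ z. ennreal (Re (form_inner (\<omega> z) (h z) CARD('n) (u z) (u z))
                * exp (- \<phi> z) * vol_density (\<omega> z)) \<partial>lebesgue_on D)
           \<le> (\<integral>\<^sup>+ z. ennreal (Re (form_inner (\<omega> z) (h z) (CARD('n) + 1)
              (B_inv (\<omega> z) (h z) (i_ddbar \<phi> z) (f z)) (f z)) * exp (- \<phi> z) * vol_density (\<omega> z))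
           \<partial>lebesgue_on D)))"


section \<open>Complex manifolds\<close>

type_synonym ('a, 'n) chart = "'a set \<times> ('a \<Rightarrow> complex^'n)"

definition is_chart :: "'a topology \<Rightarrow> ('a, 'n::finite) chart \<Rightarrow> bool" where
  "is_chart X = (\<lambda>(U, \<phi>). openin X U \<and> open (\<phi> ` U) \<and>
     homeomorphic_map (subtopology X U) (top_of_set (\<phi> ` U)) \<phi>)"

definition charts_compatible :: "('a, 'n::finite) chart \<Rightarrow> ('a, 'n) chart \<Rightarrow> bool" where
  "charts_compatible = (\<lambda>(U, \<phi>) (V, \<psi>).
     (\<forall>j. mholomorphic_on (\<lambda>z. \<psi> (inv_into U \<phi> z) $ j) (\<phi> ` (U \<inter> V))) \<and>
     (\<forall>j. mholomorphic_on (\<lambda>z. \<phi> (inv_into V \<psi> z) $ j) (\<psi> ` (U \<inter> V))))"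

definition complex_manifold :: "'a topology \<Rightarrow> ('a, 'n::finite) chart set \<Rightarrow> bool" where
  "complex_manifold X A \<longleftrightarrow>
     Hausdorff_space X \<and> second_countable X \<and>
     (\<forall>c\<in>A. is_chart X c) \<and> (\<Union>c\<in>A. fst c) = topspace X \<and>
     (\<forall>c\<in>A. \<forall>c'\<in>A. charts_compatible c c')"

text \<open>Members of the maximal atlas.\<close>

definition holomorphic_chart :: "'a topology \<Rightarrow> ('a, 'n::finite) chart set \<Rightarrow> ('a, 'n) chart \<Rightarrow> bool" where
  "holomorphic_chart X A c \<longleftrightarrow> is_chart X c \<and> (\<forall>c'\<in>A. charts_compatible c c')"

definition hol_function_on :: "('a, 'n::finite) chart set \<Rightarrow> 'a set \<Rightarrow> ('a \<Rightarrow> complex) \<Rightarrow> bool" where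
  "hol_function_on A U f \<longleftrightarrow>
     (\<forall>(V, \<phi>)\<in>A. mholomorphic_on (\<lambda>z. f (inv_into V \<phi> z)) (\<phi> ` (U \<inter> V)))"

definition psh_function_on :: "('a, 'n::finite) chart set \<Rightarrow> 'a set \<Rightarrow> ('a \<Rightarrow> ereal) \<Rightarrow> bool" where
  "psh_function_on A U \<psi> \<longleftrightarrow>
     (\<forall>(V, \<phi>)\<in>A. psh_on (\<phi> ` (U \<inter> V)) (\<lambda>z. \<psi> (inv_into V \<phi> z)))"

definition hol_hull :: "('a, 'n::finite) chart set \<Rightarrow> 'a set \<Rightarrow> 'a set \<Rightarrow> 'a set" where
  "hol_hull A U K =
     {x\<in>U. \<forall>f M. hol_function_on A U f \<and> (\<forall>y\<in>K. cmod (f y) \<le> M) \<longrightarrow> cmod (f x) \<le> M}"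

text \<open>Open Stein subsets: holomorphically convex and holomorphically separable.\<close>

definition stein_open :: "'a topology \<Rightarrow> ('a, 'n::finite) chart set \<Rightarrow> 'a set \<Rightarrow> bool" where
  "stein_open X A U \<longleftrightarrow>
     openin X U \<and>
     (\<forall>K. compactin X K \<and> K \<subseteq> U \<longrightarrow> compactin X (hol_hull A U K)) \<and>
     (\<forall>x\<in>U. \<forall>y\<in>U. x \<noteq> y \<longrightarrow> (\<exists>f. hol_function_on A U f \<and> f x \<noteq> f y))"


section \<open>Holomorphic vector bundles and Hermitian metrics\<close>

text \<open>A local trivialization over \<open>U\<close> is the fibre component \<open>\<theta>\<close> of a map
  \<open>E|\<^sub>U \<rightarrow> U \<times> \<complex>\<^sup>r\<close>. The topology and the complex structure of the total space are the ones
  determined by the trivializations.\<close>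

record ('a, 'e, 'r::finite) vbundle =
  total :: "'e set"
  proj :: "'e \<Rightarrow> 'a"
  fadd :: "'e \<Rightarrow> 'e \<Rightarrow> 'e"
  fscale :: "complex \<Rightarrow> 'e \<Rightarrow> 'e"
  trivs :: "('a set \<times> ('e \<Rightarrow> complex^'r)) set"

definition fibre :: "('a, 'e, 'r::finite) vbundle \<Rightarrow> 'a \<Rightarrow> 'e set" where
  "fibre E x = {e \<in> total E. proj E e = x}"

text \<open>The point of \<open>E\<^sub>x\<close> with coordinate vector \<open>v\<close>.\<close>

definition triv_point :: "('a, 'e, 'r::finite) vbundle \<Rightarrow> ('e \<Rightarrow> complex^'r) \<Rightarrow> 'a \<Rightarrow> complex^'r \<Rightarrow> 'e" where
  "triv_point E \<theta> x v = inv_into (fibre E x) \<theta> v"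

definition is_triv :: "'a topology \<Rightarrow> ('a, 'e, 'r::finite) vbundle \<Rightarrow> 'a set \<times> ('e \<Rightarrow> complex^'r) \<Rightarrow> bool" where
  "is_triv X E = (\<lambda>(U, \<theta>). openin X U \<and>
     (\<forall>x\<in>U. bij_betw \<theta> (fibre E x) UNIV \<and>
        (\<forall>e\<in>fibre E x. \<forall>e'\<in>fibre E x.
           fadd E e e' \<in> fibre E x \<and> \<theta> (fadd E e e') = \<theta> e + \<theta> e') \<and>
        (\<forall>c. \<forall>e\<in>fibre E x. fscale E c e \<in> fibre E x \<and> \<theta> (fscale E c e) = c *s \<theta> e)))"

text \<open>The entries of the transition matrices are holomorphic in both directions.\<close>

definition trivs_compatible :: "('a, 'n::finite) chart set \<Rightarrow> ('a, 'e, 'r::finite) vbundle \<Rightarrow>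
    'a set \<times> ('e \<Rightarrow> complex^'r) \<Rightarrow> 'a set \<times> ('e \<Rightarrow> complex^'r) \<Rightarrow> bool" where
  "trivs_compatible A E = (\<lambda>(U, \<theta>) (V, \<tau>).
     \<forall>v j. hol_function_on A (U \<inter> V) (\<lambda>x. \<tau> (triv_point E \<theta> x v) $ j) \<and>
           hol_function_on A (U \<inter> V) (\<lambda>x. \<theta> (triv_point E \<tau> x v) $ j))"

definition holomorphic_vector_bundle :: "'a topology \<Rightarrow> ('a, 'n::finite) chart set \<Rightarrow>
    ('a, 'e, 'r::finite) vbundle \<Rightarrow> bool" where
  "holomorphic_vector_bundle X A E \<longleftrightarrow>
     proj E ` total E \<subseteq> topspace X \<and>
     (\<forall>t\<in>trivs E. is_triv X E t) \<and> (\<Union>t\<in>trivs E. fst t) = topspace X \<and>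
     (\<forall>t\<in>trivs E. \<forall>t'\<in>trivs E. trivs_compatible A E t t')"

definition holomorphic_triv :: "'a topology \<Rightarrow> ('a, 'n::finite) chart set \<Rightarrow>
    ('a, 'e, 'r::finite) vbundle \<Rightarrow> 'a set \<times> ('e \<Rightarrow> complex^'r) \<Rightarrow> bool" where
  "holomorphic_triv X A E t \<longleftrightarrow> is_triv X E t \<and> (\<forall>t'\<in>trivs E. trivs_compatible A E t t')"

definition hermitian_metric :: "'a topology \<Rightarrow> ('a, 'e, 'r::finite) vbundle \<Rightarrow> ('e \<Rightarrow> 'e \<Rightarrow> complex) \<Rightarrow> bool" where
  "hermitian_metric X E h \<longleftrightarrow>
     (\<forall>x\<in>topspace X.
        (\<forall>a\<in>fibre E x. \<forall>b\<in>fibre E x. \<forall>e\<in>fibre E x. h (fadd E a b) e = h a e + h b e) \<and>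
        (\<forall>c. \<forall>a\<in>fibre E x. \<forall>e\<in>fibre E x. h (fscale E c a) e = c * h a e) \<and>
        (\<forall>a\<in>fibre E x. \<forall>b\<in>fibre E x. h b a = cnj (h a b)) \<and>
        (\<forall>e\<in>fibre E x. e \<noteq> fscale E 0 e \<longrightarrow> Re (h e e) > 0))"

definition continuous_metric :: "'a topology \<Rightarrow> ('a, 'e, 'r::finite) vbundle \<Rightarrow> ('e \<Rightarrow> 'e \<Rightarrow> complex) \<Rightarrow> bool" where
  "continuous_metric X E h \<longleftrightarrow>
     (\<forall>(U, \<theta>)\<in>trivs E. \<forall>v w.
        continuous_map (subtopology X U) euclidean
          (\<lambda>x. h (triv_point E \<theta> x v) (triv_point E \<theta> x w)))"

text \<open>Being \<open>L\<^sup>2\<close>-optimal does not depend on the trivialization of \<open>E|\<^sub>U\<close>, so it does not matter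
  that all of them are considered. As \<open>\<phi> ` U\<close> is a domain, \<open>U\<close> is connected and nonempty.\<close>

definition L2_optimal_metric :: "'a topology \<Rightarrow> ('a, 'n::finite) chart set \<Rightarrow>
    ('a, 'e, 'r::finite) vbundle \<Rightarrow> ('e \<Rightarrow> 'e \<Rightarrow> complex) \<Rightarrow> bool" where
  "L2_optimal_metric X A E h \<longleftrightarrow>
     (\<forall>U \<phi> \<theta>. holomorphic_chart X A (U, \<phi>) \<and> U \<noteq> {} \<and> connectedin X U \<and> stein_open X A U \<and>
        holomorphic_triv X A E (U, \<theta>) \<longrightarrow>
        L2_optimal_triple (\<phi> ` U)
          (\<lambda>z v w. h (triv_point E \<theta> (inv_into U \<phi> z) v) (triv_point E \<theta> (inv_into U \<phi> z) w)))"

definition hol_dual_section :: "('a, 'n::finite) chart set \<Rightarrow> ('a, 'e, 'r::finite) vbundle \<Rightarrow> 'a set \<Rightarrow>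
    ('a \<Rightarrow> 'e \<Rightarrow> complex) \<Rightarrow> bool" where
  "hol_dual_section A E U u \<longleftrightarrow>
     (\<forall>x\<in>U. (\<forall>a\<in>fibre E x. \<forall>b\<in>fibre E x. u x (fadd E a b) = u x a + u x b) \<and>
            (\<forall>c. \<forall>a\<in>fibre E x. u x (fscale E c a) = c * u x a)) \<and>
     (\<forall>(V, \<theta>)\<in>trivs E. \<forall>v. hol_function_on A (U \<inter> V) (\<lambda>x. u x (triv_point E \<theta> x v)))"

definition dual_norm :: "('a, 'e, 'r::finite) vbundle \<Rightarrow> ('e \<Rightarrow> 'e \<Rightarrow> complex) \<Rightarrow> 'a \<Rightarrow>
    ('e \<Rightarrow> complex) \<Rightarrow> real" where
  "dual_norm E h x l = (SUP e \<in> {e \<in> fibre E x. Re (h e e) \<le> 1}. cmod (l e))"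

definition log_ereal :: "real \<Rightarrow> ereal" where
  "log_ereal r = (if r = 0 then -\<infinity> else ereal (ln r))"

definition griffiths_semipositive :: "'a topology \<Rightarrow> ('a, 'n::finite) chart set \<Rightarrow>
    ('a, 'e, 'r::finite) vbundle \<Rightarrow> ('e \<Rightarrow> 'e \<Rightarrow> complex) \<Rightarrow> bool" where
  "griffiths_semipositive X A E h \<longleftrightarrow>
     (\<forall>U u. openin X U \<and> hol_dual_section A E U u \<longrightarrow>
        psh_function_on A U (\<lambda>x. log_ereal (dual_norm E h x (u x))))"

end

(* By duality, L2-optimality becomes an inequality that is linear in w = |u|^2 along a complex
   line, u a holomorphic section of the dual bundle: solving the d-bar equation on thin boxes
   around the line with the weight N |z|^2, and letting the boxes shrink, gives
     integral of w e^(-N|zeta|^2) (|zeta|^2 (B' - N B)^2 - N B^2) >= 0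
   for radial cutoffs B. If log |u| violated the mean value inequality on a disc, then, after
   multiplying u by e^(-p) for a polynomial p, w would be touched from above at a point by the
   Gaussian w(0) e^(-eps |zeta|^2), which contradicts the inequality as N tends to infinity. *)
theory Submission
  imports Defs "HOL-Real_Asymp.Real_Asymp"
begin

section \<open>Exterior algebra with the Euclidean metric\<close>

text \<open>The metric is only continuous, so there is no curvature to compute with: optimality has
  to be tested with explicit data. The coefficients of \<open>f\<close> depend on the coordinate
  along the line alone. This makes \<open>f\<close> closed, and in a thin box the metric differs
  little from its values on the line. The vector part of \<open>f\<close> is \<open>N B\<close>
  times the vector representing \<open>u\<close>; the factor \<open>N B\<close> maximizes gain minus
  cost in the estimate. Pairing the solution with the functional \<open>u\<close> and splitting by
  AM-GM pointwise, instead of applying Cauchy-Schwarz to the integrals, keeps everything linear in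
  \<open>w\<close>, so the errors vanish in the limits. Where \<open>B = 1\<close> the integrand of
  the inequality is \<open>-N w\<close> times the derivative of \<open>N e^(-N t)\<close> in
  \<open>N\<close>, with \<open>t = |zeta|^2\<close>: Gaussian means of \<open>w\<close> do not
  increase with \<open>N\<close>. Those of \<open>w(0) e^(-eps t)\<close> grow like
  \<open>N / (N + eps)\<close>, a gap of order \<open>1/N\<close> against exponentially small cutoff
  errors. The factor \<open>e^(-p)\<close> is harmless because optimality concerns every
  trivialization, and the modified section is a coordinate of a new one.\<close>

definition hermitian_ip :: "(complex^'r \<Rightarrow> complex^'r \<Rightarrow> complex) \<Rightarrow> bool" where
  "hermitian_ip h \<longleftrightarrow> (\<forall>a b c. h (a + b) c = h a c + h b c) \<and>
     (\<forall>k a c. h (k *s a) c = k * h a c) \<and> (\<forall>a b. h b a = cnj (h a b)) \<and>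
     (\<forall>a. a \<noteq> 0 \<longrightarrow> Re (h a a) > 0)"

lemma hermitian_ip_simps:
  assumes "hermitian_ip h"
  shows "h (a + b) c = h a c + h b c" "h (k *s a) c = k * h a c" "h 0 c = 0" "h c 0 = 0"
    "h c (a + b) = h c a + h c b" "h c (k *s a) = cnj k * h c a"
    "h (x *\<^sub>R a) c = x *\<^sub>R h a c" "h c (x *\<^sub>R a) = x *\<^sub>R h c a"
    "h (a - b) c = h a c - h b c" "h c (a - b) = h c a - h c b"
    "h (- a) c = - h a c" "h c (- a) = - h c a"
    "Im (h a a) = 0" "Re (h a a) \<ge> 0" "Re (h a a) = 0 \<longleftrightarrow> a = 0"
proof -
  have add: "h (a + b) c = h a c + h b c" for a b c using assms unfolding hermitian_ip_def by blast
  have mul: "h (k *s a) c = k * h a c" for k a c using assms unfolding hermitian_ip_def by blast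
  have sym: "h b a = cnj (h a b)" for a b using assms unfolding hermitian_ip_def by blast
  have pos: "a \<noteq> 0 \<Longrightarrow> Re (h a a) > 0" for a using assms unfolding hermitian_ip_def by blast
  have z: "h 0 c = 0" for c using mul[of 0 0 c] by simp
  have sc: "x *\<^sub>R a = of_real x *s a" for x :: real and a :: "complex^'r"
    by (simp only: vec_eq_iff vector_scaleR_component vector_smult_component) (simp add: scaleR_conv_of_real)
  have neg: "- a = (-1) *s a" for a :: "complex^'r" by (simp add: vec_eq_iff)
  have neg': "h (- a) c = - h a c" for a c by (subst neg, subst mul) simp
  have sub: "h (a - b) c = h a c - h b c" for a b c using add[of a "- b" c] neg'[of b c] by simp
  show "h (a + b) c = h a c + h b c" "h (k *s a) c = k * h a c" "h 0 c = 0" by fact+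
  show "h c 0 = 0" using sym[of c 0] z[of c] by simp
  show "h c (a + b) = h c a + h c b" by (simp only: sym[of c "a + b"] sym[of c a] sym[of c b] add complex_cnj_add)
  show "h c (k *s a) = cnj k * h c a" by (simp only: sym[of c "k *s a"] sym[of c a] mul complex_cnj_mult)
  show "h (x *\<^sub>R a) c = x *\<^sub>R h a c" by (simp add: sc mul scaleR_conv_of_real)
  show "h c (x *\<^sub>R a) = x *\<^sub>R h c a"
    by (simp only: sc sym[of c "of_real x *s a"] sym[of c a] mul complex_cnj_mult complex_cnj_complex_of_real scaleR_conv_of_real)
  show "h (a - b) c = h a c - h b c" by fact
  show "h c (a - b) = h c a - h c b" by (simp only: sym[of c "a - b"] sym[of c a] sym[of c b] sub complex_cnj_diff)
  show "h (- a) c = - h a c" by fact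
  show "h c (- a) = - h c a" by (simp only: sym[of c "- a"] sym[of c a] neg' complex_cnj_minus)
  show "Im (h a a) = 0" using arg_cong[OF sym[of a a], of Im] by simp
  show "Re (h a a) \<ge> 0" using pos[of a] z[of 0] by (cases "a = 0") auto
  show "Re (h a a) = 0 \<longleftrightarrow> a = 0" using pos[of a] z[of 0] by (cases "a = 0") auto
qed

lemma hermitian_ip_sum:
  assumes "hermitian_ip h"
  shows "h (\<Sum>i\<in>A. f i) c = (\<Sum>i\<in>A. h (f i) c)" "h c (\<Sum>i\<in>A. f i) = (\<Sum>i\<in>A. h c (f i))"
  by (induction A rule: infinite_finite_induct; simp add: hermitian_ip_simps[OF assms])+

section \<open>Alternating forms under permutations of the slots\<close>

lemma alt_form_cong: "alt_form k \<alpha> \<Longrightarrow> (\<And>i. i < k \<Longrightarrow> v i = w i) \<Longrightarrow> \<alpha> v = \<alpha> w"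
  unfolding alt_form_def by blast

lemma alt_form_linear: "alt_form k \<alpha> \<Longrightarrow> i < k \<Longrightarrow> linear (\<lambda>x. \<alpha> (v(i := x)))"
  unfolding alt_form_def by blast

lemma alt_form_eq0: "alt_form k \<alpha> \<Longrightarrow> i < k \<Longrightarrow> j < k \<Longrightarrow> i \<noteq> j \<Longrightarrow> v i = v j \<Longrightarrow> \<alpha> v = 0"
  unfolding alt_form_def by (cases i j rule: linorder_cases) metis+

text \<open>Polarization: with the sum \<open>v i + v j\<close> in both slots the value vanishes,
  and bilinearity leaves the two mixed terms. Only one pair of slots is involved, so that the lemma
  also serves in \<open>alt_form_of_adjacent\<close>, where alternation is known for neighbours
  only.\<close>

lemma swap_of_diag_zero:
  fixes \<alpha> :: "(nat \<Rightarrow> 'v::real_vector) \<Rightarrow> 'b::real_vector"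
  assumes lin: "\<And>v. linear (\<lambda>x. \<alpha> (v(i := x)))" "\<And>v. linear (\<lambda>x. \<alpha> (v(j := x)))"
    and diag: "\<And>v. v i = v j \<Longrightarrow> \<alpha> v = 0" and "i \<noteq> j"
  shows "\<alpha> (v(i := v j, j := v i)) = - \<alpha> v"
proof -
  let ?g = "\<lambda>x y. \<alpha> (v(i := x, j := y))"
  have 1: "?g (x + x') y = ?g x y + ?g x' y" for x x' y
    using linear_add[OF lin(1), of "v(j := y)" x x'] \<open>i \<noteq> j\<close> by (simp add: fun_upd_twist)
  have 2: "?g x (y + y') = ?g x y + ?g x y'" for x y y'
    using linear_add[OF lin(2), of "v(i := x)" y y'] by simp
  have 3: "?g x x = 0" for x using diag[of "v(i := x, j := x)"] \<open>i \<noteq> j\<close> by simp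
  have "?g (v i + v j) (v i + v j) = ?g (v i) (v i) + ?g (v i) (v j) + ?g (v j) (v i) + ?g (v j) (v j)"
    by (simp only: 1 2) (simp add: algebra_simps)
  then have "0 = ?g (v i) (v j) + ?g (v j) (v i)" by (simp only: 3) simp
  moreover have "v(i := v i, j := v j) = v" by auto
  ultimately show ?thesis by (metis eq_neg_iff_add_eq_0 add.commute)
qed

lemma alt_form_swap:
  assumes "alt_form k \<alpha>" "i < k" "j < k" "i \<noteq> j"
  shows "\<alpha> (v(i := v j, j := v i)) = - \<alpha> v"
proof (rule swap_of_diag_zero)
  show "\<And>v. v i = v j \<Longrightarrow> \<alpha> v = 0" using alt_form_eq0[OF assms] .
qed (use assms alt_form_linear in \<open>blast+\<close>)

lemma comp_transpose: "v \<circ> Transposition.transpose i j = v(i := v j, j := v i)"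
  by (auto simp: Transposition.transpose_def fun_eq_iff)

lemma alt_form_perm:
  assumes "alt_form k \<alpha>" "\<sigma> permutes {..<k}"
  shows "\<alpha> (v \<circ> \<sigma>) = of_int (sign \<sigma>) *\<^sub>R \<alpha> v"
  using assms(2) finite_lessThan
proof (induction arbitrary: v rule: permutes_induct)
  case (swap a b p)
  have "\<alpha> (v \<circ> (Transposition.transpose a b \<circ> p)) = \<alpha> ((v \<circ> Transposition.transpose a b) \<circ> p)" by (simp add: comp_assoc)
  also have "\<dots> = of_int (sign p) *\<^sub>R \<alpha> (v \<circ> Transposition.transpose a b)" by (rule swap.IH)
  also have "\<dots> = - (of_int (sign p) *\<^sub>R \<alpha> v)"
    unfolding comp_transpose using swap.hyps alt_form_swap[OF assms(1), of a b v] by simp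
  also have "\<dots> = of_int (sign (Transposition.transpose a b \<circ> p)) *\<^sub>R \<alpha> v"
    using swap.hyps by (subst sign_compose)
      (auto simp: sign_swap_id permutation_swap_id intro: permutation_permutes[THEN iffD2])
  finally show ?case .
qed auto

text \<open>The positions \<open>0, 1\<close> of a \<open>(k+2)\<close>-tuple are split off; \<open>\<beta>\<close> sees the remaining ones.\<close>

lemma alt_form_perm_shift:
  assumes "alt_form k \<beta>" "\<tau> permutes {2..<k + 2}"
  shows "\<beta> (\<lambda>m. v (\<tau> (m + 2))) = of_int (sign \<tau>) *\<^sub>R \<beta> (\<lambda>m. v (m + 2))"
  using assms(2) finite_atLeastLessThan
proof (induction arbitrary: v rule: permutes_induct)
  case (swap a b p)
  obtain a' b' where ab: "a = a' + 2" "b = b' + 2"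
    using swap.hyps by (metis add.commute atLeastLessThan_iff le_Suc_ex)
  have "\<beta> (\<lambda>m. v ((Transposition.transpose a b \<circ> p) (m + 2))) = \<beta> (\<lambda>m. (v \<circ> Transposition.transpose a b) (p (m + 2)))" by simp
  also have "\<dots> = of_int (sign p) *\<^sub>R \<beta> (\<lambda>m. (v \<circ> Transposition.transpose a b) (m + 2))" by (rule swap.IH)
  also have "(\<lambda>m. (v \<circ> Transposition.transpose a b) (m + 2)) =
      (let w = \<lambda>m. v (m + 2) in w(a - 2 := w (b - 2), b - 2 := w (a - 2)))"
    by (auto simp: comp_transpose fun_eq_iff Let_def ab)
  also have "\<beta> \<dots> = - \<beta> (\<lambda>m. v (m + 2))" unfolding Let_def
    using swap.hyps by (intro alt_form_swap[OF assms(1)]) auto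
  also have "of_int (sign p) *\<^sub>R - \<beta> (\<lambda>m. v (m + 2)) = 
      of_int (sign (Transposition.transpose a b \<circ> p)) *\<^sub>R \<beta> (\<lambda>m. v (m + 2))"
    using swap.hyps by (subst sign_compose)
      (auto simp: sign_swap_id permutation_swap_id intro: permutation_permutes[THEN iffD2])
  finally show ?case .
qed auto

lemma alt_form_eq_0_on_spanning:
  assumes \<alpha>: "alt_form k \<alpha>" and sp: "span B = UNIV"
    and B: "\<And>v. (\<And>i. i < k \<Longrightarrow> v i \<in> B) \<Longrightarrow> \<alpha> v = 0"
  shows "\<alpha> v = 0"
proof -
  \<comment> \<open>The first \<open>m\<close> slots are already arbitrary; each step of the
    induction frees one more by linearity, and \<open>m = k\<close> is the claim.\<close>
  have "\<forall>v. (\<forall>i. m \<le> i \<and> i < k \<longrightarrow> v i \<in> B) \<longrightarrow> \<alpha> v = 0" if "m \<le> k" for m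
    using that
  proof (induction m)
    case (Suc m)
    show ?case
    proof (intro allI impI)
      fix v assume v: "\<forall>i. Suc m \<le> i \<and> i < k \<longrightarrow> v i \<in> B"
      have "\<alpha> (v(m := x)) = 0" if "x \<in> B" for x
        proof -
        have "\<forall>i. m \<le> i \<and> i < k \<longrightarrow> (v(m := x)) i \<in> B" using v that by (metis Suc_leI fun_upd_apply le_neq_implies_less)
        then show ?thesis using Suc.IH Suc.prems by (meson Suc_leD)
      qed
      then have "\<alpha> (v(m := v m)) = 0"
        using linear_eq_0_on_span[OF alt_form_linear[OF \<alpha>, of m v], of B "v m"] Suc.prems sp by auto
      then show "\<alpha> v = 0" by simp
    qed
  qed (use B in auto)
  from this[of k] show ?thesis by auto
qed

section \<open>The wedge product with a 2-form\<close>

definition slot_perm :: "nat \<Rightarrow> nat \<Rightarrow> nat \<Rightarrow> nat" where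
  "slot_perm i j = Transposition.transpose 0 i \<circ> Transposition.transpose 1 (Transposition.transpose 0 i j)"

text \<open>A representative for each coset of the permutations that fix 0 and 1. The right factor
  of \<open>slot_perm\<close> aims at \<open>transpose 0 i j\<close> instead of \<open>j\<close>
  because the left factor is applied afterwards and carries that point to \<open>j\<close>.\<close>

lemma slot_perm:
  assumes "i \<noteq> j" "i < k + 2" "j < k + 2"
  shows "slot_perm i j permutes {..<k + 2}" "slot_perm i j 0 = i" "slot_perm i j 1 = j"
proof -
  have 1: "Transposition.transpose 0 i permutes {..<k + 2}" using assms by (intro permutes_swap_id) auto
  have 2: "Transposition.transpose 0 i j \<in> {..<k + 2}" using permutes_in_image[OF 1, of j] assms by auto
  show "slot_perm i j permutes {..<k + 2}" unfolding slot_perm_def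
    using 2 by (intro permutes_compose[OF _ 1] permutes_swap_id) auto
  show "slot_perm i j 0 = i" "slot_perm i j 1 = j" using assms
    by (auto simp: slot_perm_def Transposition.transpose_def)
qed

text \<open>The permutations are grouped by the pair \<open>(\<sigma> 0, \<sigma> 1)\<close>. Each
  group is a coset of the permutations of \<open>{2..<k + 2}\<close>, and its \<open>fact k\<close>
  members contribute equally, because the sign of the extra permutation is absorbed by
  \<open>\<beta>\<close>. This cancels \<open>fact k\<close> in \<open>wedge\<close> and leaves the
  factor 1/2.\<close>

lemma wedge_2_slots:
  assumes \<alpha>: "alt_form 2 \<alpha>" and \<beta>: "alt_form k \<beta>"
  shows "wedge 2 k \<alpha> \<beta> v = (1 / 2) *\<^sub>R
    (\<Sum>(i, j) \<in> {(i, j). i < k + 2 \<and> j < k + 2 \<and> i \<noteq> j}.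
       (of_int (sign (slot_perm i j)) * \<alpha> (vpair (v i) (v j))) *s \<beta> (\<lambda>m. v (slot_perm i j (m + 2))))"
proof -
  define P where "P = {(i, j). i < k + 2 \<and> j < k + 2 \<and> i \<noteq> j}"
  define S where "S = {\<sigma>. \<sigma> permutes {..<k + 2}}"
  define F where "F \<sigma> = (of_int (sign \<sigma>) * \<alpha> (v \<circ> \<sigma>)) *s \<beta> (\<lambda>i. v (\<sigma> (2 + i)))" for \<sigma>
  have finP: "finite P"
    by (rule finite_subset[of _ "{..<k+2} \<times> {..<k+2}"]) (auto simp: P_def)
  have finS: "finite S" by (simp add: S_def finite_permutations)
  have img: "(\<lambda>\<sigma>. (\<sigma> 0, \<sigma> 1)) ` S \<subseteq> P"
  proof
    fix p assume "p \<in> (\<lambda>\<sigma>. (\<sigma> 0, \<sigma> 1)) ` S"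
    then obtain \<sigma> where s: "\<sigma> permutes {..<k+2}" "p = (\<sigma> 0, \<sigma> 1)" by (auto simp: S_def)
    then show "p \<in> P" using permutes_in_image[OF s(1), of 0] permutes_in_image[OF s(1), of 1]
      inj_eq[OF permutes_inj[OF s(1)], of 0 1] by (auto simp: P_def)
  qed
  have fibre: "sum F {\<sigma> \<in> S. (\<sigma> 0, \<sigma> 1) = (i, j)} = fact k *\<^sub>R
     ((of_int (sign (slot_perm i j)) * \<alpha> (vpair (v i) (v j))) *s \<beta> (\<lambda>m. v (slot_perm i j (m + 2))))"
    if ij: "(i, j) \<in> P" for i j
  proof -
    let ?\<rho> = "slot_perm i j"
    have \<rho>: "?\<rho> permutes {..<k+2}" "?\<rho> 0 = i" "?\<rho> 1 = j" using slot_perm[of i j k] ij by (auto simp: P_def)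
    have eq: "{\<sigma> \<in> S. (\<sigma> 0, \<sigma> 1) = (i, j)} = (\<lambda>\<tau>. ?\<rho> \<circ> \<tau>) ` {\<tau>. \<tau> permutes {2..<k+2}}" (is "?L = ?R")
    proof (intro equalityI subsetI)
      fix \<sigma> assume "\<sigma> \<in> ?L"
      then have \<sigma>: "\<sigma> permutes {..<k+2}" "\<sigma> 0 = i" "\<sigma> 1 = j" by (auto simp: S_def)
      have p: "inv ?\<rho> \<circ> \<sigma> permutes {..<k+2}" by (intro permutes_compose \<sigma> permutes_inv \<rho>)
      have f: "(inv ?\<rho> \<circ> \<sigma>) 0 = 0" "(inv ?\<rho> \<circ> \<sigma>) 1 = 1"
        using \<sigma> \<rho> permutes_inverses(2)[OF \<rho>(1)] by (metis comp_apply)+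
      have "inv ?\<rho> \<circ> \<sigma> permutes {2..<k+2}"
      proof (rule permutes_superset[OF p])
        fix x assume "x \<in> {..<k+2} - {2..<k+2}"
        then have "x = 0 \<or> x = 1" by auto
        then show "(inv ?\<rho> \<circ> \<sigma>) x = x" using f by auto
      qed
      moreover have "\<sigma> = ?\<rho> \<circ> (inv ?\<rho> \<circ> \<sigma>)"
        using permutes_inverses(1)[OF \<rho>(1)] by (auto simp: fun_eq_iff)
      ultimately show "\<sigma> \<in> ?R" by blast
    next
      fix \<sigma> assume "\<sigma> \<in> ?R"
      then obtain \<tau> where \<tau>: "\<tau> permutes {2..<k+2}" "\<sigma> = ?\<rho> \<circ> \<tau>" by auto
      have "\<tau> permutes {..<k+2}" by (rule permutes_subset[OF \<tau>(1)]) auto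
      moreover have "\<tau> 0 = 0" "\<tau> 1 = 1" using \<tau>(1) by (auto simp: permutes_def)
      ultimately show "\<sigma> \<in> ?L" using \<rho> \<tau>(2) by (auto simp: S_def intro: permutes_compose)
    qed
    have inj: "inj_on (\<lambda>\<tau>. ?\<rho> \<circ> \<tau>) {\<tau>. \<tau> permutes {2..<k+2}}"
      using permutes_inj[OF \<rho>(1)] by (auto simp: inj_on_def fun_eq_iff dest: injD)
    have val: "F (?\<rho> \<circ> \<tau>) = (of_int (sign ?\<rho>) * \<alpha> (vpair (v i) (v j))) *s \<beta> (\<lambda>m. v (?\<rho> (m + 2)))"
      if \<tau>: "\<tau> permutes {2..<k+2}" for \<tau>
    proof -
      have t01: "\<tau> 0 = 0" "\<tau> 1 = 1" using \<tau> by (auto simp: permutes_def)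
      have "\<alpha> (v \<circ> (?\<rho> \<circ> \<tau>)) = \<alpha> (vpair (v i) (v j))"
      proof (rule alt_form_cong[OF \<alpha>])
        fix m :: nat assume "m < 2"
        then have "m = 0 \<or> m = 1" by auto
        then show "(v \<circ> (?\<rho> \<circ> \<tau>)) m = vpair (v i) (v j) m" using t01 \<rho> by (auto simp: vpair_def)
      qed
      moreover have "\<beta> (\<lambda>m. v ((?\<rho> \<circ> \<tau>) (2 + m))) = of_int (sign \<tau>) *\<^sub>R \<beta> (\<lambda>m. v (?\<rho> (m + 2)))"
        using alt_form_perm_shift[OF \<beta> \<tau>, of "v \<circ> ?\<rho>"] by (simp add: add.commute)
      moreover have "sign (?\<rho> \<circ> \<tau>) = sign ?\<rho> * sign \<tau>"
        using \<tau> \<rho> by (intro sign_compose) (auto intro: permutation_permutes[THEN iffD2] )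
      moreover have "(of_int (sign ?\<rho> * sign \<tau>) * c) *s (of_int (sign \<tau>) *\<^sub>R x) =
          (of_int (sign ?\<rho>) * c) *s x" for c and x :: "complex^'b"
        by (simp add: sign_def)
      ultimately show ?thesis unfolding F_def by simp
    qed
    have "sum F {\<sigma> \<in> S. (\<sigma> 0, \<sigma> 1) = (i, j)} = (\<Sum>\<tau> | \<tau> permutes {2..<k+2}. F (?\<rho> \<circ> \<tau>))"
      unfolding eq by (subst sum.reindex[OF inj]) simp
    also have "\<dots> = (\<Sum>\<tau> | \<tau> permutes {2..<k+2}. (of_int (sign ?\<rho>) * \<alpha> (vpair (v i) (v j))) *s \<beta> (\<lambda>m. v (?\<rho> (m + 2))))"
      by (rule sum.cong) (auto simp: val)
    also have "\<dots> = fact k *\<^sub>R ((of_int (sign ?\<rho>) * \<alpha> (vpair (v i) (v j))) *s \<beta> (\<lambda>m. v (?\<rho> (m + 2))))"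
      using card_permutations[of "{2..<k+2}" k] by (simp add: sum_constant_scaleR del: sum_constant)
    finally show ?thesis .
  qed
  have "sum F S = (\<Sum>p\<in>P. sum F {\<sigma> \<in> S. (\<sigma> 0, \<sigma> 1) = p})"
    using sum.group[OF finS finP img, of F] by simp
  also have "\<dots> = (\<Sum>(i, j)\<in>P. fact k *\<^sub>R
     ((of_int (sign (slot_perm i j)) * \<alpha> (vpair (v i) (v j))) *s \<beta> (\<lambda>m. v (slot_perm i j (m + 2)))))"
    by (rule sum.cong) (use fibre in auto)
  finally show ?thesis
    unfolding wedge_def P_def[symmetric] F_def[symmetric]
    by (simp add: S_def add.commute scaleR_sum_right case_prod_beta)
qed

definition pre2 :: "'v \<Rightarrow> 'v \<Rightarrow> (nat \<Rightarrow> 'v) \<Rightarrow> nat \<Rightarrow> 'v" where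
  "pre2 a b v = case_nat a (case_nat b v)"

lemma pre2_simps [simp]: "pre2 a b v 0 = a" "pre2 a b v (Suc 0) = b" "pre2 a b v (Suc (Suc m)) = v m"
  by (simp_all add: pre2_def)

lemma sum_off_diagonal:
  fixes G :: "nat \<Rightarrow> nat \<Rightarrow> 'b::comm_monoid_add"
  shows "(\<Sum>(i, j) \<in> {(i, j). i < n \<and> j < n \<and> i \<noteq> j}. G i j) =
    (\<Sum>i<n. \<Sum>j<n. if i = j then 0 else G i j)"
proof -
  have "(\<Sum>i<n. \<Sum>j<n. if i = j then 0 else G i j) =
      (\<Sum>(i, j)\<in>{..<n} \<times> {..<n}. if i = j then 0 else G i j)"
    by (rule sum.cartesian_product)
  also have "\<dots> = (\<Sum>(i, j) \<in> {(i, j). i < n \<and> j < n \<and> i \<noteq> j}. G i j)"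
    by (rule sum.mono_neutral_cong_right) auto
  finally show ?thesis ..
qed

lemma alt_form_2_vpair:
  assumes "alt_form 2 \<alpha>"
  shows "\<alpha> (vpair a a) = 0" "\<alpha> (vpair b a) = - \<alpha> (vpair a b)"
    "\<alpha> (vpair (a + a') b) = \<alpha> (vpair a b) + \<alpha> (vpair a' b)"
proof -
  have up: "(vpair x y)(0 := z) = vpair z y" for x y z :: "complex^'n" by (auto simp: vpair_def)
  show "\<alpha> (vpair a a) = 0" by (rule alt_form_eq0[OF assms, of 0 1]) (auto simp: vpair_def)
  have "\<alpha> (vpair b a) = \<alpha> ((vpair a b)(0 := vpair a b 1, 1 := vpair a b 0))"
    by (rule alt_form_cong[OF assms]) (auto simp: vpair_def)
  also have "\<dots> = - \<alpha> (vpair a b)" by (rule alt_form_swap[OF assms]) auto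
  finally show "\<alpha> (vpair b a) = - \<alpha> (vpair a b)" .
  show "\<alpha> (vpair (a + a') b) = \<alpha> (vpair a b) + \<alpha> (vpair a' b)"
    using linear_add[OF alt_form_linear[OF assms, of 0 "vpair a b"], of a a'] by (simp add: up)
qed

text \<open>The summands are sorted by how many of the two front entries go to
  \<open>\<alpha>\<close>: both, one, or none. The terms of the last kind reappear in the wedge with
  a contracted form and cancel in the commutator of \<open>euclid_contr_wedge\<close>.\<close>

lemma wedge_2_pre2:
  assumes \<alpha>: "alt_form 2 \<alpha>" and \<beta>: "alt_form k \<beta>"
  shows "wedge 2 k \<alpha> \<beta> (pre2 a b v) = \<alpha> (vpair a b) *s \<beta> v
    + (\<Sum>j<k. \<alpha> (vpair b (v j)) *s \<beta> (v(j := a)) - \<alpha> (vpair a (v j)) *s \<beta> (v(j := b)))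
    + (1 / 2) *\<^sub>R (\<Sum>(i, j) \<in> {(i, j). i < k \<and> j < k \<and> i \<noteq> j}.
         \<alpha> (vpair (v i) (v j)) *s \<beta> (v(i := a, j := b)))"
proof -
  let ?w = "pre2 a b v"
  define G where "G i j = (of_int (sign (slot_perm i j)) * \<alpha> (vpair (?w i) (?w j))) *s
      \<beta> (\<lambda>m. ?w (slot_perm i j (m + 2)))" for i j
  have sgn: "sign (slot_perm i j) =
      (if i = 0 then 1 else -1) * (if Transposition.transpose 0 i j = 1 then 1 else -1)" for i j
    unfolding slot_perm_def by (subst sign_compose) (auto simp: sign_swap_id permutation_swap_id)
  have G01: "G 0 (Suc 0) = \<alpha> (vpair a b) *s \<beta> v"
    by (simp add: G_def sgn slot_perm_def Transposition.transpose_def)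
  have G10: "G (Suc 0) 0 = \<alpha> (vpair a b) *s \<beta> v"
  proof -
    have "(\<lambda>m. ?w (slot_perm (Suc 0) 0 (m + 2))) = v"
      by (auto simp: slot_perm_def Transposition.transpose_def)
    then show ?thesis by (simp add: G_def sgn alt_form_2_vpair(2)[OF \<alpha>, of b a])
  qed
  have G0: "G 0 (Suc (Suc j)) = - (\<alpha> (vpair a (v j)) *s \<beta> (v(j := b)))" for j
  proof -
    have "(\<lambda>m. ?w (slot_perm 0 (Suc (Suc j)) (m + 2))) = v(j := b)"
      by (auto simp: slot_perm_def Transposition.transpose_def)
    then show ?thesis by (simp add: G_def sgn)
  qed
  have G0': "G (Suc (Suc j)) 0 = - (\<alpha> (vpair a (v j)) *s \<beta> (v(j := b)))" for j
  proof -
    have "(\<lambda>m. ?w (slot_perm (Suc (Suc j)) 0 (m + 2))) = v(j := b)"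
      by (auto simp: slot_perm_def Transposition.transpose_def)
    then show ?thesis by (simp add: G_def sgn alt_form_2_vpair(2)[OF \<alpha>, of "v j" a])
  qed
  have G1: "G (Suc 0) (Suc (Suc j)) = \<alpha> (vpair b (v j)) *s \<beta> (v(j := a))" for j
  proof -
    have "(\<lambda>m. ?w (slot_perm (Suc 0) (Suc (Suc j)) (m + 2))) = v(j := a)"
      by (auto simp: slot_perm_def Transposition.transpose_def)
    then show ?thesis by (simp add: G_def sgn)
  qed
  have G1': "G (Suc (Suc j)) (Suc 0) = \<alpha> (vpair b (v j)) *s \<beta> (v(j := a))" for j
  proof -
    have "(\<lambda>m. ?w (slot_perm (Suc (Suc j)) (Suc 0) (m + 2))) = v(j := a)"
      by (auto simp: slot_perm_def Transposition.transpose_def)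
    then show ?thesis by (simp add: G_def sgn alt_form_2_vpair(2)[OF \<alpha>, of "v j" b])
  qed
  have G2: "G (Suc (Suc i)) (Suc (Suc j)) = \<alpha> (vpair (v i) (v j)) *s \<beta> (v(i := a, j := b))"
    if "i \<noteq> j" for i j
  proof -
    have "(\<lambda>m. ?w (slot_perm (Suc (Suc i)) (Suc (Suc j)) (m + 2))) = v(i := a, j := b)"
      using that by (auto simp: slot_perm_def Transposition.transpose_def)
    then show ?thesis using that by (simp add: G_def sgn)
  qed
  have "(\<Sum>(i, j) \<in> {(i, j). i < k + 2 \<and> j < k + 2 \<and> i \<noteq> j}. G i j) =
    2 *\<^sub>R (\<alpha> (vpair a b) *s \<beta> v) +
    2 *\<^sub>R (\<Sum>j<k. \<alpha> (vpair b (v j)) *s \<beta> (v(j := a)) - \<alpha> (vpair a (v j)) *s \<beta> (v(j := b))) +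
    (\<Sum>i<k. \<Sum>j<k. if i = j then 0 else \<alpha> (vpair (v i) (v j)) *s \<beta> (v(i := a, j := b)))"
    unfolding sum_off_diagonal
    by (simp add: sum.lessThan_Suc_shift G01 G10 G0 G0' G1 G1' G2 sum.distrib sum_subtractf sum_negf
        algebra_simps scaleR_2 cong: if_cong del: sum.lessThan_Suc)
  then show ?thesis unfolding wedge_2_slots[OF \<alpha> \<beta>] G_def[symmetric] sum_off_diagonal
    by (simp add: algebra_simps)
qed

lemma linear_vector_smult:
  fixes f :: "'v::real_vector \<Rightarrow> complex^'m"
  assumes "linear f"
  shows "linear (\<lambda>x. c *s f x)"
  using linear_add[OF assms] linear_scale[OF assms]
  by (intro linearI) (simp_all add: vec_eq_iff distrib_left)

lemma linear_smult_vector: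
  fixes f :: "'v::real_vector \<Rightarrow> complex"
  assumes "linear f"
  shows "linear (\<lambda>x. f x *s (u :: complex^'m))"
  using linear_add[OF assms] linear_scale[OF assms]
  by (intro linearI) (simp_all add: vec_eq_iff distrib_right)

lemma linear_mult_left:
  fixes f :: "'v::real_vector \<Rightarrow> complex"
  assumes "linear f"
  shows "linear (\<lambda>x. c * f x)"
  using linear_add[OF assms] linear_scale[OF assms]
  by (intro linearI) (simp_all add: distrib_left)

lemma alt_form_wedge_2:
  assumes \<alpha>: "alt_form 2 \<alpha>" and \<beta>: "alt_form k \<beta>"
  shows "alt_form (k + 2) (wedge 2 k \<alpha> (\<beta> :: ('n::finite, complex^'r) covector))"
  unfolding alt_form_def
proof (intro conjI allI impI)
  fix v w :: "nat \<Rightarrow> complex^'n" assume vw: "\<forall>i<k + 2. v i = w i"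
  show "wedge 2 k \<alpha> \<beta> v = wedge 2 k \<alpha> \<beta> w" unfolding wedge_def
  proof (intro arg_cong2[where f = scaleR] sum.cong refl)
    fix \<sigma> assume "\<sigma> \<in> {\<sigma>. \<sigma> permutes {..<2 + k}}"
    then have \<sigma>: "\<sigma> i < k + 2" if "i < k + 2" for i using that permutes_in_image[of \<sigma> "{..<2+k}" i] by auto
    have "\<alpha> (v \<circ> \<sigma>) = \<alpha> (w \<circ> \<sigma>)" by (rule alt_form_cong[OF \<alpha>]) (use vw \<sigma> in auto)
    moreover have "\<beta> (\<lambda>i. v (\<sigma> (2 + i))) = \<beta> (\<lambda>i. w (\<sigma> (2 + i)))"
      by (rule alt_form_cong[OF \<beta>]) (use vw \<sigma> in auto)
    ultimately show "(of_int (sign \<sigma>) * \<alpha> (v \<circ> \<sigma>)) *s \<beta> (\<lambda>i. v (\<sigma> (2 + i))) =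
      (of_int (sign \<sigma>) * \<alpha> (w \<circ> \<sigma>)) *s \<beta> (\<lambda>i. w (\<sigma> (2 + i)))" by simp
  qed
next
  fix v :: "nat \<Rightarrow> complex^'n" and i assume i: "i < k + 2"
  have "linear (\<lambda>x. (of_int (sign \<sigma>) * \<alpha> ((v(i := x)) \<circ> \<sigma>)) *s \<beta> (\<lambda>m. (v(i := x)) (\<sigma> (2 + m))))"
    if \<sigma>: "\<sigma> permutes {..<2 + k}" for \<sigma>
  proof -
    define p where "p = inv \<sigma> i"
    have p: "\<sigma> p = i" "p < k + 2" using \<sigma> i permutes_inverses(1)[OF \<sigma>] permutes_in_image[OF permutes_inv[OF \<sigma>], of i]
      by (auto simp: p_def)
    have eq: "\<sigma> m = i \<longleftrightarrow> m = p" for m using p(1) permutes_inj[OF \<sigma>] by (auto dest: injD)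
    show ?thesis
    proof (cases "p < 2")
      case True
      have 1: "(v(i := x)) \<circ> \<sigma> = (v \<circ> \<sigma>)(p := x)" for x by (auto simp: eq)
      have 2: "(\<lambda>m. (v(i := x)) (\<sigma> (2 + m))) = (\<lambda>m. v (\<sigma> (2 + m)))" for x using True by (auto simp: eq)
      have L: "linear (\<lambda>x. \<alpha> ((v \<circ> \<sigma>)(p := x)))" by (rule alt_form_linear[OF \<alpha> True])
      show ?thesis unfolding 1 2
        by (intro linear_smult_vector linear_mult_left L)
    next
      case False
      have 1: "\<alpha> ((v(i := x)) \<circ> \<sigma>) = \<alpha> (v \<circ> \<sigma>)" for x
        by (rule alt_form_cong[OF \<alpha>]) (use False in \<open>auto simp: eq\<close>)
      have 2: "(\<lambda>m. (v(i := x)) (\<sigma> (2 + m))) = (\<lambda>m. v (\<sigma> (2 + m)))(p - 2 := x)" for x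
        using False by (auto simp: eq fun_eq_iff)
      have L: "linear (\<lambda>x. \<beta> ((\<lambda>m. v (\<sigma> (2 + m)))(p - 2 := x)))"
        using False p by (intro alt_form_linear[OF \<beta>]) auto
      show ?thesis unfolding 1 2
        by (rule linear_vector_smult[OF L])
    qed
  qed
  then show "linear (\<lambda>x. wedge 2 k \<alpha> \<beta> (v(i := x)))"
    unfolding wedge_def by (intro linear_compose_scale_right linear_compose_sum) auto
next
  fix v :: "nat \<Rightarrow> complex^'n" and i j assume ij: "i < j \<and> j < k + 2 \<and> v i = v j"
  define F where "F \<sigma> = (of_int (sign \<sigma>) * \<alpha> (v \<circ> \<sigma>)) *s \<beta> (\<lambda>i. v (\<sigma> (2 + i)))" for \<sigma>
  let ?t = "Transposition.transpose i j"
  have t: "?t permutes {..<2 + k}" using ij by (intro permutes_swap_id) auto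
  have vt: "v (?t m) = v m" for m using ij by (auto simp: Transposition.transpose_def)
  \<comment> \<open>The transposition leaves \<open>v\<close> unchanged but reverses the sign, so
    composing with it shows that the sum over all permutations equals its own negative.\<close>
  have "F (?t \<circ> \<sigma>) = - F \<sigma>" if \<sigma>: "\<sigma> permutes {..<2+k}" for \<sigma>
  proof -
    have "sign (?t \<circ> \<sigma>) = - sign \<sigma>" using ij \<sigma>
      by (subst sign_compose) (auto simp: sign_swap_id permutation_swap_id intro: permutation_permutes[THEN iffD2])
    moreover have "v \<circ> (?t \<circ> \<sigma>) = v \<circ> \<sigma>" using vt by auto
    ultimately show ?thesis by (simp add: F_def vt)
  qed
  then have "sum F {\<sigma>. \<sigma> permutes {..<2+k}} = (\<Sum>\<sigma> | \<sigma> permutes {..<2+k}. - F \<sigma>)"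
    by (subst setum_permutations_compose_left[OF t]) (auto intro: sum.cong)
  then have "sum F {\<sigma>. \<sigma> permutes {..<2+k}} = 0" by (simp add: sum_negf vec_eq_iff)
  then show "wedge 2 k \<alpha> \<beta> v = 0" by (simp add: wedge_def F_def add.commute)
qed

lemma sum_PiE_Suc:
  fixes G :: "(nat \<Rightarrow> 'a) \<Rightarrow> 'b::comm_monoid_add"
  assumes "finite S"
  shows "(\<Sum>I \<in> {..<Suc k} \<rightarrow>\<^sub>E S. G I) = (\<Sum>a\<in>S. \<Sum>I \<in> {..<k} \<rightarrow>\<^sub>E S. G (case_nat a I))"
proof -
  have "bij_betw (\<lambda>(a, I). case_nat a I) (S \<times> ({..<k} \<rightarrow>\<^sub>E S)) ({..<Suc k} \<rightarrow>\<^sub>E S)"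
  proof (rule bij_betw_byWitness[where f' = "\<lambda>I. (I 0, \<lambda>i. I (Suc i))"])
    show "(\<lambda>(a, I). case_nat a I) ` (S \<times> ({..<k} \<rightarrow>\<^sub>E S)) \<subseteq> {..<Suc k} \<rightarrow>\<^sub>E S"
    proof clarify
      fix a and I :: "nat \<Rightarrow> 'a" assume a: "a \<in> S" and I: "I \<in> {..<k} \<rightarrow>\<^sub>E S"
      show "case_nat a I \<in> {..<Suc k} \<rightarrow>\<^sub>E S"
      proof (rule PiE_I)
        fix x assume "x \<in> {..<Suc k}" then show "case_nat a I x \<in> S"
          using a PiE_mem[OF I] by (cases x) auto
      next
        fix x assume "x \<notin> {..<Suc k}" then show "case_nat a I x = undefined"
          using PiE_arb[OF I] by (cases x) auto
      qed
    qed
    show "(\<lambda>I. (I 0, \<lambda>i. I (Suc i))) ` ({..<Suc k} \<rightarrow>\<^sub>E S) \<subseteq> S \<times> ({..<k} \<rightarrow>\<^sub>E S)"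
    proof (rule image_subsetI)
      fix I :: "nat \<Rightarrow> 'a" assume I: "I \<in> {..<Suc k} \<rightarrow>\<^sub>E S"
      show "(I 0, \<lambda>i. I (Suc i)) \<in> S \<times> ({..<k} \<rightarrow>\<^sub>E S)"
        using PiE_mem[OF I] PiE_arb[OF I] by (intro SigmaI PiE_I) auto
    qed
    show "\<forall>p\<in>S \<times> ({..<k} \<rightarrow>\<^sub>E S). (\<lambda>I. (I 0, \<lambda>i. I (Suc i))) ((\<lambda>(a, I). case_nat a I) p) = p"
      by (intro ballI) (simp add: case_prod_beta)
    show "\<forall>I\<in>{..<Suc k} \<rightarrow>\<^sub>E S. (\<lambda>(a, I). case_nat a I) (I 0, \<lambda>i. I (Suc i)) = I"
    proof
      fix I :: "nat \<Rightarrow> 'a"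
      show "(\<lambda>(a, I). case_nat a I) (I 0, \<lambda>i. I (Suc i)) = I"
      proof
        fix x show "(\<lambda>(a, I). case_nat a I) (I 0, \<lambda>i. I (Suc i)) x = I x" by (cases x) simp_all
      qed
    qed
  qed
  from sum.reindex_bij_betw[OF this, of G]
  show ?thesis by (simp add: sum.cartesian_product case_prod_beta)
qed

lemma sum_PiE_permute:
  fixes G :: "(nat \<Rightarrow> 'a) \<Rightarrow> 'b::comm_monoid_add"
  assumes \<sigma>: "\<sigma> permutes {..<k}"
  shows "(\<Sum>I \<in> {..<k} \<rightarrow>\<^sub>E S. G (I \<circ> \<sigma>)) = (\<Sum>I \<in> {..<k} \<rightarrow>\<^sub>E S. G I)"
proof -
  have *: "I \<circ> \<tau> \<in> {..<k} \<rightarrow>\<^sub>E S" if "\<tau> permutes {..<k}" "I \<in> {..<k} \<rightarrow>\<^sub>E S" for \<tau> and I :: "nat \<Rightarrow> 'a"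
    using that permutes_in_image[OF that(1)]
    by (auto simp: PiE_iff extensional_def)
  have "bij_betw (\<lambda>I. I \<circ> \<sigma>) ({..<k} \<rightarrow>\<^sub>E S) ({..<k} \<rightarrow>\<^sub>E S)"
    by (rule bij_betw_byWitness[where f' = "\<lambda>I. I \<circ> inv \<sigma>"])
      (use *[OF \<sigma>] *[OF permutes_inv[OF \<sigma>]] permutes_inverses[OF \<sigma>] in \<open>auto simp: comp_assoc fun_eq_iff\<close>)
  from sum.reindex_bij_betw[OF this, of G] show ?thesis .
qed

text \<open>Since \<open>\<beta>\<close> is alternating, every permutation in the wedge contributes
  the same sum over frame tuples. Their number \<open>fact (k + 2)\<close> cancels the normalization
  of the inner product, and of the normalization of the wedge only the 1/2 and the
  \<open>fact k\<close> of the smaller inner product remain. Reality of \<open>\<omega>\<close> lets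
  its values pass into the conjugate-linear argument of \<open>h\<close>. The result exhibits the
  adjoint of \<open>\<omega> \<and>\<close> as an explicit contraction.\<close>

lemma wedge_form_inner:
  assumes h: "hermitian_ip h" and \<beta>: "alt_form (k + 2) \<beta>"
    and \<omega>: "alt_form 2 \<omega>" "\<And>v. \<omega> v \<in> \<real>"
  shows "form_inner \<omega>0 h (k + 2) (wedge 2 k \<omega> \<alpha>) (\<beta> :: ('n::finite, complex^'r) covector) =
    form_inner \<omega>0 h k \<alpha> (\<lambda>v. (1 / 2) *\<^sub>R (\<Sum>a<2 * CARD('n). \<Sum>b<2 * CARD('n).
       \<omega> (vpair (onframe \<omega>0 a) (onframe \<omega>0 b)) *s \<beta> (pre2 (onframe \<omega>0 a) (onframe \<omega>0 b) v)))"
proof -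
  define e where "e = onframe \<omega>0"
  define m where "m = 2 * CARD('n)"
  define T where "T I = \<omega> (e \<circ> I) * h (\<alpha> (\<lambda>i. (e \<circ> I) (2 + i))) (\<beta> (e \<circ> I))" for I :: "nat \<Rightarrow> nat"
  let ?P = "\<lambda>k. {..<k} \<rightarrow>\<^sub>E {..<m}"
  let ?S = "{\<sigma>. \<sigma> permutes {..<2 + k}}"
  have 1: "h ((of_int (sign \<sigma>) * \<omega> ((e \<circ> I) \<circ> \<sigma>)) *s \<alpha> (\<lambda>i. (e \<circ> I) (\<sigma> (2 + i)))) (\<beta> (e \<circ> I)) = T (I \<circ> \<sigma>)"
    if \<sigma>: "\<sigma> permutes {..<2 + k}" for \<sigma> I
  proof -
    have "\<beta> ((e \<circ> I) \<circ> \<sigma>) = of_int (sign \<sigma>) *\<^sub>R \<beta> (e \<circ> I)"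
      by (rule alt_form_perm[OF \<beta>]) (use \<sigma> in \<open>simp add: add.commute\<close>)
    then show ?thesis
      by (simp add: T_def hermitian_ip_simps[OF h] comp_assoc[symmetric]) (simp add: comp_def scaleR_conv_of_real)
  qed
  have 2: "h (wedge 2 k \<omega> \<alpha> (e \<circ> I)) (\<beta> (e \<circ> I)) = (1 / (2 * fact k)) *\<^sub>R (\<Sum>\<sigma>\<in>?S. T (I \<circ> \<sigma>))" for I
    unfolding wedge_def hermitian_ip_simps(7)[OF h] hermitian_ip_sum(1)[OF h]
  proof (intro arg_cong2[where f = scaleR] sum.cong refl)
    show "1 / (fact 2 * fact k) = (1 / (2 * fact k) :: real)" by simp
  qed (rule 1, simp)
  have "(\<Sum>I\<in>?P (k + 2). h (wedge 2 k \<omega> \<alpha> (e \<circ> I)) (\<beta> (e \<circ> I))) =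
      (1 / (2 * fact k)) *\<^sub>R (\<Sum>I\<in>?P (k + 2). \<Sum>\<sigma>\<in>?S. T (I \<circ> \<sigma>))"
    by (simp only: 2 scaleR_sum_right)
  also have "(\<Sum>I\<in>?P (k + 2). \<Sum>\<sigma>\<in>?S. T (I \<circ> \<sigma>)) = (\<Sum>\<sigma>\<in>?S. \<Sum>I\<in>?P (k + 2). T (I \<circ> \<sigma>))"
    by (rule sum.swap)
  also have "\<dots> = (\<Sum>\<sigma>\<in>?S. \<Sum>I\<in>?P (k + 2). T I)"
    by (intro sum.cong refl sum_PiE_permute) (simp add: add.commute)
  also have "\<dots> = fact (k + 2) * (\<Sum>I\<in>?P (k + 2). T I)"
  proof -
    have "card ?S = fact (k + 2)" by (rule card_permutations) auto
    then show ?thesis by (simp only: sum_constant of_nat_fact)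
  qed
  also have "(\<Sum>I\<in>?P (k + 2). T I) = (\<Sum>a<m. \<Sum>b<m. \<Sum>I\<in>?P k. T (case_nat a (case_nat b I)))"
    by (simp add: sum_PiE_Suc)
  also have "\<dots> = (\<Sum>a<m. \<Sum>b<m. \<Sum>I\<in>?P k. \<omega> (vpair (e a) (e b)) * h (\<alpha> (e \<circ> I)) (\<beta> (pre2 (e a) (e b) (e \<circ> I))))"
  proof (intro sum.cong refl)
    fix a b and I :: "nat \<Rightarrow> nat"
    have "\<omega> (e \<circ> case_nat a (case_nat b I)) = \<omega> (vpair (e a) (e b))"
      by (rule alt_form_cong[OF \<omega>(1)]) (auto simp: vpair_def less_Suc_eq numeral_2_eq_2)
    moreover have "e \<circ> case_nat a (case_nat b I) = pre2 (e a) (e b) (e \<circ> I)"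
      by (auto simp: pre2_def fun_eq_iff split: nat.splits)
    ultimately show "T (case_nat a (case_nat b I)) = \<omega> (vpair (e a) (e b)) * h (\<alpha> (e \<circ> I)) (\<beta> (pre2 (e a) (e b) (e \<circ> I)))"
      by (simp add: T_def comp_def)
  qed
  also have "\<dots> = (\<Sum>I\<in>?P k. \<Sum>a<m. \<Sum>b<m. \<omega> (vpair (e a) (e b)) * h (\<alpha> (e \<circ> I)) (\<beta> (pre2 (e a) (e b) (e \<circ> I))))"
    by (subst sum.swap[of _ "?P k"]) (intro sum.cong refl sum.swap)
  also have "\<dots> = (\<Sum>I\<in>?P k. h (\<alpha> (e \<circ> I)) (\<Sum>a<m. \<Sum>b<m. \<omega> (vpair (e a) (e b)) *s \<beta> (pre2 (e a) (e b) (e \<circ> I))))"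
    by (simp add: hermitian_ip_sum[OF h] hermitian_ip_simps[OF h] Reals_cnj_iff[THEN iffD1, OF \<omega>(2)])
  finally show ?thesis
    unfolding form_inner_def e_def[symmetric] m_def[symmetric]
    by (simp only: hermitian_ip_simps(8)[OF h] scaleR_sum_right[symmetric])
       (simp add: scaleR_conv_of_real field_simps del: fact_Suc add_2_eq_Suc')
qed

section \<open>Orthonormal frames, the Euclidean Kaehler form and its adjoint\<close>

lemma frame_span:
  fixes e :: "nat \<Rightarrow> 'v::euclidean_space"
  assumes "\<And>i j. i < DIM('v) \<Longrightarrow> j < DIM('v) \<Longrightarrow> inner (e i) (e j) = (if i = j then 1 else 0)"
  shows "span (e ` {..<DIM('v)}) = UNIV" "x = (\<Sum>a<DIM('v). inner x (e a) *\<^sub>R e a)"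
proof -
  let ?B = "e ` {..<DIM('v)}"
  have inj: "inj_on e {..<DIM('v)}"
    using assms by (intro inj_onI) (metis lessThan_iff zero_neq_one)
  have orth: "pairwise orthogonal ?B"
    using assms by (auto simp: pairwise_def orthogonal_def)
  have "0 \<notin> ?B" using assms by (auto simp: image_iff) (metis inner_zero_left zero_neq_one)
  then have ind: "independent ?B" by (rule pairwise_orthogonal_independent[OF orth])
  show sp: "span ?B = UNIV"
    using card_eq_dim[of ?B UNIV] ind card_image[OF inj] by auto
  have "x \<in> span ?B" using sp by simp
  moreover have "norm v = 1" if "v \<in> ?B" for v using that assms by (auto simp: norm_eq_1)
  ultimately have "(\<Sum>v\<in>?B. inner x v *\<^sub>R v) = x"
    using orthonormal_basis_expand[OF orth] by simp
  then show "x = (\<Sum>a<DIM('v). inner x (e a) *\<^sub>R e a)"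
    by (simp add: sum.reindex[OF inj])
qed

lemma vector_smult_scaleR: "c *s (r *\<^sub>R x) = r *\<^sub>R (c *s (x :: complex^'n))"
  by (simp add: vec_eq_iff)

text \<open>The standard Kaehler form, half of \<open>\<i>\<close> times the sum of dz_j wedge
  dz-bar_j, written through the real inner product so that \<open>riem\<close> becomes the Euclidean
  metric.\<close>

definition euclid_form :: "('n::finite, complex) covector" where
  "euclid_form v = of_real (inner (\<i> *s v 0) (v 1))"

lemma inner_ii: "inner (\<i> *s u) (\<i> *s v) = inner u (v :: complex^'n)"
  by (simp add: inner_vec_def inner_complex_def algebra_simps)

lemma inner_i_skew: "inner (\<i> *s u) v = - inner u (\<i> *s v :: complex^'n)"
  by (simp add: inner_vec_def inner_complex_def algebra_simps flip: sum_negf)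

lemma inner_i_self: "inner (\<i> *s u) (u :: complex^'n) = 0"
  using inner_i_skew[of u u] by (simp add: inner_commute)

lemma riem_euclid: "riem euclid_form u v = inner u v"
  by (simp add: riem_def euclid_form_def vpair_def inner_ii)

lemma euclid_form_vpair: "euclid_form (vpair a b) = of_real (inner (\<i> *s a) b)"
  by (simp add: euclid_form_def vpair_def)

lemma alt_form_euclid: "alt_form 2 (euclid_form :: ('n::finite, complex) covector)"
  unfolding alt_form_def
proof (intro conjI allI impI)
  fix v :: "nat \<Rightarrow> complex^'n" and i :: nat assume "i < 2"
  then have "i = 0 \<or> i = 1" by auto
  then show "linear (\<lambda>x. euclid_form (v(i := x)))"
    by (auto intro!: linearI simp: euclid_form_def inner_add_left inner_add_right vector_add_ldistrib
        inner_i_skew vector_smult_scaleR) (simp_all only: scaleR_conv_of_real)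
next
  fix v :: "nat \<Rightarrow> complex^'n" and i j :: nat assume "i < j \<and> j < 2 \<and> v i = v j"
  then have "v 0 = v 1" by (cases i; cases j) (auto simp: less_Suc_eq numeral_2_eq_2)
  then show "euclid_form v = 0" by (simp add: euclid_form_def inner_i_self)
qed (simp add: euclid_form_def)

text \<open>\<open>onframe\<close> is an arbitrary choice, so only the existence of an orthonormal
  frame is at stake; an enumeration of the standard real basis is one.\<close>

lemma onframe_euclid:
  "i < 2 * CARD('n) \<Longrightarrow> j < 2 * CARD('n) \<Longrightarrow>
   inner (onframe (euclid_form :: ('n::finite, complex) covector) i) (onframe euclid_form j) = (if i = j then 1 else 0)"
proof -
  have "\<exists>b. bij_betw b {0..<DIM(complex^'n)} (Basis :: (complex^'n) set)"
    using ex_bij_betw_nat_finite[OF finite_Basis[where 'a = "complex^'n"]] by simp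
  then obtain b where b: "bij_betw b {0..<2 * CARD('n)} (Basis :: (complex^'n) set)" by (auto simp: mult.commute)
  have "inner (b i) (b j) = (if i = j then 1 else 0)" if "i < 2 * CARD('n)" "j < 2 * CARD('n)" for i j
  proof -
    have "b i \<in> Basis" "b j \<in> Basis" using that bij_betwE[OF b] by auto
    moreover have "b i = b j \<longleftrightarrow> i = j"
      using that b by (intro inj_on_eq_iff[of b "{0..<2 * CARD('n)}"]) (auto simp: bij_betw_def)
    ultimately show ?thesis by (simp add: inner_Basis)
  qed
  then have "\<exists>e :: nat \<Rightarrow> complex^'n. \<forall>i<2 * CARD('n). \<forall>j<2 * CARD('n).
      riem euclid_form (e i) (e j) = (if i = j then 1 else 0)"
    by (intro exI[of _ b]) (auto simp: riem_euclid)
  from someI_ex[OF this] show "i < 2 * CARD('n) \<Longrightarrow> j < 2 * CARD('n) \<Longrightarrow> ?thesis"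
    unfolding onframe_def riem_euclid by blast
qed

text \<open>The contraction found in \<open>wedge_form_inner\<close> for the Euclidean form. It
  makes \<open>Lambda_op\<close>, which is given only by its adjointness, computable.\<close>

definition euclid_contr :: "('n::finite, complex^'r) covector \<Rightarrow> ('n, complex^'r) covector" where
  "euclid_contr \<beta> v = (1 / 2) *\<^sub>R (\<Sum>a<2 * CARD('n). \<Sum>b<2 * CARD('n).
     euclid_form (vpair (onframe euclid_form a) (onframe euclid_form b) :: nat \<Rightarrow> complex^'n)
       *s \<beta> (pre2 (onframe euclid_form a) (onframe euclid_form b) v))"

lemma pre2_upd: "pre2 a b (v(i := x)) = (pre2 a b v)(Suc (Suc i) := x)"
  by (auto simp: pre2_def fun_eq_iff split: nat.split)

lemma alt_form_pre2:
  fixes \<beta> :: "('n::finite, complex^'r) covector"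
  assumes "alt_form (k + 2) \<beta>"
  shows "alt_form k (\<lambda>v. \<beta> (pre2 a b v))"
  unfolding alt_form_def
proof (intro conjI allI impI)
  fix v w :: "nat \<Rightarrow> complex^'n" assume "\<forall>i<k. v i = w i"
  then show "\<beta> (pre2 a b v) = \<beta> (pre2 a b w)"
    by (intro alt_form_cong[OF assms]) (auto simp: pre2_def split: nat.split)
next
  fix v :: "nat \<Rightarrow> complex^'n" and i assume "i < k"
  then show "linear (\<lambda>x. \<beta> (pre2 a b (v(i := x))))"
    unfolding pre2_upd by (intro alt_form_linear[OF assms]) auto
next
  fix v :: "nat \<Rightarrow> complex^'n" and i j assume "i < j \<and> j < k \<and> v i = v j"
  then show "\<beta> (pre2 a b v) = 0"
    by (intro alt_form_eq0[OF assms, of "Suc (Suc i)" "Suc (Suc j)"]) auto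
qed

lemma alt_form_sum:
  assumes "\<And>i. i \<in> A \<Longrightarrow> alt_form k (\<alpha> i)"
  shows "alt_form k (\<lambda>v. \<Sum>i\<in>A. \<alpha> i v)"
  unfolding alt_form_def
proof (intro conjI allI impI)
  fix v w :: "nat \<Rightarrow> complex^'b" assume "\<forall>i<k. v i = w i"
  then show "(\<Sum>i\<in>A. \<alpha> i v) = (\<Sum>i\<in>A. \<alpha> i w)"
    by (intro sum.cong refl alt_form_cong[OF assms]) auto
next
  fix v :: "nat \<Rightarrow> complex^'b" and i assume "i < k"
  then show "linear (\<lambda>x. \<Sum>j\<in>A. \<alpha> j (v(i := x)))"
    by (intro linear_compose_sum ballI alt_form_linear[OF assms])
next
  fix v :: "nat \<Rightarrow> complex^'b" and i j assume "i < j \<and> j < k \<and> v i = v j"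
  then show "(\<Sum>l\<in>A. \<alpha> l v) = 0"
    by (intro sum.neutral ballI alt_form_eq0[OF assms, of _ i j]) auto
qed

lemma alt_form_smult: "alt_form k \<alpha> \<Longrightarrow> alt_form k (\<lambda>v. c *s (\<alpha> v :: complex^'m))"
  unfolding alt_form_def by (simp add: linear_vector_smult)

lemma alt_form_scaleR: "alt_form k \<alpha> \<Longrightarrow> alt_form k (\<lambda>v. c *\<^sub>R (\<alpha> v :: complex^'m))"
  unfolding alt_form_def by (simp add: linear_compose_scale_right)

lemma alt_form_diff: "alt_form k \<alpha> \<Longrightarrow> alt_form k \<beta> \<Longrightarrow> alt_form k (\<lambda>v. \<alpha> v - \<beta> v)"
  unfolding alt_form_def by (simp add: linear_compose_sub) metis

lemma alt_form_euclid_contr: "alt_form (k + 2) \<beta> \<Longrightarrow> alt_form k (euclid_contr \<beta>)"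
  unfolding euclid_contr_def[abs_def]
  by (intro alt_form_scaleR alt_form_sum alt_form_smult alt_form_pre2)

lemma form_inner_self_eq_0:
  fixes \<delta> :: "('n::finite, complex^'r) covector"
  assumes h: "hermitian_ip h" and \<delta>: "alt_form k \<delta>" and 0: "form_inner euclid_form h k \<delta> \<delta> = 0"
  shows "\<delta> v = 0"
proof (rule alt_form_eq_0_on_spanning[OF \<delta>])
  let ?e = "onframe (euclid_form :: ('n, complex) covector)"
  let ?m = "2 * CARD('n)"
  show "span (?e ` {..<DIM(complex^'n)}) = UNIV"
    by (rule frame_span(1)) (use onframe_euclid[where 'n = 'n] in \<open>simp add: mult.commute\<close>)
  fix v assume v: "\<And>i. i < k \<Longrightarrow> v i \<in> ?e ` {..<DIM(complex^'n)}"
  then have "\<forall>i. \<exists>a. i < k \<longrightarrow> a < ?m \<and> v i = ?e a" by (force simp: mult.commute)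
  then obtain I where I: "\<And>i. i < k \<Longrightarrow> I i < ?m \<and> v i = ?e (I i)" by metis
  \<comment> \<open>The index functions in \<open>form_inner\<close> take the value
    \<open>undefined\<close> outside \<open>{..<k}\<close>, hence the restriction.\<close>
  let ?J = "restrict I {..<k}"
  have J: "?J \<in> {..<k} \<rightarrow>\<^sub>E {..<?m}" using I by auto
  have "(\<Sum>I \<in> {..<k} \<rightarrow>\<^sub>E {..<?m}. Re (h (\<delta> (?e \<circ> I)) (\<delta> (?e \<circ> I)))) = 0"
  proof -
    have "(\<Sum>I \<in> {..<k} \<rightarrow>\<^sub>E {..<?m}. h (\<delta> (?e \<circ> I)) (\<delta> (?e \<circ> I))) = 0"
      using 0 by (simp add: form_inner_def)
    from arg_cong[OF this, of Re] show ?thesis by simp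
  qed
  then have "Re (h (\<delta> (?e \<circ> ?J)) (\<delta> (?e \<circ> ?J))) = 0"
    using J by (subst (asm) sum_nonneg_eq_0_iff) (auto simp: finite_PiE hermitian_ip_simps[OF h])
  then have "\<delta> (?e \<circ> ?J) = 0" by (simp add: hermitian_ip_simps[OF h])
  moreover have "\<delta> v = \<delta> (?e \<circ> ?J)" by (rule alt_form_cong[OF \<delta>]) (use I in auto)
  ultimately show "\<delta> v = 0" by simp
qed

lemma form_inner_diff_right:
  assumes h: "hermitian_ip h"
  shows "form_inner \<omega> h k \<alpha> (\<lambda>v. \<beta> v - \<gamma> v) = form_inner \<omega> h k \<alpha> \<beta> - form_inner \<omega> h k \<alpha> \<gamma>"
  by (simp add: form_inner_def hermitian_ip_simps[OF h] sum_subtractf diff_divide_distrib)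

lemma euclid_form_real: "euclid_form v \<in> \<real>"
  by (simp add: euclid_form_def)

text \<open>Existence for the \<open>THE\<close> is \<open>wedge_form_inner\<close>. For uniqueness,
  the difference of two candidates is orthogonal to every \<open>k\<close>-form, in particular to
  itself.\<close>

lemma Lambda_op_euclid:
  fixes \<beta> :: "('n::finite, complex^'r) covector"
  assumes h: "hermitian_ip h" and \<beta>: "alt_form (k + 2) \<beta>"
  shows "Lambda_op euclid_form h k \<beta> = euclid_contr \<beta>"
  unfolding Lambda_op_def
proof (rule the_equality)
  have adj: "form_inner euclid_form h (k + 2) (wedge 2 k euclid_form \<alpha>) \<beta> = form_inner euclid_form h k \<alpha> (euclid_contr \<beta>)"
    for \<alpha> unfolding euclid_contr_def[abs_def]
    by (rule wedge_form_inner[OF h \<beta> alt_form_euclid euclid_form_real])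
  then show "alt_form k (euclid_contr \<beta>) \<and> (\<forall>\<alpha>. alt_form k \<alpha> \<longrightarrow>
     form_inner euclid_form h (k + 2) (wedge 2 k euclid_form \<alpha>) \<beta> = form_inner euclid_form h k \<alpha> (euclid_contr \<beta>))"
    using alt_form_euclid_contr[OF \<beta>] by blast
  fix \<gamma> :: "('n, complex^'r) covector" assume \<gamma>: "alt_form k \<gamma> \<and> (\<forall>\<alpha>. alt_form k \<alpha> \<longrightarrow>
     form_inner euclid_form h (k + 2) (wedge 2 k euclid_form \<alpha>) \<beta> = form_inner euclid_form h k \<alpha> \<gamma>)"
  have d: "alt_form k (\<lambda>v. \<gamma> v - euclid_contr \<beta> v)"
    using \<gamma> alt_form_euclid_contr[OF \<beta>] by (intro alt_form_diff) auto
  have "form_inner euclid_form h k (\<lambda>v. \<gamma> v - euclid_contr \<beta> v) (\<lambda>v. \<gamma> v - euclid_contr \<beta> v) = 0"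
    unfolding form_inner_diff_right[OF h] using \<gamma> d adj by auto
  from form_inner_self_eq_0[OF h d this] show "\<gamma> = euclid_contr \<beta>" by auto
qed

text \<open>The Kaehler identity \<open>[L, \<Lambda>] = k - n\<close> on \<open>k\<close>-covectors, by expanding \<open>\<omega> \<and> \<beta>\<close> in the two
  slots that are contracted.\<close>

lemma euclid_contr_wedge:
  fixes \<beta> :: "('n::finite, complex^'r) covector"
  assumes \<beta>: "alt_form (k + 2) \<beta>"
  shows "wedge 2 k euclid_form (euclid_contr \<beta>) v - euclid_contr (wedge 2 (k + 2) euclid_form \<beta>) v =
    (real (k + 2) - real CARD('n)) *\<^sub>R \<beta> v"
proof -
  define e where "e = onframe (euclid_form :: ('n, complex) covector)"
  define m where "m = 2 * CARD('n)"
  have DIM: "DIM(complex^'n) = m" by (simp add: m_def mult.commute)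
  have orth: "inner (e i) (e j) = (if i = j then 1 else 0)" if "i < m" "j < m" for i j
    using onframe_euclid[where 'n = 'n] that by (simp add: e_def m_def)
  have ex: "x = (\<Sum>a<m. inner x (e a) *\<^sub>R e a)" for x
    by (rule frame_span(2)[of e x, unfolded DIM, OF orth])
  define W where "W x y = (euclid_form (vpair x y) :: complex)" for x y :: "complex^'n"
  have W: "W x y = of_real (inner (\<i> *s x) y)" for x y by (simp add: W_def euclid_form_vpair)
  have Wskew: "W x y = - W y x" for x y
    using inner_i_skew[of x y] inner_commute[of x "\<i> *s y"] by (simp add: W)
  have exL: "f x = (\<Sum>a<m. inner x (e a) *\<^sub>R f (e a))" if "linear f" for f :: "complex^'n \<Rightarrow> complex^'r" and x
    by (subst ex) (simp add: linear_sum[OF that] linear_scale[OF that])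
  have rs: "of_real r *s u = r *\<^sub>R (u :: complex^'r)" for r u
    by (simp only: vec_eq_iff vector_scaleR_component vector_smult_component) (simp add: scaleR_conv_of_real)
  have par: "inner x y = (\<Sum>a<m. inner x (e a) * inner (e a) y)" for x y
  proof -
    have "inner x y = inner (\<Sum>a<m. inner x (e a) *\<^sub>R e a) y" by (rule arg_cong2[OF ex refl])
    then show ?thesis by (simp add: inner_sum_left)
  qed
  have s1: "(\<Sum>b<m. inner (\<i> *s e a) (e b) * inner (\<i> *s e a) (e b)) = 1" if "a < m" for a
  proof -
    have "inner (\<i> *s e a) (\<i> *s e a) = (\<Sum>b<m. inner (\<i> *s e a) (e b) * inner (\<i> *s e a) (e b))"
      by (subst par) (simp add: inner_commute)
    then show ?thesis using orth that by (simp add: inner_ii)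
  qed
  \<comment> \<open>Parseval turns the sum into the square of the complex structure, whence the
    minus sign; the signs in \<open>T2\<close> and \<open>T3\<close> come from here.\<close>
  have s2: "(\<Sum>b<m. inner (\<i> *s x) (e b) * inner (\<i> *s e b) y) = - inner x y" for x y
  proof -
    have "(\<Sum>b<m. inner (\<i> *s x) (e b) * inner (\<i> *s e b) y) = - (\<Sum>b<m. inner (\<i> *s x) (e b) * inner (e b) (\<i> *s y))"
      by (simp add: inner_i_skew sum_negf)
    also have "(\<Sum>b<m. inner (\<i> *s x) (e b) * inner (e b) (\<i> *s y)) = inner (\<i> *s x) (\<i> *s y)"
      by (rule par[symmetric])
    finally show ?thesis by (simp add: inner_ii)
  qed
  let ?Q = "{(i, j). i < k + 2 \<and> j < k + 2 \<and> i \<noteq> j}"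
  \<comment> \<open>\<open>X\<close> collects the terms in which both contracted vectors sit in
    \<open>\<beta>\<close>. It enters both products of the commutator with the factor 1/4 and
    cancels. Of the rest, \<open>T1\<close> counts the real dimension and \<open>T2\<close>,
    \<open>T3\<close> return \<open>\<beta> v\<close> once for each slot, up to sign.\<close>
  define X where "X = (\<Sum>a<m. \<Sum>b<m. W (e a) (e b) *s (\<Sum>(i, j)\<in>?Q. W (v i) (v j) *s \<beta> (v(i := e a, j := e b))))"
  have T1: "(\<Sum>a<m. \<Sum>b<m. W (e a) (e b) *s (W (e a) (e b) *s \<beta> v)) = real m *\<^sub>R \<beta> v"
  proof -
    have "(\<Sum>a<m. \<Sum>b<m. W (e a) (e b) *s (W (e a) (e b) *s \<beta> v)) =
        (\<Sum>a<m. (\<Sum>b<m. inner (\<i> *s e a) (e b) * inner (\<i> *s e a) (e b)) *\<^sub>R \<beta> v)"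
      by (simp add: W rs scaleR_sum_left)
    also have "\<dots> = (\<Sum>a<m. 1 *\<^sub>R \<beta> v)" by (intro sum.cong refl) (simp add: s1)
    finally show ?thesis by (simp only: sum_constant_scaleR card_lessThan scaleR_one)
  qed
  have T2: "(\<Sum>a<m. \<Sum>b<m. W (e a) (e b) *s (W (e b) (v j) *s \<beta> (v(j := e a)))) = - \<beta> v" if "j < k + 2" for j
  proof -
    have "(\<Sum>a<m. \<Sum>b<m. W (e a) (e b) *s (W (e b) (v j) *s \<beta> (v(j := e a)))) =
        (\<Sum>a<m. (\<Sum>b<m. inner (\<i> *s e a) (e b) * inner (\<i> *s e b) (v j)) *\<^sub>R \<beta> (v(j := e a)))"
      by (simp add: W rs scaleR_sum_left)
    also have "\<dots> = - (\<Sum>a<m. inner (v j) (e a) *\<^sub>R \<beta> (v(j := e a)))"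
      unfolding s2 by (simp add: sum_negf inner_commute)
    also have "\<dots> = - \<beta> (v(j := v j))" by (subst exL[OF alt_form_linear[OF \<beta> that], symmetric]) simp
    finally show ?thesis by simp
  qed
  have T3: "(\<Sum>a<m. \<Sum>b<m. W (e a) (e b) *s (W (e a) (v j) *s \<beta> (v(j := e b)))) = \<beta> v" if "j < k + 2" for j
  proof -
    have "(\<Sum>a<m. \<Sum>b<m. W (e a) (e b) *s (W (e a) (v j) *s \<beta> (v(j := e b)))) =
        (\<Sum>b<m. \<Sum>a<m. W (e a) (e b) *s (W (e a) (v j) *s \<beta> (v(j := e b))))" by (rule sum.swap)
    also have "\<dots> = - (\<Sum>b<m. \<Sum>a<m. W (e b) (e a) *s (W (e a) (v j) *s \<beta> (v(j := e b))))"
      unfolding sum_negf[symmetric] by (intro sum.cong refl) (subst Wskew, simp add: vector_smult_lneg)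
    finally show ?thesis using T2[OF that] by simp
  qed
  have "euclid_contr (wedge 2 (k + 2) euclid_form \<beta>) v = (1 / 2) *\<^sub>R (real m *\<^sub>R \<beta> v
     + (\<Sum>j<k+2. - \<beta> v - \<beta> v) + (1 / 2) *\<^sub>R X)"
  proof -
    have "euclid_contr (wedge 2 (k + 2) euclid_form \<beta>) v = (1 / 2) *\<^sub>R (
      (\<Sum>a<m. \<Sum>b<m. W (e a) (e b) *s (W (e a) (e b) *s \<beta> v)) +
      (\<Sum>a<m. \<Sum>b<m. \<Sum>j<k+2. W (e a) (e b) *s (W (e b) (v j) *s \<beta> (v(j := e a)))
            - W (e a) (e b) *s (W (e a) (v j) *s \<beta> (v(j := e b)))) + (1 / 2) *\<^sub>R X)"
    proof -
      define Q where "Q x y = (\<Sum>(i, j)\<in>?Q. W (v i) (v j) *s \<beta> (v(i := x, j := y)))" for x y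
      have st: "W (e a) (e b) *s wedge 2 (k + 2) euclid_form \<beta> (pre2 (e a) (e b) v) =
          W (e a) (e b) *s (W (e a) (e b) *s \<beta> v) +
          (\<Sum>j<k+2. W (e a) (e b) *s (W (e b) (v j) *s \<beta> (v(j := e a)))
            - W (e a) (e b) *s (W (e a) (v j) *s \<beta> (v(j := e b)))) + (1 / 2) *\<^sub>R (W (e a) (e b) *s Q (e a) (e b))" for a b
        unfolding wedge_2_pre2[OF alt_form_euclid \<beta>] W_def[symmetric] Q_def[symmetric]
        by (simp only: vector_add_ldistrib vector_smult_scaleR vec.scale_sum_right vec.scale_right_diff_distrib)
      show ?thesis
        unfolding euclid_contr_def e_def[symmetric] m_def[symmetric] W_def[symmetric] X_def Q_def[symmetric] st
        by (simp only: sum.distrib scaleR_sum_right[symmetric])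
    qed
    also have "(\<Sum>a<m. \<Sum>b<m. \<Sum>j<k+2. W (e a) (e b) *s (W (e b) (v j) *s \<beta> (v(j := e a)))
            - W (e a) (e b) *s (W (e a) (v j) *s \<beta> (v(j := e b)))) =
        (\<Sum>j<k+2. \<Sum>a<m. \<Sum>b<m. W (e a) (e b) *s (W (e b) (v j) *s \<beta> (v(j := e a)))
            - W (e a) (e b) *s (W (e a) (v j) *s \<beta> (v(j := e b))))"
      by (subst sum.swap[of _ "{..<k+2}"]) (intro sum.cong refl sum.swap)
    also have "\<dots> = (\<Sum>j<k+2. - \<beta> v - \<beta> v)"
      by (intro sum.cong refl) (simp only: sum_subtractf T2 T3 lessThan_iff)
    finally show ?thesis by (simp only: T1)
  qed
  moreover have "wedge 2 k euclid_form (euclid_contr \<beta>) v = (1 / 4) *\<^sub>R X"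
  proof -
    \<comment> \<open>Up to a permutation of the slots, putting \<open>a\<close> and
      \<open>b\<close> in front of the remaining entries is the same as inserting them at
      \<open>i\<close> and \<open>j\<close>; the sign of this permutation meets the same sign in the
      wedge and disappears.\<close>
    have c: "\<beta> (pre2 a b (\<lambda>l. v (slot_perm i j (l + 2)))) = of_int (sign (slot_perm i j)) *\<^sub>R \<beta> (v(i := a, j := b))"
      if "(i, j) \<in> ?Q" for i j a b
    proof -
      have \<rho>: "slot_perm i j permutes {..<k+2}" "slot_perm i j 0 = i" "slot_perm i j 1 = j"
        using that slot_perm[of i j k] by auto
      have ne: "slot_perm i j (Suc (Suc l)) \<noteq> i" "slot_perm i j (Suc (Suc l)) \<noteq> j" for l
        using \<rho> inj_eq[OF permutes_inj[OF \<rho>(1)], of "Suc (Suc l)"] by (metis nat.distinct(1) nat.inject One_nat_def)+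
      have "pre2 a b (\<lambda>l. v (slot_perm i j (l + 2))) = v(i := a, j := b) \<circ> slot_perm i j"
      proof
        fix l show "pre2 a b (\<lambda>l. v (slot_perm i j (l + 2))) l = (v(i := a, j := b) \<circ> slot_perm i j) l"
        proof (cases l)
          case 0 then show ?thesis using that \<rho> by auto
        next
          case (Suc l') then show ?thesis using \<rho> ne by (cases l') auto
        qed
      qed
      then show ?thesis using alt_form_perm[OF \<beta> \<rho>(1)] by simp
    qed
    have "(of_int (sign (slot_perm i j)) * W (v i) (v j)) *s euclid_contr \<beta> (\<lambda>l. v (slot_perm i j (l + 2))) =
      (1 / 2) *\<^sub>R (\<Sum>a<m. \<Sum>b<m. W (e a) (e b) *s (W (v i) (v j) *s \<beta> (v(i := e a, j := e b))))"
      if "(i, j) \<in> ?Q" for i j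
    proof -
      have sg: "of_int (sign (slot_perm i j)) *\<^sub>R x = complex_of_int (sign (slot_perm i j)) *s x" for x :: "complex^'r"
        by (simp add: sign_def)
      have sg2: "complex_of_int (sign (slot_perm i j)) * complex_of_int (sign (slot_perm i j)) = 1"
        by (simp add: sign_def)
      have "(of_int (sign (slot_perm i j)) * W (v i) (v j)) *s euclid_contr \<beta> (\<lambda>l. v (slot_perm i j (l + 2))) =
       (1 / 2) *\<^sub>R (\<Sum>a<m. \<Sum>b<m. (of_int (sign (slot_perm i j)) * W (v i) (v j)) *s (W (e a) (e b) *s 
         (of_int (sign (slot_perm i j)) *s \<beta> (v(i := e a, j := e b)))))"
        unfolding euclid_contr_def e_def[symmetric] m_def[symmetric] c[OF that] W_def[symmetric] sg vector_smult_scaleR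
        by (simp only: vec.scale_sum_right)
      also have "\<dots> = (1 / 2) *\<^sub>R (\<Sum>a<m. \<Sum>b<m. W (e a) (e b) *s (W (v i) (v j) *s \<beta> (v(i := e a, j := e b))))"
        unfolding vector_smult_assoc
        by (intro arg_cong2[where f = scaleR] sum.cong refl arg_cong2[where f = "(*s)"]) (use sg2 in algebra)
      finally show ?thesis .
    qed
    then have "wedge 2 k euclid_form (euclid_contr \<beta>) v =
      (1 / 2) *\<^sub>R (\<Sum>(i, j)\<in>?Q. (1 / 2) *\<^sub>R (\<Sum>a<m. \<Sum>b<m. W (e a) (e b) *s (W (v i) (v j) *s \<beta> (v(i := e a, j := e b)))))"
      unfolding wedge_2_slots[OF alt_form_euclid alt_form_euclid_contr[OF \<beta>]] W_def[symmetric]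
      by (intro arg_cong2[where f = scaleR] sum.cong refl) auto
    also have "\<dots> = (1 / 4) *\<^sub>R (\<Sum>p\<in>?Q. \<Sum>a<m. \<Sum>b<m. W (e a) (e b) *s (W (v (fst p)) (v (snd p)) *s \<beta> (v(fst p := e a, snd p := e b))))"
      by (simp add: case_prod_beta flip: scaleR_sum_right)
    also have "(\<Sum>p\<in>?Q. \<Sum>a<m. \<Sum>b<m. W (e a) (e b) *s (W (v (fst p)) (v (snd p)) *s \<beta> (v(fst p := e a, snd p := e b)))) = X"
      unfolding X_def vec.scale_sum_right case_prod_beta
      by (subst sum.swap) (intro sum.cong refl sum.swap)
    finally show ?thesis .
  qed
  moreover have "(\<Sum>j<k+2. - \<beta> v - \<beta> v) = (- 2 * real (k + 2)) *\<^sub>R \<beta> v"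
  proof -
    have "- x - x = (- 2) *\<^sub>R x" for x :: "complex^'r"
      by (simp add: vec_eq_iff scaleR_conv_of_real)
    then show ?thesis by (simp only: sum_constant_scaleR card_lessThan scaleR_scaleR mult.commute)
  qed
  moreover have "(1 / 2) *\<^sub>R (a *\<^sub>R x + c *\<^sub>R x + (1 / 2) *\<^sub>R y) = ((a + c) / 2) *\<^sub>R x + (1 / 4) *\<^sub>R y"
    for a c and x y :: "complex^'r"
    by (simp add: scaleR_right_distrib scaleR_left_distrib add_divide_distrib)
  moreover have "(real m + (- 2 * real (k + 2))) / 2 = - (real (k + 2) - real CARD('n))"
    by (simp add: m_def)
  ultimately show ?thesis by (simp only: scaleR_minus_left) simp
qed

lemma wedge_scale_left: "wedge 2 k (\<lambda>v. c * \<alpha> v) \<beta> v = c *s wedge 2 k \<alpha> \<beta> v"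
  unfolding wedge_def vector_smult_scaleR vec.scale_sum_right vector_smult_assoc
  by (simp add: mult.left_commute mult.assoc)

text \<open>In degree \<open>n + 1\<close> the factor \<open>k - n\<close> of the Kaehler identity
  is 1, so the commutator with a multiple of the Kaehler form is multiplication by that
  multiple.\<close>

lemma B_op_euclid:
  fixes g :: "('n::finite, complex^'r) covector"
  assumes h: "hermitian_ip h" and g: "alt_form (CARD('n) + 1) g"
  shows "B_op euclid_form h (\<lambda>v. c * euclid_form v) g = (\<lambda>v. c *s g v)"
proof -
  define k where "k = CARD('n) - 1"
  have k: "CARD('n) + 1 = k + 2" by (simp add: k_def)
  have a: "alt_form (k + 2) g" using g by (simp only: k)
  have 1: "Lambda_op euclid_form h k g = euclid_contr g" by (rule Lambda_op_euclid[OF h a])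
  have "alt_form (k + 2 + 2) (wedge 2 (k + 2) (\<lambda>v. c * euclid_form v) g)"
    unfolding wedge_scale_left[abs_def] by (intro alt_form_smult alt_form_wedge_2 alt_form_euclid a)
  then have "Lambda_op euclid_form h (k + 2) (wedge 2 (k + 2) (\<lambda>v. c * euclid_form v) g) =
      euclid_contr (wedge 2 (k + 2) (\<lambda>v. c * euclid_form v) g)"
    by (rule Lambda_op_euclid[OF h])
  also have "\<dots> = (\<lambda>v. c *s euclid_contr (wedge 2 (k + 2) euclid_form g) v)"
    unfolding euclid_contr_def[abs_def] wedge_scale_left vector_smult_scaleR vec.scale_sum_right vector_smult_assoc
    by (simp add: mult.commute)
  finally show ?thesis
    unfolding B_op_def k k_def[symmetric] 1 wedge_scale_left
    using euclid_contr_wedge[OF a] k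
    by (simp add: vec.scale_right_diff_distrib[symmetric])
qed

lemma B_inv_euclid:
  fixes f :: "('n::finite, complex^'r) covector"
  assumes h: "hermitian_ip h" and f: "pq_form CARD('n) 1 f" and c: "c \<noteq> 0"
  shows "B_inv euclid_form h (\<lambda>v. c * euclid_form v) f = (\<lambda>v. (1 / c) *s f v)"
  unfolding B_inv_def
proof (rule the_equality)
  have "pq_form CARD('n) 1 (\<lambda>v. (1 / c) *s f v)"
    using f by (auto simp: pq_form_def intro!: alt_form_smult simp: vector_smult_assoc mult.commute)
  then show "pq_form CARD('n) 1 (\<lambda>v. (1 / c) *s f v) \<and>
      B_op euclid_form h (\<lambda>v. c * euclid_form v) (\<lambda>v. (1 / c) *s f v) = f"
    using c by (simp add: B_op_euclid[OF h] pq_form_def vector_smult_assoc)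
  fix g assume g: "pq_form CARD('n) 1 g \<and> B_op euclid_form h (\<lambda>v. c * euclid_form v) g = f"
  then have "(\<lambda>v. c *s g v) = f" using B_op_euclid[OF h, of g c] by (simp add: pq_form_def)
  then show "g = (\<lambda>v. (1 / c) *s f v)" using c by (auto simp: vector_smult_assoc)
qed

section \<open>Forms of bidegree (k,0) are complex multilinear\<close>

lemma norm_smult_vec: "norm (c *s (x :: complex^'m)) = cmod c * norm x"
  by (simp add: norm_vec_def norm_mult L2_set_right_distrib)

text \<open>The product rule for a multilinear map. The parameter \<open>m\<close> counts the slots
  that move, so that the induction can set them in motion one by one.\<close>

lemma alt_form_directional_derivative:
  fixes U :: "('n::finite, complex^'r) covector"
  assumes U: "alt_form k U" and "m \<le> k"
  shows "((\<lambda>t. U (\<lambda>i. if i < m then v i + t *\<^sub>R w i else v i)) has_vector_derivative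
     (\<Sum>i<m. U (v(i := w i)))) (at 0)"
  using assms(2)
proof (induction m arbitrary: v)
  case (Suc m)
  let ?f = "\<lambda>v t. U (\<lambda>i. if i < m then v i + t *\<^sub>R w i else v i)"
  have 1: "U (\<lambda>i. if i < Suc m then v i + t *\<^sub>R w i else v i) = ?f v t + t *\<^sub>R ?f (v(m := w m)) t" for t
  proof -
    define x where "x = (\<lambda>i. if i < m then v i + t *\<^sub>R w i else v i)"
    have L: "linear (\<lambda>y. U (x(m := y)))" using Suc.prems by (intro alt_form_linear[OF U]) auto
    have "(\<lambda>i. if i < Suc m then v i + t *\<^sub>R w i else v i) = x(m := v m + t *\<^sub>R w m)"
      by (auto simp: x_def less_Suc_eq)
    moreover have "x(m := v m) = x" by (auto simp: x_def)
    moreover have "(\<lambda>i. if i < m then (v(m := w m)) i + t *\<^sub>R w i else (v(m := w m)) i) = x(m := w m)"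
      by (auto simp: x_def)
    ultimately show ?thesis using linear_add[OF L, of "v m" "t *\<^sub>R w m"] linear_scale[OF L, of t "w m"]
      by (simp add: x_def)
  qed
  have "((\<lambda>t. ?f v t + t *\<^sub>R ?f (v(m := w m)) t) has_vector_derivative
      (\<Sum>i<m. U (v(i := w i))) + (0 *\<^sub>R (\<Sum>i<m. U ((v(m := w m))(i := w i))) + 1 *\<^sub>R ?f (v(m := w m)) 0)) (at 0)"
    using Suc.prems
    by (intro has_vector_derivative_add has_vector_derivative_scaleR Suc.IH DERIV_ident) auto
  moreover have "?f (v(m := w m)) 0 = U (v(m := w m))" by (rule arg_cong[where f = U]) auto
  ultimately show ?case unfolding 1
    by (simp only: sum.lessThan_Suc scaleR_zero_left scaleR_one add_0_left)
qed auto

text \<open>The derivative at \<open>t = 0\<close> of the homogeneity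
  \<open>U ((1 + t \<i>) v) = (1 + t \<i>)^k U v\<close> that defines the bidegree.\<close>

lemma pq_form_k0_sum:
  fixes U :: "('n::finite, complex^'r) covector"
  assumes U: "pq_form k 0 U"
  shows "(\<Sum>i<k. U (v(i := \<i> *s v i))) = (of_nat k * \<i>) *s U v"
proof -
  have a: "alt_form k U" and sc: "\<And>c v. U (\<lambda>i. c *s v i) = c ^ k *s U v"
    using U by (auto simp: pq_form_def)
  have "((\<lambda>t. U (\<lambda>i. if i < k then v i + t *\<^sub>R (\<i> *s v i) else v i)) has_vector_derivative
     (\<Sum>i<k. U (v(i := \<i> *s v i)))) (at 0)"
    by (rule alt_form_directional_derivative[OF a]) simp
  moreover have "U (\<lambda>i. if i < k then v i + t *\<^sub>R (\<i> *s v i) else v i) = (1 + of_real t * \<i>) ^ k *s U v" for t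
  proof -
    have "U (\<lambda>i. if i < k then v i + t *\<^sub>R (\<i> *s v i) else v i) = U (\<lambda>i. (1 + of_real t * \<i>) *s v i)"
    proof (rule alt_form_cong[OF a])
      fix i assume "i < k"
      show "(if i < k then v i + t *\<^sub>R (\<i> *s v i) else v i) = (1 + of_real t * \<i>) *s v i"
        using \<open>i < k\<close> by (simp add: vec_eq_iff algebra_simps)
          (simp add: scaleR_conv_of_real)
    qed
    then show ?thesis by (simp only: sc)
  qed
  moreover have "((\<lambda>t. (1 + of_real t * \<i>) ^ k *s U v) has_vector_derivative (of_nat k * \<i>) *s U v) (at 0)"
  proof -
    have "((\<lambda>t::real. (1 + of_real t * \<i>) ^ k) has_vector_derivative of_nat k * \<i>) (at 0)"
    proof -
      have "((\<lambda>z. (1 + z * \<i>) ^ k) has_field_derivative of_nat k * \<i>) (at (complex_of_real 0))"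
        by (auto intro!: derivative_eq_intros)
      from has_vector_derivative_real_field[OF this] show ?thesis by simp
    qed
    moreover have "bounded_linear (\<lambda>c. c *s U v)"
      by (intro linear_conv_bounded_linear[THEN iffD1] linear_smult_vector linear_ident[unfolded id_def])
    ultimately show ?thesis by (rule bounded_linear.has_vector_derivative[rotated])
  qed
  ultimately show ?thesis by (metis (no_types, lifting) ext vector_derivative_at)
qed

text \<open>Bidegree is defined by scaling all entries at once, so linearity over the complex
  numbers in a single slot has to be extracted. The defect \<open>V\<close> of slot \<open>i\<close>
  satisfies the identity of \<open>pq_form_k0_sum\<close>, but multiplying slot \<open>i\<close> by
  \<open>\<i>\<close> multiplies \<open>V\<close> by \<open>-\<i>\<close>. Hence
  \<open>k + 1\<close> times its norm is at most the sum of \<open>k - 1\<close> of its norms at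
  other tuples, and at a maximum over a finite set of tuples stable under \<open>\<i>\<close> this
  forces \<open>V = 0\<close>.\<close>

lemma pq_form_k0_clinear:
  fixes U :: "('n::finite, complex^'r) covector"
  assumes U: "pq_form k 0 U" and i: "i < k"
  shows "U (v(i := \<i> *s v i)) = \<i> *s U v"
proof -
  have a: "alt_form k U" using U by (simp add: pq_form_def)
  define V where "V v = U (v(i := \<i> *s v i)) - \<i> *s U v" for v
  \<comment> \<open>A finite real spanning set that multiplication by \<open>\<i>\<close> maps into
    itself; tuples from it remain such tuples when one entry is multiplied by
    \<open>\<i>\<close>.\<close>
  define B :: "(complex^'n) set" where "B = (\<lambda>(a, p). \<i> ^ a *s axis p 1) ` ({..<4} \<times> UNIV)"
  have finB: "finite B" by (simp add: B_def)
  have iB: "\<i> *s x \<in> B" if "x \<in> B" for x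
  proof -
    obtain a p where x: "x = \<i> ^ a *s axis p 1" "a < 4" using \<open>x \<in> B\<close> by (auto simp: B_def)
    have "a = 0 \<or> a = 1 \<or> a = 2 \<or> a = 3" using x(2) by auto
    then have "\<i> ^ (Suc a mod 4) = \<i> * \<i> ^ a" by (elim disjE) (simp_all add: power3_eq_cube)
    then have "\<i> *s x = \<i> ^ (Suc a mod 4) *s axis p 1"
      using x(1) by (simp add: vector_smult_assoc)
    then show ?thesis unfolding B_def by (intro image_eqI[of _ _ "(Suc a mod 4, p)"]) auto
  qed
  have sV: "(\<Sum>j<k. V (v(j := \<i> *s v j))) = (of_nat k * \<i>) *s V v" for v
  proof -
    define w where "w = v(i := \<i> *s v i)"
    have "V (v(j := \<i> *s v j)) = U (w(j := \<i> *s w j)) - \<i> *s U (v(j := \<i> *s v j))" for j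
      unfolding V_def w_def by (cases "j = i") (auto simp: fun_upd_twist)
    then show ?thesis
      by (simp add: sum_subtractf vec.scale_sum_right[symmetric] pq_form_k0_sum[OF U])
        (simp add: V_def w_def vec.scale_right_diff_distrib vector_smult_assoc mult.commute)
  qed
  have Vi: "V (v(i := \<i> *s v i)) = - \<i> *s V v" for v
  proof -
    have L: "linear (\<lambda>x. U (v(i := x)))" by (rule alt_form_linear[OF a i])
    have "\<i> *s (\<i> *s v i) = - v i" by (simp add: vec_eq_iff flip: mult.assoc)
    then have "U (v(i := \<i> *s (\<i> *s v i))) = - U v" using linear_neg[OF L, of "v i"] by simp
    then show ?thesis by (simp add: V_def vec.scale_right_diff_distrib vector_smult_assoc)
  qed
  define T where "T = {..<k} \<rightarrow>\<^sub>E B"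
  have T: "finite T" "T \<noteq> {}"
  proof -
    show "finite T" by (simp add: T_def finB finite_PiE)
    have "axis undefined 1 \<in> B" unfolding B_def by (intro image_eqI[of _ _ "(0, undefined)"]) auto
    then show "T \<noteq> {}" by (auto simp: T_def PiE_eq_empty_iff)
  qed
  define M where "M = Max ((\<lambda>v. norm (V v)) ` T)"
  have M: "norm (V v) \<le> M" if "v \<in> T" for v using that T by (simp add: M_def)
  have "M \<in> (\<lambda>v. norm (V v)) ` T" unfolding M_def using T by (intro Max_in) auto
  then obtain v0 where v0: "v0 \<in> T" "norm (V v0) = M" by auto
  \<comment> \<open>At the maximizing tuple the term \<open>j = i\<close> of \<open>sV\<close> is
    \<open>-\<i>\<close> times \<open>V v0\<close> and moves to the other side, which raises the
    factor \<open>k\<close> to \<open>k + 1\<close> and leaves \<open>k - 1\<close> terms.\<close>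
  have "real (k + 1) * M \<le> real (k - 1) * M"
  proof -
    have "(of_nat k * \<i>) *s V v0 = (\<Sum>j\<in>{..<k} - {i}. V (v0(j := \<i> *s v0 j))) + - \<i> *s V v0"
      using i by (subst sV[symmetric]) (simp add: sum.remove Vi del: vector_smult_lneg)
    then have "(of_nat (k + 1) * \<i>) *s V v0 = (\<Sum>j\<in>{..<k} - {i}. V (v0(j := \<i> *s v0 j)))"
      by (simp add: algebra_simps vec.scale_left_distrib)
    then have "real (k + 1) * M = norm (\<Sum>j\<in>{..<k} - {i}. V (v0(j := \<i> *s v0 j)))"
      using norm_smult_vec[of "of_nat (k + 1) * \<i>" "V v0"] v0(2) by (simp add: norm_mult del: of_nat_Suc of_nat_add)
    also have "\<dots> \<le> (\<Sum>j\<in>{..<k} - {i}. M)"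
    proof (rule order.trans[OF norm_sum], rule sum_mono, rule M)
      fix j assume j: "j \<in> {..<k} - {i}"
      have v0T: "v0 \<in> {..<k} \<rightarrow>\<^sub>E B" using v0(1) by (simp add: T_def)
      show "v0(j := \<i> *s v0 j) \<in> T" unfolding T_def
      proof (rule PiE_I)
        fix x assume "x \<in> {..<k}" then show "(v0(j := \<i> *s v0 j)) x \<in> B"
          using PiE_mem[OF v0T, of x] iB by auto
      next
        fix x assume "x \<notin> {..<k}" then show "(v0(j := \<i> *s v0 j)) x = undefined"
          using PiE_arb[OF v0T, of x] j by auto
      qed
    qed
    finally show ?thesis using i by simp
  qed
  then have "M \<le> 0" using i by (simp add: of_nat_diff algebra_simps)
  then have V0: "V v = 0" if "v \<in> T" for v
    using order.trans[OF M[OF that] \<open>M \<le> 0\<close>] by simp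
  have "\<forall>v. (\<forall>j. m \<le> j \<and> j < k \<longrightarrow> v j \<in> B) \<longrightarrow> V v = 0" if "m \<le> k" for m
    using that
  proof (induction m)
    case 0
    show ?case
    proof (intro allI impI)
      fix v assume v: "\<forall>j. 0 \<le> j \<and> j < k \<longrightarrow> v j \<in> B"
      let ?v = "restrict v {..<k}"
      have "V v = V ?v" unfolding V_def using i
        by (intro arg_cong2[where f = "(-)"] arg_cong[where f = "(*s) \<i>"] alt_form_cong[OF a]) auto
      moreover have "?v \<in> T" using v by (auto simp: T_def)
      ultimately show "V v = 0" using V0 by simp
    qed
  next
    case (Suc m)
    show ?case
    proof (intro allI impI)
      fix v assume v: "\<forall>j. Suc m \<le> j \<and> j < k \<longrightarrow> v j \<in> B"
      have L: "linear (\<lambda>x. V (v(m := x)))"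
      proof -
        have "linear (\<lambda>x. U (v(m := x)))" using Suc.prems by (intro alt_form_linear[OF a]) auto
        moreover have "linear (\<lambda>x. U ((v(m := x))(i := \<i> *s (v(m := x)) i)))"
        proof (cases "m = i")
          case True
          have "linear (\<lambda>x. U (v(i := x)))" by (intro alt_form_linear[OF a] i)
          from linear_compose[OF linear_vector_smult[OF linear_ident[unfolded id_def], of \<i>] this] True
          show ?thesis by (simp add: o_def)
        next
          case False
          then have "(v(m := x))(i := \<i> *s (v(m := x)) i) = (v(i := \<i> *s v i))(m := x)" for x by (simp add: fun_upd_twist)
          moreover have "linear (\<lambda>x. U ((v(i := \<i> *s v i))(m := x)))"
            using Suc.prems by (intro alt_form_linear[OF a]) auto
          ultimately show ?thesis by simp
        qed
        ultimately show ?thesis unfolding V_def by (intro linear_compose_sub linear_vector_smult)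
      qed
      have "V (v(m := x)) = 0" if "x \<in> B" for x
      proof -
        have "\<forall>j. m \<le> j \<and> j < k \<longrightarrow> (v(m := x)) j \<in> B" using v that by (metis Suc_leI fun_upd_apply le_neq_implies_less)
        then show ?thesis using Suc.IH Suc.prems by (meson Suc_leD)
      qed
      moreover have "span B = UNIV"
      proof -
        have "(Basis :: (complex^'n) set) \<subseteq> B"
        proof
          fix x :: "complex^'n" assume "x \<in> Basis"
          then obtain p where "x = axis p 1 \<or> x = axis p \<i>" by (auto simp: Basis_vec_def Basis_complex_def)
          then show "x \<in> B"
          proof
            assume "x = axis p 1" then show ?thesis unfolding B_def by (intro image_eqI[of _ _ "(0, p)"]) auto
          next
            assume "x = axis p \<i>" then show ?thesis unfolding B_def
              by (intro image_eqI[of _ _ "(1, p)"]) (auto simp: vec_eq_iff axis_def)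
          qed
        qed
        then show ?thesis by (metis span_Basis span_mono top.extremum_uniqueI)
      qed
      ultimately have "V (v(m := v m)) = 0" using linear_eq_0_on_span[OF L, of B "v m"] by auto
      then show "V v = 0" by simp
    qed
  qed
  from this[of k] have "V v = 0" by auto
  then show ?thesis by (simp add: V_def)
qed

text \<open>The space of alternating complex \<open>n\<close>-linear forms on an
  \<open>n\<close>-dimensional space is a line: a tuple of complex basis vectors either repeats an
  entry or permutes the given one. The real span needed for the extension to all vectors is that of
  the basis and its multiples by \<open>\<i>\<close>.\<close>

lemma clinear_form_eq_0:
  fixes U :: "('n::finite, complex^'r) covector"
  assumes U: "alt_form CARD('n) U"
    and clin: "\<And>v i. i < CARD('n) \<Longrightarrow> U (v(i := \<i> *s v i)) = \<i> *s U v"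
    and b: "bij_betw b {..<CARD('n)} (UNIV :: 'n set)" and Ub: "U (\<lambda>i. axis (b i) 1) = 0"
  shows "U v = 0"
proof -
  let ?n = "CARD('n)"
  define B0 where "B0 = range (\<lambda>p::'n. axis p (1::complex))"
  have sp: "span (B0 \<union> (*s) \<i> ` B0) = UNIV"
  proof -
    have "(Basis :: (complex^'n) set) \<subseteq> B0 \<union> (*s) \<i> ` B0"
    proof
      fix x :: "complex^'n" assume "x \<in> Basis"
      then obtain p where "x = axis p 1 \<or> x = axis p \<i>" by (auto simp: Basis_vec_def Basis_complex_def)
      moreover have "axis p \<i> = \<i> *s axis p (1::complex)" by (auto simp: vec_eq_iff axis_def)
      ultimately show "x \<in> B0 \<union> (*s) \<i> ` B0" by (auto simp: B0_def)
    qed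
    then show ?thesis by (metis span_Basis span_mono top.extremum_uniqueI)
  qed
  have "\<forall>v. (\<forall>i. m \<le> i \<and> i < ?n \<longrightarrow> v i \<in> B0) \<longrightarrow> U v = 0" if "m \<le> ?n" for m
    using that
  proof (induction m)
    case 0
    show ?case
    proof (intro allI impI)
      fix v assume "\<forall>i. 0 \<le> i \<and> i < ?n \<longrightarrow> v i \<in> B0"
      then have "\<forall>i. \<exists>p. i < ?n \<longrightarrow> v i = axis p 1" by (auto simp: B0_def)
      then obtain p where p: "\<And>i. i < ?n \<Longrightarrow> v i = axis (p i) 1" by metis
      show "U v = 0"
      proof (cases "inj_on p {..<?n}")
        case False
        then obtain i j where "i < ?n" "j < ?n" "i \<noteq> j" "p i = p j" by (auto simp: inj_on_def)
        then show ?thesis using p by (intro alt_form_eq0[OF U, of i j]) auto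
      next
        case True
        define \<sigma> where "\<sigma> i = (if i < ?n then inv_into {..<?n} b (p i) else i)" for i
        have b\<sigma>: "b (\<sigma> i) = p i" "\<sigma> i < ?n" if "i < ?n" for i
        proof -
          have "p i \<in> b ` {..<?n}" using b by (auto simp: bij_betw_def)
          then show "b (\<sigma> i) = p i" "\<sigma> i < ?n" using that inv_into_into[of "p i" b "{..<?n}"]
            by (simp_all add: \<sigma>_def f_inv_into_f)
        qed
        have "inj_on \<sigma> {..<?n}"
          by (intro inj_onI) (metis True b\<sigma>(1) inj_on_def lessThan_iff)
        moreover have "\<sigma> ` {..<?n} \<subseteq> {..<?n}" using b\<sigma> by auto
        ultimately have "bij_betw \<sigma> {..<?n} {..<?n}"
          by (simp add: bij_betw_def endo_inj_surj)
        then have "\<sigma> permutes {..<?n}" by (rule bij_imp_permutes) (auto simp: \<sigma>_def)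
        moreover have "U v = U ((\<lambda>i. axis (b i) 1) \<circ> \<sigma>)"
          by (rule alt_form_cong[OF U]) (auto simp: p b\<sigma>)
        ultimately show ?thesis using alt_form_perm[OF U, of \<sigma> "\<lambda>i. axis (b i) 1"] Ub by simp
      qed
    qed
  next
    case (Suc m)
    show ?case
    proof (intro allI impI)
      fix v assume v: "\<forall>j. Suc m \<le> j \<and> j < ?n \<longrightarrow> v j \<in> B0"
      have "U (v(m := x)) = 0" if "x \<in> B0" for x
      proof -
        have "\<forall>j. m \<le> j \<and> j < ?n \<longrightarrow> (v(m := x)) j \<in> B0" using v that by (metis Suc_leI fun_upd_apply le_neq_implies_less)
        then show ?thesis using Suc.IH Suc.prems by (meson Suc_leD)
      qed
      moreover have "U (v(m := \<i> *s x)) = \<i> *s U (v(m := x))" for x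
        using clin[of m "v(m := x)"] Suc.prems by simp
      ultimately have "U (v(m := x)) = 0" if "x \<in> B0 \<union> (*s) \<i> ` B0" for x using that by auto
      then have "U (v(m := v m)) = 0"
        using linear_eq_0_on_span[OF alt_form_linear[OF U, of m v], of "B0 \<union> (*s) \<i> ` B0" "v m"] Suc.prems sp by auto
      then show "U v = 0" by simp
    qed
  qed
  from this[of ?n] show ?thesis by auto
qed

text \<open>\<open>dz\<^bsub>b 0\<^esub> \<and> dz\<^bsub>b 1\<^esub> \<and> \<dots>\<close> for an enumeration \<open>b\<close> of the coordinates.\<close>

definition dz_form :: "(nat \<Rightarrow> 'n) \<Rightarrow> ('n::finite, complex) covector" where
  "dz_form b v = det (\<chi> p. v (inv_into {..<CARD('n)} b p))"

text \<open>The wedge of a 1-covector \<open>\<theta>\<close> with a \<open>k\<close>-covector, as a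
  sum over the position that \<open>\<theta>\<close> takes. This shape, with \<open>omit\<close>,
  matches the sums in \<open>dbar_form\<close> and \<open>weak_dbar\<close>.\<close>

definition ext :: "('v \<Rightarrow> complex) \<Rightarrow> nat \<Rightarrow> ((nat \<Rightarrow> 'v) \<Rightarrow> complex) \<Rightarrow> (nat \<Rightarrow> 'v) \<Rightarrow> complex" where
  "ext \<theta> k \<beta> v = (\<Sum>i\<le>k. (-1) ^ i * \<theta> (v i) * \<beta> (omit i v))"

context
  fixes b :: "nat \<Rightarrow> 'n::finite"
  assumes b: "bij_betw b {..<CARD('n)} UNIV"
begin

lemma inv_b: "inv_into {..<CARD('n)} b p < CARD('n)" "b (inv_into {..<CARD('n)} b p) = p"
  "i < CARD('n) \<Longrightarrow> inv_into {..<CARD('n)} b (b i) = i"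
proof -
  have p: "p \<in> b ` {..<CARD('n)}" using b by (simp add: bij_betw_def)
  show "inv_into {..<CARD('n)} b p < CARD('n)" using inv_into_into[OF p] by simp
  show "b (inv_into {..<CARD('n)} b p) = p" by (rule f_inv_into_f[OF p])
  show "i < CARD('n) \<Longrightarrow> inv_into {..<CARD('n)} b (b i) = i"
    using b by (intro inv_into_f_f) (auto simp: bij_betw_def)
qed

lemma dz_form_upd:
  assumes "i < CARD('n)"
  shows "dz_form b (v(i := x)) = det (\<chi> p. if p = b i then x else v (inv_into {..<CARD('n)} b p))"
  unfolding dz_form_def 
proof (intro arg_cong[where f = det], unfold vec_lambda_inject[OF UNIV_I UNIV_I], rule HOL.ext)
  fix p
  have "inv_into {..<CARD('n)} b p = i \<longleftrightarrow> p = b i" using inv_b(2)[of p] inv_b(3)[OF assms] by auto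
  then show "(v(i := x)) (inv_into {..<CARD('n)} b p) = (if p = b i then x else v (inv_into {..<CARD('n)} b p))" by simp
qed

lemma dz_form_clinear:
  assumes "i < CARD('n)"
  shows "dz_form b (v(i := c *s x)) = c * dz_form b (v(i := x))"
  unfolding dz_form_upd[OF assms] by (rule det_row_mul)

lemma alt_form_dz: "alt_form CARD('n) (dz_form b)"
  unfolding alt_form_def
proof (intro conjI allI impI)
  fix v w :: "nat \<Rightarrow> complex^'n" assume "\<forall>i<CARD('n). v i = w i"
  then show "dz_form b v = dz_form b w" unfolding dz_form_def
    by (intro arg_cong[where f = det]) (simp add: vec_eq_iff inv_b(1))
next
  fix v :: "nat \<Rightarrow> complex^'n" and i assume i: "i < CARD('n)"
  show "linear (\<lambda>x. dz_form b (v(i := x)))"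
  proof (rule linearI)
    fix x y show "dz_form b (v(i := x + y)) = dz_form b (v(i := x)) + dz_form b (v(i := y))"
      unfolding dz_form_upd[OF i] by (rule det_row_add)
    fix c :: real
    have "c *\<^sub>R x = of_real c *s x"
      by (simp only: vec_eq_iff vector_scaleR_component vector_smult_component) (simp add: scaleR_conv_of_real)
    then show "dz_form b (v(i := c *\<^sub>R x)) = c *\<^sub>R dz_form b (v(i := x))"
      by (simp add: dz_form_clinear[OF i] scaleR_conv_of_real)
  qed
next
  fix v :: "nat \<Rightarrow> complex^'n" and i j assume "i < j \<and> j < CARD('n) \<and> v i = v j"
  moreover from this have "b i \<noteq> b j" using inv_b(3)[of i] inv_b(3)[of j] by auto
  ultimately show "dz_form b v = 0" unfolding dz_form_def
    by (intro det_identical_rows[of "b i" "b j"]) (simp_all add: row_def inv_b(3))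
qed

lemma dz_form_basis: "dz_form b (\<lambda>i. axis (b i) 1) = 1"
proof -
  have "(\<chi> p. axis (b (inv_into {..<CARD('n)} b p)) 1) = (mat 1 :: complex^'n^'n)"
    by (auto simp: vec_eq_iff mat_def axis_def inv_b)
  then show ?thesis by (simp add: dz_form_def)
qed

text \<open>This reduces the unknown solution of the dbar equation to one vector-valued function,
  its value on the standard frame.\<close>

lemma pq_form_n0_eq:
  fixes U :: "('n, complex^'r) covector"
  assumes U: "pq_form CARD('n) 0 U"
  shows "U v = dz_form b v *s U (\<lambda>i. axis (b i) 1)"
proof -
  have a: "alt_form CARD('n) U" using U by (simp add: pq_form_def)
  define c where "c = U (\<lambda>i. axis (b i) 1)"
  have ad: "alt_form CARD('n) (\<lambda>v. dz_form b v *s c)"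
    using alt_form_dz unfolding alt_form_def by (auto intro: linear_smult_vector)
  have "U v - dz_form b v *s c = 0"
  proof (rule clinear_form_eq_0[OF alt_form_diff[OF a ad] _ b])
    fix v i assume i: "i < CARD('n)"
    show "U (v(i := \<i> *s v i)) - dz_form b (v(i := \<i> *s v i)) *s c = \<i> *s (U v - dz_form b v *s c)"
      by (simp add: pq_form_k0_clinear[OF U i] dz_form_clinear[OF i] vec.scale_right_diff_distrib vector_smult_assoc)
  qed (simp add: dz_form_basis c_def)
  then show ?thesis by (simp add: c_def)
qed

end

section \<open>Exterior multiplication by a 1-form\<close>

lemma omit_upd:
  "omit i (v(p := x)) = (if p < i then (omit i v)(p := x) else if p = i then omit i v else (omit i v)(p - 1 := x))"
  by (auto simp: omit_def fun_eq_iff)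

text \<open>Two equal entries are brought closer by exchanging the farther one with its neighbour,
  which changes only the sign; the induction is on their distance.\<close>

lemma alt_form_of_adjacent:
  assumes cong: "\<And>v w. (\<And>i. i < k \<Longrightarrow> v i = w i) \<Longrightarrow> \<alpha> v = \<alpha> w"
    and lin: "\<And>v i. i < k \<Longrightarrow> linear (\<lambda>x. \<alpha> (v(i := x)))"
    and adj: "\<And>v i. Suc i < k \<Longrightarrow> v i = v (Suc i) \<Longrightarrow> \<alpha> v = 0"
  shows "alt_form k \<alpha>"
proof -
  have "\<alpha> v = 0" if "v i = v (Suc (i + d))" "Suc (i + d) < k" for v i d
    using that
  proof (induction d arbitrary: v)
    case 0 then show ?case using adj by simp
  next
    case (Suc d)
    let ?p = "Suc (i + d)" let ?q = "Suc ?p"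
    let ?w = "v(?p := v ?q, ?q := v ?p)"
    have "\<alpha> ?w = - \<alpha> v"
    proof (rule swap_of_diag_zero)
      show "linear (\<lambda>x. \<alpha> (v(?p := x)))" "linear (\<lambda>x. \<alpha> (v(?q := x)))" for v
        using Suc.prems by (intro lin, simp)+
    qed (use Suc.prems adj in auto)
    moreover have "\<alpha> ?w = 0" by (rule Suc.IH) (use Suc.prems in auto)
    ultimately show ?case by simp
  qed
  then have "\<alpha> v = 0" if "i < j" "j < k" "v i = v j" for v i j
    using that less_imp_Suc_add[OF that(1)] by blast
  then show ?thesis unfolding alt_form_def using cong lin by blast
qed

lemma alt_form_ext:
  fixes \<beta> :: "('n::finite, complex) covector"
  assumes \<beta>: "alt_form k \<beta>" and l: "linear \<theta>"
  shows "alt_form (k + 1) (ext \<theta> k \<beta>)"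
proof (rule alt_form_of_adjacent)
  fix v w :: "nat \<Rightarrow> complex^'n" assume vw: "\<And>i. i < k + 1 \<Longrightarrow> v i = w i"
  show "ext \<theta> k \<beta> v = ext \<theta> k \<beta> w" unfolding ext_def
  proof (intro sum.cong refl)
    fix i assume "i \<in> {..k}"
    moreover from this have "\<beta> (omit i v) = \<beta> (omit i w)" by (intro alt_form_cong[OF \<beta>]) (auto simp: omit_def vw)
    ultimately show "(-1) ^ i * \<theta> (v i) * \<beta> (omit i v) = (-1) ^ i * \<theta> (w i) * \<beta> (omit i w)" using vw by simp
  qed
next
  fix v :: "nat \<Rightarrow> complex^'n" and p assume p: "p < k + 1"
  have "linear (\<lambda>x. (-1) ^ i * \<theta> ((v(p := x)) i) * \<beta> (omit i (v(p := x))))" if "i \<le> k" for i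
  proof (cases "p = i")
    case True
    then show ?thesis using linear_mult_left[OF l, of "(-1) ^ i * \<beta> (omit i v)"] by (simp add: omit_upd mult_ac)
  next
    case False
    define q where "q = (if p < i then p else p - 1)"
    have "linear (\<lambda>x. \<beta> ((omit i v)(q := x)))"
      using False p that by (intro alt_form_linear[OF \<beta>]) (auto simp: q_def)
    moreover have "omit i (v(p := x)) = (omit i v)(q := x)" for x using False by (auto simp: omit_upd q_def)
    ultimately show ?thesis using linear_mult_left[of "\<lambda>x. \<beta> ((omit i v)(q := x))" "(-1) ^ i * \<theta> (v i)"] False by simp
  qed
  then show "linear (\<lambda>x. ext \<theta> k \<beta> (v(p := x)))" unfolding ext_def by (intro linear_compose_sum) auto
next
  fix v :: "nat \<Rightarrow> complex^'n" and p assume p: "Suc p < k + 1" "v p = v (Suc p)"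
  \<comment> \<open>Only the terms \<open>p\<close> and \<open>p + 1\<close> survive; their
    omissions agree and their signs are opposite.\<close>
  have o: "omit p v = omit (Suc p) v"
    using p(2) by (auto simp: omit_def fun_eq_iff less_Suc_eq)
  have z: "\<beta> (omit i v) = 0" if "i \<le> k" "i \<noteq> p" "i \<noteq> Suc p" for i
  proof (cases "i < p")
    case True then show ?thesis using p by (intro alt_form_eq0[OF \<beta>, of "p - 1" p]) (auto simp: omit_def)
  next
    case False then show ?thesis using p that by (intro alt_form_eq0[OF \<beta>, of p "Suc p"]) (auto simp: omit_def)
  qed
  have "ext \<theta> k \<beta> v = (\<Sum>i\<in>{p, Suc p}. (-1) ^ i * \<theta> (v i) * \<beta> (omit i v))"
    unfolding ext_def using p by (intro sum.mono_neutral_right) (auto simp: z)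
  then show "ext \<theta> k \<beta> v = 0" using p o by simp
qed

text \<open>\<open>\<theta> \<and> \<theta> \<and> \<beta> = 0\<close>: the terms \<open>(i, j)\<close> and \<open>(j + 1, i)\<close> with \<open>i \<le> j\<close> cancel.\<close>

lemma ext_ext_zero: "ext \<theta> (Suc k) (ext \<theta> k \<beta>) v = 0"
proof -
  define t where "t i j = (-1) ^ (i + j) * \<theta> (v i) * \<theta> (omit i v j) * \<beta> (omit j (omit i v))" for i j
  have "ext \<theta> (Suc k) (ext \<theta> k \<beta>) v = (\<Sum>i\<le>Suc k. \<Sum>j\<le>k. t i j)"
    unfolding ext_def t_def by (simp add: sum_distrib_left power_add mult_ac)
  also have "\<dots> = (\<Sum>(i, j)\<in>{..Suc k} \<times> {..k}. t i j)" by (rule sum.cartesian_product)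
  also have "{..Suc k} \<times> {..k} = {(i, j). i \<le> j \<and> j \<le> k} \<union> {(i, j). j < i \<and> i \<le> Suc k}" by auto
  also have "(\<Sum>(i, j)\<in>\<dots>. t i j) = (\<Sum>(i, j)\<in>{(i, j). i \<le> j \<and> j \<le> k}. t i j) + (\<Sum>(i, j)\<in>{(i, j). j < i \<and> i \<le> Suc k}. t i j)"
    by (rule sum.union_disjoint)
      (auto intro: finite_subset[of _ "{..Suc k} \<times> {..Suc k}"])
  also have "(\<Sum>(i, j)\<in>{(i, j). j < i \<and> i \<le> Suc k}. t i j) = (\<Sum>(i, j)\<in>{(i, j). i \<le> j \<and> j \<le> k}. t (Suc j) i)"
    by (rule sum.reindex_bij_witness[of _ "\<lambda>(i, j). (Suc j, i)" "\<lambda>(i, j). (j, i - 1)"]) auto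
  also have "\<dots> = (\<Sum>(i, j)\<in>{(i, j). i \<le> j \<and> j \<le> k}. - t i j)"
  proof (intro sum.cong refl, clarify)
    fix i j assume "i \<le> j" "j \<le> k"
    then have "omit (Suc j) v i = v i" "omit i v j = v (Suc j)" "omit i (omit (Suc j) v) = omit j (omit i v)"
      by (auto simp: omit_def fun_eq_iff)
    then show "t (Suc j) i = - t i j" by (simp add: t_def add.commute mult_ac)
  qed
  also have "\<dots> = - (\<Sum>(i, j)\<in>{(i, j). i \<le> j \<and> j \<le> k}. t i j)"
    unfolding sum_negf[symmetric] by (intro sum.cong refl) auto
  finally show ?thesis by simp
qed

lemma alt_form_front:
  assumes \<gamma>: "alt_form (Suc k) \<gamma>" and i: "i \<le> k"
  shows "\<gamma> (\<lambda>m. if m = 0 then v i else omit i v (m - 1)) = (-1) ^ i *\<^sub>R \<gamma> v"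
  using i
proof (induction i arbitrary: v)
  case 0
  have "(\<lambda>m. if m = 0 then v 0 else omit 0 v (m - 1)) = v" by (auto simp: omit_def)
  then show ?case by simp
next
  case (Suc i)
  let ?w = "v(i := v (Suc i), Suc i := v i)"
  have eq: "(\<lambda>m. if m = 0 then v (Suc i) else omit (Suc i) v (m - 1)) = (\<lambda>m. if m = 0 then ?w i else omit i ?w (m - 1))"
    by (auto simp: omit_def fun_eq_iff)
  have "\<gamma> (\<lambda>m. if m = 0 then v (Suc i) else omit (Suc i) v (m - 1)) = (-1) ^ i *\<^sub>R \<gamma> ?w"
    unfolding eq using Suc.prems by (intro Suc.IH) simp
  also have "\<dots> = (-1) ^ Suc i *\<^sub>R \<gamma> v"
    by (subst alt_form_swap[OF \<gamma>, of i "Suc i" v]) (use Suc.prems in simp_all)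
  finally show ?case .
qed

text \<open>Only the last two slots contribute, since the others leave a repeated direction.\<close>

lemma sum_omit_test_frame:
  fixes \<beta> :: "('n::finite, complex^'r) covector"
  assumes \<beta>: "alt_form (Suc k) \<beta>"
    and clin: "\<And>v i. i < Suc k \<Longrightarrow> \<beta> (v(i := \<i> *s v i)) = \<i> *s \<beta> v"
    and D: "\<And>x. D (\<i> *s x) = - \<i> * D x"
    and v: "v (Suc k) = \<i> *s v k"
  shows "(\<Sum>i\<le>Suc k. ((-1) ^ i * D (v i)) *s \<beta> (omit i v)) = ((-1) ^ k * (2 * \<i>) * D (v k)) *s \<beta> v"
proof -
  have z: "\<beta> (omit i v) = 0" if "i < k" for i
  proof -
    have "\<beta> (omit i v) = \<beta> ((omit i v)(k := \<i> *s v k))"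
      by (rule arg_cong[where f = \<beta>]) (use v that in \<open>auto simp: omit_def fun_eq_iff\<close>)
    also have "\<dots> = \<i> *s \<beta> ((omit i v)(k := v k))"
      using clin[of k "(omit i v)(k := v k)"] by simp
    also have "\<beta> ((omit i v)(k := v k)) = 0"
      using that by (intro alt_form_eq0[OF \<beta>, of "k - 1" k]) (auto simp: omit_def)
    finally show ?thesis by simp
  qed
  have "(\<Sum>i\<le>Suc k. ((-1) ^ i * D (v i)) *s \<beta> (omit i v)) = (\<Sum>i\<in>{k, Suc k}. ((-1) ^ i * D (v i)) *s \<beta> (omit i v))"
    by (rule sum.mono_neutral_right) (auto simp: z)
  also have "\<dots> = ((-1) ^ k * D (v k)) *s \<beta> (omit k v) + ((-1) ^ Suc k * D (v (Suc k))) *s \<beta> (omit (Suc k) v)"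
    by simp
  also have "\<beta> (omit k v) = \<beta> (v(k := \<i> *s v k))"
    by (rule alt_form_cong[OF \<beta>]) (auto simp: omit_def v)
  also have "\<dots> = \<i> *s \<beta> v" by (rule clin) simp
  also have "\<beta> (omit (Suc k) v) = \<beta> v" by (rule alt_form_cong[OF \<beta>]) (auto simp: omit_def)
  also have "((-1) ^ k * D (v k)) *s (\<i> *s \<beta> v) + ((-1) ^ Suc k * D (v (Suc k))) *s \<beta> v =
      ((-1) ^ k * (2 * \<i>) * D (v k)) *s \<beta> v"
    by (simp add: v D vector_smult_assoc vec.scale_left_distrib[symmetric] algebra_simps del: vector_smult_lneg)
  finally show ?thesis .
qed

lemma permutes_front:
  assumes "i \<le> k"
  shows "(\<lambda>m. if m = 0 then i else if m \<le> i then m - 1 else m) permutes {..<Suc k}"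
proof (rule bij_imp_permutes)
  show "bij_betw (\<lambda>m. if m = 0 then i else if m \<le> i then m - 1 else m) {..<Suc k} {..<Suc k}"
    by (rule bij_betw_byWitness[where f' = "\<lambda>m. if m = i then 0 else if m < i then Suc m else m"])
      (use assms in \<open>auto split: if_splits\<close>)
qed (use assms in auto)

section \<open>The norms of dz and of dz-bar_j wedge dz\<close>

lemma euclid_frame:
  defines "e \<equiv> onframe (euclid_form :: ('n::finite, complex) covector)"
  shows "x = (\<Sum>a<2 * CARD('n). inner x (e a) *\<^sub>R e a)"
    and "inner x y = (\<Sum>a<2 * CARD('n). inner x (e a) * inner (e a) y)"
    and "linear f \<Longrightarrow> f x = (\<Sum>a<2 * CARD('n). inner x (e a) *\<^sub>R f (e a))"
proof -
  have DIM: "DIM(complex^'n) = 2 * CARD('n)" by (simp add: mult.commute)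
  have orth: "inner (e i) (e j) = (if i = j then 1 else 0)" if "i < 2 * CARD('n)" "j < 2 * CARD('n)" for i j
    using onframe_euclid[where 'n = 'n] that by (simp add: e_def)
  show ex: "x = (\<Sum>a<2 * CARD('n). inner x (e a) *\<^sub>R e a)" for x
    by (rule frame_span(2)[of e x, unfolded DIM, OF orth])
  have "inner x y = inner (\<Sum>a<2 * CARD('n). inner x (e a) *\<^sub>R e a) y" by (rule arg_cong2[OF ex refl])
  then show "inner x y = (\<Sum>a<2 * CARD('n). inner x (e a) * inner (e a) y)" by (simp add: inner_sum_left)
  show "f x = (\<Sum>a<2 * CARD('n). inner x (e a) *\<^sub>R f (e a))" if "linear f"
    by (subst ex) (simp add: linear_sum[OF that] linear_scale[OF that])
qed

lemma component_inner:
  "(x :: complex^'n) $ j = of_real (inner x (axis j 1)) + \<i> * of_real (inner x (axis j \<i>))"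
  by (simp add: complex_eq_iff inner_axis inner_complex_def)

lemma linear_cnj_component: "linear (\<lambda>x :: complex^'n. cnj (x $ j))"
  by (rule linearI) (simp_all add: complex_eq_iff)

context
  fixes b :: "nat \<Rightarrow> 'n::finite" and j :: 'n
  assumes b: "bij_betw b {..<CARD('n)} UNIV"
begin

text \<open>This is \<open>fact n\<close> times the squared Euclidean norm of
  \<open>dz_form b\<close>. It stays symbolic, since the same factor enters the norm of
  \<open>f\<close> and the norm of the solution; what is needed is that it is positive.\<close>

definition "dz_norm2 = (\<Sum>I \<in> {..<CARD('n)} \<rightarrow>\<^sub>E {..<2 * CARD('n)}.
  (cmod (dz_form b (onframe euclid_form \<circ> I)))\<^sup>2)"

text \<open>By alternation each of the \<open>n + 1\<close> positions of dz-bar_j contributes the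
  same sum over \<open>H\<close>, whence the factor \<open>n + 1\<close>. Contracting dz-bar_j with
  itself gives 2, its squared length (\<open>s1\<close>); contracting it with a slot of dz gives 0
  by type (\<open>s0\<close>).\<close>

lemma norm_ext_dz:
  "(\<Sum>I \<in> {..<Suc CARD('n)} \<rightarrow>\<^sub>E {..<2 * CARD('n)}.
     (cmod (ext (\<lambda>x. cnj (x $ j)) CARD('n) (dz_form b) (onframe euclid_form \<circ> I)))\<^sup>2) =
   2 * (real CARD('n) + 1) * dz_norm2"
proof -
  define n where "n = CARD('n)"
  define e where "e = onframe (euclid_form :: ('n, complex) covector)"
  define \<theta> where "\<theta> = (\<lambda>x :: complex^'n. cnj (x $ j))"
  define \<beta> where "\<beta> = dz_form b"
  define \<gamma> where "\<gamma> = ext \<theta> n \<beta>"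
  let ?m = "2 * CARD('n)"
  have n0: "n > 0" by (simp add: n_def)
  have \<beta>: "alt_form n \<beta>" unfolding \<beta>_def n_def by (rule alt_form_dz[OF b])
  have \<gamma>: "alt_form (Suc n) \<gamma>"
    using alt_form_ext[OF \<beta> linear_cnj_component[of j]] by (simp add: \<gamma>_def \<theta>_def)
  define H where "H I = cnj (\<gamma> (e \<circ> I)) * (\<theta> (e (I 0)) * \<beta> (\<lambda>m. e (I (Suc m))))" for I :: "nat \<Rightarrow> nat"
  have H: "cnj (\<gamma> (e \<circ> I)) * ((-1) ^ i * \<theta> ((e \<circ> I) i) * \<beta> (omit i (e \<circ> I))) =
      H (I \<circ> (\<lambda>m. if m = 0 then i else if m \<le> i then m - 1 else m))" if "i \<le> n" for i I
  proof -
    let ?c = "\<lambda>m. if m = 0 then i else if m \<le> i then m - 1 else m"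
    have "e \<circ> (I \<circ> ?c) = (\<lambda>m. if m = 0 then (e \<circ> I) i else omit i (e \<circ> I) (m - 1))"
      by (auto simp: omit_def fun_eq_iff)
    then have "\<gamma> (e \<circ> (I \<circ> ?c)) = (-1) ^ i *\<^sub>R \<gamma> (e \<circ> I)"
      using alt_form_front[OF \<gamma> that, of "e \<circ> I"] by simp
    moreover have "(\<lambda>m. e ((I \<circ> ?c) (Suc m))) = omit i (e \<circ> I)"
      by (auto simp: omit_def fun_eq_iff)
    ultimately show ?thesis unfolding H_def by (simp add: scaleR_conv_of_real)
  qed
  have "(\<Sum>I \<in> {..<Suc n} \<rightarrow>\<^sub>E {..<?m}. cnj (\<gamma> (e \<circ> I)) * \<gamma> (e \<circ> I)) =
      (\<Sum>I \<in> {..<Suc n} \<rightarrow>\<^sub>E {..<?m}. \<Sum>i\<le>n. H (I \<circ> (\<lambda>m. if m = 0 then i else if m \<le> i then m - 1 else m)))"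
    unfolding \<gamma>_def[THEN fun_cong, unfolded ext_def] sum_distrib_left
    by (intro sum.cong refl, subst H[symmetric]) (simp_all add: \<gamma>_def[THEN fun_cong, unfolded ext_def])
  also have "\<dots> = (\<Sum>i\<le>n. \<Sum>I \<in> {..<Suc n} \<rightarrow>\<^sub>E {..<?m}. H (I \<circ> (\<lambda>m. if m = 0 then i else if m \<le> i then m - 1 else m)))"
    by (rule sum.swap)
  also have "\<dots> = (\<Sum>i\<le>n. \<Sum>I \<in> {..<Suc n} \<rightarrow>\<^sub>E {..<?m}. H I)"
    by (rule sum.cong[OF refl], rule sum_PiE_permute[where G = H, OF permutes_front]) simp
  also have "\<dots> = of_nat (n + 1) * (\<Sum>I \<in> {..<Suc n} \<rightarrow>\<^sub>E {..<?m}. H I)" by simp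
  also have "(\<Sum>I \<in> {..<Suc n} \<rightarrow>\<^sub>E {..<?m}. H I) = (\<Sum>a<?m. \<Sum>I \<in> {..<n} \<rightarrow>\<^sub>E {..<?m}. H (case_nat a I))"
    by (rule sum_PiE_Suc) simp
  also have "\<dots> = (\<Sum>I \<in> {..<n} \<rightarrow>\<^sub>E {..<?m}. \<Sum>a<?m. H (case_nat a I))" by (rule sum.swap)
  also have "\<dots> = (\<Sum>I \<in> {..<n} \<rightarrow>\<^sub>E {..<?m}. of_real (2 * (cmod (\<beta> (e \<circ> I)))\<^sup>2))"
  proof (intro sum.cong refl)
    fix I :: "nat \<Rightarrow> nat"
    define w where "w = e \<circ> I"
    have om: "omit (Suc i) (case_nat a w) = case_nat a (omit i w)" for i and a :: "complex^'n"
      by (auto simp: omit_def fun_eq_iff split: nat.split)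
    have ga: "\<gamma> (case_nat (e a) w) = \<theta> (e a) * \<beta> w - (\<Sum>i<n. (-1) ^ i * \<theta> (w i) * \<beta> (case_nat (e a) (omit i w)))" for a
    proof -
      have "omit 0 (case_nat (e a) w) = w" by (auto simp: omit_def)
      then show ?thesis
        by (simp add: \<gamma>_def ext_def lessThan_Suc_atMost[symmetric] sum.lessThan_Suc_shift om sum_negf del: sum.lessThan_Suc)
    qed
    have Ha: "H (case_nat a I) = cnj (\<gamma> (case_nat (e a) w)) * (\<theta> (e a) * \<beta> w)" for a
    proof -
      have "e \<circ> case_nat a I = case_nat (e a) w" by (auto simp: w_def fun_eq_iff split: nat.split)
      then show ?thesis by (simp add: H_def w_def comp_def)
    qed
    \<comment> \<open>Expanding the \<open>j\<close>-th component in real inner products evaluates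
      the slot at \<open>axis j 1\<close> plus \<open>\<i>\<close> times its value at
      \<open>axis j \<i>\<close>. The slot is complex linear, so this is
      \<open>1 + \<i>^2 = 0\<close> times the first value.\<close>
    have s0: "(\<Sum>a<?m. (e a $ j) * \<beta> (case_nat (e a) x)) = 0" for x
    proof -
      have L: "linear (\<lambda>y. \<beta> ((case_nat 0 x)(0 := y)))" by (rule alt_form_linear[OF \<beta> n0])
      have u: "(case_nat 0 x)(0 := y) = case_nat y x" for y by (auto split: nat.split)
      note L' = L[unfolded u]
      have 1: "(\<Sum>a<?m. inner y (e a) *\<^sub>R \<beta> (case_nat (e a) x)) = \<beta> (case_nat y x)" for y
        using euclid_frame(3)[OF L', of y] by (simp add: e_def)
      have "(\<Sum>a<?m. (e a $ j) * \<beta> (case_nat (e a) x)) =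
          (\<Sum>a<?m. inner (axis j 1) (e a) *\<^sub>R \<beta> (case_nat (e a) x)) +
          \<i> * (\<Sum>a<?m. inner (axis j \<i>) (e a) *\<^sub>R \<beta> (case_nat (e a) x))"
        unfolding component_inner sum_distrib_left sum.distrib[symmetric]
        by (intro sum.cong refl) (simp add: algebra_simps inner_commute scaleR_conv_of_real)
      also have "\<dots> = \<beta> (case_nat (axis j 1) x) + \<i> * \<beta> (case_nat (axis j \<i>) x)" by (simp only: 1)
      also have "axis j \<i> = \<i> *s axis j (1::complex)" by (auto simp: vec_eq_iff axis_def)
      also have "\<beta> (case_nat (\<i> *s axis j 1) x) = \<i> * \<beta> (case_nat (axis j 1) x)"
        using dz_form_clinear[OF b, of 0 "case_nat 0 x" \<i> "axis j 1"] by (simp add: \<beta>_def u)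
      finally show ?thesis by (simp flip: mult.assoc)
    qed
    have s1: "(\<Sum>a<?m. cnj (\<theta> (e a)) * \<theta> (e a)) = 2"
    proof -
      have "(\<Sum>a<?m. cnj (\<theta> (e a)) * \<theta> (e a)) = of_real (\<Sum>a<?m. inner (axis j 1) (e a) * inner (e a) (axis j 1))
          + of_real (\<Sum>a<?m. inner (axis j \<i>) (e a) * inner (e a) (axis j \<i>))"
        unfolding of_real_sum sum.distrib[symmetric]
        by (intro sum.cong refl)
          (simp add: \<theta>_def component_inner[of "e _"] complex_eq_iff inner_commute power2_eq_square algebra_simps)
      also have "\<dots> = 2" unfolding e_def euclid_frame(2)[symmetric] by (simp add: inner_axis_axis)
      finally show ?thesis .
    qed
    have c\<theta>: "cnj (\<theta> y) = y $ j" for y by (simp add: \<theta>_def)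
    have "(\<Sum>a<?m. H (case_nat a I)) = (\<Sum>a<?m. cnj (\<theta> (e a)) * \<theta> (e a)) * (cnj (\<beta> w) * \<beta> w)
      - (\<Sum>i<n. (-1) ^ i * cnj (\<theta> (w i)) * \<beta> w * cnj (\<Sum>a<?m. (e a $ j) * \<beta> (case_nat (e a) (omit i w))))"
      unfolding Ha ga
      by (simp add: algebra_simps sum_subtractf sum_distrib_left sum_distrib_right \<theta>_def)
        (subst sum.swap, simp add: mult_ac)
    also have "\<dots> = of_real (2 * (cmod (\<beta> w))\<^sup>2)"
      unfolding s0 s1 of_real_mult complex_norm_square by simp
    finally show "(\<Sum>a<?m. H (case_nat a I)) = of_real (2 * (cmod (\<beta> (e \<circ> I)))\<^sup>2)" by (simp add: w_def)
  qed
  finally have X: "(\<Sum>I \<in> {..<Suc n} \<rightarrow>\<^sub>E {..<?m}. cnj (\<gamma> (e \<circ> I)) * \<gamma> (e \<circ> I)) =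
      of_nat (n + 1) * (\<Sum>I \<in> {..<n} \<rightarrow>\<^sub>E {..<?m}. of_real (2 * (cmod (\<beta> (e \<circ> I)))\<^sup>2))" .
  have "of_real (\<Sum>I \<in> {..<Suc n} \<rightarrow>\<^sub>E {..<?m}. (cmod (\<gamma> (e \<circ> I)))\<^sup>2) =
      (\<Sum>I \<in> {..<Suc n} \<rightarrow>\<^sub>E {..<?m}. cnj (\<gamma> (e \<circ> I)) * \<gamma> (e \<circ> I))"
    unfolding of_real_sum complex_norm_square by (simp add: mult.commute)
  also have "\<dots> = of_real ((real n + 1) * (\<Sum>I \<in> {..<n} \<rightarrow>\<^sub>E {..<?m}. 2 * (cmod (\<beta> (e \<circ> I)))\<^sup>2))"
    unfolding X of_real_mult of_real_sum by simp
  also have "(\<Sum>I \<in> {..<n} \<rightarrow>\<^sub>E {..<?m}. 2 * (cmod (\<beta> (e \<circ> I)))\<^sup>2) = 2 * dz_norm2"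
    by (simp add: dz_norm2_def sum_distrib_left[symmetric] e_def \<beta>_def n_def)
  finally have "of_real (\<Sum>I \<in> {..<Suc n} \<rightarrow>\<^sub>E {..<?m}. (cmod (\<gamma> (e \<circ> I)))\<^sup>2) =
      complex_of_real (2 * (real n + 1) * dz_norm2)" by (simp only: mult_ac)
  then show ?thesis unfolding of_real_eq_iff by (simp add: \<gamma>_def \<theta>_def \<beta>_def e_def n_def)
qed

lemma dz_norm2_pos: "dz_norm2 > 0"
proof (rule ccontr)
  assume "\<not> dz_norm2 > 0"
  moreover have "dz_norm2 \<ge> 0" by (simp add: dz_norm2_def sum_nonneg)
  ultimately have z: "dz_norm2 = 0" by simp
  define c where "c = axis (undefined :: 'n) (1::complex)"
  have h: "hermitian_ip (\<lambda>x y :: complex^'n. \<Sum>i\<in>UNIV. x $ i * cnj (y $ i))"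
    unfolding hermitian_ip_def
  proof (intro conjI allI impI)
    fix a :: "complex^'n" assume "a \<noteq> 0"
    then obtain i where "a $ i \<noteq> 0" by (auto simp: vec_eq_iff)
    then have "0 < (\<Sum>i\<in>UNIV. (cmod (a $ i))\<^sup>2)" by (intro sum_pos2[of _ i]) auto
    then show "Re (\<Sum>i\<in>UNIV. a $ i * cnj (a $ i)) > 0"
      unfolding cmod_power2 by (simp add: power2_eq_square)
  qed (simp_all add: sum.distrib sum_distrib_left algebra_simps)
  have "alt_form CARD('n) (\<lambda>v. dz_form b v *s c)"
    using alt_form_dz[OF b] unfolding alt_form_def by (auto intro: linear_smult_vector)
  moreover have "form_inner euclid_form (\<lambda>x y. \<Sum>i\<in>UNIV. x $ i * cnj (y $ i)) CARD('n) (\<lambda>v. dz_form b v *s c) (\<lambda>v. dz_form b v *s c) = 0"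
    using z by (simp add: form_inner_def dz_norm2_def sum_nonneg_eq_0_iff finite_PiE)
  ultimately have "dz_form b (\<lambda>i. axis (b i) 1) *s c = 0" using form_inner_self_eq_0[OF h] by blast
  then show False by (auto simp: dz_form_basis[OF b] c_def axis_eq_0_iff)
qed

lemma form_inner_n0:
  fixes U :: "('n, complex^'r) covector"
  assumes h: "hermitian_ip h" and U: "pq_form CARD('n) 0 U"
  shows "form_inner euclid_form h CARD('n) U U =
    of_real (dz_norm2 / fact CARD('n)) * h (U (\<lambda>i. axis (b i) 1)) (U (\<lambda>i. axis (b i) 1))"
proof -
  have "h (U v) (U v) = of_real ((cmod (dz_form b v))\<^sup>2) * h (U (\<lambda>i. axis (b i) 1)) (U (\<lambda>i. axis (b i) 1))" for v
    unfolding pq_form_n0_eq[OF b U, of v] hermitian_ip_simps(2,6)[OF h] complex_norm_square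
    by (simp add: mult_ac)
  then have "(\<Sum>I \<in> {..<CARD('n)} \<rightarrow>\<^sub>E {..<2 * CARD('n)}. h (U (onframe euclid_form \<circ> I)) (U (onframe euclid_form \<circ> I))) =
      (\<Sum>I \<in> {..<CARD('n)} \<rightarrow>\<^sub>E {..<2 * CARD('n)}. of_real ((cmod (dz_form b (onframe euclid_form \<circ> I)))\<^sup>2)
        * h (U (\<lambda>i. axis (b i) 1)) (U (\<lambda>i. axis (b i) 1)))"
    by (intro sum.cong refl)
  then show ?thesis unfolding form_inner_def dz_norm2_def
    by (simp add: sum_distrib_right[symmetric])
qed

text \<open>The covector dz-bar_j wedge dz_b with coefficient \<open>F\<close>. The right-hand side
  of the dbar equation will be of this kind at each point.\<close>

definition dzbar_form :: "complex^'r \<Rightarrow> ('n, complex^'r) covector" where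
  "dzbar_form F v = ext (\<lambda>x. cnj (x $ j)) CARD('n) (dz_form b) v *s F"

text \<open>The factor 2 is the squared length of dz-bar_j. It cancels the 2 in
  \<open>i_ddbar_quadratic\<close>, so that the weight \<open>N |z|^2\<close> charges exactly
  \<open>1/N\<close> for \<open>f\<close>.\<close>

lemma form_inner_dzbar:
  assumes h: "hermitian_ip h"
  shows "form_inner euclid_form h (CARD('n) + 1) (\<lambda>v. c *s dzbar_form F v) (dzbar_form F) =
    c * 2 * of_real (dz_norm2 / fact CARD('n)) * h F F"
proof -
  let ?x = "\<lambda>v. ext (\<lambda>x. cnj (x $ j)) CARD('n) (dz_form b) v"
  have "h (c *s dzbar_form F v) (dzbar_form F v) = c * h F F * of_real ((cmod (?x v))\<^sup>2)" for v
    unfolding dzbar_form_def hermitian_ip_simps[OF h] complex_norm_square by (simp add: mult_ac)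
  then have "form_inner euclid_form h (CARD('n) + 1) (\<lambda>v. c *s dzbar_form F v) (dzbar_form F) =
     c * h F F * of_real (2 * (real CARD('n) + 1) * dz_norm2) / fact (CARD('n) + 1)"
    unfolding norm_ext_dz[symmetric] by (simp add: form_inner_def sum_distrib_left)
  also have "\<dots> = c * 2 * of_real (dz_norm2 / fact CARD('n)) * h F F"
  proof -
    have "1 + complex_of_nat CARD('n) \<noteq> 0"
      using of_nat_neq_0[of "CARD('n)", where 'a = complex] by simp
    then show ?thesis by (simp add: divide_simps)
  qed
  finally show ?thesis .
qed

lemma pq_form_dzbar: "pq_form CARD('n) 1 (dzbar_form F)"
  unfolding pq_form_def
proof (intro conjI allI)
  show "alt_form (CARD('n) + 1) (dzbar_form F)"
    using alt_form_ext[OF alt_form_dz[OF b] linear_cnj_component[of j]]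
    unfolding alt_form_def dzbar_form_def by (auto intro: linear_smult_vector)
  fix c :: complex and v :: "nat \<Rightarrow> complex^'n"
  have "dz_form b (\<lambda>i. c *s w i) = c ^ CARD('n) * dz_form b w" for w
  proof -
    have "dz_form b (\<lambda>i. if i < m then c *s w i else w i) = c ^ m * dz_form b w" if "m \<le> CARD('n)" for m
      using that
    proof (induction m)
      case (Suc m)
      let ?w = "\<lambda>i. if i < m then c *s w i else w i"
      have "(\<lambda>i. if i < Suc m then c *s w i else w i) = ?w(m := c *s w m)" by (auto simp: less_Suc_eq)
      then have "dz_form b (\<lambda>i. if i < Suc m then c *s w i else w i) = c * dz_form b (?w(m := w m))"
        using dz_form_clinear[OF b, of m ?w c "w m"] Suc.prems by simp
      also have "?w(m := w m) = ?w" by auto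
      finally show ?case using Suc by simp
    qed simp
    from this[of "CARD('n)"] show ?thesis
      using alt_form_cong[OF alt_form_dz[OF b], of "\<lambda>i. c *s w i" "\<lambda>i. if i < CARD('n) then c *s w i else w i"] by simp
  qed
  moreover have "omit i (\<lambda>i. c *s v i) = (\<lambda>m. c *s omit i v m)" for i by (auto simp: omit_def)
  ultimately show "dzbar_form F (\<lambda>i. c *s v i) = (c ^ CARD('n) * cnj c ^ 1) *s dzbar_form F v"
    by (simp add: dzbar_form_def ext_def vector_smult_assoc sum_distrib_left mult_ac)
qed

end

lemma vol_density_euclid: "vol_density (euclid_form :: ('n::finite, complex) covector) = 1"
proof -
  have "(\<chi> (s::'n + 'n) (t::'n + 'n). riem euclid_form (std_real_basis s) (std_real_basis t)) = (mat 1 :: real^('n + 'n)^('n + 'n))"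
    by (auto simp: vec_eq_iff mat_def riem_euclid std_real_basis_def inner_axis_axis inner_complex_def split: sum.splits)
  then show ?thesis by (simp add: vol_density_def)
qed

section \<open>Smooth weights and cutoffs\<close>

lemma Ck_SucI:
  assumes "\<And>x. (f has_derivative f' x) (at x)" and "\<And>v. Ck_on k UNIV (\<lambda>x. f' x v)"
  shows "Ck_on (Suc k) UNIV f"
proof -
  have "frechet_derivative f (at x) = f' x" for x
    using assms(1) frechet_derivative_at by metis
  then show ?thesis using assms by (auto simp: differentiable_def)
qed

lemma Ck_SucE:
  assumes "Ck_on (Suc k) UNIV f"
  obtains f' where "\<And>x. (f has_derivative f' x) (at x)" "\<And>v. Ck_on k UNIV (\<lambda>x. f' x v)"
  using assms that[of "\<lambda>x. frechet_derivative f (at x)"] by (simp add: frechet_derivative_works)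

lemma Ck_Suc_imp: "Ck_on (Suc k) UNIV f \<Longrightarrow> Ck_on k UNIV f"
proof (induction k arbitrary: f)
  case 0 then show ?case by (auto intro!: continuous_at_imp_continuous_on differentiable_imp_continuous_within)
next
  case (Suc k) then show ?case by (metis Ck_on.simps(2))
qed

lemma Ck_subset: "Ck_on k UNIV f \<Longrightarrow> Ck_on k S f"
proof (induction k arbitrary: f)
  case 0 then show ?case using continuous_on_subset by fastforce
qed auto

lemma Ck_const: "Ck_on k UNIV (\<lambda>x. c)"
proof (induction k arbitrary: c)
  case (Suc k) show ?case by (rule Ck_SucI[OF has_derivative_const Suc])
qed auto

lemma Ck_bounded_linear: "bounded_linear f \<Longrightarrow> Ck_on k UNIV f"
proof (cases k)
  case (Suc m)
  assume "bounded_linear f"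
  then show ?thesis unfolding Suc
    by (intro Ck_SucI[of f "\<lambda>_. f"] Ck_const bounded_linear_imp_has_derivative)
qed (simp add: linear_continuous_on)

lemma Ck_add: "Ck_on k UNIV f \<Longrightarrow> Ck_on k UNIV g \<Longrightarrow> Ck_on k UNIV (\<lambda>x. f x + g x)"
proof (induction k arbitrary: f g)
  case 0 then show ?case by (auto intro: continuous_on_add)
next
  case (Suc k)
  obtain f' g' where "\<And>x. (f has_derivative f' x) (at x)" "\<And>v. Ck_on k UNIV (\<lambda>x. f' x v)"
    "\<And>x. (g has_derivative g' x) (at x)" "\<And>v. Ck_on k UNIV (\<lambda>x. g' x v)"
    using Suc.prems by (metis Ck_SucE)
  then show ?case by (intro Ck_SucI[of _ "\<lambda>x v. f' x v + g' x v"] has_derivative_add Suc.IH)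
qed

lemma Ck_bilinear:
  assumes "bounded_bilinear (bp :: 'b::real_normed_vector \<Rightarrow> 'c::real_normed_vector \<Rightarrow> 'd::real_normed_vector)"
  shows "Ck_on k UNIV f \<Longrightarrow> Ck_on k UNIV g \<Longrightarrow> Ck_on k UNIV (\<lambda>x. bp (f x) (g x))"
proof (induction k arbitrary: f g)
  case 0 then show ?case by (auto intro: bounded_bilinear.continuous_on[OF assms])
next
  case (Suc k)
  obtain f' g' where "\<And>x. (f has_derivative f' x) (at x)" "\<And>v. Ck_on k UNIV (\<lambda>x. f' x v)"
    "\<And>x. (g has_derivative g' x) (at x)" "\<And>v. Ck_on k UNIV (\<lambda>x. g' x v)"
    using Suc.prems by (metis Ck_SucE)
  then show ?case using Suc.prems
    by (intro Ck_SucI[of _ "\<lambda>x v. bp (f x) (g' x v) + bp (f' x v) (g x)"]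
        bounded_bilinear.FDERIV[OF assms] Ck_add Suc.IH Ck_Suc_imp[OF Suc.prems(1)] Ck_Suc_imp[OF Suc.prems(2)])
qed

lemmas Ck_mult = Ck_bilinear[OF bounded_bilinear_mult]
lemmas Ck_inner = Ck_bilinear[OF bounded_bilinear_inner]

lemma Ck_linear_comp:
  assumes "bounded_linear L" shows "Ck_on k UNIV f \<Longrightarrow> Ck_on k UNIV (\<lambda>x. L (f x))"
proof (induction k arbitrary: f)
  case 0 then show ?case by (auto intro: bounded_linear.continuous_on[OF assms])
next
  case (Suc k)
  obtain f' where "\<And>x. (f has_derivative f' x) (at x)" "\<And>v. Ck_on k UNIV (\<lambda>x. f' x v)"
    using Suc.prems by (metis Ck_SucE)
  then show ?case
    by (intro Ck_SucI[of _ "\<lambda>x v. L (f' x v)"] bounded_linear.has_derivative[OF assms] Suc.IH)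
qed

text \<open>The outer function comes with the whole sequence \<open>D\<close> of its derivatives,
  since the induction on \<open>k\<close> has to be applied to \<open>D (Suc m)\<close> in place of
  \<open>D m\<close>.\<close>

lemma Ck_real_comp:
  assumes D: "\<And>m x. (D m has_real_derivative D (Suc m) x) (at x)"
  shows "Ck_on k UNIV g \<Longrightarrow> Ck_on k UNIV (\<lambda>x. D m (g x))"
proof (induction k arbitrary: m)
  case 0
  have "continuous_on UNIV (D m)" using D by (intro continuous_at_imp_continuous_on ballI DERIV_isCont)
  then show ?case using 0 continuous_on_compose2[of UNIV "D m" UNIV g] by auto
next
  case (Suc k)
  obtain g' where g': "\<And>x. (g has_derivative g' x) (at x)" "\<And>v. Ck_on k UNIV (\<lambda>x. g' x v)"
    using Suc.prems by (metis Ck_SucE)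
  have "((\<lambda>x. D m (g x)) has_derivative (\<lambda>v. D (Suc m) (g x) * g' x v)) (at x)" for x
    using DERIV_compose_FDERIV[OF D g'(1)] by (simp add: mult.commute)
  moreover have "Ck_on k UNIV (\<lambda>x. D (Suc m) (g x) * g' x v)" for v
    by (intro Ck_mult Suc.IH Ck_Suc_imp[OF Suc.prems] g')
  ultimately show ?case by (rule Ck_SucI)
qed

lemma Ck_inverse:
  fixes f :: "'a::real_normed_vector \<Rightarrow> real"
  assumes nz: "\<And>x. f x \<noteq> 0"
  shows "Ck_on k UNIV f \<Longrightarrow> Ck_on k UNIV (\<lambda>x. inverse (f x))"
proof (induction k)
  case 0 then show ?case using nz by (auto intro: continuous_on_inverse)
next
  case (Suc k)
  obtain f' where f': "\<And>x. (f has_derivative f' x) (at x)" "\<And>v. Ck_on k UNIV (\<lambda>x. f' x v)"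
    using Suc.prems by (metis Ck_SucE)
  have "((\<lambda>x. inverse (f x)) has_derivative (\<lambda>v. (-1) * (inverse (f x) * f' x v * inverse (f x)))) (at x)" for x
    using Deriv.has_derivative_inverse[OF nz f'(1)] by simp
  moreover have "Ck_on k UNIV (\<lambda>x. (-1) * (inverse (f x) * f' x v * inverse (f x)))" for v
    by (intro Ck_mult Suc.IH[OF Ck_Suc_imp[OF Suc.prems]] f' Ck_const)
  ultimately show ?case by (rule Ck_SucI)
qed

lemma Ck_prod:
  fixes f :: "'i \<Rightarrow> 'a::real_normed_vector \<Rightarrow> real"
  assumes "\<And>i. i \<in> A \<Longrightarrow> Ck_on k UNIV (f i)"
  shows "Ck_on k UNIV (\<lambda>x. \<Prod>i\<in>A. f i x)"
  using assms by (induction A rule: infinite_finite_induct) (auto intro: Ck_mult Ck_const)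

lemma Ck_exp: "Ck_on k UNIV g \<Longrightarrow> Ck_on k UNIV (\<lambda>x. exp (g x :: real))"
  using Ck_real_comp[of "\<lambda>_. exp" k g] DERIV_exp by simp

text \<open>The derivatives of \<open>t \<mapsto> exp (-1/t)\<close> are \<open>p (1/t) exp (-1/t)\<close> with polynomials \<open>p\<close>.\<close>

definition flat :: "real \<Rightarrow> real" where "flat t = (if t \<le> 0 then 0 else exp (- (1 / t)))"

text \<open>With \<open>s = 1/t\<close> the derivative of \<open>p(s) e^(-s)\<close> in
  \<open>t\<close> is \<open>s^2 (p(s) - p'(s)) e^(-s)\<close>; the recursion is read off from
  this.\<close>

primrec flat_poly :: "nat \<Rightarrow> real poly" where
  "flat_poly 0 = 1"
| "flat_poly (Suc m) = [:0, 0, 1:] * (flat_poly m - pderiv (flat_poly m))"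

definition flat_deriv :: "nat \<Rightarrow> real \<Rightarrow> real" where
  "flat_deriv m t = (if t \<le> 0 then 0 else poly (flat_poly m) (1 / t) * exp (- (1 / t)))"

lemma poly_exp_tendsto_0: "((\<lambda>s::real. poly p s * exp (- s)) \<longlongrightarrow> 0) at_top"
proof -
  have "((\<lambda>s. \<Sum>i\<le>degree p. coeff p i * (s ^ i / exp s)) \<longlongrightarrow> (\<Sum>i\<le>degree p. coeff p i * 0)) at_top"
    by (intro tendsto_sum tendsto_mult tendsto_const tendsto_power_div_exp_0)
  moreover have "poly p s * exp (- s) = (\<Sum>i\<le>degree p. coeff p i * (s ^ i / exp s))" for s
    by (simp add: poly_altdef sum_distrib_right exp_minus divide_inverse mult.assoc)
  ultimately show ?thesis by simp
qed

lemma flat_deriv: "(flat_deriv m has_real_derivative flat_deriv (Suc m) x) (at x)"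
proof (cases x "0::real" rule: linorder_cases)
  case less
  have "((\<lambda>_. 0) has_real_derivative 0) (at x)" by simp
  then show ?thesis using less
    by (subst DERIV_cong_ev[OF refl _ refl, of _ "\<lambda>_. 0"])
      (auto simp: flat_deriv_def intro!: eventually_mono[OF order_tendstoD(2)[OF tendsto_ident_at[of x UNIV] less]]
        eventually_nhds_in_open[of "{..<0}" x, THEN eventually_mono])
next
  case greater
  let ?f = "\<lambda>t. poly (flat_poly m) (1 / t) * exp (- (1 / t))"
  have "(?f has_real_derivative flat_deriv (Suc m) x) (at x)"
    using greater by (auto intro!: derivative_eq_intros poly_DERIV[THEN DERIV_chain2]
      simp: flat_deriv_def power2_eq_square field_simps)
  moreover have "eventually (\<lambda>t. flat_deriv m t = ?f t) (nhds x)"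
    using eventually_nhds_in_open[of "{0<..}" x] greater by (auto simp: flat_deriv_def elim: eventually_mono)
  ultimately show ?thesis by (subst DERIV_cong_ev[OF refl _ refl]) auto
next
  case equal
  have "((\<lambda>h. (flat_deriv m (0 + h) - flat_deriv m 0) / h) \<longlongrightarrow> 0) (at_right 0)"
  proof -
    have "filterlim (\<lambda>h::real. 1 / h) at_top (at_right 0)"
      using filterlim_inverse_at_top_right by (simp add: inverse_eq_divide)
    \<comment> \<open>The difference quotient at 0 divides by \<open>h\<close>, which multiplies the
      polynomial in \<open>1/h\<close> by its variable and so leaves an expression of the same
      kind.\<close>
    from filterlim_compose[OF poly_exp_tendsto_0[of "[:0, 1:] * flat_poly m"] this]
    have "((\<lambda>h. poly ([:0, 1:] * flat_poly m) (1 / h) * exp (- (1 / h))) \<longlongrightarrow> 0) (at_right 0)" .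
    then show ?thesis
    proof (rule Lim_transform_eventually)
      show "\<forall>\<^sub>F h in at_right 0. poly ([:0, 1:] * flat_poly m) (1 / h) * exp (- (1 / h)) =
          (flat_deriv m (0 + h) - flat_deriv m 0) / h"
        unfolding eventually_at_right_field by (auto simp: flat_deriv_def intro!: exI[of _ 1])
    qed
  qed
  moreover have "((\<lambda>h. (flat_deriv m (0 + h) - flat_deriv m 0) / h) \<longlongrightarrow> 0) (at_left 0)"
  proof (rule Lim_transform_eventually[OF tendsto_const])
    show "\<forall>\<^sub>F h in at_left 0. 0 = (flat_deriv m (0 + h) - flat_deriv m 0) / h"
      unfolding eventually_at_left_field by (auto simp: flat_deriv_def intro!: exI[of _ "-1"])
  qed
  ultimately have "((\<lambda>h. (flat_deriv m (0 + h) - flat_deriv m 0) / h) \<longlongrightarrow> 0) (at 0)"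
    by (simp add: filterlim_split_at)
  then show ?thesis using equal by (simp add: DERIV_def flat_deriv_def)
qed

lemma flat_deriv_0: "flat_deriv 0 = flat"
  by (simp add: flat_deriv_def flat_def fun_eq_iff)

lemma Ck_flat: "Ck_on k UNIV g \<Longrightarrow> Ck_on k UNIV (\<lambda>x. flat (g x))"
  using Ck_real_comp[of flat_deriv k g 0] flat_deriv by (simp add: flat_deriv_0)

lemma flat_nonneg: "flat t \<ge> 0" and flat_pos: "t > 0 \<Longrightarrow> flat t > 0" and flat_0: "t \<le> 0 \<Longrightarrow> flat t = 0"
  by (simp_all add: flat_def)

definition cutoff :: "real \<Rightarrow> real \<Rightarrow> real \<Rightarrow> real" where
  "cutoff a b t = flat (b - t) * inverse (flat (b - t) + flat (t - a))"

context
  fixes a b :: real assumes ab: "a < b"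
begin

lemma cutoff_denom: "flat (b - t) + flat (t - a) > 0"
  using ab flat_pos[of "b - t"] flat_pos[of "t - a"] flat_nonneg[of "b - t"] flat_nonneg[of "t - a"]
  by (cases "t < b") (auto intro: add_pos_nonneg add_nonneg_pos)

lemma cutoff_1: "t \<le> a \<Longrightarrow> cutoff a b t = 1"
  using cutoff_denom[of t] by (auto simp: cutoff_def flat_0)

lemma cutoff_0: "t \<ge> b \<Longrightarrow> cutoff a b t = 0"
  by (simp add: cutoff_def flat_0)

lemma cutoff_bounds: "0 \<le> cutoff a b t" "cutoff a b t \<le> 1"
  using cutoff_denom[of t] flat_nonneg[of "b - t"] flat_nonneg[of "t - a"]
  by (auto simp: cutoff_def divide_simps)

lemma Ck_cutoff:
  assumes "Ck_on k UNIV g" shows "Ck_on k UNIV (\<lambda>x. cutoff a b (g x))"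
proof -
  have m: "Ck_on k UNIV (\<lambda>x. b - g x)" "Ck_on k UNIV (\<lambda>x. g x - a)"
    using Ck_add[OF Ck_const[of k b] Ck_mult[OF Ck_const[of k "-1"] assms]]
      Ck_add[OF assms Ck_const[of k "-a"]] by simp_all
  show ?thesis unfolding cutoff_def
    by (intro Ck_mult Ck_inverse Ck_add Ck_flat m) (use cutoff_denom less_irrefl in metis)
qed

end

lemma smooth_onI: "(\<And>k. Ck_on k UNIV f) \<Longrightarrow> smooth_on S f"
  by (simp add: smooth_on_def Ck_subset)

section \<open>The quadratic weight and the flat metric\<close>

lemma frechet_quadratic:
  "((\<lambda>w :: complex^'n. complex_of_real (N * inner w w)) has_derivative (\<lambda>u. of_real (2 * N * inner w u))) (at w)"
  by (auto intro!: derivative_eq_intros simp: inner_commute algebra_simps)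

text \<open>The complex Hessian of the weight is a constant multiple of the Kaehler form. Therefore
  \<open>B_op\<close> is a scalar for this weight and its inverse is explicit.\<close>

lemma i_ddbar_quadratic:
  "i_ddbar (\<lambda>z :: complex^'n::finite. N * inner z z) z = (\<lambda>v. of_real (2 * N) * euclid_form v)"
proof
  fix v
  have db: "dbar_form 0 (\<lambda>w _. complex_of_real (N * inner w w)) z u =
      of_real N * (of_real (inner z (u 0)) + \<i> * of_real (inner z (\<i> *s u 0)))" for z :: "complex^'n" and u
    by (simp add: dbar_form_def dbar_dir_def frechet_derivative_at[OF frechet_quadratic, symmetric] algebra_simps del: of_real_mult)
       (simp add: algebra_simps)
  have "((\<lambda>w. of_real N * (of_real (inner w u) + \<i> * of_real (inner w (\<i> *s u)))) has_derivative
     (\<lambda>x. of_real N * (complex_of_real (inner x u) + \<i> * of_real (inner x (\<i> *s u))))) (at z)" for u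
    by (auto intro!: derivative_eq_intros)
  note d = frechet_derivative_at[OF this, symmetric]
  have dd: "del_dir x (\<lambda>w. of_real N * (of_real (inner w u) + \<i> * of_real (inner w (\<i> *s u)))) z =
     of_real N * (complex_of_real (inner x u) + \<i> * of_real (inner x (\<i> *s u)))" for x u
    unfolding del_dir_def d by (simp add: inner_ii inner_i_skew field_simps)
  have "i_ddbar (\<lambda>z. N * inner z z) z v = \<i> * (of_real N * (complex_of_real (inner (v 0) (v 1)) + \<i> * of_real (inner (v 0) (\<i> *s v 1)))
      - of_real N * (complex_of_real (inner (v 1) (v 0)) + \<i> * of_real (inner (v 1) (\<i> *s v 0))))"
    unfolding i_ddbar_def del_form_def db by (simp add: dd omit_def)
  also have "\<dots> = of_real (2 * N) * euclid_form v"
  proof -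
    have e: "inner (v 1) (\<i> *s v 0) = inner (\<i> *s v 0) (v 1)" "inner (v 0) (\<i> *s v 1) = - inner (\<i> *s v 0) (v 1)"
      "inner (v 1) (v 0) = inner (v 0) (v 1)"
      by (rule inner_commute, simp only: inner_i_skew minus_minus, rule inner_commute)
    show ?thesis unfolding e by (simp add: euclid_form_def algebra_simps)
  qed
  finally show "i_ddbar (\<lambda>z. N * inner z z) z v = of_real (2 * N) * euclid_form v" .
qed

lemma smooth_strictly_psh_quadratic:
  assumes "N > 0"
  shows "smooth_strictly_psh_on D (\<lambda>z :: complex^'n::finite. N * inner z z)"
  unfolding smooth_strictly_psh_on_def
proof (intro conjI ballI allI impI)
  show "smooth_on D (\<lambda>z :: complex^'n. N * inner z z)"
    by (intro smooth_onI Ck_mult Ck_const Ck_inner Ck_bounded_linear bounded_linear_ident)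
  fix z u :: "complex^'n" assume "u \<noteq> 0"
  then show "0 < Re (i_ddbar (\<lambda>z. N * inner z z) z (vpair u (\<i> *s u)))"
    using assms by (simp add: i_ddbar_quadratic euclid_form_vpair inner_ii)
qed

lemma kaehler_euclid: "kaehler_metric_on D (\<lambda>_. euclid_form :: ('n::finite, complex) covector)"
  unfolding kaehler_metric_on_def
proof (intro conjI allI ballI impI)
  show "smooth_on D (\<lambda>z. euclid_form v)" for v :: "nat \<Rightarrow> complex^'n" by (intro smooth_onI Ck_const)
  show "euclid_form (\<lambda>i. c *s v i) = c * cnj c * euclid_form v" for c and v :: "nat \<Rightarrow> complex^'n"
    by (simp add: euclid_form_def complex_eq_iff inner_vec_def inner_complex_def sum_distrib_left algebra_simps power2_eq_square)
  show "0 < riem euclid_form u u" if "u \<noteq> 0" for u :: "complex^'n" using that by (simp add: riem_euclid)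
  show "del_form 2 (\<lambda>_. euclid_form) z v + dbar_form 2 (\<lambda>_. euclid_form) z v = 0" for z :: "complex^'n" and v
    by (simp add: del_form_def dbar_form_def del_dir_def dbar_dir_def frechet_derivative_const)
qed (simp_all add: alt_form_euclid euclid_form_def)

section \<open>Gaussian means\<close>

text \<open>Squares take the place of discs: they are boxes for the gauge integral, and they scale
  in the same way.\<close>

definition sq_box :: "real \<Rightarrow> complex set" where
  "sq_box c = cbox (Complex (- c) (- c)) (Complex c c)"

lemma mem_sq_box: "z \<in> sq_box c \<longleftrightarrow> \<bar>Re z\<bar> \<le> c \<and> \<bar>Im z\<bar> \<le> c"
  by (auto simp: sq_box_def in_cbox_complex_iff)

lemma integral_gauss_scale:
  assumes "N > 0" "c > 0"
  shows "N * integral (sq_box c) (\<lambda>z. exp (- N * (cmod z)\<^sup>2)) = integral (sq_box (sqrt N * c)) (\<lambda>z. exp (- (cmod z)\<^sup>2))"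
proof -
  let ?m = "sqrt N"
  have m: "?m > 0" using assms by simp
  have "(\<lambda>z. exp (- (cmod z)\<^sup>2)) integrable_on sq_box (?m * c)" unfolding sq_box_def
    by (intro integrable_continuous continuous_intros)
  then have "((\<lambda>z. exp (- (cmod z)\<^sup>2)) has_integral integral (sq_box (?m * c)) (\<lambda>z. exp (- (cmod z)\<^sup>2)))
     (cbox (Complex (- (?m * c)) (- (?m * c))) (Complex (?m * c) (?m * c)))"
    by (simp add: has_integral_integral sq_box_def)
  from has_integral_affinity[OF this, of ?m 0] m
  have "((\<lambda>z. exp (- (cmod (?m *\<^sub>R z))\<^sup>2)) has_integral (1 / N) * integral (sq_box (?m * c)) (\<lambda>z. exp (- (cmod z)\<^sup>2)))
     ((\<lambda>x. (1 / ?m) *\<^sub>R x) ` sq_box (?m * c))" using assms by (simp add: sq_box_def)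
  moreover have "(\<lambda>x. (1 / ?m) *\<^sub>R x) ` sq_box (?m * c) = sq_box c"
  proof (intro equalityI subsetI)
    fix z assume "z \<in> sq_box c"
    then have "?m *\<^sub>R z \<in> sq_box (?m * c)" using m by (auto simp: mem_sq_box abs_mult)
    moreover have "z = (1 / ?m) *\<^sub>R (?m *\<^sub>R z)" using m by simp
    ultimately show "z \<in> (\<lambda>x. (1 / ?m) *\<^sub>R x) ` sq_box (?m * c)" by blast
  qed (use m in \<open>auto simp: mem_sq_box abs_mult field_simps\<close>)
  moreover have "(cmod (?m *\<^sub>R z))\<^sup>2 = N * (cmod z)\<^sup>2" for z using assms by (simp add: power_mult_distrib)
  ultimately have "((\<lambda>z. exp (- N * (cmod z)\<^sup>2)) has_integral (1 / N) * integral (sq_box (?m * c)) (\<lambda>z. exp (- (cmod z)\<^sup>2))) (sq_box c)"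
    by simp
  then show ?thesis using assms by (simp add: integral_unique)
qed

lemma integral_gauss_mono:
  assumes "0 < c" "c \<le> d"
  shows "integral (sq_box c) (\<lambda>z. exp (- (cmod z)\<^sup>2)) \<le> integral (sq_box d) (\<lambda>z. exp (- (cmod z)\<^sup>2))"
  by (rule integral_subset_le) (use assms in \<open>auto simp: mem_sq_box sq_box_def[of c] sq_box_def[of d] subset_iff
     in_cbox_complex_iff intro!: integrable_continuous continuous_intros\<close>)

lemma integral_gauss_pos: "c > 0 \<Longrightarrow> integral (sq_box c) (\<lambda>z. exp (- (cmod z)\<^sup>2)) > 0"
proof -
  assume c: "c > 0"
  have i: "(\<lambda>z. exp (- (cmod z)\<^sup>2)) integrable_on sq_box c" unfolding sq_box_def
    by (intro integrable_continuous continuous_intros)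
  have "integral (sq_box c) (\<lambda>_. exp (- 2 * c\<^sup>2)) \<le> integral (sq_box c) (\<lambda>z. exp (- (cmod z)\<^sup>2))"
  proof (rule integral_le[OF _ i])
    fix z assume "z \<in> sq_box c"
    then have "(Re z)\<^sup>2 \<le> c\<^sup>2" "(Im z)\<^sup>2 \<le> c\<^sup>2" using c by (auto simp: mem_sq_box abs_le_square_iff[symmetric])
    then show "exp (- 2 * c\<^sup>2) \<le> exp (- (cmod z)\<^sup>2)" by (simp add: cmod_power2)
  qed (unfold sq_box_def, rule integrable_const)
  moreover have "integral (sq_box c) (\<lambda>_. exp (- 2 * c\<^sup>2)) = measure lborel (sq_box c) * exp (- 2 * c\<^sup>2)"
    by (simp add: sq_box_def)
  moreover have "measure lborel (sq_box c) > 0"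
    using c by (simp add: sq_box_def content_pos_lt_eq Basis_complex_def)
  then have "measure lborel (sq_box c) * exp (- 2 * c\<^sup>2) > 0" by (intro mult_pos_pos) auto
  ultimately show ?thesis by linarith
qed

text \<open>\<open>M(N) = \<integral> N e\<^bsup>-Nt\<^esup> B\<^sup>2 w\<close> with \<open>t = |z|\<^sup>2\<close> is nonincreasing in \<open>N\<close> up to exponentially small
  errors, and tends to a multiple of \<open>w 0\<close>; this is incompatible with \<open>w \<le> w 0 e\<^bsup>-\<epsilon>t\<^esup>\<close>.\<close>

lemma gaussian_touching_contradiction:
  fixes w :: "complex \<Rightarrow> real" and B B' :: "real \<Rightarrow> real"
  assumes w: "continuous_on UNIV w" "\<And>z. w z \<ge> 0" "w 0 > 0" and \<epsilon>: "\<epsilon> > 0"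
    and touch: "\<And>z. (cmod z)\<^sup>2 \<le> b \<Longrightarrow> w z \<le> w 0 * exp (- \<epsilon> * (cmod z)\<^sup>2)"
    and ab: "0 < a" "a < b" "b \<le> R\<^sup>2" "R > 0"
    and B: "\<And>t. (B has_real_derivative B' t) (at t)" "continuous_on UNIV B'" "\<And>t. t \<le> a \<Longrightarrow> B t = 1"
      "\<And>t. t \<ge> b \<Longrightarrow> B t = 0" "\<And>t. 0 \<le> B t \<and> B t \<le> 1"
    and ineq: "\<And>N. N \<ge> 1 \<Longrightarrow> 0 \<le> integral (sq_box R) (\<lambda>z. w z * (exp (- N * (cmod z)\<^sup>2) *
        ((cmod z)\<^sup>2 * (B' ((cmod z)\<^sup>2) - N * B ((cmod z)\<^sup>2))\<^sup>2 - N * (B ((cmod z)\<^sup>2))\<^sup>2)))"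
  shows False
proof -
  define T where "T z = (cmod z)\<^sup>2" for z
  have cT [continuous_intros]: "continuous_on S T" for S unfolding T_def by (intro continuous_intros)
  have cB: "continuous_on UNIV B" using B(1) by (intro continuous_at_imp_continuous_on ballI DERIV_isCont)
  have cBT [continuous_intros]: "continuous_on S (\<lambda>z. B (T z))" "continuous_on S (\<lambda>z. B' (T z))" for S
    using continuous_on_compose2[OF cB cT] continuous_on_compose2[OF B(2) cT] by auto
  have cw [continuous_intros]: "continuous_on S w" for S using w(1) continuous_on_subset by blast
  have B'0: "B' t = 0" if "t < a" for t
  proof -
    have "(B has_real_derivative 0) (at t)"
    proof (subst DERIV_cong_ev[OF refl _ refl])
      show "\<forall>\<^sub>F x in nhds t. B x = 1"
        using eventually_nhds_in_open[of "{..<a}" t] that by (auto elim!: eventually_mono simp: B(3))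
    qed simp
    then show ?thesis using B(1) DERIV_unique by blast
  qed
  define Q where "Q = sq_box R"
  have Qi: "continuous_on Q f \<Longrightarrow> f integrable_on Q" for f :: "complex \<Rightarrow> real"
    unfolding Q_def sq_box_def by (rule integrable_continuous)
  have inQ: "z \<in> Q" if "T z \<le> b" for z
  proof -
    have "cmod z \<le> R" 
    proof (rule power2_le_imp_le)
      show "(cmod z)\<^sup>2 \<le> R\<^sup>2" using that ab unfolding T_def by linarith
    qed (use ab in simp)
    then show ?thesis using abs_Re_le_cmod[of z] abs_Im_le_cmod[of z] by (auto simp: Q_def mem_sq_box)
  qed
  \<comment> \<open>\<open>M'\<close> is the derivative of \<open>M\<close> because
    \<open>N e^(-N t)\<close> has the derivative \<open>(1 - N t) e^(-N t)\<close> in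
    \<open>N\<close>. Where \<open>B = 1\<close>, the integrand of \<open>ineq\<close> is
    \<open>-N\<close> times the integrand of \<open>M'\<close>.\<close>
  define M where "M N = integral Q (\<lambda>z. N * exp (- N * T z) * ((B (T z))\<^sup>2 * w z))" for N
  define M' where "M' N = integral Q (\<lambda>z. (1 - N * T z) * exp (- N * T z) * ((B (T z))\<^sup>2 * w z))" for N
  have dM: "(M has_real_derivative M' N) (at N)" for N
  proof -
    have "((\<lambda>N. integral (cbox (Complex (- R) (- R)) (Complex R R)) (\<lambda>z. N * exp (- N * T z) * ((B (T z))\<^sup>2 * w z))) has_field_derivative
      integral (cbox (Complex (- R) (- R)) (Complex R R)) (\<lambda>z. (1 - N * T z) * exp (- N * T z) * ((B (T z))\<^sup>2 * w z))) (at N within UNIV)"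
    proof (rule leibniz_rule_field_derivative)
      fix N z
      show "((\<lambda>N. N * exp (- N * T z) * ((B (T z))\<^sup>2 * w z)) has_field_derivative (1 - N * T z) * exp (- N * T z) * ((B (T z))\<^sup>2 * w z)) (at N within UNIV)"
        by (auto intro!: derivative_eq_intros simp: algebra_simps)
      show "(\<lambda>z. N * exp (- N * T z) * ((B (T z))\<^sup>2 * w z)) integrable_on cbox (Complex (- R) (- R)) (Complex R R)"
        by (intro integrable_continuous continuous_intros)
      have c: "continuous_on S (\<lambda>p. w (snd p))" "continuous_on S (\<lambda>p. B (T (snd p)))" "continuous_on S (\<lambda>p. T (snd p))" for S :: "(real \<times> complex) set"
      proof -
        have s: "continuous_on S (\<lambda>p. snd p)" by (intro continuous_intros)
        show "continuous_on S (\<lambda>p. w (snd p))" "continuous_on S (\<lambda>p. B (T (snd p)))" "continuous_on S (\<lambda>p. T (snd p))"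
          using continuous_on_compose2[OF w(1) s] continuous_on_compose2[OF cBT(1)[of UNIV] s]
            continuous_on_compose2[OF cT[of UNIV] s] by auto
      qed
      show "continuous_on (UNIV \<times> cbox (Complex (- R) (- R)) (Complex R R)) (\<lambda>(N, z). (1 - N * T z) * exp (- N * T z) * ((B (T z))\<^sup>2 * w z))"
        unfolding case_prod_beta by (intro continuous_intros c)
    qed auto
    then show ?thesis by (simp add: M_def[abs_def] M'_def Q_def sq_box_def)
  qed
  \<comment> \<open>\<open>C\<close> bounds the terms that contain \<open>B'\<close>. They vanish
    where \<open>T z < a\<close>, so the Gaussian factor is at most \<open>exp (- N * a)\<close> on
    them.\<close>
  obtain C where C: "\<And>z. z \<in> Q \<Longrightarrow> w z * (T z * (B' (T z))\<^sup>2) + 2 * (w z * (T z * \<bar>B (T z)\<bar> * \<bar>B' (T z)\<bar>)) \<le> C" and C0: "C \<ge> 0"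
  proof -
    have "continuous_on Q (\<lambda>z. w z * (T z * (B' (T z))\<^sup>2) + 2 * (w z * (T z * \<bar>B (T z)\<bar> * \<bar>B' (T z)\<bar>)))"
      by (intro continuous_intros)
    moreover have "compact Q" by (simp add: Q_def sq_box_def)
    ultimately have "bounded ((\<lambda>z. w z * (T z * (B' (T z))\<^sup>2) + 2 * (w z * (T z * \<bar>B (T z)\<bar> * \<bar>B' (T z)\<bar>))) ` Q)"
      by (intro compact_imp_bounded compact_continuous_image)
    then obtain C where "\<And>z. z \<in> Q \<Longrightarrow> norm (w z * (T z * (B' (T z))\<^sup>2) + 2 * (w z * (T z * \<bar>B (T z)\<bar> * \<bar>B' (T z)\<bar>))) \<le> C"
      by (auto simp: bounded_iff)
    then show ?thesis by (intro that[of "\<bar>C\<bar>"]) (auto, smt (verit))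
  qed
  define C1 where "C1 = C * measure lborel Q"
  have C1: "C1 \<ge> 0" using C0 by (simp add: C1_def)
  have M'le: "M' N \<le> C1 * exp (- N * a)" if N: "N \<ge> 1" for N
  proof -
    let ?K = "\<lambda>z. w z * (exp (- N * T z) * (T z * (B' (T z) - N * B (T z))\<^sup>2 - N * (B (T z))\<^sup>2))"
    have "0 \<le> integral Q ?K" using ineq[OF N] by (simp add: Q_def T_def)
    also have "integral Q ?K \<le> integral Q (\<lambda>z. - N * ((1 - N * T z) * exp (- N * T z) * ((B (T z))\<^sup>2 * w z)) + N * C * exp (- N * a))"
    proof (rule integral_le)
      fix z assume z: "z \<in> Q"
      have eq: "?K z = - N * ((1 - N * T z) * exp (- N * T z) * ((B (T z))\<^sup>2 * w z)) +
         exp (- N * T z) * (w z * (T z * (B' (T z))\<^sup>2) - 2 * N * (w z * (T z * B (T z) * B' (T z))))"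
        by (simp add: algebra_simps power2_eq_square)
      have "exp (- N * T z) * (w z * (T z * (B' (T z))\<^sup>2) - 2 * N * (w z * (T z * B (T z) * B' (T z)))) \<le> N * C * exp (- N * a)"
      proof (cases "T z < a")
        case True then show ?thesis using B'0 C0 N by simp
      next
        case False
        have Tp: "T z \<ge> 0" by (simp add: T_def)
        have "- (B (T z) * B' (T z)) \<le> \<bar>B (T z)\<bar> * \<bar>B' (T z)\<bar>" by (metis abs_ge_minus_self abs_mult)
        then have "w z * T z * (- (B (T z) * B' (T z))) \<le> w z * T z * (\<bar>B (T z)\<bar> * \<bar>B' (T z)\<bar>)"
          using w(2) Tp by (intro mult_left_mono) auto
        then have m1: "N * (w z * T z * (- (B (T z) * B' (T z)))) \<le> N * (w z * T z * (\<bar>B (T z)\<bar> * \<bar>B' (T z)\<bar>))"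
          using N by (rule_tac mult_left_mono) auto
        moreover have "w z * (T z * (B' (T z))\<^sup>2) \<le> N * (w z * (T z * (B' (T z))\<^sup>2))"
          using mult_right_mono[of 1 N "w z * (T z * (B' (T z))\<^sup>2)"] N w(2)[of z] Tp by simp
        ultimately have "w z * (T z * (B' (T z))\<^sup>2) - 2 * N * (w z * (T z * B (T z) * B' (T z)))
          \<le> N * (w z * (T z * (B' (T z))\<^sup>2) + 2 * (w z * (T z * \<bar>B (T z)\<bar> * \<bar>B' (T z)\<bar>)))"
          by (simp add: algebra_simps)
        also have "\<dots> \<le> N * C" using C[OF z] N by (intro mult_left_mono) auto
        finally have "exp (- N * T z) * (w z * (T z * (B' (T z))\<^sup>2) - 2 * N * (w z * (T z * B (T z) * B' (T z)))) \<le> exp (- N * T z) * (N * C)"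
          by (intro mult_left_mono) auto
        also have "\<dots> \<le> exp (- N * a) * (N * C)"
          using False N C0 by (intro mult_right_mono) (auto simp: mult_left_mono)
        finally show ?thesis by (simp add: mult_ac)
      qed
      then show "?K z \<le> - N * ((1 - N * T z) * exp (- N * T z) * ((B (T z))\<^sup>2 * w z)) + N * C * exp (- N * a)"
        unfolding eq by simp
    qed (intro Qi continuous_intros)+
    also have "\<dots> = - N * M' N + N * C * exp (- N * a) * measure lborel Q"
      unfolding M'_def
      by (subst integral_add; (intro Qi continuous_intros)?) (simp add: Q_def sq_box_def)
    finally have "N * M' N \<le> N * (C1 * exp (- N * a))" by (simp add: C1_def mult_ac)
    then show ?thesis using N by simp
  qed
  \<comment> \<open>The bound on \<open>M'\<close> integrates to
    \<open>- C1 / a * exp (- N * a)\<close>; adding the opposite term to \<open>M\<close> gives a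
    nonincreasing function.\<close>
  have L: "M N' \<le> M N + C1 / a * exp (- N * a)" if "1 \<le> N" "N \<le> N'" for N N'
  proof -
    have "M N' + C1 / a * exp (- N' * a) \<le> M N + C1 / a * exp (- N * a)"
    proof (rule DERIV_nonpos_imp_nonincreasing[OF that(2), where f = "\<lambda>N. M N + C1 / a * exp (- N * a)"])
      fix x assume "N \<le> x" "x \<le> N'"
      have "((\<lambda>N. M N + C1 / a * exp (- N * a)) has_real_derivative (M' x - C1 * exp (- x * a))) (at x)"
        using ab by (auto intro!: derivative_eq_intros dM)
      moreover have "M' x - C1 * exp (- x * a) \<le> 0" using M'le[of x] that \<open>N \<le> x\<close> by simp
      ultimately show "\<exists>y. ((\<lambda>N. M N + C1 / a * exp (- N * a)) has_real_derivative y) (at x) \<and> y \<le> 0" by blast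
    qed
    moreover have "C1 / a * exp (- N' * a) \<ge> 0" using C1 ab by simp
    ultimately show ?thesis by linarith
  qed
  define g where "g c = integral (sq_box c) (\<lambda>z. exp (- (cmod z)\<^sup>2))" for c
  have up: "M N \<le> w 0 * (N / (N + \<epsilon>)) * g (sqrt (N + \<epsilon>) * R)" if "N \<ge> 1" for N
  proof -
    have "M N \<le> integral Q (\<lambda>z. w 0 * N * exp (- (N + \<epsilon>) * (cmod z)\<^sup>2))" unfolding M_def
    proof (rule integral_le)
      fix z assume "z \<in> Q"
      have "(B (T z))\<^sup>2 * w z \<le> w 0 * exp (- \<epsilon> * T z)"
      proof (cases "T z \<le> b")
        case True
        have "(B (T z))\<^sup>2 \<le> 1" using B(5)[of "T z"] by (simp add: power_le_one)
        then have "(B (T z))\<^sup>2 * w z \<le> 1 * w z" using w(2) by (intro mult_right_mono) auto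
        then show ?thesis using touch[of z] True by (simp add: T_def)
      qed (use B(4) w(3) in auto)
      then have "N * exp (- N * T z) * ((B (T z))\<^sup>2 * w z) \<le> N * exp (- N * T z) * (w 0 * exp (- \<epsilon> * T z))"
        using that by (intro mult_left_mono) auto
      also have "\<dots> = w 0 * N * exp (- (N + \<epsilon>) * (cmod z)\<^sup>2)"
        by (simp add: T_def algebra_simps exp_add[symmetric])
      finally show "N * exp (- N * T z) * ((B (T z))\<^sup>2 * w z) \<le> w 0 * N * exp (- (N + \<epsilon>) * (cmod z)\<^sup>2)" .
    qed (intro Qi continuous_intros)+
    also have "\<dots> = w 0 * N * integral (sq_box R) (\<lambda>z. exp (- (N + \<epsilon>) * (cmod z)\<^sup>2))" by (simp add: Q_def)
    also have "\<dots> = w 0 * (N / (N + \<epsilon>)) * g (sqrt (N + \<epsilon>) * R)"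
      using integral_gauss_scale[of "N + \<epsilon>" R] that \<epsilon> ab by (simp add: g_def field_simps)
    finally show ?thesis .
  qed
  \<comment> \<open>For large \<open>N'\<close> the Gaussian concentrates at 0, where
    \<open>B = 1\<close> and \<open>w\<close> is close to \<open>w 0\<close>, so \<open>M N'\<close>
    is nearly \<open>w 0\<close> times a Gaussian integral. By \<open>L\<close> this lower bound is
    inherited by every smaller \<open>N\<close>.\<close>
  have low: "w 0 * (1 - \<eta>) * g d \<le> M N + C1 / a * exp (- N * a)" if N: "N \<ge> 1" and \<eta>: "0 < \<eta>" "\<eta> < 1" and d: "d > 0" for N \<eta> d
  proof -
    have "isCont w 0" using w(1) by (simp add: continuous_on_eq_continuous_at)
    then obtain r where r: "r > 0" "\<And>z. cmod z < r \<Longrightarrow> \<bar>w z - w 0\<bar> < \<eta> * w 0"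
      using \<eta> w(3) unfolding continuous_at_eps_delta by (metis diff_zero dist_complex_def dist_real_def mult_pos_pos dist_norm)
    define c where "c = min (r / 4) (min (sqrt a / 2) R)"
    have c: "c > 0" "c \<le> R" using r ab by (auto simp: c_def)
    have cz: "T z \<le> a" "cmod z < r" if "z \<in> sq_box c" for z
    proof -
      have 1: "cmod z \<le> \<bar>Re z\<bar> + \<bar>Im z\<bar>" by (rule cmod_le)
      then have "cmod z \<le> 2 * c" using that by (auto simp: mem_sq_box)
      then show "cmod z < r" using r by (auto simp: c_def min_def split: if_splits)
      have "cmod z \<le> sqrt a" using \<open>cmod z \<le> 2 * c\<close> by (auto simp: c_def min_def split: if_splits)
      then show "T z \<le> a" unfolding T_def using ab by (metis norm_ge_zero power_mono real_sqrt_pow2 less_imp_le)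
    qed
    \<comment> \<open>So large that rescaling by \<open>sqrt N'\<close> enlarges the small square to
      half-width at least \<open>d\<close>.\<close>
    define N' where "N' = max N ((d / c)\<^sup>2)"
    have N': "N' \<ge> N" "sqrt N' * c \<ge> d"
    proof -
      have "sqrt N' \<ge> d / c" by (rule real_le_rsqrt) (simp add: N'_def)
      then show "sqrt N' * c \<ge> d" using c by (simp add: field_simps)
    qed (simp add: N'_def)
    have "w 0 * (1 - \<eta>) * g d \<le> w 0 * (1 - \<eta>) * g (sqrt N' * c)"
      unfolding g_def using N' d w(3) \<eta> by (intro mult_left_mono integral_gauss_mono) auto
    also have "\<dots> = integral (sq_box c) (\<lambda>z. N' * exp (- N' * (cmod z)\<^sup>2) * (w 0 * (1 - \<eta>)))"
      using integral_gauss_scale[of N' c] N N' c by (simp add: g_def mult_ac)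
    also have "\<dots> \<le> integral Q (\<lambda>z. N' * exp (- N' * T z) * ((B (T z))\<^sup>2 * w z))"
    proof -
      have "integral (sq_box c) (\<lambda>z. N' * exp (- N' * (cmod z)\<^sup>2) * (w 0 * (1 - \<eta>))) \<le> integral (sq_box c) (\<lambda>z. N' * exp (- N' * T z) * ((B (T z))\<^sup>2 * w z))"
      proof (rule integral_le)
        fix z assume z: "z \<in> sq_box c"
        have "w 0 * (1 - \<eta>) \<le> (B (T z))\<^sup>2 * w z" using r(2)[OF cz(2)[OF z]] B(3)[OF cz(1)[OF z]] by (simp add: abs_less_iff algebra_simps)
        then show "N' * exp (- N' * (cmod z)\<^sup>2) * (w 0 * (1 - \<eta>)) \<le> N' * exp (- N' * T z) * ((B (T z))\<^sup>2 * w z)"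
          using N N' by (simp add: T_def mult_left_mono)
      qed (unfold sq_box_def, (intro integrable_continuous continuous_intros)+)
      also have "\<dots> \<le> integral Q (\<lambda>z. N' * exp (- N' * T z) * ((B (T z))\<^sup>2 * w z))"
      proof (rule integral_subset_le)
        show "sq_box c \<subseteq> Q" using c by (auto simp: Q_def mem_sq_box)
        show "(\<lambda>z. N' * exp (- N' * T z) * ((B (T z))\<^sup>2 * w z)) integrable_on sq_box c"
          unfolding sq_box_def by (intro integrable_continuous continuous_intros)
        show "(\<lambda>z. N' * exp (- N' * T z) * ((B (T z))\<^sup>2 * w z)) integrable_on Q" by (intro Qi continuous_intros)
      qed (use N N' w(2) in auto)
      finally show ?thesis .
    qed
    also have "\<dots> = M N'" by (simp add: M_def)
    also have "\<dots> \<le> M N + C1 / a * exp (- N * a)" by (rule L[OF N N'(1)])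
    finally show ?thesis .
  qed
  have low': "w 0 * g d \<le> M N + C1 / a * exp (- N * a)" if "N \<ge> 1" "d > 0" for N d
  proof -
    have "((\<lambda>\<eta>. w 0 * (1 - \<eta>) * g d) \<longlongrightarrow> w 0 * (1 - 0) * g d) (at_right 0)" by (intro tendsto_intros)
    then have "w 0 * (1 - 0) * g d \<le> M N + C1 / a * exp (- N * a)"
    proof (rule tendsto_upperbound)
      show "\<forall>\<^sub>F \<eta> in at_right 0. w 0 * (1 - \<eta>) * g d \<le> M N + C1 / a * exp (- N * a)"
        unfolding eventually_at_right_field using low[OF that(1) _ _ that(2)] by (intro exI[of _ 1]) auto
    qed simp
    then show ?thesis by simp
  qed
  \<comment> \<open>The Gaussian integral over the plane. That it is finite follows from
    \<open>low'\<close> itself; both bounds for \<open>M\<close> are multiples of it, so no closed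
    form is called for.\<close>
  define S where "S = (SUP d\<in>{0<..}. g d)"
  have bdd: "bdd_above (g ` {0<..})"
  proof (rule bdd_aboveI2)
    fix d :: real assume "d \<in> {0<..}"
    then show "g d \<le> (M 1 + C1 / a * exp (- 1 * a)) / w 0" using low'[of 1 d] w(3) by (simp add: field_simps)
  qed
  have gS: "g d \<le> S" if "d > 0" for d unfolding S_def using that by (intro cSUP_upper bdd) auto
  have S0: "S > 0" using integral_gauss_pos[of 1] gS[of 1] by (simp add: g_def)
  have key: "w 0 * S * \<epsilon> \<le> (N + \<epsilon>) * (C1 / a * exp (- N * a))" if N: "N \<ge> 1" for N
  proof -
    have "S \<le> (M N + C1 / a * exp (- N * a)) / w 0" unfolding S_def
    proof (rule cSUP_least)
      fix d :: real assume "d \<in> {0<..}"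
      then show "g d \<le> (M N + C1 / a * exp (- N * a)) / w 0" using low'[OF N, of d] w(3) by (simp add: field_simps)
    qed simp
    then have "w 0 * S \<le> M N + C1 / a * exp (- N * a)" using w(3) by (simp add: field_simps)
    also have "M N \<le> w 0 * (N / (N + \<epsilon>)) * g (sqrt (N + \<epsilon>) * R)" by (rule up[OF N])
    also have "\<dots> \<le> w 0 * (N / (N + \<epsilon>)) * S" using N \<epsilon> w(3) ab by (intro mult_left_mono gS) auto
    finally have "w 0 * S \<le> w 0 * (N / (N + \<epsilon>)) * S + C1 / a * exp (- N * a)" by simp
    then have "(N + \<epsilon>) * (w 0 * S) \<le> (N + \<epsilon>) * (w 0 * (N / (N + \<epsilon>)) * S + C1 / a * exp (- N * a))"
      using N \<epsilon> by (intro mult_left_mono) auto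
    also have "\<dots> = N * (w 0 * S) + (N + \<epsilon>) * (C1 / a * exp (- N * a))" using N \<epsilon> by (simp add: field_simps)
    finally show ?thesis by (simp add: algebra_simps)
  qed
  \<comment> \<open>The relative gap \<open>\<epsilon> / (N + \<epsilon>)\<close> between the two
    bounds closes only like \<open>1/N\<close>, while the cutoff error decays exponentially.\<close>
  have "((\<lambda>N. (N + \<epsilon>) * (C1 / a * exp (- N * a))) \<longlongrightarrow> 0) at_top" using ab(1) by real_asymp
  then have "w 0 * S * \<epsilon> \<le> 0"
    by (rule tendsto_lowerbound) (use key in \<open>auto intro: eventually_mono[OF eventually_ge_at_top[of 1]]\<close>)
  then show False using w(3) S0 \<epsilon> by (simp add: mult_le_0_iff)
qed

section \<open>Circle means\<close>

text \<open>On the unit circle \<open>cnj z\<close> is \<open>1/z\<close>, so in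
  \<open>Re x Re y = Re (x y + x cnj y) / 2\<close> the mixed term is again a monomial. The factor
  to be conjugated is chosen such that the exponent stays nonnegative.\<close>

lemma Re_monomial_mult:
  fixes a b :: complex
  obtains p where "\<And>z. cmod z = 1 \<Longrightarrow> Re (a * z ^ i) * Re (b * z ^ j) = Re (poly p z)"
proof -
  have prod: "Re x * Re y = Re ((x * y + x * cnj y) / 2)" for x y :: complex by (simp add: algebra_simps)
  have zz: "z * cnj z = 1" if "cmod z = 1" for z using complex_norm_square[of z] that by simp
  have red: "z ^ (k + l) * cnj z ^ l = z ^ k" if "cmod z = 1" for z k l
    using zz[OF that] by (simp add: power_add mult.assoc flip: power_mult_distrib)
  show ?thesis
  proof (cases "j \<le> i")
    case True
    show ?thesis
    proof (rule that[of "smult (1 / 2) (monom (a * b) (i + j) + monom (a * cnj b) (i - j))"])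
      fix z assume z: "cmod z = 1"
      have "z ^ i * cnj z ^ j = z ^ (i - j)" using red[OF z, of "i - j" j] True by simp
      then have e: "a * z ^ i * cnj (b * z ^ j) = a * cnj b * z ^ (i - j)" by (simp add: mult_ac)
      show "Re (a * z ^ i) * Re (b * z ^ j) = Re (poly (smult (1 / 2) (monom (a * b) (i + j) + monom (a * cnj b) (i - j))) z)"
      proof -
        have "poly (smult (1 / 2) (monom (a * b) (i + j) + monom (a * cnj b) (i - j))) z =
            (a * z ^ i * (b * z ^ j) + a * cnj b * z ^ (i - j)) / 2"
          by (simp add: poly_monom power_add mult_ac)
        then show ?thesis unfolding prod e by (simp only:)
      qed
    qed
  next
    case False
    show ?thesis
    proof (rule that[of "smult (1 / 2) (monom (a * b) (i + j) + monom (cnj a * b) (j - i))"])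
      fix z assume z: "cmod z = 1"
      have "z ^ j * cnj z ^ i = z ^ (j - i)" using red[OF z, of "j - i" i] False by simp
      then have e': "b * z ^ j * cnj (a * z ^ i) = cnj a * b * z ^ (j - i)" by (simp add: mult_ac)
      have e: "Re (b * z ^ j) * Re (a * z ^ i) = Re ((b * z ^ j * (a * z ^ i) + cnj a * b * z ^ (j - i)) / 2)"
        using prod[of "b * z ^ j" "a * z ^ i"] unfolding e' .
      show "Re (a * z ^ i) * Re (b * z ^ j) = Re (poly (smult (1 / 2) (monom (a * b) (i + j) + monom (cnj a * b) (j - i))) z)"
      proof -
        have "poly (smult (1 / 2) (monom (a * b) (i + j) + monom (cnj a * b) (j - i))) z =
            (b * z ^ j * (a * z ^ i) + cnj a * b * z ^ (j - i)) / 2"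
          by (simp add: poly_monom power_add mult_ac)
        then show ?thesis unfolding mult.commute[of "Re (a * z ^ i)"] e by (simp only:)
      qed
    qed
  qed
qed

lemma Re_poly_mult:
  fixes p q :: "complex poly"
  obtains r where "\<And>z. cmod z = 1 \<Longrightarrow> Re (poly p z) * Re (poly q z) = Re (poly r z)"
proof -
  have "\<forall>i j. \<exists>r. \<forall>z. cmod z = 1 \<longrightarrow> Re (coeff p i * z ^ i) * Re (coeff q j * z ^ j) = Re (poly r z)"
    by (metis Re_monomial_mult)
  then obtain r where r: "\<And>i j z. cmod z = 1 \<Longrightarrow> Re (coeff p i * z ^ i) * Re (coeff q j * z ^ j) = Re (poly (r i j) z)"
    by metis
  show ?thesis
  proof (rule that[of "\<Sum>i\<le>degree p. \<Sum>j\<le>degree q. r i j"])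
    fix z :: complex assume "cmod z = 1"
    then show "Re (poly p z) * Re (poly q z) = Re (poly (\<Sum>i\<le>degree p. \<Sum>j\<le>degree q. r i j) z)"
      by (simp only: poly_altdef[of p] poly_altdef[of q] poly_sum Re_sum sum_product r)
  qed
qed

text \<open>Together with the Stone-Weierstrass theorem this replaces the Poisson integral:
  continuous data on the circle are approximated by \<open>Re p\<close>, which is harmonic in the
  disc. A linear \<open>f\<close> is the real part of \<open>(f 1 - \<i> f \<i>) z\<close>, and
  products are covered by \<open>Re_poly_mult\<close>.\<close>

lemma real_polynomial_on_circle:
  fixes f :: "complex \<Rightarrow> real"
  assumes "real_polynomial_function f"
  shows "\<exists>p. \<forall>z. cmod z = 1 \<longrightarrow> f z = Re (poly p z)"
  using assms
proof induction
  case (linear f)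
  have eq: "f z = Re z * f 1 + Im z * f \<i>" for z
  proof -
    have "f z = f (Re z *\<^sub>R 1 + Im z *\<^sub>R \<i>)" by (simp add: complex_eq scaleR_conv_of_real mult.commute flip: complex_eq)
    then show ?thesis using linear by (simp add: bounded_linear.linear linear_add linear_scale)
  qed
  show ?case
  proof (intro exI[of _ "[:0, Complex (f 1) (- f \<i>):]"] allI impI)
    fix z show "f z = Re (poly [:0, Complex (f 1) (- f \<i>):] z)" by (subst eq) (simp add: algebra_simps)
  qed
next
  case (const c) show ?case by (intro exI[of _ "[:of_real c:]"]) simp
next
  case (add f g)
  then obtain p q where "\<forall>z. cmod z = 1 \<longrightarrow> f z = Re (poly p z)" "\<forall>z. cmod z = 1 \<longrightarrow> g z = Re (poly q z)" by blast
  then show ?case by (intro exI[of _ "p + q"]) simp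
next
  case (mult f g)
  then obtain p q where pq: "\<forall>z. cmod z = 1 \<longrightarrow> f z = Re (poly p z)" "\<forall>z. cmod z = 1 \<longrightarrow> g z = Re (poly q z)" by blast
  obtain r where "\<And>z. cmod z = 1 \<Longrightarrow> Re (poly p z) * Re (poly q z) = Re (poly r z)" using Re_poly_mult by metis
  then show ?case using pq by metis
qed

lemma circle_mean_poly: "((\<lambda>t. Re (poly p (cis t))) has_integral 2 * pi * Re (poly p 0)) {0..2 * pi}"
proof -
  have "((\<lambda>t. c * cis t ^ k) has_integral (if k = 0 then 2 * pi * c else 0)) {0..2 * pi}" for c :: complex and k :: nat
  proof (cases "k = 0")
    case True
    then show ?thesis using has_integral_const_real[of c 0 "2 * pi"] by (simp add: scaleR_conv_of_real)
  next
    case False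
    have e: "exp (\<i> * of_nat k * of_real t) = cis (real k * t)" for t
      by (simp add: cis_conv_exp mult_ac)
    have "((\<lambda>t. c * cis t ^ k) has_integral (c / (\<i> * k) * cis (real k * (2 * pi)) - c / (\<i> * k) * cis (real k * 0))) {0..2 * pi}"
    proof (rule fundamental_theorem_of_calculus)
      fix t :: real
      have "((\<lambda>z. c / (\<i> * k) * exp (\<i> * k * z)) has_field_derivative c * exp (\<i> * k * of_real t)) (at (of_real t))"
        using False by (auto intro!: derivative_eq_intros)
      note has_vector_derivative_real_field[OF this, of "{0..2*pi}"]
      moreover have "cis t ^ k = cis (real k * t)" by (rule Complex.DeMoivre)
      ultimately show "((\<lambda>t. c / (\<i> * k) * cis (real k * t)) has_vector_derivative c * cis t ^ k) (at t within {0..2 * pi})"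
        by (simp only: e)
    qed simp
    moreover have "cis (real k * (2 * pi)) = 1"
      using cis_multiple_2pi[of "of_nat k"] by (simp add: mult_ac)
    ultimately show ?thesis using False by simp
  qed
  then have "((\<lambda>t. \<Sum>k\<le>degree p. coeff p k * cis t ^ k) has_integral (\<Sum>k\<le>degree p. if k = 0 then 2 * pi * coeff p k else 0)) {0..2 * pi}"
    by (intro has_integral_sum) auto
  then have "((\<lambda>t. poly p (cis t)) has_integral 2 * pi * poly p 0) {0..2 * pi}"
    by (simp add: poly_altdef[of p "cis _"] poly_0_coeff_0 if_distrib cong: if_cong)
  from has_integral_linear[OF this bounded_linear_Re] show ?thesis by (simp add: o_def)
qed

text \<open>Truncation at \<open>1 / m\<close> makes the logarithm continuous. Only its negative
  part \<open>b m\<close> depends on \<open>m\<close>; it increases with \<open>m\<close> and its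
  integrals stay below a fixed bound, so monotone convergence yields the negative part of
  \<open>log_ereal (g z)\<close>, zeros of \<open>g\<close> included.\<close>

lemma circle_mean_lower:
  fixes g :: "complex \<Rightarrow> real"
  assumes g: "continuous_on (cball 0 1) g" "\<And>z. g z \<ge> 0"
    and m: "\<And>m :: nat. m \<ge> 1 \<Longrightarrow> 2 * pi * l \<le> integral {0..2 * pi} (\<lambda>t. ln (max (g (cis t)) (1 / real m)))"
  shows "ereal l \<le> circle_mean (\<lambda>z. log_ereal (g z))"
proof -
  define u where "u t = g (cis t)" for t
  define L where "L = lebesgue_on {0..2 * pi}"
  have cu: "continuous_on UNIV u" unfolding u_def
    by (intro continuous_on_compose2[OF g(1)] continuous_intros) auto
  have cu' [continuous_intros]: "continuous_on S u" for S using cu continuous_on_subset by blast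
  have u0: "u t \<ge> 0" for t by (simp add: u_def g)
  have int: "integrable L f" "integral\<^sup>L L f = integral {0..2 * pi} f" "f \<in> borel_measurable L" if "continuous_on {0..2 * pi} f" for f :: "real \<Rightarrow> real"
  proof -
    show "integrable L f" unfolding L_def by (rule continuous_imp_integrable_real[OF that])
    then show "integral\<^sup>L L f = integral {0..2 * pi} f" "f \<in> borel_measurable L"
      unfolding L_def by (auto intro: lebesgue_integral_eq_integral)
  qed
  define a where "a t = ln (max (u t) 1)" for t
  define b where "b m t = max 0 (- ln (max (u t) (1 / real (Suc m))))" for m t
  have ca: "continuous_on S a" for S unfolding a_def
    by (intro continuous_intros) auto
  have mpos: "max (u t) (1 / real (Suc m)) > 0" for t m by (simp add: less_max_iff_disj)
  have cb: "continuous_on S (b m)" for S m unfolding b_def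
    using mpos by (intro continuous_intros) (auto simp: less_imp_neq[symmetric] simp del: of_nat_Suc)
  have ab: "ln (max (u t) (1 / real (Suc m))) = a t - b m t" for t m
  proof (cases "u t \<ge> 1")
    case True
    moreover have "1 / real (Suc m) \<le> 1" by simp
    ultimately have "max (u t) (1 / real (Suc m)) = u t" "max (u t) 1 = u t" by linarith+
    then show ?thesis using True by (simp add: a_def b_def)
  next
    case False
    then have "max (u t) (1 / real (Suc m)) \<le> 1" by (simp add: max_def)
    then have "ln (max (u t) (1 / real (Suc m))) \<le> 0" using mpos[of t m] by (simp add: ln_le_zero_iff)
    then show ?thesis using False by (simp add: a_def b_def)
  qed
  have Ib: "integral\<^sup>L L (b m) \<le> integral\<^sup>L L a - 2 * pi * l" for m
  proof -
    have "2 * pi * l \<le> integral {0..2 * pi} (\<lambda>t. a t - b m t)"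
      using m[of "Suc m"] unfolding u_def[symmetric] ab by simp
    also have "\<dots> = integral\<^sup>L L (\<lambda>t. a t - b m t)" by (intro int(2)[symmetric] continuous_intros ca cb)
    also have "\<dots> = integral\<^sup>L L a - integral\<^sup>L L (b m)" by (intro Bochner_Integration.integral_diff int(1) ca cb)
    finally show ?thesis by simp
  qed
  have a0: "a t \<ge> 0" for t by (simp add: a_def)
  have b0: "b m t \<ge> 0" for t m by (simp add: b_def)
  have pos: "e2ennreal (log_ereal (u t)) = ennreal (a t)" for t
    using u0[of t] by (auto simp: log_ereal_def a_def e2ennreal_ereal max_def ennreal_neg ln_le_zero_iff e2ennreal_neg)
  \<comment> \<open>At a zero of \<open>u\<close> the truncated values grow without bound; elsewhere
    they are eventually constant.\<close>
  have neg: "e2ennreal (- log_ereal (u t)) = (SUP m. ennreal (b m t))" for t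
  proof (cases "u t = 0")
    case True
    have e: "(SUP m. ennreal (b m t)) = top"
    proof (rule ennreal_SUP_eq_top)
      fix n :: nat
      obtain m :: nat where m: "exp (real n) \<le> real m" using real_arch_simple by blast
      have "real n \<le> ln (real (Suc m))" using m by (subst ln_ge_iff) auto
      then have "real n \<le> b m t" using True by (simp add: b_def ln_div max_def del: of_nat_Suc)
      then show "\<exists>i\<in>UNIV. of_nat n \<le> ennreal (b i t)" by (auto simp: ennreal_of_nat_eq_real_of_nat intro!: exI[of _ m] ennreal_leI)
    qed
    show ?thesis unfolding e using True by (simp add: log_ereal_def)
  next
    case False
    then have ut: "u t > 0" using u0[of t] by simp
    have "b m t \<le> max 0 (- ln (u t))" for m
      using ut mpos[of t m] unfolding b_def by (intro max.mono order.refl le_imp_neg_le) (simp add: ln_le_cancel_iff)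
    moreover obtain m where "1 / real (Suc m) < u t" using ut reals_Archimedean by (metis inverse_eq_divide)
    then have "b m t = max 0 (- ln (u t))" by (simp add: b_def max_def)
    ultimately have "(SUP m. ennreal (b m t)) = ennreal (max 0 (- ln (u t)))"
      by (intro antisym SUP_least ennreal_leI) (auto intro: SUP_upper2[of m])
    then show ?thesis using False ut by (auto simp: log_ereal_def e2ennreal_ereal max_def ennreal_neg)
  qed
  have "(\<integral>\<^sup>+ t. e2ennreal (log_ereal (g (cis t))) \<partial>L) = ennreal (integral\<^sup>L L a)"
    unfolding u_def[symmetric] pos by (intro nn_integral_eq_integral int ca) (simp add: a0)
  moreover have "(\<integral>\<^sup>+ t. e2ennreal (- log_ereal (g (cis t))) \<partial>L) \<le> ennreal (integral\<^sup>L L a - 2 * pi * l)"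
  proof -
    have inc: "incseq (\<lambda>m t. ennreal (b m t))"
    proof (intro incseq_SucI le_funI ennreal_leI)
      fix m t
      have "1 / real (Suc (Suc m)) \<le> 1 / real (Suc m)" by (simp add: frac_le)
      then have "max (u t) (1 / real (Suc (Suc m))) \<le> max (u t) (1 / real (Suc m))" by (rule max.mono[OF order.refl])
      then have l: "ln (max (u t) (1 / real (Suc (Suc m)))) \<le> ln (max (u t) (1 / real (Suc m)))"
        by (rule ln_le_cancel_iff[THEN iffD2, OF mpos mpos])
      show "b m t \<le> b (Suc m) t" unfolding b_def by (intro max.mono order.refl le_imp_neg_le l)
    qed
    have "(\<integral>\<^sup>+ t. (SUP m. ennreal (b m t)) \<partial>L) = (SUP m. \<integral>\<^sup>+ t. ennreal (b m t) \<partial>L)"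
      using int(3)[OF cb] by (intro nn_integral_monotone_convergence_SUP inc) auto
    also have "\<dots> = (SUP m. ennreal (integral\<^sup>L L (b m)))"
      by (intro SUP_cong refl nn_integral_eq_integral int cb) (simp add: b0)
    also have "\<dots> \<le> ennreal (integral\<^sup>L L a - 2 * pi * l)"
      by (intro SUP_least ennreal_leI Ib)
    finally show ?thesis unfolding u_def[symmetric] neg .
  qed
  moreover have nn: "integral\<^sup>L L a - 2 * pi * l \<ge> 0"
    using Ib[of 0] Bochner_Integration.integral_nonneg[of L "b 0"] b0 by (meson order.trans)
  ultimately have "enn2ereal (\<integral>\<^sup>+ t. e2ennreal (log_ereal (g (cis t))) \<partial>L) = ereal (integral\<^sup>L L a)"
     "enn2ereal (\<integral>\<^sup>+ t. e2ennreal (- log_ereal (g (cis t))) \<partial>L) \<le> ereal (integral\<^sup>L L a - 2 * pi * l)"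
    using a0 by (simp_all add: enn2ereal_ennreal less_eq_ennreal.rep_eq Bochner_Integration.integral_nonneg)
  then have "ereal (2 * pi * l) \<le> enn2ereal (\<integral>\<^sup>+ t. e2ennreal (log_ereal (g (cis t))) \<partial>L)
      - enn2ereal (\<integral>\<^sup>+ t. e2ennreal (- log_ereal (g (cis t))) \<partial>L)"
    by (cases "enn2ereal (\<integral>\<^sup>+ t. e2ennreal (- log_ereal (g (cis t))) \<partial>L)") auto
  then have "ereal (1 / (2 * pi)) * ereal (2 * pi * l) \<le> circle_mean (\<lambda>z. log_ereal (g z))"
    unfolding circle_mean_def L_def by (intro ereal_mult_left_mono) auto
  then show ?thesis by simp
qed

text \<open>If the submean inequality fails, subtract from \<open>log g\<close> the harmonic function with slightly
  larger boundary values and add \<open>\<epsilon>|z|\<^sup>2\<close>; the maximum is then attained in the interior.\<close>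

lemma submean_or_touching:
  fixes g :: "complex \<Rightarrow> real"
  assumes g: "continuous_on (cball 0 1) g" "\<And>z. g z \<ge> 0"
    and fail: "\<not> log_ereal (g 0) \<le> circle_mean (\<lambda>z. log_ereal (g z))"
  obtains z0 p \<epsilon> where "cmod z0 < 1" "\<epsilon> > 0" "g z0 > 0"
    "\<And>z. cmod z \<le> 1 \<Longrightarrow> g z \<le> g z0 * exp (Re (poly p z) - Re (poly p z0) - \<epsilon> * (cmod (z - z0))\<^sup>2)"
proof -
  have g0: "g 0 > 0" using fail g(2)[of 0] by (cases "g 0 = 0") (auto simp: log_ereal_def)
  then have "\<not> ereal (ln (g 0)) \<le> circle_mean (\<lambda>z. log_ereal (g z))" using fail by (simp add: log_ereal_def)
  then obtain m :: nat where m: "m \<ge> 1" "2 * pi * ln (g 0) > integral {0..2 * pi} (\<lambda>t. ln (max (g (cis t)) (1 / real m)))"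
    using circle_mean_lower[OF g, of "ln (g 0)"] by (meson not_le)
  define f where "f z = ln (max (g z) (1 / real m))" for z
  have mp: "max (g z) (1 / real m) > 0" for z using m by (simp add: less_max_iff_disj)
  have cf: "continuous_on (cball 0 1) f" unfolding f_def
    using mp by (intro continuous_intros g) (auto simp: less_imp_neq[symmetric])
  \<comment> \<open>On the circle \<open>p\<close> lies between \<open>f\<close> and
    \<open>f + 2 * \<eta>\<close>, which raises the integral by at most
    \<open>4 * pi * \<eta>\<close>. The 8 in the denominator makes this half of the gap.\<close>
  define \<eta> where "\<eta> = (2 * pi * ln (g 0) - integral {0..2 * pi} (\<lambda>t. f (cis t))) / (8 * pi)"
  have \<eta>: "\<eta> > 0" using m by (simp add: \<eta>_def f_def)
  have "continuous_on (sphere 0 1) f" using cf by (rule continuous_on_subset) auto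
  then obtain q where q: "real_polynomial_function q" "\<And>z. z \<in> sphere 0 1 \<Longrightarrow> \<bar>f z - q z\<bar> < \<eta>"
    using Stone_Weierstrass_real_polynomial_function[of "sphere 0 (1::real)" f \<eta>] \<eta> by (metis compact_sphere)
  obtain p0 where p0: "\<And>z. cmod z = 1 \<Longrightarrow> q z = Re (poly p0 z)" using real_polynomial_on_circle[OF q(1)] by blast
  define p where "p = p0 + [:of_real \<eta>:]"
  have p: "f z \<le> Re (poly p z)" "Re (poly p z) \<le> f z + 2 * \<eta>" if "cmod z = 1" for z
    using q(2)[of z] p0[OF that] that by (auto simp: p_def abs_less_iff)
  have "2 * pi * Re (poly p 0) \<le> integral {0..2 * pi} (\<lambda>t. f (cis t) + 2 * \<eta>)"
  proof (rule has_integral_le[OF circle_mean_poly integrable_integral])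
    have "continuous_on {0..2 * pi} (\<lambda>t. f (cis t))"
      by (intro continuous_on_compose2[OF cf] continuous_intros) auto
    then show "(\<lambda>t. f (cis t) + 2 * \<eta>) integrable_on {0..2 * pi}"
      by (intro integrable_continuous_real continuous_intros)
  qed (use p in auto)
  also have "\<dots> = integral {0..2 * pi} (\<lambda>t. f (cis t)) + 4 * pi * \<eta>"
  proof -
    have "continuous_on {0..2 * pi} (\<lambda>t. f (cis t))"
      by (intro continuous_on_compose2[OF cf] continuous_intros) auto
    then show ?thesis by (subst integral_add) (auto intro!: integrable_continuous_real)
  qed
  also have "\<dots> < 2 * pi * ln (g 0)" using \<eta> by (simp add: \<eta>_def field_simps)
  finally have p0g: "Re (poly p 0) < ln (g 0)" by simp
  \<comment> \<open>With half of the remaining gap, \<open>G 0 = exp (2 * \<epsilon>)\<close> still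
    exceeds the bound \<open>exp \<epsilon>\<close> for \<open>G\<close> on the circle.\<close>
  define \<epsilon> where "\<epsilon> = (ln (g 0) - Re (poly p 0)) / 2"
  have \<epsilon>: "\<epsilon> > 0" using p0g by (simp add: \<epsilon>_def)
  define G where "G z = g z * exp (\<epsilon> * (cmod z)\<^sup>2 - Re (poly p z))" for z
  have "continuous_on (cball 0 1) G" unfolding G_def by (intro continuous_intros g(1))
  then obtain z0 where z0: "z0 \<in> cball 0 1" "\<And>z. z \<in> cball 0 1 \<Longrightarrow> G z \<le> G z0"
    using continuous_attains_sup[of "cball 0 (1::real)" G] by auto
  have G0: "G 0 > exp \<epsilon>"
  proof -
    have "exp \<epsilon> < exp (ln (g 0) - Re (poly p 0))" using \<epsilon> by (simp add: \<epsilon>_def)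
    then show ?thesis using g0 by (simp add: G_def exp_diff exp_minus divide_inverse)
  qed
  have "cmod z0 < 1"
  proof (rule ccontr)
    assume "\<not> cmod z0 < 1"
    then have n1: "cmod z0 = 1" using z0(1) by simp
    have "g z0 \<le> exp (f z0)" using mp[of z0] by (simp add: f_def)
    also have "\<dots> \<le> exp (Re (poly p z0))" using p(1)[OF n1] by simp
    finally have "g z0 * exp (- Re (poly p z0)) \<le> 1" by (simp add: exp_minus field_simps)
    then have "G z0 \<le> exp \<epsilon>" using n1 by (simp add: G_def exp_diff exp_minus field_simps)
    then show False using G0 z0(2)[of 0] by simp
  qed
  moreover have "g z0 > 0"
  proof -
    have "G z0 > 0" using G0 z0(2)[of 0] by (metis exp_gt_zero less_trans less_le_trans centre_in_cball zero_le_one)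
    then show ?thesis by (simp add: G_def zero_less_mult_iff)
  qed
  \<comment> \<open>The difference of \<open>|z|^2\<close> and \<open>|z0|^2\<close> is
    \<open>|z - z0|^2\<close> plus the real part of a polynomial of degree 1; the linear coefficient
    added to \<open>p\<close> absorbs the latter.\<close>
  moreover have "g z \<le> g z0 * exp (Re (poly (p + [:0, - (2 * of_real \<epsilon> * cnj z0):]) z)
      - Re (poly (p + [:0, - (2 * of_real \<epsilon> * cnj z0):]) z0) - \<epsilon> * (cmod (z - z0))\<^sup>2)" if "cmod z \<le> 1" for z
  proof -
    have "G z \<le> G z0" using z0(2)[of z] that by simp
    then have "G z * exp (- (\<epsilon> * (cmod z)\<^sup>2 - Re (poly p z))) \<le> G z0 * exp (- (\<epsilon> * (cmod z)\<^sup>2 - Re (poly p z)))"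
      by (intro mult_right_mono) auto
    moreover have "g z = G z * exp (- (\<epsilon> * (cmod z)\<^sup>2 - Re (poly p z)))"
      unfolding G_def mult.assoc exp_add[symmetric] by simp
    ultimately have "g z \<le> g z0 * exp (\<epsilon> * (cmod z0)\<^sup>2 - Re (poly p z0)) * exp (- (\<epsilon> * (cmod z)\<^sup>2 - Re (poly p z)))"
      unfolding G_def[of z0, symmetric] by linarith
    also have "\<dots> = g z0 * exp ((\<epsilon> * (cmod z0)\<^sup>2 - Re (poly p z0)) + - (\<epsilon> * (cmod z)\<^sup>2 - Re (poly p z)))"
      by (simp only: mult.assoc exp_add)
    also have "(\<epsilon> * (cmod z0)\<^sup>2 - Re (poly p z0)) + - (\<epsilon> * (cmod z)\<^sup>2 - Re (poly p z)) =
       Re (poly (p + [:0, - (2 * of_real \<epsilon> * cnj z0):]) z) - Re (poly (p + [:0, - (2 * of_real \<epsilon> * cnj z0):]) z0) - \<epsilon> * (cmod (z - z0))\<^sup>2"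
      by (simp only: cmod_power2) (simp add: power2_eq_square algebra_simps)
    finally show ?thesis .
  qed
  ultimately show ?thesis using \<epsilon> that by blast
qed

section \<open>Thin boxes around a complex line\<close>

definition vbox :: "'n \<Rightarrow> real \<Rightarrow> real \<Rightarrow> (complex^'n::finite) set" where
  "vbox j R \<delta> = {z. \<bar>Re (z $ j)\<bar> < R \<and> \<bar>Im (z $ j)\<bar> < R \<and>
     (\<forall>k. k \<noteq> j \<longrightarrow> \<bar>Re (z $ k)\<bar> < \<delta> \<and> \<bar>Im (z $ k)\<bar> < \<delta>)}"

text \<open>The box without a bound on the coordinate \<open>j\<close>: over it, the integral of a
  function of \<open>z $ j\<close> is exactly a multiple of the integral over the plane.\<close>

definition slab :: "'n \<Rightarrow> real \<Rightarrow> (complex^'n::finite) set" where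
  "slab j \<delta> = {z. \<forall>k. k \<noteq> j \<longrightarrow> \<bar>Re (z $ k)\<bar> < \<delta> \<and> \<bar>Im (z $ k)\<bar> < \<delta>}"

lemma open_slab: "open (slab j \<delta>)"
proof -
  have "slab j \<delta> = (\<Inter>k\<in>UNIV - {j}. {z. \<bar>Re (z $ k)\<bar> < \<delta>} \<inter> {z. \<bar>Im (z $ k)\<bar> < \<delta>})"
    by (auto simp: slab_def)
  then show ?thesis
    by (auto intro!: open_INT open_Int open_Collect_less continuous_intros)
qed

lemma vbox_slab: "vbox j R \<delta> = slab j \<delta> \<inter> {z. \<bar>Re (z $ j)\<bar> < R} \<inter> {z. \<bar>Im (z $ j)\<bar> < R}"
  by (auto simp: vbox_def slab_def)

lemma open_vbox: "open (vbox j R \<delta>)"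
  unfolding vbox_slab by (intro open_Int open_slab open_Collect_less continuous_intros)

lemma vbox_lebesgue: "vbox j R \<delta> \<in> sets lebesgue"
  by (rule sets_completionI_sets) (simp add: borel_open open_vbox)

lemma vbox_mono: "\<delta> \<le> \<delta>' \<Longrightarrow> vbox j R \<delta> \<subseteq> vbox j R \<delta>'"
  by (force simp: vbox_def)

lemma prod_Basis_vec:
  "(\<Prod>b\<in>Basis. inner (x :: complex^'n) b) = (\<Prod>k\<in>UNIV. Re (x $ k) * Im (x $ k))"
proof -
  have B: "Basis = (\<lambda>(k::'n, u::complex). axis k u) ` (UNIV \<times> Basis)" by (auto simp: Basis_vec_def)
  have inj: "inj_on (\<lambda>(k::'n, u::complex). axis k u) (UNIV \<times> Basis)"
    by (auto simp: inj_on_def axis_eq_axis)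
  have "(\<Prod>b\<in>Basis. inner x b) = (\<Prod>(k, u)\<in>UNIV \<times> Basis. inner (x $ k) u)"
    unfolding B by (subst prod.reindex[OF inj]) (auto simp: inner_axis intro!: prod.cong)
  also have "\<dots> = (\<Prod>k\<in>UNIV. \<Prod>u\<in>Basis. inner (x $ k) u)" by (rule prod.cartesian_product[symmetric])
  finally show ?thesis by (simp add: Basis_complex_def inner_complex_def)
qed

text \<open>A form of Fubini that does not identify the space with a product: the scaled image of
  Lebesgue measure on the slab under \<open>z $ j\<close> agrees with Lebesgue measure on boxes and
  hence everywhere.\<close>

lemma nn_integral_slab:
  fixes j :: "'n::finite"
  assumes \<delta>: "\<delta> > 0" and g: "g \<in> borel_measurable borel"
  shows "(\<integral>\<^sup>+z. g (z $ j) * indicator (slab j \<delta>) z \<partial>lborel) =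
    ennreal ((2 * \<delta>) ^ (2 * (CARD('n) - 1))) * (\<integral>\<^sup>+\<zeta>. g \<zeta> \<partial>lborel)"
proof -
  define V where "V = (2 * \<delta>) ^ (2 * (CARD('n) - 1))"
  have V: "V > 0" using \<delta> by (simp add: V_def)
  have meas: "(\<lambda>z :: complex^'n. z $ j) \<in> borel_measurable borel"
    by (intro borel_measurable_continuous_onI continuous_intros)
  have sl: "slab j \<delta> \<in> sets borel" by (rule borel_open[OF open_slab])
  define M where "M = scale_measure (ennreal (1 / V)) (distr (restrict_space lborel (slab j \<delta>)) borel (\<lambda>z. z $ j))"
  have meas': "(\<lambda>z. z $ j) \<in> measurable (restrict_space lborel (slab j \<delta>)) borel"
    using meas by (intro measurable_restrict_space1) simp
  have "lborel = M"
  proof (rule lborel_eqI)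
    show "sets M = sets borel" by (simp add: M_def)
    fix l u :: complex assume lu: "\<And>b. b \<in> Basis \<Longrightarrow> l \<bullet> b \<le> u \<bullet> b"
    then have lu': "Re l \<le> Re u" "Im l \<le> Im u" using lu[of 1] lu[of \<i>] by (auto simp: Basis_complex_def inner_complex_def)
    define L U where "L = (\<chi> k. if k = j then l else Complex (- \<delta>) (- \<delta>))" and "U = (\<chi> k. if k = j then u else Complex \<delta> \<delta>)"
    have eq: "(\<lambda>z. z $ j) -` box l u \<inter> slab j \<delta> = box L U"
    proof (intro set_eqI)
      fix z :: "complex^'n"
      have "z \<in> box L U \<longleftrightarrow> (\<forall>k. z $ k \<in> box (L $ k) (U $ k))"
        by (auto simp: mem_box Basis_vec_def inner_axis)
      also have "\<dots> \<longleftrightarrow> z \<in> (\<lambda>z. z $ j) -` box l u \<inter> slab j \<delta>"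
        by (auto simp: L_def U_def slab_def in_box_complex_iff split: if_splits) (metis abs_less_iff minus_less_iff)+
      finally show "z \<in> (\<lambda>z. z $ j) -` box l u \<inter> slab j \<delta> \<longleftrightarrow> z \<in> box L U" by simp
    qed
    have sub: "box L U \<subseteq> slab j \<delta>" using eq by auto
    have "emeasure M (box l u) = ennreal (1 / V) * emeasure lborel (box L U)"
      unfolding M_def using sl meas'
      by (simp add: emeasure_scale_measure emeasure_distr emeasure_restrict_space eq sub)
    also have "emeasure lborel (box L U) = ennreal (\<Prod>b\<in>Basis. (U - L) \<bullet> b)"
    proof (rule emeasure_lborel_box)
      fix b :: "complex^'n" assume "b \<in> Basis"
      then show "L \<bullet> b \<le> U \<bullet> b" using lu' \<delta>
        by (auto simp: Basis_vec_def inner_axis L_def U_def Basis_complex_def inner_complex_def split: if_splits)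
    qed
    also have "(\<Prod>b\<in>Basis. (U - L) \<bullet> b) = (\<Prod>k\<in>UNIV. Re ((U - L) $ k) * Im ((U - L) $ k))"
      by (rule prod_Basis_vec)
    also have "\<dots> = (Re (u - l) * Im (u - l)) * (\<Prod>k\<in>UNIV - {j}. (2 * \<delta>) * (2 * \<delta>))"
      by (subst prod.remove[of UNIV j]) (auto simp: L_def U_def intro!: prod.cong)
    also have "(\<Prod>k\<in>UNIV - {j}. (2 * \<delta>) * (2 * \<delta>)) = V"
      by (simp add: V_def power_mult card_Diff_singleton power2_eq_square)
    also have "ennreal (1 / V) * ennreal (Re (u - l) * Im (u - l) * V) = ennreal (Re (u - l) * Im (u - l))"
      using V lu' by (subst ennreal_mult[symmetric]) auto
    also have "Re (u - l) * Im (u - l) = (\<Prod>b\<in>Basis. (u - l) \<bullet> b)"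
      by (simp add: Basis_complex_def inner_complex_def)
    finally show "emeasure M (box l u) = ennreal (\<Prod>b\<in>Basis. (u - l) \<bullet> b)" .
  qed
  then have "(\<integral>\<^sup>+\<zeta>. g \<zeta> \<partial>lborel) = (\<integral>\<^sup>+\<zeta>. g \<zeta> \<partial>M)" by simp
  also have "\<dots> = ennreal (1 / V) * (\<integral>\<^sup>+z. g (z $ j) * indicator (slab j \<delta>) z \<partial>lborel)"
    unfolding M_def using g meas' sl
    by (simp add: nn_integral_scale_measure nn_integral_distr nn_integral_restrict_space)
  finally have "ennreal V * (\<integral>\<^sup>+\<zeta>. g \<zeta> \<partial>lborel) = (ennreal V * ennreal (1 / V)) * (\<integral>\<^sup>+z. g (z $ j) * indicator (slab j \<delta>) z \<partial>lborel)"
    by (simp add: mult.assoc)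
  also have "ennreal V * ennreal (1 / V) = 1" using V by (simp flip: ennreal_mult)
  finally show ?thesis by (simp add: V_def)
qed

lemma nn_integral_vbox_le:
  fixes j :: "'n::finite"
  assumes \<delta>: "\<delta> > 0" and g: "g \<in> borel_measurable borel" and le: "\<And>z. z \<in> vbox j R \<delta> \<Longrightarrow> f z \<le> g (z $ j)"
  shows "(\<integral>\<^sup>+z. f z \<partial>lebesgue_on (vbox j R \<delta>)) \<le> ennreal ((2 * \<delta>) ^ (2 * (CARD('n) - 1))) * (\<integral>\<^sup>+\<zeta>. g \<zeta> \<partial>lborel)"
proof -
  have vb: "vbox j R \<delta> \<in> sets lebesgue" by (rule vbox_lebesgue)
  have m: "(\<lambda>z :: complex^'n. g (z $ j) * indicator (slab j \<delta>) z) \<in> borel_measurable lborel"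
  proof -
    have "(\<lambda>z :: complex^'n. z $ j) \<in> borel_measurable borel"
      by (intro borel_measurable_continuous_onI continuous_intros)
    note [measurable] = measurable_compose[OF this g] borel_open[OF open_slab[of j \<delta>]]
    show ?thesis by measurable
  qed
  have "(\<integral>\<^sup>+z. f z \<partial>lebesgue_on (vbox j R \<delta>)) = (\<integral>\<^sup>+z. f z * indicator (vbox j R \<delta>) z \<partial>lebesgue)"
    using vb by (simp add: nn_integral_restrict_space)
  also have "\<dots> \<le> (\<integral>\<^sup>+z. g (z $ j) * indicator (slab j \<delta>) z \<partial>lebesgue)"
    using le by (intro nn_integral_mono) (auto simp: indicator_def vbox_slab)
  also have "\<dots> = (\<integral>\<^sup>+z. g (z $ j) * indicator (slab j \<delta>) z \<partial>lborel)"
    by (rule nn_integral_completion)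
  finally show ?thesis using nn_integral_slab[OF \<delta> g, of j] by simp
qed

text \<open>The lower bound uses only the inner slab of width \<open>\<delta>\<close>, where a
  transversal cutoff supported in the larger box can be identically 1.\<close>

lemma nn_integral_vbox_ge:
  fixes j :: "'n::finite"
  assumes \<delta>: "\<delta> > 0" "\<delta> \<le> \<delta>'" and g: "g \<in> borel_measurable borel"
    and le: "\<And>z. z \<in> slab j \<delta> \<Longrightarrow> z \<in> vbox j R \<delta>' \<Longrightarrow> g (z $ j) \<le> f z"
    and z: "\<And>\<zeta>. \<not> (\<bar>Re \<zeta>\<bar> < R \<and> \<bar>Im \<zeta>\<bar> < R) \<Longrightarrow> g \<zeta> = 0"
  shows "ennreal ((2 * \<delta>) ^ (2 * (CARD('n) - 1))) * (\<integral>\<^sup>+\<zeta>. g \<zeta> \<partial>lborel) \<le> (\<integral>\<^sup>+z. f z \<partial>lebesgue_on (vbox j R \<delta>'))"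
proof -
  have vb: "vbox j R \<delta>' \<in> sets lebesgue" by (rule vbox_lebesgue)
  have "ennreal ((2 * \<delta>) ^ (2 * (CARD('n) - 1))) * (\<integral>\<^sup>+\<zeta>. g \<zeta> \<partial>lborel) = (\<integral>\<^sup>+z. g (z $ j) * indicator (slab j \<delta>) z \<partial>lborel)"
    by (rule nn_integral_slab[OF \<delta>(1) g, symmetric])
  also have "\<dots> = (\<integral>\<^sup>+z. g (z $ j) * indicator (slab j \<delta>) z \<partial>lebesgue)"
    by (rule nn_integral_completion[symmetric])
  also have "\<dots> \<le> (\<integral>\<^sup>+z. f z * indicator (vbox j R \<delta>') z \<partial>lebesgue)"
  proof (intro nn_integral_mono)
    fix z :: "complex^'n"
    have "z \<in> vbox j R \<delta>'" if "z \<in> slab j \<delta>" "\<bar>Re (z $ j)\<bar> < R \<and> \<bar>Im (z $ j)\<bar> < R"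
      using that \<delta> by (force simp: vbox_def slab_def)
    then show "g (z $ j) * indicator (slab j \<delta>) z \<le> f z * indicator (vbox j R \<delta>') z"
      using le[of z] z[of "z $ j"] by (auto simp: indicator_def)
  qed
  also have "\<dots> = (\<integral>\<^sup>+z. f z \<partial>lebesgue_on (vbox j R \<delta>'))"
    using vb by (simp add: nn_integral_restrict_space)
  finally show ?thesis .
qed

section \<open>Weak derivatives, the closed test form and a single component of the dbar
  equation\<close>

lemma compact_support_integral:
  fixes f :: "'a::euclidean_space \<Rightarrow> 'b::euclidean_space"
  assumes f: "continuous_on UNIV f" and K: "compact K" "K \<subseteq> D" "\<And>z. z \<notin> K \<Longrightarrow> f z = 0" and D: "D \<in> sets lebesgue"
  shows "integrable lborel f" "integrable (lebesgue_on D) f" "integral\<^sup>L (lebesgue_on D) f = integral\<^sup>L lborel f"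
proof -
  have "integrable lborel (\<lambda>x. indicator K x *\<^sub>R f x)"
    by (rule borel_integrable_compact[OF K(1)]) (use f continuous_on_subset in blast)
  moreover have "(\<lambda>x. indicator K x *\<^sub>R f x) = f" using K(3) by (auto simp: indicator_def fun_eq_iff)
  ultimately show i: "integrable lborel f" by simp
  have m: "f \<in> borel_measurable lborel" using f by (simp add: borel_measurable_continuous_onI)
  have e: "(\<lambda>x. indicator D x *\<^sub>R f x) = f" using K by (auto simp: indicator_def fun_eq_iff)
  have il: "integrable lebesgue f" using i m by (simp add: integrable_completion)
  show "integrable (lebesgue_on D) f" using il D by (simp add: integrable_restrict_space e)
  show "integral\<^sup>L (lebesgue_on D) f = integral\<^sup>L lborel f"
    using D m by (simp add: integral_restrict_space e integral_completion)
qed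

lemma smooth_differentiable:
  assumes "smooth_on UNIV \<eta>"
  shows "(\<eta> has_derivative frechet_derivative \<eta> (at z)) (at z)"
    and "continuous_on UNIV (\<lambda>z. frechet_derivative \<eta> (at z) v)" and "continuous_on UNIV \<eta>"
proof -
  have "Ck_on (Suc 0) UNIV \<eta>" using assms by (simp add: smooth_on_def)
  then show "(\<eta> has_derivative frechet_derivative \<eta> (at z)) (at z)"
    "continuous_on UNIV (\<lambda>z. frechet_derivative \<eta> (at z) v)"
    by (auto simp: frechet_derivative_works)
  have "Ck_on 0 UNIV \<eta>" using assms by (simp only: smooth_on_def)
  then show "continuous_on UNIV \<eta>" by simp
qed

text \<open>A derivative along \<open>u\<close> integrates to zero against a function that is constant along \<open>u\<close>:
  pass to the limit in the difference quotients, whose integrals vanish by translation invariance.\<close>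

lemma integral_derivative_transversal:
  fixes \<eta> :: "complex^'n::finite \<Rightarrow> complex" and F :: "complex \<Rightarrow> complex^'r"
  assumes \<eta>: "smooth_on UNIV \<eta>" and K: "compact K" "\<And>z. z \<notin> K \<Longrightarrow> \<eta> z = 0"
    and F: "continuous_on UNIV F" and u: "u $ j = 0"
  shows "(\<integral>z. frechet_derivative \<eta> (at z) u *s F (z $ j) \<partial>lborel) = 0"
proof -
  let ?d = "\<lambda>z. frechet_derivative \<eta> (at z) u"
  note d\<eta> = smooth_differentiable[OF \<eta>]
  define h where "h m = 1 / real (Suc m)" for m
  have h: "h m > 0" "h m \<le> 1" for m by (auto simp: h_def)
  define q where "q m z = (\<eta> (z + h m *\<^sub>R u) - \<eta> z) *s F (z $ j)" for m z
  have cF: "continuous_on UNIV (\<lambda>z :: complex^'n. F (z $ j))"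
    by (intro continuous_on_compose2[OF F] continuous_intros) auto
  have csm: "continuous_on UNIV (\<lambda>z. c z *s G z)" if "continuous_on UNIV c" "continuous_on UNIV G"
    for c :: "complex^'n \<Rightarrow> complex" and G :: "complex^'n \<Rightarrow> complex^'r"
    unfolding vector_scalar_mult_def using that by (intro continuous_intros)
  obtain r where r: "\<And>z. z \<in> K \<Longrightarrow> norm z \<le> r" using compact_imp_bounded[OF K(1)] by (auto simp: bounded_iff)
  \<comment> \<open>Enlarged by \<open>norm u\<close> so that all translates of
    \<open>\<eta>\<close> by \<open>s *\<^sub>R u\<close> with \<open>0 \<le> s \<le> 1\<close>
    vanish outside \<open>C\<close>; this gives one dominating function for all difference
    quotients.\<close>
  define C where "C = cball (0 :: complex^'n) (r + norm u)"
  have comp: "compact C" by (simp add: C_def)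
  have out: "\<eta> (z + s *\<^sub>R u) = 0" if "z \<notin> C" "0 \<le> s" "s \<le> 1" for z s
  proof (rule K(2), rule notI)
    assume "z + s *\<^sub>R u \<in> K"
    then have "norm (z + s *\<^sub>R u) \<le> r" by (rule r)
    moreover have "norm z \<le> norm (z + s *\<^sub>R u) + norm (s *\<^sub>R u)" using norm_triangle_ineq4[of "z + s *\<^sub>R u" "s *\<^sub>R u"] by simp
    moreover have "norm (s *\<^sub>R u) \<le> norm u" using that by (simp add: mult_left_le_one_le)
    ultimately show False using that by (simp add: C_def)
  qed
  have d0: "?d z = 0" if "z \<notin> K" for z
  proof -
    have "open (- K)" using K(1) by (simp add: compact_imp_closed open_Compl)
    then have "(\<eta> has_derivative (\<lambda>_. 0)) (at z)"
      using has_derivative_transform_within_open[OF has_derivative_const, of "- K" z 0 \<eta> UNIV] K(2) that by auto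
    then show ?thesis using frechet_derivative_at by metis
  qed
  obtain D where D: "\<And>z. cmod (?d z) \<le> D" and D0: "D \<ge> 0"
  proof -
    have "compact (?d ` K)" by (rule compact_continuous_image[OF _ K(1)]) (use d\<eta>(2) continuous_on_subset in blast)
    then obtain D where "\<And>z. z \<in> K \<Longrightarrow> cmod (?d z) \<le> D" using compact_imp_bounded by (fastforce simp: bounded_iff)
    then have "cmod (?d z) \<le> max D 0" for z using d0[of z] by (cases "z \<in> K") fastforce+
    then show ?thesis by (intro that[of "max D 0"]) auto
  qed
  obtain E where E: "\<And>z. z \<in> C \<Longrightarrow> norm (F (z $ j)) \<le> E"
  proof -
    have "compact ((\<lambda>z. F (z $ j)) ` C)" by (rule compact_continuous_image[OF _ comp]) (use cF continuous_on_subset in blast)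
    then show ?thesis using that compact_imp_bounded by (fastforce simp: bounded_iff)
  qed
  have lip: "cmod (\<eta> (z + s *\<^sub>R u) - \<eta> z) \<le> D * s" if "s > 0" for z s
  proof -
    have "norm (\<eta> (z + s *\<^sub>R u) - \<eta> (z + 0 *\<^sub>R u)) \<le> D * norm (s - 0)"
    proof (rule differentiable_bound[of UNIV "\<lambda>t. \<eta> (z + t *\<^sub>R u)" "\<lambda>t x. x *\<^sub>R ?d (z + t *\<^sub>R u)"])
      fix t :: real
      have "((\<lambda>t. \<eta> (z + t *\<^sub>R u)) has_derivative (\<lambda>x. frechet_derivative \<eta> (at (z + t *\<^sub>R u)) (x *\<^sub>R u))) (at t)"
        by (rule has_derivative_compose[OF _ d\<eta>(1)]) (auto intro!: derivative_eq_intros)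
      then show "((\<lambda>t. \<eta> (z + t *\<^sub>R u)) has_derivative (\<lambda>x. x *\<^sub>R ?d (z + t *\<^sub>R u))) (at t within UNIV)"
        using has_derivative_linear[OF d\<eta>(1)] by (simp add: linear_scale)
      show "onorm (\<lambda>x. x *\<^sub>R ?d (z + t *\<^sub>R u)) \<le> D"
      proof (rule onorm_bound[OF D0])
        fix x show "norm (x *\<^sub>R ?d (z + t *\<^sub>R u)) \<le> D * norm x"
          using mult_right_mono[OF D[of "z + t *\<^sub>R u"], of "\<bar>x\<bar>"] by (simp add: mult.commute)
      qed
    qed auto
    then show ?thesis using that by simp
  qed
  have lim: "(\<lambda>m. integral\<^sup>L lborel (\<lambda>z. (1 / h m) *\<^sub>R q m z)) \<longlonglongrightarrow> integral\<^sup>L lborel (\<lambda>z. ?d z *s F (z $ j))"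
  proof (rule integral_dominated_convergence[where w = "\<lambda>z. indicator C z *\<^sub>R (D * E)"])
    show "(\<lambda>z. ?d z *s F (z $ j)) \<in> borel_measurable lborel"
      using csm[OF d\<eta>(2) cF] by (simp add: borel_measurable_continuous_onI)
    have cq: "continuous_on UNIV (q m)" for m unfolding q_def
      by (intro csm cF continuous_intros continuous_on_compose2[OF d\<eta>(3)]) auto
    show "(\<lambda>z. (1 / h m) *\<^sub>R q m z) \<in> borel_measurable lborel" for m
    proof -
      have "continuous_on UNIV (\<lambda>z. (1 / h m) *\<^sub>R q m z)" by (intro continuous_intros cq)
      then show ?thesis by (simp add: borel_measurable_continuous_onI)
    qed
    show "integrable lborel (\<lambda>z. indicator C z *\<^sub>R (D * E))"
      by (rule borel_integrable_compact[OF comp]) simp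
    show "AE z in lborel. (\<lambda>m. (1 / h m) *\<^sub>R q m z) \<longlonglongrightarrow> ?d z *s F (z $ j)"
    proof (rule AE_I2)
      fix z
      have "((\<lambda>t. \<eta> (z + t *\<^sub>R u)) has_vector_derivative ?d z) (at 0)"
      proof -
        have "((\<lambda>t. \<eta> (z + t *\<^sub>R u)) has_derivative (\<lambda>x. frechet_derivative \<eta> (at (z + 0 *\<^sub>R u)) (x *\<^sub>R u))) (at 0)"
          by (rule has_derivative_compose[OF _ d\<eta>(1)]) (auto intro!: derivative_eq_intros)
        then show ?thesis using has_derivative_linear[OF d\<eta>(1)] by (simp add: has_vector_derivative_def linear_scale)
      qed
      then have "((\<lambda>t. norm (\<eta> (z + t *\<^sub>R u) - \<eta> z - t *\<^sub>R ?d z) / norm t) \<longlongrightarrow> 0) (at 0)"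
        unfolding has_vector_derivative_def has_derivative_at by simp
      then have "((\<lambda>t. norm ((\<eta> (z + t *\<^sub>R u) - \<eta> z) /\<^sub>R t - ?d z)) \<longlongrightarrow> 0) (at 0)"
      proof (rule Lim_transform_eventually)
        show "\<forall>\<^sub>F t in at 0. norm (\<eta> (z + t *\<^sub>R u) - \<eta> z - t *\<^sub>R ?d z) / norm t =
            norm ((\<eta> (z + t *\<^sub>R u) - \<eta> z) /\<^sub>R t - ?d z)"
          unfolding eventually_at_filter
        proof (intro always_eventually allI impI)
          fix t :: real assume t: "t \<noteq> 0"
          have "(\<eta> (z + t *\<^sub>R u) - \<eta> z) /\<^sub>R t - ?d z = (\<eta> (z + t *\<^sub>R u) - \<eta> z - t *\<^sub>R ?d z) /\<^sub>R t"
            using t by (simp add: scaleR_diff_right)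
          then show "norm (\<eta> (z + t *\<^sub>R u) - \<eta> z - t *\<^sub>R ?d z) / norm t =
            norm ((\<eta> (z + t *\<^sub>R u) - \<eta> z) /\<^sub>R t - ?d z)" by (simp add: divide_inverse mult.commute)
        qed
      qed
      then have "((\<lambda>t. (\<eta> (z + t *\<^sub>R u) - \<eta> z) /\<^sub>R t) \<longlongrightarrow> ?d z) (at 0)"
        by (rule LIM_zero_cancel[OF tendsto_norm_zero_cancel])
      moreover have "filterlim h (at 0) sequentially"
        unfolding filterlim_at
      proof
        show "h \<longlonglongrightarrow> 0" unfolding h_def[abs_def] using LIMSEQ_inverse_real_of_nat by (simp add: inverse_eq_divide)
        show "\<forall>\<^sub>F m in sequentially. h m \<in> UNIV \<and> h m \<noteq> 0"
          using h(1) by (intro always_eventually) (auto simp: less_imp_neq[symmetric])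
      qed
      ultimately have "(\<lambda>m. (\<eta> (z + h m *\<^sub>R u) - \<eta> z) /\<^sub>R h m) \<longlonglongrightarrow> ?d z" by (rule filterlim_compose)
      then have "(\<lambda>m. ((\<eta> (z + h m *\<^sub>R u) - \<eta> z) /\<^sub>R h m) *s F (z $ j)) \<longlonglongrightarrow> ?d z *s F (z $ j)"
        unfolding vector_scalar_mult_def by (intro tendsto_intros)
      moreover have "((\<eta> (z + h m *\<^sub>R u) - \<eta> z) /\<^sub>R h m) *s F (z $ j) = (1 / h m) *\<^sub>R q m z" for m
        by (simp only: q_def vec_eq_iff vector_scaleR_component vector_smult_component) (simp add: inverse_eq_divide)
      ultimately show "(\<lambda>m. (1 / h m) *\<^sub>R q m z) \<longlonglongrightarrow> ?d z *s F (z $ j)" by simp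
    qed
    fix m
    show "AE z in lborel. norm ((1 / h m) *\<^sub>R q m z) \<le> indicator C z *\<^sub>R (D * E)"
    proof (rule AE_I2)
      fix z
      show "norm ((1 / h m) *\<^sub>R q m z) \<le> indicator C z *\<^sub>R (D * E)"
      proof (cases "z \<in> C")
        case True
        have "norm (q m z) \<le> (D * h m) * E" unfolding q_def norm_smult_vec
          using lip[OF h(1), of z] E[OF True] D0 h(1)[of m] by (intro mult_mono) auto
        then show ?thesis using True h(1)[of m] by (simp add: field_simps)
      next
        case False
        then show ?thesis using out[of z "h m"] out[of z 0] h[of m] by (simp add: q_def)
      qed
    qed
  qed
  have "integral\<^sup>L lborel (q m) = 0" for m
  proof -
    have c1: "continuous_on UNIV (\<lambda>z. \<eta> z *s F (z $ j))" by (intro csm cF d\<eta>)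
    have i1: "integrable lborel (\<lambda>z. \<eta> z *s F (z $ j))"
      by (rule compact_support_integral(1)[OF c1 K(1) order.refl]) (use K in \<open>auto simp: compact_imp_closed\<close>)
    have c2: "continuous_on UNIV (\<lambda>z. \<eta> (z + h m *\<^sub>R u) *s F (z $ j))"
      by (intro csm cF continuous_intros continuous_on_compose2[OF d\<eta>(3)]) auto
    have i2: "integrable lborel (\<lambda>z. \<eta> (z + h m *\<^sub>R u) *s F (z $ j))"
      by (rule compact_support_integral(1)[OF c2 comp order.refl])
        (use out[of _ "h m"] h[of m] comp in \<open>auto simp: compact_imp_closed\<close>)
    have "integral\<^sup>L lborel (\<lambda>z. \<eta> z *s F (z $ j)) = integral\<^sup>L (distr lborel borel ((+) (h m *\<^sub>R u))) (\<lambda>z. \<eta> z *s F (z $ j))"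
      by (simp add: lborel_distr_plus)
    also have "\<dots> = integral\<^sup>L lborel (\<lambda>z. \<eta> (h m *\<^sub>R u + z) *s F ((h m *\<^sub>R u + z) $ j))"
      using c1 by (subst integral_distr) (auto simp: borel_measurable_continuous_onI)
    \<comment> \<open>Since \<open>u $ j = 0\<close>, the translation does not move the argument of
      \<open>F\<close>, and the two integrals that form \<open>q m\<close> agree.\<close>
    also have "\<dots> = integral\<^sup>L lborel (\<lambda>z. \<eta> (z + h m *\<^sub>R u) *s F (z $ j))"
      using u by (simp add: add.commute)
    finally show ?thesis using i1 i2
      unfolding q_def by (simp add: vec.scale_left_diff_distrib)
  qed
  then have "integral\<^sup>L lborel (\<lambda>z. (1 / h m) *\<^sub>R q m z) = 0" for m by simp
  then have "(\<lambda>m. integral\<^sup>L lborel (\<lambda>z. (1 / h m) *\<^sub>R q m z)) \<longlonglongrightarrow> 0"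
    by (simp only: tendsto_const)
  from LIMSEQ_unique[OF lim this] show ?thesis .
qed

lemma hermitian_ip_expand:
  assumes "hermitian_ip h"
  shows "h x y = (\<Sum>a\<in>UNIV. \<Sum>b\<in>UNIV. x $ a * cnj (y $ b) * h (axis a 1) (axis b 1))"
proof -
  have "h x y = h (\<Sum>a\<in>UNIV. x $ a *s axis a 1) (\<Sum>b\<in>UNIV. y $ b *s axis b 1)"
    by (simp only: basis_expansion)
  then show ?thesis
    by (simp add: hermitian_ip_sum[OF assms] hermitian_ip_simps(2,6)[OF assms] sum_distrib_left mult_ac)
      (rule sum.swap)
qed

lemma hermitian_ip_CS:
  assumes h: "hermitian_ip h"
  shows "(cmod (h x y))\<^sup>2 \<le> Re (h x x) * Re (h y y)"
proof (cases "y = 0")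
  case False
  define d where "d = Re (h y y)"
  have d: "d > 0" using hermitian_ip_simps(14,15)[OF h, of y] False by (simp add: d_def less_le)
  have hyy: "h y y = of_real d" using hermitian_ip_simps(13)[OF h, of y] by (simp add: d_def complex_eq_iff)
  have hyx: "h y x = cnj (h x y)" using h unfolding hermitian_ip_def by blast
  define c where "c = h x y / of_real d"
  have "0 \<le> Re (h (x - c *s y) (x - c *s y))" by (rule hermitian_ip_simps(14)[OF h])
  also have "h (x - c *s y) (x - c *s y) = h x x - cnj c * h x y - c * cnj (h x y) + c * cnj c * of_real d"
    by (simp add: hermitian_ip_simps(9,10,2,6)[OF h] hyy hyx algebra_simps)
  also have "\<dots> = h x x - of_real ((cmod (h x y))\<^sup>2) / of_real d"
    unfolding complex_norm_square using d by (simp add: c_def field_simps)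
  finally have "(cmod (h x y))\<^sup>2 / d \<le> Re (h x x)" by (simp add: Re_divide_of_real)
  then show ?thesis using d by (simp add: d_def[symmetric] field_simps)
qed (simp add: hermitian_ip_simps[OF h])

lemma dbar_dir_conj_linear:
  assumes "(\<eta> has_derivative frechet_derivative \<eta> (at z)) (at z)"
  shows "dbar_dir (\<i> *s x) \<eta> z = - \<i> * dbar_dir x \<eta> z"
    and "dbar_dir x \<eta> z = (\<Sum>k\<in>UNIV. cnj (x $ k) * dbar_dir (axis k 1) \<eta> z)"
proof -
  define L where "L = frechet_derivative \<eta> (at z)"
  have L: "linear L" unfolding L_def by (rule has_derivative_linear[OF assms])
  define T where "T x = (L x + \<i> * L (\<i> *s x)) / 2" for x
  have T: "dbar_dir x \<eta> z = T x" for x by (simp add: dbar_dir_def T_def L_def)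
  have ii: "\<i> *s (\<i> *s x) = - x" for x :: "complex^'a" by (simp add: vec_eq_iff flip: mult.assoc)
  have Ti: "T (\<i> *s x) = - \<i> * T x" for x
    by (simp add: T_def ii linear_neg[OF L] field_simps)
  have lT: "linear T"
  proof -
    have "linear (\<lambda>x. L (\<i> *s x))"
      using linear_compose[OF linear_vector_smult[OF linear_ident[unfolded id_def], of \<i>] L] by (simp add: o_def)
    then have "linear (\<lambda>x. (1 / 2) * (L x + \<i> * L (\<i> *s x)))"
      by (intro linear_mult_left linear_compose_add L)
    then show ?thesis by (simp add: T_def[abs_def])
  qed
  have Tc: "T (c *s x) = cnj c * T x" for c x
  proof -
    have "c *s x = Re c *\<^sub>R x + Im c *\<^sub>R (\<i> *s x)"
      by (simp add: vec_eq_iff complex_eq_iff)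
    then have "T (c *s x) = Re c *\<^sub>R T x + Im c *\<^sub>R T (\<i> *s x)"
      by (simp only: linear_add[OF lT] linear_scale[OF lT])
    then show ?thesis unfolding Ti by (simp add: complex_eq_iff)
  qed
  show "dbar_dir (\<i> *s x) \<eta> z = - \<i> * dbar_dir x \<eta> z" by (simp only: T Ti)
  have "T x = T (\<Sum>k\<in>UNIV. x $ k *s axis k 1)" by (simp only: basis_expansion)
  also have "\<dots> = (\<Sum>k\<in>UNIV. cnj (x $ k) * T (axis k 1))" by (simp add: linear_sum[OF lT] Tc)
  finally show "dbar_dir x \<eta> z = (\<Sum>k\<in>UNIV. cnj (x $ k) * dbar_dir (axis k 1) \<eta> z)" by (simp only: T)
qed

lemma continuous_on_smult_vec:
  assumes "continuous_on S c" "continuous_on S G"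
  shows "continuous_on S (\<lambda>z. c z *s (G z :: complex^'r))"
  unfolding vector_scalar_mult_def using assms by (intro continuous_intros)

text \<open>Formally, dbar of the form is the sum over \<open>k\<close> of dz-bar_k wedge dz-bar_j
  wedge dz with the derivative of \<open>F (z $ j)\<close> along \<open>k\<close>. The term
  \<open>k = j\<close> has a repeated factor, and the others differentiate across the line. As
  \<open>F\<close> is merely continuous, the derivatives are carried by the test function.\<close>

lemma dzbar_closed:
  fixes j :: "'n::finite" and F :: "complex \<Rightarrow> complex^'r"
  assumes b: "bij_betw b {..<CARD('n)} (UNIV :: 'n set)" and F: "continuous_on UNIV F" and D: "D \<in> sets lebesgue"
  shows "weak_dbar D (CARD('n) + 1) (\<lambda>z. dzbar_form b j (F (z $ j))) (\<lambda>_ _. 0)"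
  unfolding weak_dbar_def
proof (intro allI impI)
  fix \<eta> and v :: "nat \<Rightarrow> complex^'n" assume "test_function D \<eta>"
  then obtain K where \<eta>: "smooth_on UNIV \<eta>" and K: "compact K" "K \<subseteq> D" "\<And>z. z \<notin> K \<Longrightarrow> \<eta> z = 0"
    by (auto simp: test_function_def)
  note d\<eta> = smooth_differentiable[OF \<eta>]
  define n where "n = CARD('n)"
  have cF: "continuous_on UNIV (\<lambda>z :: complex^'n. F (z $ j))"
    by (intro continuous_on_compose2[OF F] continuous_intros) auto
  have d0: "frechet_derivative \<eta> (at z) = (\<lambda>_. 0)" if "z \<notin> K" for z
  proof -
    have "open (- K)" using K(1) by (simp add: compact_imp_closed open_Compl)
    then have "(\<eta> has_derivative (\<lambda>_. 0)) (at z)"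
      using has_derivative_transform_within_open[OF has_derivative_const, of "- K" z 0 \<eta> UNIV] K(3) that by auto
    then show ?thesis using frechet_derivative_at by metis
  qed
  have cd: "continuous_on UNIV (\<lambda>z. dbar_dir x \<eta> z *s F (z $ j))" for x
    unfolding dbar_dir_def by (intro continuous_on_smult_vec cF continuous_intros d\<eta>) simp
  have i: "integrable (lebesgue_on D) (\<lambda>z. dbar_dir x \<eta> z *s F (z $ j))" 
      "integral\<^sup>L (lebesgue_on D) (\<lambda>z. dbar_dir x \<eta> z *s F (z $ j)) = integral\<^sup>L lborel (\<lambda>z. dbar_dir x \<eta> z *s F (z $ j))" for x
    by (intro compact_support_integral(2,3)[OF cd K(1,2) _ D], simp add: dbar_dir_def d0)+
  have z0: "integral\<^sup>L lborel (\<lambda>z. dbar_dir (axis k 1) \<eta> z *s F (z $ j)) = 0" if k: "k \<noteq> j" for k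
  proof -
    have c: "continuous_on UNIV (\<lambda>z. frechet_derivative \<eta> (at z) u *s F (z $ j))" for u
      by (intro continuous_on_smult_vec cF d\<eta>)
    have ii: "integrable lborel (\<lambda>z. frechet_derivative \<eta> (at z) u *s F (z $ j))" for u
      by (rule compact_support_integral(1)[OF c K(1) order.refl]) (use K d0 in \<open>auto simp: compact_imp_closed\<close>)
    have e: "dbar_dir (axis k 1) \<eta> z *s F (z $ j) = (1 / 2) *s (frechet_derivative \<eta> (at z) (axis k 1) *s F (z $ j))
       + (\<i> / 2) *s (frechet_derivative \<eta> (at z) (\<i> *s axis k 1) *s F (z $ j))" for z
      by (simp add: vec_eq_iff dbar_dir_def field_simps)
    have bl: "bounded_linear (\<lambda>y :: complex^'r. c *s y)" for c
      by (intro linear_conv_bounded_linear[THEN iffD1] linear_vector_smult linear_ident[unfolded id_def])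
    have "integral\<^sup>L lborel (\<lambda>z. frechet_derivative \<eta> (at z) u *s F (z $ j)) = 0" if "u $ j = 0" for u
      by (rule integral_derivative_transversal[OF \<eta> K(1) K(3) F that])
    moreover have "axis k 1 $ j = (0::complex)" "(\<i> *s axis k 1) $ j = (0::complex)" using k by (auto simp: axis_def)
    ultimately have zz: "integral\<^sup>L lborel (\<lambda>z. frechet_derivative \<eta> (at z) (axis k 1) *s F (z $ j)) = 0"
      "integral\<^sup>L lborel (\<lambda>z. frechet_derivative \<eta> (at z) (\<i> *s axis k 1) *s F (z $ j)) = 0" by blast+
    show ?thesis unfolding e
      by (subst Bochner_Integration.integral_add[OF integrable_bounded_linear[OF bl ii] integrable_bounded_linear[OF bl ii]])
        (simp only: integral_bounded_linear[OF bl ii] zz, simp)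
  qed
  define \<theta> where "\<theta> k = (\<lambda>x :: complex^'n. cnj (x $ k))" for k
  define \<beta> where "\<beta> = ext (\<theta> j) n (dz_form b)"
  \<comment> \<open>Conjugate linearity expands the derivative along \<open>v i\<close> in the
    coordinate directions; collecting the terms with the same \<open>k\<close> produces the wedge
    with dz-bar_k.\<close>
  have "(\<Sum>i\<le>n + 1. ((-1) ^ i * dbar_dir (v i) \<eta> z) *s dzbar_form b j (F (z $ j)) (omit i v)) =
     (\<Sum>k\<in>UNIV. ext (\<theta> k) (Suc n) \<beta> v *s (dbar_dir (axis k 1) \<eta> z *s F (z $ j)))" for z
  proof -
    have "(\<Sum>i\<le>n + 1. ((-1) ^ i * dbar_dir (v i) \<eta> z) *s dzbar_form b j (F (z $ j)) (omit i v)) =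
      (\<Sum>i\<le>n + 1. \<Sum>k\<in>UNIV. ((-1) ^ i * \<theta> k (v i) * \<beta> (omit i v) * dbar_dir (axis k 1) \<eta> z) *s F (z $ j))"
    proof (intro sum.cong refl)
      fix i
      have "((-1) ^ i * dbar_dir (v i) \<eta> z) *s dzbar_form b j (F (z $ j)) (omit i v) =
         ((\<Sum>k\<in>UNIV. (-1) ^ i * \<theta> k (v i) * \<beta> (omit i v) * dbar_dir (axis k 1) \<eta> z)) *s F (z $ j)"
        unfolding dzbar_form_def[OF b] dbar_dir_conj_linear(2)[OF d\<eta>(1), of "v i"] vector_smult_assoc
        by (simp add: \<beta>_def \<theta>_def n_def sum_distrib_left sum_distrib_right mult_ac)
      then show "((-1) ^ i * dbar_dir (v i) \<eta> z) *s dzbar_form b j (F (z $ j)) (omit i v) =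
         (\<Sum>k\<in>UNIV. ((-1) ^ i * \<theta> k (v i) * \<beta> (omit i v) * dbar_dir (axis k 1) \<eta> z) *s F (z $ j))"
        by (simp only: vec.scale_sum_left)
    qed
    also have "\<dots> = (\<Sum>k\<in>UNIV. \<Sum>i\<le>n + 1. ((-1) ^ i * \<theta> k (v i) * \<beta> (omit i v) * dbar_dir (axis k 1) \<eta> z) *s F (z $ j))"
      by (rule sum.swap)
    also have "\<dots> = (\<Sum>k\<in>UNIV. ext (\<theta> k) (Suc n) \<beta> v *s (dbar_dir (axis k 1) \<eta> z *s F (z $ j)))"
      unfolding ext_def[of "\<theta> _" "Suc n"] vector_smult_assoc
      by (simp only: vec.scale_sum_left[symmetric] sum_distrib_right Suc_eq_plus1)
    finally show ?thesis .
  qed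
  then have "(\<integral>z. (\<Sum>i\<le>n + 1. ((-1) ^ i * dbar_dir (v i) \<eta> z) *s dzbar_form b j (F (z $ j)) (omit i v)) \<partial>lebesgue_on D) =
     (\<integral>z. (\<Sum>k\<in>UNIV. ext (\<theta> k) (Suc n) \<beta> v *s (dbar_dir (axis k 1) \<eta> z *s F (z $ j))) \<partial>lebesgue_on D)"
    by simp
  also have "\<dots> = (\<Sum>k\<in>UNIV. \<integral>z. ext (\<theta> k) (Suc n) \<beta> v *s (dbar_dir (axis k 1) \<eta> z *s F (z $ j)) \<partial>lebesgue_on D)"
  proof (rule Bochner_Integration.integral_sum)
    fix k
    have bl: "bounded_linear (\<lambda>y :: complex^'r. c *s y)" for c
      by (intro linear_conv_bounded_linear[THEN iffD1] linear_vector_smult linear_ident[unfolded id_def])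
    show "integrable (lebesgue_on D) (\<lambda>z. ext (\<theta> k) (Suc n) \<beta> v *s (dbar_dir (axis k 1) \<eta> z *s F (z $ j)))"
      by (rule integrable_bounded_linear[OF bl i(1)])
  qed
  also have "\<dots> = 0"
  proof (intro sum.neutral ballI)
    fix k
    have bl: "bounded_linear (\<lambda>y :: complex^'r. c *s y)" for c
      by (intro linear_conv_bounded_linear[THEN iffD1] linear_vector_smult linear_ident[unfolded id_def])
    show "(\<integral>z. ext (\<theta> k) (Suc n) \<beta> v *s (dbar_dir (axis k 1) \<eta> z *s F (z $ j)) \<partial>lebesgue_on D) = 0"
    proof (cases "k = j")
      case True
      then have "ext (\<theta> k) (Suc n) \<beta> v = 0" unfolding \<beta>_def by (simp add: ext_ext_zero)
      then show ?thesis by simp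
    next
      case False
      then show ?thesis using integral_bounded_linear[OF bl i(1), of "ext (\<theta> k) (Suc n) \<beta> v" "axis k 1"] i(2) z0 by simp
    qed
  qed
  finally show "(\<integral>z. \<eta> z *s 0 \<partial>lebesgue_on D) = - (\<integral>z. (\<Sum>i\<le>CARD('n) + 1. ((-1) ^ i * dbar_dir (v i) \<eta> z) *s
      dzbar_form b j (F (z $ j)) (omit i v)) \<partial>lebesgue_on D)"
    by (simp add: n_def)
qed

text \<open>The equation is evaluated on the frame that enumerates the coordinates, ends with
  \<open>axis j 1\<close> and is extended by \<open>\<i> *s axis j 1\<close>. By
  \<open>sum_omit_test_frame\<close> both sides collapse to a single term with the same constant, so
  only the derivative along \<open>j\<close> is left. This is why the enumeration has
  \<open>j\<close> in the last place.\<close>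

lemma weak_dbar_test:
  fixes j :: "'n::finite" and F :: "complex \<Rightarrow> complex^'r"
  assumes b: "bij_betw b {..<CARD('n)} (UNIV :: 'n set)" "b (CARD('n) - 1) = j"
    and U: "\<And>z. z \<in> D \<Longrightarrow> pq_form CARD('n) 0 (U z)"
    and w: "weak_dbar D CARD('n) U (\<lambda>z. dzbar_form b j (F (z $ j)))" and \<eta>: "test_function D \<eta>" and D: "D \<in> sets lebesgue"
  obtains c where "c \<noteq> 0" "(\<integral>z. c *s (\<eta> z *s F (z $ j)) \<partial>lebesgue_on D) =
    - (\<integral>z. c *s (dbar_dir (axis j 1) \<eta> z *s U z (\<lambda>i. axis (b i) 1)) \<partial>lebesgue_on D)"
proof -
  obtain k where k: "CARD('n) = Suc k" by (metis Suc_pred zero_less_card_finite)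
  have bk: "b k = j" using b(2) k by simp
  define v where "v i = (if i < Suc k then axis (b i) (1::complex) else \<i> *s axis j 1)" for i
  have vk: "v k = axis j 1" "v (Suc k) = \<i> *s v k" using bk by (auto simp: v_def)
  have vb: "v i = axis (b i) 1" if "i < Suc k" for i using that by (simp add: v_def)
  note d\<eta> = smooth_differentiable[of \<eta>]
  have sm: "smooth_on UNIV \<eta>" using \<eta> by (simp add: test_function_def)
  define c where "c = (-1) ^ k * (2 * \<i>)"
  have f: "dzbar_form b j G v = c *s G" for G :: "complex^'r"
  proof -
    have ad: "alt_form (Suc k) (\<lambda>v. dz_form b v *s G)"
      using alt_form_dz[OF b(1)] unfolding k alt_form_def by (auto intro: linear_smult_vector)
    have dzc: "dz_form b (v(i := \<i> *s v i)) *s G = \<i> *s (dz_form b v *s G)" if "i < Suc k" for v i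
      using dz_form_clinear[OF b(1), of i v \<i> "v i"] that k by (simp add: vector_smult_assoc)
    have "dzbar_form b j G v = (\<Sum>i\<le>Suc k. ((-1) ^ i * cnj (v i $ j)) *s (dz_form b (omit i v) *s G))"
      unfolding dzbar_form_def[OF b(1)] ext_def k vector_smult_assoc vec.scale_sum_left ..
    also have "\<dots> = ((-1) ^ k * (2 * \<i>) * cnj (v k $ j)) *s (dz_form b v *s G)"
      by (rule sum_omit_test_frame[OF ad dzc _ vk(2)]) simp_all
    also have "dz_form b v = dz_form b (\<lambda>i. axis (b i) 1)"
      by (rule alt_form_cong[OF alt_form_dz[OF b(1)]]) (simp add: vb k)
    finally show ?thesis by (simp add: dz_form_basis[OF b(1)] vk(1) c_def)
  qed
  have u: "(\<Sum>i\<le>CARD('n). ((-1) ^ i * dbar_dir (v i) \<eta> z) *s U z (omit i v)) =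
      c *s (dbar_dir (axis j 1) \<eta> z *s U z (\<lambda>i. axis (b i) 1))" if z: "z \<in> D" for z
  proof -
    have a: "alt_form (Suc k) (U z)" using U[OF z] by (simp add: pq_form_def k)
    have cl: "U z (v(i := \<i> *s v i)) = \<i> *s U z v" if "i < Suc k" for v i
      using pq_form_k0_clinear[OF U[OF z]] that k by simp
    have "(\<Sum>i\<le>Suc k. ((-1) ^ i * dbar_dir (v i) \<eta> z) *s U z (omit i v)) =
       ((-1) ^ k * (2 * \<i>) * dbar_dir (v k) \<eta> z) *s U z v"
      by (rule sum_omit_test_frame[OF a cl _ vk(2)], assumption) (rule dbar_dir_conj_linear(1)[OF d\<eta>(1)[OF sm]])
    also have "U z v = U z (\<lambda>i. axis (b i) 1)" by (rule alt_form_cong[OF a]) (simp add: vb)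
    finally show ?thesis by (simp add: k vk(1) c_def vector_smult_assoc)
  qed
  have "(\<integral>z. \<eta> z *s dzbar_form b j (F (z $ j)) v \<partial>lebesgue_on D) =
      - (\<integral>z. (\<Sum>i\<le>CARD('n). ((-1) ^ i * dbar_dir (v i) \<eta> z) *s U z (omit i v)) \<partial>lebesgue_on D)"
    using w \<eta> unfolding weak_dbar_def by blast
  also have "(\<integral>z. (\<Sum>i\<le>CARD('n). ((-1) ^ i * dbar_dir (v i) \<eta> z) *s U z (omit i v)) \<partial>lebesgue_on D) =
     (\<integral>z. c *s (dbar_dir (axis j 1) \<eta> z *s U z (\<lambda>i. axis (b i) 1)) \<partial>lebesgue_on D)"
    by (rule Bochner_Integration.integral_cong[OF refl]) (use u D in \<open>simp add: space_restrict_space\<close>)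
  finally have "(\<integral>z. c *s (\<eta> z *s F (z $ j)) \<partial>lebesgue_on D) =
    - (\<integral>z. c *s (dbar_dir (axis j 1) \<eta> z *s U z (\<lambda>i. axis (b i) 1)) \<partial>lebesgue_on D)"
    by (simp add: f vector_smult_assoc mult.commute)
  moreover have "c \<noteq> 0" by (simp add: c_def)
  ultimately show ?thesis using that by blast
qed

lemma enumeration_with_last: "\<exists>b. bij_betw b {..<CARD('n::finite)} (UNIV :: 'n set) \<and> b (CARD('n) - 1) = j"
proof -
  obtain b0 where b0: "bij_betw b0 {..<CARD('n)} (UNIV :: 'n set)"
    using ex_bij_betw_nat_finite[of "UNIV :: 'n set"] by (auto simp: lessThan_atLeast0)
  then obtain i where i: "i < CARD('n)" "b0 i = j" by (auto simp: bij_betw_def image_iff) (metis UNIV_I imageE lessThan_iff)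
  let ?t = "Transposition.transpose i (CARD('n) - 1)"
  have "?t permutes {..<CARD('n)}" using i by (intro permutes_swap_id) auto
  then have "bij_betw (b0 \<circ> ?t) {..<CARD('n)} UNIV" using b0 by (intro bij_betw_trans[OF permutes_imp_bij])
  then show ?thesis using i by (intro exI[of _ "b0 \<circ> ?t"]) simp
qed

section \<open>Test functions on thin boxes\<close>

lemma cutoff_deriv:
  assumes ab: "a < b"
  obtains B' where "\<And>t. (cutoff a b has_real_derivative B' t) (at t)" "continuous_on UNIV B'"
    "\<And>t. t \<le> a \<Longrightarrow> B' t = 0" "\<And>t. t \<ge> b \<Longrightarrow> B' t = 0"
proof -
  have "Ck_on (Suc 0) UNIV (\<lambda>t. cutoff a b t)"
    by (intro Ck_cutoff[OF ab] Ck_bounded_linear bounded_linear_ident)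
  then obtain f' where f': "\<And>x. (cutoff a b has_derivative f' x) (at x)" "\<And>v. continuous_on UNIV (\<lambda>x. f' x v)"
    by (elim Ck_SucE) auto
  have d: "(cutoff a b has_real_derivative f' t 1) (at t)" for t
  proof -
    have e: "f' t h = f' t 1 * h" for h
      using linear_scale[OF has_derivative_linear[OF f'(1)], of t h 1] by simp
    have "(*) (f' t 1) = f' t" by (rule HOL.ext) (rule e[symmetric])
    then show ?thesis using f'(1)[of t] by (simp only: has_field_derivative_def)
  qed
  \<comment> \<open>The cutoff attains its maximum up to \<open>a\<close> and its minimum from
    \<open>b\<close> on, so the derivative vanishes there, the end points included.\<close>
  have "f' t 1 = 0" if "t \<le> a" for t
    by (rule DERIV_local_max[OF d, of 1]) (use cutoff_1[OF ab that] cutoff_bounds[OF ab] in auto)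
  moreover have "f' t 1 = 0" if "t \<ge> b" for t
    by (rule DERIV_local_min[OF d, of 1]) (use cutoff_0[OF ab that] cutoff_bounds[OF ab] in auto)
  ultimately show ?thesis using that[of "\<lambda>t. f' t 1"] d f'(2) by blast
qed

lemma derivative_along_line:
  assumes "(f has_derivative f') (at z)"
  shows "((\<lambda>t. f (z + t *\<^sub>R u)) has_vector_derivative f' u) (at 0)"
proof -
  have "((\<lambda>t. f (z + t *\<^sub>R u)) has_derivative (\<lambda>x. f' (x *\<^sub>R u))) (at 0)"
    by (rule has_derivative_compose[where g = f and f = "\<lambda>t. z + t *\<^sub>R u"])
      (use assms in \<open>auto intro!: derivative_eq_intros\<close>)
  then show ?thesis using has_derivative_linear[OF assms] by (simp add: has_vector_derivative_def linear_scale)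
qed

lemma norm_le_sum_vec: "norm (z :: complex^'n) \<le> (\<Sum>k\<in>UNIV. cmod (z $ k))"
  unfolding norm_vec_def by (rule L2_set_le_sum) simp

lemma inner_self_vec: "inner (z :: complex^'n) z = (\<Sum>k\<in>UNIV. (cmod (z $ k))\<^sup>2)"
  by (simp add: inner_vec_def power2_norm_eq_inner)

text \<open>The cutoff is applied to squares of real and imaginary parts, which are smooth, in
  contrast to their absolute values.\<close>

definition transversal_cutoff :: "'n \<Rightarrow> real \<Rightarrow> real \<Rightarrow> complex^'n::finite \<Rightarrow> real" where
  "transversal_cutoff j p q z = (\<Prod>k\<in>UNIV - {j}. cutoff (p\<^sup>2) (q\<^sup>2) ((Re (z $ k))\<^sup>2) * cutoff (p\<^sup>2) (q\<^sup>2) ((Im (z $ k))\<^sup>2))"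

lemma transversal_cutoff:
  assumes pq: "0 < p" "p < q"
  shows "0 \<le> transversal_cutoff j p q z" "transversal_cutoff j p q z \<le> 1"
    "z \<in> slab j p \<Longrightarrow> transversal_cutoff j p q z = 1"
    "transversal_cutoff j p q (z + axis j c) = transversal_cutoff j p q z"
    "k \<noteq> j \<Longrightarrow> \<not> (\<bar>Re (z $ k)\<bar> \<le> q \<and> \<bar>Im (z $ k)\<bar> \<le> q) \<Longrightarrow> transversal_cutoff j p q z = 0"
    "Ck_on m UNIV (transversal_cutoff j p q)"
proof -
  have lt: "p\<^sup>2 < q\<^sup>2" using pq by (simp add: power_strict_mono)
  note cb = cutoff_bounds[OF lt]
  show "0 \<le> transversal_cutoff j p q z" unfolding transversal_cutoff_def
    by (intro prod_nonneg mult_nonneg_nonneg cb ballI)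
  show "transversal_cutoff j p q z \<le> 1" unfolding transversal_cutoff_def
    by (intro prod_le_1 conjI mult_nonneg_nonneg mult_le_one cb)
  show "transversal_cutoff j p q z = 1" if "z \<in> slab j p"
  proof -
    have "\<bar>Re (z $ k)\<bar> \<le> \<bar>p\<bar>" "\<bar>Im (z $ k)\<bar> \<le> \<bar>p\<bar>" if "k \<noteq> j" for k
      using \<open>z \<in> slab j p\<close> that pq by (force simp: slab_def)+
    then have "(Re (z $ k))\<^sup>2 \<le> p\<^sup>2" "(Im (z $ k))\<^sup>2 \<le> p\<^sup>2" if "k \<noteq> j" for k
      using that by (simp_all add: abs_le_square_iff)
    then show ?thesis unfolding transversal_cutoff_def using cutoff_1[OF lt] by (intro prod.neutral) simp
  qed
  show "transversal_cutoff j p q (z + axis j c) = transversal_cutoff j p q z"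
    unfolding transversal_cutoff_def by (intro prod.cong refl) (auto simp: axis_def)
  show "transversal_cutoff j p q z = 0" if k: "k \<noteq> j" "\<not> (\<bar>Re (z $ k)\<bar> \<le> q \<and> \<bar>Im (z $ k)\<bar> \<le> q)"
  proof -
    have "q\<^sup>2 \<le> (Re (z $ k))\<^sup>2 \<or> q\<^sup>2 \<le> (Im (z $ k))\<^sup>2"
      using k(2) pq abs_le_square_iff[of q "Re (z $ k)"] abs_le_square_iff[of q "Im (z $ k)"] by auto
    then have "cutoff (p\<^sup>2) (q\<^sup>2) ((Re (z $ k))\<^sup>2) * cutoff (p\<^sup>2) (q\<^sup>2) ((Im (z $ k))\<^sup>2) = 0"
      using cutoff_0[OF lt] by auto
    then show ?thesis unfolding transversal_cutoff_def using k(1) by (intro prod_zero) auto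
  qed
  have "Ck_on m UNIV (\<lambda>z :: complex^'a. (Re (z $ k))\<^sup>2)" "Ck_on m UNIV (\<lambda>z :: complex^'a. (Im (z $ k))\<^sup>2)" for k
    unfolding power2_eq_square
    by (intro Ck_mult Ck_bounded_linear bounded_linear_compose[OF bounded_linear_Re bounded_linear_vec_nth]
      bounded_linear_compose[OF bounded_linear_Im bounded_linear_vec_nth])+
  then show "Ck_on m UNIV (transversal_cutoff j p q)"
    unfolding transversal_cutoff_def[abs_def] by (intro Ck_prod Ck_mult Ck_cutoff[OF lt])
qed

lemma compact_vbox_core:
  "compact {z :: complex^'n::finite. (cmod (z $ j))\<^sup>2 \<le> b \<and> (\<forall>k. k \<noteq> j \<longrightarrow> \<bar>Re (z $ k)\<bar> \<le> q \<and> \<bar>Im (z $ k)\<bar> \<le> q)}"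
  (is "compact ?K")
proof (rule compact_eq_bounded_closed[THEN iffD2], rule conjI)
  have "norm z \<le> (\<Sum>k\<in>(UNIV :: 'n set). \<bar>sqrt b\<bar> + 2 * \<bar>q\<bar>)" if z: "z \<in> ?K" for z
  proof (rule order.trans[OF norm_le_sum_vec sum_mono])
    fix k
    show "cmod (z $ k) \<le> \<bar>sqrt b\<bar> + 2 * \<bar>q\<bar>"
    proof (cases "k = j")
      case True
      have "cmod (z $ j) \<le> sqrt b" using z by (intro real_le_rsqrt) simp
      then show ?thesis using True by simp
    next
      case False
      then have "\<bar>Re (z $ k)\<bar> \<le> q" "\<bar>Im (z $ k)\<bar> \<le> q" using z by auto
      then show ?thesis using cmod_le[of "z $ k"] by linarith
    qed
  qed
  then show "bounded ?K" by (auto simp: bounded_iff)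
  have "?K = {z. (cmod (z $ j))\<^sup>2 \<le> b} \<inter> (\<Inter>k\<in>UNIV - {j}. {z. \<bar>Re (z $ k)\<bar> \<le> q} \<inter> {z. \<bar>Im (z $ k)\<bar> \<le> q})"
    by auto
  then show "closed ?K" by (auto intro!: closed_Int closed_INT closed_Collect_le continuous_intros)
qed

text \<open>Along the line \<open>\<eta>\<close> is the Gaussian of the weight times a radial
  cutoff. In the direction \<open>j\<close> only functions of \<open>|z $ j|^2\<close> are
  differentiated, and dbar of \<open>|z $ j|^2\<close> is \<open>z $ j\<close>; the transversal
  factor is constant in that direction.\<close>

lemma test_function_product:
  fixes j :: "'n::finite" and N :: real
  assumes pq: "0 < p" "p < q" "q < \<delta>" and ab: "0 < a" "a < b" "b < R\<^sup>2" "R > 0"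
    and B': "\<And>t. (cutoff a b has_real_derivative B' t) (at t)"
  defines "\<eta> \<equiv> \<lambda>z. complex_of_real (exp (- N * (cmod (z $ j))\<^sup>2) * cutoff a b ((cmod (z $ j))\<^sup>2) * transversal_cutoff j p q z)"
  shows "test_function (vbox j R \<delta>) \<eta>"
    and "dbar_dir (axis j 1) \<eta> z = z $ j * of_real (exp (- N * (cmod (z $ j))\<^sup>2) *
      (B' ((cmod (z $ j))\<^sup>2) - N * cutoff a b ((cmod (z $ j))\<^sup>2)) * transversal_cutoff j p q z)"
proof -
  note tc = transversal_cutoff[OF pq(1,2)]
  have ck2: "Ck_on m UNIV (\<lambda>z :: complex^'n. (cmod (z $ j))\<^sup>2)" for m
    unfolding power2_norm_eq_inner
    by (intro Ck_inner Ck_bounded_linear bounded_linear_vec_nth)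
  have sm: "smooth_on UNIV \<eta>" unfolding \<eta>_def
    by (intro smooth_onI Ck_linear_comp[OF bounded_linear_of_real] Ck_mult Ck_exp Ck_const ck2 tc(6) Ck_cutoff[OF ab(2)])
  define K where "K = {z :: complex^'n. (cmod (z $ j))\<^sup>2 \<le> b \<and> (\<forall>k. k \<noteq> j \<longrightarrow> \<bar>Re (z $ k)\<bar> \<le> q \<and> \<bar>Im (z $ k)\<bar> \<le> q)}"
  have rb: "sqrt b < R" using ab by (simp add: real_less_lsqrt)
  have "compact K" unfolding K_def by (rule compact_vbox_core)
  moreover have "K \<subseteq> vbox j R \<delta>"
  proof
    fix z assume z: "z \<in> K"
    have "cmod (z $ j) \<le> sqrt b" using z by (intro real_le_rsqrt) (simp add: K_def)
    then show "z \<in> vbox j R \<delta>" using z rb pq abs_Re_le_cmod[of "z $ j"] abs_Im_le_cmod[of "z $ j"]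
      by (force simp: vbox_def K_def)
  qed
  moreover have "\<eta> z = 0" if zK: "z \<notin> K" for z
  proof (cases "(cmod (z $ j))\<^sup>2 \<le> b")
    case True
    then obtain k where k: "k \<noteq> j" "\<not> (\<bar>Re (z $ k)\<bar> \<le> q \<and> \<bar>Im (z $ k)\<bar> \<le> q)"
      using zK unfolding K_def by blast
    then show ?thesis using tc(5)[OF k] by (simp add: \<eta>_def)
  next
    case False then show ?thesis using cutoff_0[OF ab(2)] by (simp add: \<eta>_def)
  qed
  ultimately show "test_function (vbox j R \<delta>) \<eta>" using sm unfolding test_function_def by blast
  define A' where "A' t = exp (- N * t) * (B' t - N * cutoff a b t)" for t
  have A': "((\<lambda>t. exp (- N * t) * cutoff a b t) has_real_derivative A' t) (at t)" for t
    by (auto intro!: derivative_eq_intros B' simp: A'_def algebra_simps)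
  have fr: "frechet_derivative \<eta> (at z) (axis j c) = of_real (A' ((cmod (z $ j))\<^sup>2) * (2 * inner (z $ j) c) * transversal_cutoff j p q z)" for c
  proof -
    have "((\<lambda>t. \<eta> (z + t *\<^sub>R axis j c)) has_vector_derivative frechet_derivative \<eta> (at z) (axis j c)) (at 0)"
      by (rule derivative_along_line[OF smooth_differentiable(1)[OF sm]])
    moreover have "\<eta> (z + t *\<^sub>R axis j c) = of_real (exp (- N * inner (z $ j + t *\<^sub>R c) (z $ j + t *\<^sub>R c)) *
       cutoff a b (inner (z $ j + t *\<^sub>R c) (z $ j + t *\<^sub>R c)) * transversal_cutoff j p q z)" for t
    proof -
      have "t *\<^sub>R axis j c = axis j (t *\<^sub>R c)" by (auto simp: vec_eq_iff axis_def)
      then show ?thesis by (simp only: \<eta>_def tc(4)) (simp add: power2_norm_eq_inner)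
    qed
    moreover have "((\<lambda>t. complex_of_real (exp (- N * inner (z $ j + t *\<^sub>R c) (z $ j + t *\<^sub>R c)) *
       cutoff a b (inner (z $ j + t *\<^sub>R c) (z $ j + t *\<^sub>R c)) * transversal_cutoff j p q z)) has_vector_derivative
       of_real (A' ((cmod (z $ j))\<^sup>2) * (2 * inner (z $ j) c) * transversal_cutoff j p q z)) (at 0)"
    proof -
      have "((\<lambda>t. inner (z $ j + t *\<^sub>R c) (z $ j + t *\<^sub>R c)) has_real_derivative 2 * inner (z $ j) c) (at 0)"
        unfolding has_field_derivative_def
        by (auto intro!: derivative_eq_intros simp: inner_commute algebra_simps fun_eq_iff)
      moreover have "((\<lambda>t. exp (- N * t) * cutoff a b t) has_real_derivative A' ((cmod (z $ j))\<^sup>2)) (at (inner (z $ j + 0 *\<^sub>R c) (z $ j + 0 *\<^sub>R c)))"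
        using A' by (simp add: power2_norm_eq_inner)
      ultimately have "((\<lambda>t. exp (- N * inner (z $ j + t *\<^sub>R c) (z $ j + t *\<^sub>R c)) * cutoff a b (inner (z $ j + t *\<^sub>R c) (z $ j + t *\<^sub>R c)))
         has_real_derivative A' ((cmod (z $ j))\<^sup>2) * (2 * inner (z $ j) c)) (at 0)"
        by (rule DERIV_chain2[rotated])
      then show ?thesis
        by (intro has_vector_derivative_of_real DERIV_cmult_right)
          (simp add: has_real_derivative_iff_has_vector_derivative[symmetric])
    qed
    ultimately show ?thesis by (metis (no_types, lifting) ext vector_derivative_at)
  qed
  have "\<i> *s axis j 1 = axis j \<i>" by (auto simp: vec_eq_iff axis_def)
  then show "dbar_dir (axis j 1) \<eta> z = z $ j * of_real (exp (- N * (cmod (z $ j))\<^sup>2) *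
      (B' ((cmod (z $ j))\<^sup>2) - N * cutoff a b ((cmod (z $ j))\<^sup>2)) * transversal_cutoff j p q z)"
    unfolding dbar_dir_def by (simp only: fr A'_def[symmetric]) (simp add: complex_eq_iff inner_complex_def)
qed

lemma integral_component_bound:
  fixes f :: "'a \<Rightarrow> complex^'r"
  shows "ennreal (cmod (integral\<^sup>L M f $ i)) \<le> (\<integral>\<^sup>+z. ennreal (cmod (f z $ i)) \<partial>M)"
proof (cases "integrable M f")
  case True
  have "integral\<^sup>L M f $ i = integral\<^sup>L M (\<lambda>z. f z $ i)"
    using integral_bounded_linear[OF bounded_linear_vec_nth True, of i] by simp
  moreover have "integrable M (\<lambda>z. f z $ i)"
    using integrable_bounded_linear[OF bounded_linear_vec_nth True] .
  ultimately show ?thesis using integral_norm_bound_ennreal by fastforce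
next
  \<comment> \<open>The Bochner integral of a function that is not integrable is 0, so the bound
    holds without information on the integrability of \<open>f\<close>.\<close>
  case False then show ?thesis by (simp add: not_integrable_integral_eq)
qed

lemma radial_integrable:
  fixes g :: "complex \<Rightarrow> real"
  assumes "continuous_on UNIV g" "\<And>\<zeta>. (cmod \<zeta>)\<^sup>2 \<ge> b \<Longrightarrow> g \<zeta> = 0"
  shows "integrable lborel g"
proof (rule compact_support_integral(1)[OF assms(1), of "cball 0 (sqrt b)" UNIV])
  fix z :: complex assume "z \<notin> cball 0 (sqrt b)"
  then have "\<not> cmod z \<le> sqrt b" by simp
  then have "(cmod z)\<^sup>2 \<ge> b" using real_le_rsqrt[of "cmod z" b] by linarith
  then show "g z = 0" by (rule assms(2))
qed auto

section \<open>The inequality along a complex line\<close>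

lemma continuous_on_hermitian:
  assumes ip: "\<And>z. z \<in> D \<Longrightarrow> hermitian_ip (H z)" and H: "\<And>v w. continuous_on D (\<lambda>z. H z v w)"
    and x: "continuous_on D x" and y: "continuous_on D y"
  shows "continuous_on D (\<lambda>z. H z (x z) (y z))"
proof -
  have "continuous_on D (\<lambda>z. \<Sum>a\<in>UNIV. \<Sum>b\<in>UNIV. x z $ a * cnj (y z $ b) * H z (axis a 1) (axis b 1))"
    by (intro continuous_intros H x y)
  moreover have "H z (x z) (y z) = (\<Sum>a\<in>UNIV. \<Sum>b\<in>UNIV. x z $ a * cnj (y z $ b) * H z (axis a 1) (axis b 1))" if "z \<in> D" for z
    by (rule hermitian_ip_expand[OF ip[OF that]])
  ultimately show ?thesis by (simp cong: continuous_on_cong)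
qed

lemma measurable_hermitian:
  fixes U :: "complex^'n::finite \<Rightarrow> complex^'r"
  assumes D: "D \<in> sets lebesgue" and ip: "\<And>z. z \<in> D \<Longrightarrow> hermitian_ip (H z)"
    and H: "\<And>v w. continuous_on D (\<lambda>z. H z v w)" and U: "U \<in> borel_measurable (lebesgue_on D)"
  shows "(\<lambda>z. Re (H z (U z) (U z))) \<in> borel_measurable (lebesgue_on D)"
proof -
  have c: "(\<lambda>z. U z $ a) \<in> borel_measurable (lebesgue_on D)" for a
    using measurable_compose[OF U, of "\<lambda>x. x $ a" borel] by (simp add: borel_measurable_continuous_onI continuous_intros)
  have cc: "(\<lambda>z. cnj (U z $ a)) \<in> borel_measurable (lebesgue_on D)" for a
    using measurable_compose[OF c, of cnj borel] by (simp add: borel_measurable_continuous_onI continuous_intros)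
  have h: "(\<lambda>z. H z v w) \<in> borel_measurable (lebesgue_on D)" for v w
    by (rule continuous_imp_measurable_on_sets_lebesgue[OF H D])
  have m: "(\<lambda>z. \<Sum>a\<in>UNIV. \<Sum>b\<in>UNIV. U z $ a * cnj (U z $ b) * H z (axis a 1) (axis b 1)) \<in> borel_measurable (lebesgue_on D)"
    by (intro borel_measurable_sum borel_measurable_times c cc h)
  have "(\<lambda>z. Re (\<Sum>a\<in>UNIV. \<Sum>b\<in>UNIV. U z $ a * cnj (U z $ b) * H z (axis a 1) (axis b 1))) \<in> borel_measurable (lebesgue_on D)"
    using measurable_compose[OF m, of Re borel] by (simp add: borel_measurable_continuous_onI continuous_intros)
  moreover have "Re (H z (U z) (U z)) = Re (\<Sum>a\<in>UNIV. \<Sum>b\<in>UNIV. U z $ a * cnj (U z $ b) * H z (axis a 1) (axis b 1))" if "z \<in> space (lebesgue_on D)" for z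
    using hermitian_ip_expand[OF ip, of z "U z" "U z"] that D by (simp add: space_restrict_space)
  ultimately show ?thesis by (subst measurable_cong) auto
qed

text \<open>The equation dbar u = f is tested with \<open>\<eta>\<close> in the coordinate
  \<open>i0\<close>, where \<open>near2\<close> bounds \<open>|v $ i0|^2\<close> by
  \<open>|v|^2\<close> times the squared dual norm. The defects stay separate:
  \<open>\<kappa>\<close> is the share of the width that the transversal cutoff leaves, the
  exponential is the transversal part of the weight, and \<open>\<epsilon>\<close> measures how far
  the metric on the box is from the metric on the line.\<close>

lemma local_estimate_fixed:
  fixes H :: "complex^'n::finite \<Rightarrow> complex^'r \<Rightarrow> complex^'r \<Rightarrow> complex" and S :: "complex \<Rightarrow> complex^'r"
  assumes R: "R > 0" and \<delta>: "\<delta> > 0" and ab: "0 < a" "a < b" "b < R\<^sup>2" and N: "N > 0"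
    and \<kappa>: "0 < \<kappa>" "\<kappa> < 1" and \<epsilon>: "\<epsilon> \<ge> 0"
    and opt: "L2_optimal_triple (vbox j R \<delta>) H"
    and ip: "\<And>z. z \<in> vbox j R \<delta> \<Longrightarrow> hermitian_ip (H z)"
    and cH: "\<And>v w. continuous_on (vbox j R \<delta>) (\<lambda>z. H z v w)"
    and S: "continuous_on UNIV S" and W: "continuous_on UNIV W" "\<And>\<zeta>. W \<zeta> \<ge> 0"
    and SW: "\<And>\<zeta>. (cmod \<zeta>)\<^sup>2 \<le> b \<Longrightarrow> S \<zeta> $ i0 = of_real (W \<zeta>)"
    and near1: "\<And>z. z \<in> vbox j R \<delta> \<Longrightarrow> (cmod (z $ j))\<^sup>2 \<le> b \<Longrightarrow> Re (H z (S (z $ j)) (S (z $ j))) \<le> W (z $ j) + \<epsilon>"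
    and near2: "\<And>z v. z \<in> vbox j R \<delta> \<Longrightarrow> (cmod (z $ j))\<^sup>2 \<le> b \<Longrightarrow> (cmod (v $ i0))\<^sup>2 \<le> Re (H z v v) * (W (z $ j) + \<epsilon>)"
    and B': "\<And>t. (cutoff a b has_real_derivative B' t) (at t)" "continuous_on UNIV B'" "\<And>t. t \<ge> b \<Longrightarrow> B' t = 0"
  shows "\<kappa> ^ (2 * (CARD('n) - 1)) * (LINT \<zeta>|lborel. N * exp (- N * (cmod \<zeta>)\<^sup>2) * (cutoff a b ((cmod \<zeta>)\<^sup>2))\<^sup>2 * W \<zeta>)
    \<le> 1 / 2 * exp (2 * N * real CARD('n) * \<delta>\<^sup>2) * (LINT \<zeta>|lborel. (cmod \<zeta>)\<^sup>2 * exp (- N * (cmod \<zeta>)\<^sup>2) *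
          (B' ((cmod \<zeta>)\<^sup>2) - N * cutoff a b ((cmod \<zeta>)\<^sup>2))\<^sup>2 * (W \<zeta> + \<epsilon>))
     + 1 / 2 * (LINT \<zeta>|lborel. N * exp (- N * (cmod \<zeta>)\<^sup>2) * (cutoff a b ((cmod \<zeta>)\<^sup>2))\<^sup>2 * (W \<zeta> + \<epsilon>))"
proof -
  define n where "n = CARD('n)"
  define D where "D = vbox j R \<delta>"
  define V where "V = (2 * \<delta>) ^ (2 * (n - 1))"
  define E where "E = exp (2 * N * real n * \<delta>\<^sup>2)"
  define T where "T \<zeta> = (cmod \<zeta>)\<^sup>2" for \<zeta>
  define Bc where "Bc \<zeta> = cutoff a b (T \<zeta>)" for \<zeta>
  define gX where "gX \<zeta> = N * exp (- N * T \<zeta>) * (Bc \<zeta>)\<^sup>2 * W \<zeta>" for \<zeta>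
  define gY where "gY \<zeta> = T \<zeta> * exp (- N * T \<zeta>) * (B' (T \<zeta>) - N * Bc \<zeta>)\<^sup>2 * (W \<zeta> + \<epsilon>)" for \<zeta>
  define gZ where "gZ \<zeta> = N * exp (- N * T \<zeta>) * (Bc \<zeta>)\<^sup>2 * (W \<zeta> + \<epsilon>)" for \<zeta>
  have V: "V > 0" using \<delta> by (simp add: V_def)
  have D: "D \<in> sets lebesgue" unfolding D_def by (rule vbox_lebesgue)
  have spD: "space (lebesgue_on D) = D" by (simp add: space_restrict_space)
  have T0: "T \<zeta> \<ge> 0" for \<zeta> by (simp add: T_def)
  have cT: "continuous_on UNIV T" unfolding T_def by (intro continuous_intros)
  have "continuous_on UNIV (cutoff a b)" using B'(1) by (intro continuous_at_imp_continuous_on ballI DERIV_isCont)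
  from continuous_on_compose2[OF this cT] have cB: "continuous_on UNIV Bc" by (simp add: Bc_def[abs_def])
  have cB': "continuous_on UNIV (\<lambda>\<zeta>. B' (T \<zeta>))" using continuous_on_compose2[OF B'(2) cT] by simp
  have B0: "Bc \<zeta> = 0" "B' (T \<zeta>) = 0" if "T \<zeta> \<ge> b" for \<zeta>
    using cutoff_0[OF ab(2) that] B'(3)[OF that] by (simp_all add: Bc_def)
  have cg: "continuous_on UNIV gX" "continuous_on UNIV gY" "continuous_on UNIV gZ"
    unfolding gX_def gY_def gZ_def by (intro continuous_intros cT cB cB' W(1))+
  have g0: "gX \<zeta> \<ge> 0" "gY \<zeta> \<ge> 0" "gZ \<zeta> \<ge> 0" for \<zeta>
    using N W(2)[of \<zeta>] \<epsilon> T0[of \<zeta>] by (simp_all add: gX_def gY_def gZ_def)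
  have ig: "integrable lborel gX" "integrable lborel gY" "integrable lborel gZ"
    by (rule radial_integrable[OF cg(1), of b] radial_integrable[OF cg(2), of b] radial_integrable[OF cg(3), of b],
      simp add: gX_def gY_def gZ_def B0[unfolded T_def] T_def Bc_def cutoff_0[OF ab(2)] B'(3))+
  have mg: "(\<lambda>\<zeta>. ennreal (c * g \<zeta>)) \<in> borel_measurable borel" if "continuous_on UNIV g" for c and g :: "complex \<Rightarrow> real"
    using that by (intro measurable_compose[OF _ measurable_ennreal] borel_measurable_continuous_onI continuous_intros)
  have nng: "(\<integral>\<^sup>+\<zeta>. ennreal (c * g \<zeta>) \<partial>lborel) = ennreal (c * integral\<^sup>L lborel g)"
    if "integrable lborel g" "\<And>\<zeta>. g \<zeta> \<ge> 0" "c \<ge> 0" for c and g :: "complex \<Rightarrow> real"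
    using that by (subst nn_integral_eq_integral) auto
  have I0: "integral\<^sup>L lborel gX \<ge> 0" "integral\<^sup>L lborel gY \<ge> 0" "integral\<^sup>L lborel gZ \<ge> 0"
    using g0 by (auto intro: Bochner_Integration.integral_nonneg)
  obtain e where e: "bij_betw e {..<CARD('n)} (UNIV :: 'n set)" "e (CARD('n) - 1) = j" using enumeration_with_last by blast
  \<comment> \<open>For a coefficient \<open>c\<close> in front of \<open>S\<close>, the pairing
    with \<open>\<eta>\<close> gains \<open>c B\<close> and the estimate for the solution costs
    \<open>c^2 / (2 N)\<close>; \<open>c = N B\<close> maximizes the difference.\<close>
  define F where "F \<zeta> = (N * Bc \<zeta>) *\<^sub>R S \<zeta>" for \<zeta>
  have cF: "continuous_on UNIV F" unfolding F_def by (intro continuous_intros cB S)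
  define f where "f = (\<lambda>z :: complex^'n. dzbar_form e j (F (z $ j)))"
  define \<phi> where "\<phi> = (\<lambda>z :: complex^'n. N * inner z z)"
  define \<omega> where "\<omega> = (\<lambda>_ :: complex^'n. euclid_form :: ('n, complex) covector)"
  define \<kappa>0 where "\<kappa>0 = dz_norm2 e / fact CARD('n)"
  have \<kappa>0: "\<kappa>0 > 0" using dz_norm2_pos[OF e(1)] by (simp add: \<kappa>0_def)
  define rhs where "rhs = (\<integral>\<^sup>+ z. ennreal (Re (form_inner (\<omega> z) (H z) (CARD('n) + 1)
              (B_inv (\<omega> z) (H z) (i_ddbar \<phi> z) (f z)) (f z)) * exp (- \<phi> z) * vol_density (\<omega> z)) \<partial>lebesgue_on D)"
  have rhs_le: "rhs \<le> ennreal (\<kappa>0 * V * integral\<^sup>L lborel gZ)"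
  proof -
    have "rhs \<le> ennreal V * (\<integral>\<^sup>+\<zeta>. ennreal (\<kappa>0 * gZ \<zeta>) \<partial>lborel)"
      unfolding rhs_def D_def V_def n_def
    proof (rule nn_integral_vbox_le[OF \<delta> mg[OF cg(3)]], rule ennreal_leI)
      fix z :: "complex^'n" assume z: "z \<in> vbox j R \<delta>"
      note h = ip[OF z]
      have "B_inv (\<omega> z) (H z) (i_ddbar \<phi> z) (f z) = (\<lambda>v. (1 / of_real (2 * N)) *s f z v)"
        unfolding \<omega>_def \<phi>_def i_ddbar_quadratic f_def
        using N by (intro B_inv_euclid[OF h pq_form_dzbar[OF e(1)]]) simp
      then have "form_inner (\<omega> z) (H z) (CARD('n) + 1) (B_inv (\<omega> z) (H z) (i_ddbar \<phi> z) (f z)) (f z) =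
          (1 / of_real (2 * N)) * 2 * of_real \<kappa>0 * H z (F (z $ j)) (F (z $ j))"
        unfolding \<omega>_def f_def \<kappa>0_def by (simp only: form_inner_dzbar[OF e(1) h])
      also have "H z (F (z $ j)) (F (z $ j)) = of_real ((N * Bc (z $ j))\<^sup>2) * H z (S (z $ j)) (S (z $ j))"
        unfolding F_def hermitian_ip_simps(7,8)[OF h] by (simp add: scaleR_conv_of_real power2_eq_square)
      also have "(1 / of_real (2 * N)) * 2 * of_real \<kappa>0 * (of_real ((N * Bc (z $ j))\<^sup>2) * H z (S (z $ j)) (S (z $ j))) =
          of_real (\<kappa>0 * N * (Bc (z $ j))\<^sup>2) * H z (S (z $ j)) (S (z $ j))"
        using N by (simp add: field_simps power2_eq_square)
      finally have r: "Re (form_inner (\<omega> z) (H z) (CARD('n) + 1) (B_inv (\<omega> z) (H z) (i_ddbar \<phi> z) (f z)) (f z)) =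
          \<kappa>0 * N * (Bc (z $ j))\<^sup>2 * Re (H z (S (z $ j)) (S (z $ j)))" by simp
      have vd: "vol_density (\<omega> z) = 1" by (simp add: \<omega>_def vol_density_euclid)
      have "cmod (z $ j) \<le> norm z" by (rule Finite_Cartesian_Product.norm_nth_le)
      then have "T (z $ j) \<le> inner z z" unfolding T_def power2_norm_eq_inner[symmetric] by (intro power_mono) auto
      then have ex: "exp (- \<phi> z) \<le> exp (- N * T (z $ j))" using N by (simp add: \<phi>_def)
      show "Re (form_inner (\<omega> z) (H z) (CARD('n) + 1) (B_inv (\<omega> z) (H z) (i_ddbar \<phi> z) (f z)) (f z)) * exp (- \<phi> z) * vol_density (\<omega> z)
          \<le> \<kappa>0 * gZ (z $ j)"
      proof (cases "T (z $ j) \<le> b")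
        case True
        have "\<kappa>0 * N * (Bc (z $ j))\<^sup>2 * Re (H z (S (z $ j)) (S (z $ j))) * exp (- \<phi> z) \<le>
            \<kappa>0 * N * (Bc (z $ j))\<^sup>2 * (W (z $ j) + \<epsilon>) * exp (- N * T (z $ j))"
          using near1[OF z] True \<kappa>0 N ex hermitian_ip_simps(14)[OF h] W(2)[of "z $ j"] \<epsilon>
          by (intro mult_mono mult_left_mono) (auto simp: T_def)
        then show ?thesis unfolding r vd by (simp add: gZ_def mult_ac)
      next
        case False
        then show ?thesis unfolding r vd using B0[of "z $ j"] by (simp add: gZ_def)
      qed
    qed
    also have "\<dots> = ennreal (V * (\<kappa>0 * integral\<^sup>L lborel gZ))"
      using nng[OF ig(3) g0(3), of \<kappa>0] \<kappa>0 V I0 by (simp add: ennreal_mult)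
    finally show ?thesis by (simp add: mult_ac)
  qed
  have cfz: "continuous_on UNIV (\<lambda>z. f z v)" for v
    unfolding f_def dzbar_form_def[OF e(1)]
    by (intro continuous_on_smult_vec continuous_intros continuous_on_compose2[OF cF]) auto
  have "\<exists>U. (\<forall>z\<in>D. pq_form CARD('n) 0 (U z)) \<and> locally_integrable_form D U \<and> weak_dbar D CARD('n) U f \<and>
      (\<integral>\<^sup>+ z. ennreal (Re (form_inner (\<omega> z) (H z) CARD('n) (U z) (U z)) * exp (- \<phi> z) * vol_density (\<omega> z)) \<partial>lebesgue_on D) \<le> rhs"
  proof -
    have "pq_form CARD('n) 1 (f z)" for z unfolding f_def by (rule pq_form_dzbar[OF e(1)])
    moreover have "locally_L2_form D f" unfolding locally_L2_form_def
    proof (intro allI conjI impI)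
      fix v
      show "(\<lambda>z. f z v) \<in> borel_measurable (lebesgue_on D)"
        using D cfz continuous_on_subset by (intro continuous_imp_measurable_on_sets_lebesgue) blast+
      fix K assume K: "compact K \<and> K \<subseteq> D"
      have "compact ((\<lambda>z. f z v) ` K)" using K cfz continuous_on_subset by (intro compact_continuous_image) blast+
      then obtain M where M: "\<And>z. z \<in> K \<Longrightarrow> norm (f z v) \<le> M" using compact_imp_bounded by (fastforce simp: bounded_iff)
      have "(\<integral>\<^sup>+ z. ennreal ((norm (f z v))\<^sup>2) \<partial>lebesgue_on K) \<le> (\<integral>\<^sup>+ z. ennreal (M\<^sup>2) \<partial>lebesgue_on K)"
        using M by (intro nn_integral_mono ennreal_leI power_mono) (auto simp: space_restrict_space)
      also have "\<dots> < \<infinity>"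
      proof -
        have "emeasure lebesgue K < \<infinity>" using K lmeasurable_compact[of K] by (auto simp: fmeasurable_def)
        moreover have "K \<in> sets lebesgue" using K by (simp add: compact_imp_closed lmeasurable_compact fmeasurableD)
        ultimately show ?thesis by (simp add: emeasure_restrict_space space_restrict_space ennreal_mult_less_top)
      qed
      finally show "(\<integral>\<^sup>+ z. ennreal ((norm (f z v))\<^sup>2) \<partial>lebesgue_on K) < \<infinity>" .
    qed
    moreover have "weak_dbar D (CARD('n) + 1) f (\<lambda>_ _. 0)" unfolding f_def by (rule dzbar_closed[OF e(1) cF D])
    moreover have "smooth_strictly_psh_on D \<phi>" unfolding \<phi>_def by (rule smooth_strictly_psh_quadratic[OF N])
    moreover have "kaehler_metric_on D \<omega>" unfolding \<omega>_def by (rule kaehler_euclid)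
    moreover have "rhs < \<infinity>" using rhs_le by (simp add: le_less_trans)
    ultimately show ?thesis using opt unfolding L2_optimal_triple_def D_def[symmetric] rhs_def by blast
  qed
  then obtain U where U: "\<And>z. z \<in> D \<Longrightarrow> pq_form CARD('n) 0 (U z)" "locally_integrable_form D U" "weak_dbar D CARD('n) U f"
    "(\<integral>\<^sup>+ z. ennreal (Re (form_inner (\<omega> z) (H z) CARD('n) (U z) (U z)) * exp (- \<phi> z) * vol_density (\<omega> z)) \<partial>lebesgue_on D) \<le> rhs"
    by blast
  define u where "u z = U z (\<lambda>i. axis (e i) 1)" for z
  define hu where "hu z = Re (H z (u z) (u z)) * exp (- \<phi> z)" for z
  have hu0: "hu z \<ge> 0" if "z \<in> D" for z using hermitian_ip_simps(14)[OF ip] that by (simp add: hu_def D_def)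
  have mhu: "hu \<in> borel_measurable (lebesgue_on D)"
  proof -
    have "(\<lambda>z. Re (H z (u z) (u z))) \<in> borel_measurable (lebesgue_on D)"
      using U(2) ip cH by (intro measurable_hermitian[OF D]) (auto simp: D_def locally_integrable_form_def u_def)
    moreover have "(\<lambda>z. exp (- \<phi> z)) \<in> borel_measurable (lebesgue_on D)"
      unfolding \<phi>_def by (intro continuous_imp_measurable_on_sets_lebesgue[OF _ D] continuous_intros)
    ultimately show ?thesis unfolding hu_def by (intro borel_measurable_times)
  qed
  \<comment> \<open>The constant \<open>\<kappa>0\<close> of the norm of dz multiplies both sides of
    the estimate supplied by optimality and cancels.\<close>
  have hu: "(\<integral>\<^sup>+z. ennreal (hu z) \<partial>lebesgue_on D) \<le> ennreal (V * integral\<^sup>L lborel gZ)"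
  proof -
    have "ennreal \<kappa>0 * (\<integral>\<^sup>+z. ennreal (hu z) \<partial>lebesgue_on D) = (\<integral>\<^sup>+z. ennreal (\<kappa>0 * hu z) \<partial>lebesgue_on D)"
      using mhu \<kappa>0 by (subst nn_integral_cmult[symmetric]) (auto intro!: nn_integral_cong simp: ennreal_mult')
    also have "\<dots> \<le> rhs"
    proof (rule order.trans[OF eq_refl U(4)], rule nn_integral_cong)
      fix z assume "z \<in> space (lebesgue_on D)"
      then have z: "z \<in> D" by (simp add: spD)
      have fi: "form_inner euclid_form (H z) CARD('n) (U z) (U z) = of_real \<kappa>0 * H z (u z) (u z)"
        unfolding \<kappa>0_def u_def by (rule form_inner_n0[OF e(1) ip U(1)]) (use z in \<open>simp_all add: D_def\<close>)
      show "ennreal (\<kappa>0 * hu z) = ennreal (Re (form_inner (\<omega> z) (H z) CARD('n) (U z) (U z)) * exp (- \<phi> z) * vol_density (\<omega> z))"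
        unfolding \<omega>_def vol_density_euclid fi by (simp add: hu_def mult_ac)
    qed
    also note rhs_le
    finally have "ennreal \<kappa>0 * (\<integral>\<^sup>+z. ennreal (hu z) \<partial>lebesgue_on D) \<le> ennreal \<kappa>0 * ennreal (V * integral\<^sup>L lborel gZ)"
      using \<kappa>0 V I0 by (simp add: ennreal_mult mult.assoc)
    then show ?thesis using \<kappa>0 by (subst (asm) ennreal_mult_le_mult_iff) auto
  qed
  \<comment> \<open>The transversal cutoff is 1 up to \<open>\<kappa> * \<delta>\<close> and
    vanishes from the midpoint \<open>q\<close> of \<open>\<kappa> * \<delta>\<close> and
    \<open>\<delta>\<close> on, which makes its support compact in the box.\<close>
  define p where "p = \<kappa> * \<delta>"
  define q where "q = (1 + \<kappa>) / 2 * \<delta>"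
  have pq: "0 < p" "p < q" "q < \<delta>" using \<kappa> \<delta> by (auto simp: p_def q_def)
  define \<xi> where "\<xi> = transversal_cutoff j p q"
  note tc = transversal_cutoff[OF pq(1,2), where j = j, folded \<xi>_def]
  define \<eta> where "\<eta> = (\<lambda>z. complex_of_real (exp (- N * (cmod (z $ j))\<^sup>2) * cutoff a b ((cmod (z $ j))\<^sup>2) * \<xi> z))"
  note tf = test_function_product[OF pq ab R B'(1), where j = j and N = N, folded \<xi>_def, folded \<eta>_def]
  obtain c where c: "c \<noteq> 0" "(\<integral>z. c *s (\<eta> z *s F (z $ j)) \<partial>lebesgue_on D) =
    - (\<integral>z. c *s (dbar_dir (axis j 1) \<eta> z *s u z) \<partial>lebesgue_on D)"
    using weak_dbar_test[OF e U(1) U(3)[unfolded f_def] tf(1)[folded D_def] D] unfolding u_def by blast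
  \<comment> \<open>By \<open>SW\<close> the coordinate \<open>i0\<close> of \<open>S\<close> is
    real and nonnegative on the support, so the left-hand side is \<open>c\<close> times a
    nonnegative integral and taking absolute values loses nothing.\<close>
  have left: "(c *s (\<eta> z *s F (z $ j))) $ i0 = c * of_real (\<xi> z * gX (z $ j))" for z
  proof (cases "T (z $ j) \<le> b")
    case True
    have "(c *s (\<eta> z *s F (z $ j))) $ i0 = c * (\<eta> z * ((N * Bc (z $ j)) *\<^sub>R (S (z $ j) $ i0)))"
      by (simp only: F_def vector_smult_component vector_scaleR_component)
    also have "\<dots> = c * (\<eta> z * ((N * Bc (z $ j)) *\<^sub>R of_real (W (z $ j))))"
      using SW[of "z $ j"] True by (simp add: T_def)
    also have "\<dots> = c * of_real (\<xi> z * gX (z $ j))"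
      by (simp add: \<eta>_def gX_def T_def Bc_def scaleR_conv_of_real power2_eq_square mult_ac)
    finally show ?thesis .
  next
    case False
    then show ?thesis using B0[of "z $ j"] by (simp add: F_def gX_def)
  qed
  obtain K where K: "compact K" "K \<subseteq> D" "\<And>z. z \<notin> K \<Longrightarrow> \<eta> z = 0" "smooth_on UNIV \<eta>"
    using tf(1) by (auto simp: test_function_def D_def)
  have "continuous_on UNIV (\<lambda>z. c *s (\<eta> z *s F (z $ j)))"
    by (intro continuous_on_smult_vec continuous_intros smooth_differentiable(3)[OF K(4)] continuous_on_compose2[OF cF]) auto
  then have il: "integrable (lebesgue_on D) (\<lambda>z. c *s (\<eta> z *s F (z $ j)))"
    by (rule compact_support_integral(2)[OF _ K(1,2) _ D]) (simp add: K(3))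
  have ilc: "integrable (lebesgue_on D) (\<lambda>z. c * of_real (\<xi> z * gX (z $ j)))"
    using integrable_bounded_linear[OF bounded_linear_vec_nth il, of i0] by (simp only: left)
  have ir: "integrable (lebesgue_on D) (\<lambda>z. \<xi> z * gX (z $ j))"
  proof -
    have "integrable (lebesgue_on D) (\<lambda>z. Re ((1 / c) * (c * of_real (\<xi> z * gX (z $ j)))))"
      by (intro integrable_Re integrable_mult_right ilc)
    then show ?thesis using c(1) by simp
  qed
  have \<xi>g: "\<xi> z * gX (z $ j) \<ge> 0" for z using tc(1) g0(1) by simp
  have "(\<integral>z. c *s (\<eta> z *s F (z $ j)) \<partial>lebesgue_on D) $ i0 = (\<integral>z. c * of_real (\<xi> z * gX (z $ j)) \<partial>lebesgue_on D)"
    using integral_bounded_linear[OF bounded_linear_vec_nth il, of i0] by (simp only: left)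
  also have "\<dots> = c * of_real (\<integral>z. \<xi> z * gX (z $ j) \<partial>lebesgue_on D)"
    by (simp only: integral_mult_right_zero integral_complex_of_real)
  finally have lhs_eq: "cmod ((\<integral>z. c *s (\<eta> z *s F (z $ j)) \<partial>lebesgue_on D) $ i0) = cmod c * (\<integral>z. \<xi> z * gX (z $ j) \<partial>lebesgue_on D)"
    using \<xi>g by (simp add: norm_mult Bochner_Integration.integral_nonneg del: of_real_mult)
  have mgY: "(\<lambda>z. ennreal (cmod c / 2 * (E * gY (z $ j)))) \<in> borel_measurable (lebesgue_on D)"
  proof -
    have "continuous_on D (\<lambda>z. cmod c / 2 * (E * gY (z $ j)))"
      by (intro continuous_intros continuous_on_compose2[OF cg(2)]) auto
    from continuous_imp_measurable_on_sets_lebesgue[OF this D] show ?thesis by measurable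
  qed
  \<comment> \<open>Cauchy-Schwarz in the fibre turns \<open>|u $ i0|^2\<close> into
    \<open>|u|^2 (W + \<epsilon>)\<close>. The weights are split such that one factor is exactly the
    integrand \<open>hu\<close> controlled by optimality and the other depends on the coordinate
    along the line alone.\<close>
  have amgm: "cmod ((c *s (dbar_dir (axis j 1) \<eta> z *s u z)) $ i0) \<le> cmod c / 2 * (E * gY (z $ j)) + cmod c / 2 * hu z"
    if z: "z \<in> D" for z
  proof -
    define A where "A = exp (- N * T (z $ j)) * (B' (T (z $ j)) - N * Bc (z $ j))"
    have db: "dbar_dir (axis j 1) \<eta> z = z $ j * of_real (A * \<xi> z)"
      unfolding tf(2) by (simp add: A_def T_def Bc_def)
    have E0: "E > 0" by (simp add: E_def)
    have "cmod (dbar_dir (axis j 1) \<eta> z) * cmod (u z $ i0) \<le> (E * gY (z $ j) + hu z) / 2"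
    proof (cases "T (z $ j) \<le> b")
      case False
      then have "A = 0" using B0[of "z $ j"] by (simp add: A_def)
      then show ?thesis unfolding db using hu0[OF z] g0(2) E0 by simp
    next
      case True
      \<comment> \<open>The coordinates other than \<open>j\<close> contribute at most
        \<open>2 * \<delta>^2\<close> each, which explains the exponent of \<open>E\<close>.\<close>
      have "inner z z = T (z $ j) + (\<Sum>k\<in>UNIV - {j}. (cmod (z $ k))\<^sup>2)"
        unfolding inner_self_vec by (subst sum.remove[of UNIV j]) (auto simp: T_def)
      also have "\<dots> \<le> T (z $ j) + (\<Sum>k\<in>UNIV - {j}. 2 * \<delta>\<^sup>2)"
      proof (intro add_left_mono sum_mono)
        fix k assume "k \<in> UNIV - {j}"
        then have "\<bar>Re (z $ k)\<bar> \<le> \<bar>\<delta>\<bar>" "\<bar>Im (z $ k)\<bar> \<le> \<bar>\<delta>\<bar>" using z \<delta> by (force simp: D_def vbox_def)+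
        then have "(Re (z $ k))\<^sup>2 \<le> \<delta>\<^sup>2" "(Im (z $ k))\<^sup>2 \<le> \<delta>\<^sup>2" by (simp_all only: abs_le_square_iff)
        then show "(cmod (z $ k))\<^sup>2 \<le> 2 * \<delta>\<^sup>2" by (simp add: cmod_power2)
      qed
      also have "\<dots> \<le> T (z $ j) + real n * (2 * \<delta>\<^sup>2)"
        by (simp add: n_def card_Diff_singleton mult_right_mono)
      finally have "N * inner z z \<le> N * (T (z $ j) + real n * (2 * \<delta>\<^sup>2))" using N by (intro mult_left_mono) auto
      then have ex: "exp (N * inner z z) \<le> exp (N * T (z $ j)) * E"
        unfolding E_def exp_add[symmetric] by (simp add: algebra_simps)
      define d where "d = cmod (dbar_dir (axis j 1) \<eta> z)"
      have "d\<^sup>2 = T (z $ j) * A\<^sup>2 * (\<xi> z)\<^sup>2" unfolding d_def db by (simp add: norm_mult power_mult_distrib T_def)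
      also have "\<dots> \<le> T (z $ j) * A\<^sup>2 * 1"
        using T0 tc(1,2)[of z] by (intro mult_left_mono) (auto simp: power_le_one)
      finally have d2: "d\<^sup>2 \<le> T (z $ j) * A\<^sup>2" by simp
      have u2: "(cmod (u z $ i0))\<^sup>2 \<le> Re (H z (u z) (u z)) * (W (z $ j) + \<epsilon>)"
        using near2[OF z[unfolded D_def], of "u z"] True by (simp add: T_def)
      have "(d * cmod (u z $ i0))\<^sup>2 \<le> (T (z $ j) * A\<^sup>2) * (Re (H z (u z) (u z)) * (W (z $ j) + \<epsilon>))"
        unfolding power_mult_distrib using d2 u2 T0 by (intro mult_mono) auto
      also have "\<dots> = (T (z $ j) * A\<^sup>2 * (W (z $ j) + \<epsilon>) * exp (N * inner z z)) * hu z"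
        by (simp add: hu_def \<phi>_def exp_minus field_simps)
      also have "\<dots> \<le> (T (z $ j) * A\<^sup>2 * (W (z $ j) + \<epsilon>) * (exp (N * T (z $ j)) * E)) * hu z"
        using ex T0 W(2)[of "z $ j"] \<epsilon> hu0[OF z] by (intro mult_right_mono mult_left_mono) auto
      also have "T (z $ j) * A\<^sup>2 * (W (z $ j) + \<epsilon>) * (exp (N * T (z $ j)) * E) = E * gY (z $ j)"
      proof -
        have "exp (- N * T (z $ j)) * exp (- N * T (z $ j)) * exp (N * T (z $ j)) = exp (- N * T (z $ j))"
          by (simp flip: exp_add)
        then show ?thesis by (simp add: A_def gY_def power2_eq_square mult_ac)
      qed
      \<comment> \<open>AM-GM for the squares; the root is taken by monotonicity at the end.\<close>
      also have "E * gY (z $ j) * hu z \<le> ((E * gY (z $ j) + hu z) / 2)\<^sup>2"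
      proof -
        have "0 \<le> (E * gY (z $ j) - hu z)\<^sup>2" by simp
        then show ?thesis by (simp add: power2_eq_square field_simps)
      qed
      finally show ?thesis unfolding d_def[symmetric]
        by (rule power2_le_imp_le) (use g0(2) E0 hu0[OF z] in simp)
    qed
    then have "cmod c * (cmod (dbar_dir (axis j 1) \<eta> z) * cmod (u z $ i0)) \<le> cmod c * ((E * gY (z $ j) + hu z) / 2)"
      by (intro mult_left_mono) auto
    then show ?thesis by (simp add: norm_mult algebra_simps)
  qed
  have "ennreal (cmod c * (\<integral>z. \<xi> z * gX (z $ j) \<partial>lebesgue_on D)) =
      ennreal (cmod ((\<integral>z. c *s (dbar_dir (axis j 1) \<eta> z *s u z) \<partial>lebesgue_on D) $ i0))"
    unfolding lhs_eq[symmetric] c(2) by simp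
  also have "\<dots> \<le> (\<integral>\<^sup>+z. ennreal (cmod ((c *s (dbar_dir (axis j 1) \<eta> z *s u z)) $ i0)) \<partial>lebesgue_on D)"
    by (rule integral_component_bound)
  also have "\<dots> \<le> (\<integral>\<^sup>+z. ennreal (cmod c / 2 * (E * gY (z $ j))) + ennreal (cmod c / 2 * hu z) \<partial>lebesgue_on D)"
  proof (rule nn_integral_mono)
    fix z assume "z \<in> space (lebesgue_on D)"
    then have z: "z \<in> D" by (simp add: spD)
    have "E \<ge> 0" by (simp add: E_def)
    then have "ennreal (cmod c / 2 * (E * gY (z $ j)) + cmod c / 2 * hu z) = ennreal (cmod c / 2 * (E * gY (z $ j))) + ennreal (cmod c / 2 * hu z)"
      using g0(2)[of "z $ j"] hu0[OF z] by (intro ennreal_plus) auto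
    with ennreal_leI[OF amgm[OF z]]
    show "ennreal (cmod ((c *s (dbar_dir (axis j 1) \<eta> z *s u z)) $ i0)) \<le> ennreal (cmod c / 2 * (E * gY (z $ j))) + ennreal (cmod c / 2 * hu z)"
      by (simp only:)
  qed
  also have "\<dots> = (\<integral>\<^sup>+z. ennreal (cmod c / 2 * (E * gY (z $ j))) \<partial>lebesgue_on D) + (\<integral>\<^sup>+z. ennreal (cmod c / 2 * hu z) \<partial>lebesgue_on D)"
    using mhu by (intro nn_integral_add mgY) measurable
  also have "\<dots> \<le> ennreal (cmod c / 2 * E * V * integral\<^sup>L lborel gY) + ennreal (cmod c / 2 * (V * integral\<^sup>L lborel gZ))"
  proof (rule add_mono)
    have "(\<integral>\<^sup>+z. ennreal (cmod c / 2 * (E * gY (z $ j))) \<partial>lebesgue_on D) \<le> ennreal V * (\<integral>\<^sup>+\<zeta>. ennreal ((cmod c / 2 * E) * gY \<zeta>) \<partial>lborel)"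
      unfolding D_def V_def n_def by (rule nn_integral_vbox_le[OF \<delta> mg[OF cg(2)]]) (simp add: mult.assoc)
    also have "\<dots> = ennreal (V * (cmod c / 2 * E * integral\<^sup>L lborel gY))"
      using V I0 by (subst nng[OF ig(2) g0(2)]) (auto simp: E_def ennreal_mult[symmetric] mult_ac)
    finally show "(\<integral>\<^sup>+z. ennreal (cmod c / 2 * (E * gY (z $ j))) \<partial>lebesgue_on D) \<le> ennreal (cmod c / 2 * E * V * integral\<^sup>L lborel gY)"
      by (simp add: mult_ac)
    have "(\<integral>\<^sup>+z. ennreal (cmod c / 2 * hu z) \<partial>lebesgue_on D) = ennreal (cmod c / 2) * (\<integral>\<^sup>+z. ennreal (hu z) \<partial>lebesgue_on D)"
      using mhu by (subst nn_integral_cmult[symmetric]) (auto intro!: nn_integral_cong ennreal_mult simp: hu0 spD simp del: times_divide_eq_left)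
    also have "\<dots> \<le> ennreal (cmod c / 2) * ennreal (V * integral\<^sup>L lborel gZ)" by (intro mult_left_mono hu) auto
    finally show "(\<integral>\<^sup>+z. ennreal (cmod c / 2 * hu z) \<partial>lebesgue_on D) \<le> ennreal (cmod c / 2 * (V * integral\<^sup>L lborel gZ))"
      by (subst (asm) ennreal_mult[symmetric]) (use V I0 in auto)
  qed
  also have "\<dots> = ennreal (cmod c / 2 * E * V * integral\<^sup>L lborel gY + cmod c / 2 * (V * integral\<^sup>L lborel gZ))"
    using V I0 by (simp add: E_def)
  finally have up: "cmod c * (\<integral>z. \<xi> z * gX (z $ j) \<partial>lebesgue_on D) \<le> cmod c / 2 * E * V * integral\<^sup>L lborel gY + cmod c / 2 * (V * integral\<^sup>L lborel gZ)"
    using V I0 by (subst (asm) ennreal_le_iff) (auto simp: E_def)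
  have low: "\<kappa> ^ (2 * (n - 1)) * V * integral\<^sup>L lborel gX \<le> (\<integral>z. \<xi> z * gX (z $ j) \<partial>lebesgue_on D)"
  proof -
    have "ennreal ((2 * p) ^ (2 * (CARD('n) - 1))) * (\<integral>\<^sup>+\<zeta>. ennreal (1 * gX \<zeta>) \<partial>lborel) \<le> (\<integral>\<^sup>+z. ennreal (\<xi> z * gX (z $ j)) \<partial>lebesgue_on (vbox j R \<delta>))"
    proof (rule nn_integral_vbox_ge[OF pq(1) _ mg[OF cg(1)]])
      show "p \<le> \<delta>" using pq by simp
      show "ennreal (1 * gX (z $ j)) \<le> ennreal (\<xi> z * gX (z $ j))" if "z \<in> slab j p" for z using tc(3)[OF that] by simp
      fix \<zeta> assume o: "\<not> (\<bar>Re \<zeta>\<bar> < R \<and> \<bar>Im \<zeta>\<bar> < R)"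
      have "T \<zeta> \<ge> b"
      proof (rule ccontr)
        assume "\<not> T \<zeta> \<ge> b"
        then have "(cmod \<zeta>)\<^sup>2 < R\<^sup>2" using ab by (simp add: T_def)
        then have "cmod \<zeta> < R" using R by (intro power2_less_imp_less[of _ R]) auto
        then show False using o abs_Re_le_cmod[of \<zeta>] abs_Im_le_cmod[of \<zeta>] by linarith
      qed
      then show "ennreal (1 * gX \<zeta>) = 0" using B0[of \<zeta>] by (simp add: gX_def)
    qed
    also have "(\<integral>\<^sup>+z. ennreal (\<xi> z * gX (z $ j)) \<partial>lebesgue_on (vbox j R \<delta>)) = ennreal (\<integral>z. \<xi> z * gX (z $ j) \<partial>lebesgue_on D)"
      unfolding D_def[symmetric] using \<xi>g by (intro nn_integral_eq_integral ir) auto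
    also have "ennreal ((2 * p) ^ (2 * (CARD('n) - 1))) * (\<integral>\<^sup>+\<zeta>. ennreal (1 * gX \<zeta>) \<partial>lborel) = ennreal (\<kappa> ^ (2 * (n - 1)) * V * integral\<^sup>L lborel gX)"
    proof -
      have "(2 * p) ^ (2 * (CARD('n) - 1)) = \<kappa> ^ (2 * (n - 1)) * V"
        unfolding p_def V_def n_def power_mult_distrib[symmetric] by (simp add: mult_ac)
      then show ?thesis unfolding nng[OF ig(1) g0(1) zero_le_one]
        by (subst ennreal_mult[symmetric]) (use V \<kappa> I0 in auto)
    qed
    finally show ?thesis using \<xi>g by (subst (asm) ennreal_le_iff) (auto intro: Bochner_Integration.integral_nonneg)
  qed
  have "cmod c * V * (\<kappa> ^ (2 * (n - 1)) * integral\<^sup>L lborel gX) \<le> cmod c * (\<integral>z. \<xi> z * gX (z $ j) \<partial>lebesgue_on D)"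
    using mult_left_mono[OF low, of "cmod c"] by (simp add: mult_ac)
  also note up
  also have "cmod c / 2 * E * V * integral\<^sup>L lborel gY + cmod c / 2 * (V * integral\<^sup>L lborel gZ) =
      cmod c * V * (1 / 2 * E * integral\<^sup>L lborel gY + 1 / 2 * integral\<^sup>L lborel gZ)" by (simp add: algebra_simps)
  finally have "\<kappa> ^ (2 * (n - 1)) * integral\<^sup>L lborel gX \<le> 1 / 2 * E * integral\<^sup>L lborel gY + 1 / 2 * integral\<^sup>L lborel gZ"
    using c(1) V by (subst (asm) mult_le_cancel_left_pos) auto
  then show ?thesis by (simp only: gX_def[abs_def] gY_def[abs_def] gZ_def[abs_def] T_def Bc_def n_def E_def)
qed

text \<open>\<open>s\<close> represents the functional \<open>v \<mapsto> v $ i0\<close>, so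
  \<open>s z $ i0\<close> is its squared dual norm. For fixed \<open>N\<close> the limits are taken
  in the order \<open>\<delta>\<close>, \<open>\<epsilon>\<close>, \<open>\<kappa>\<close>: the size
  of the box depends on \<open>\<epsilon>\<close>, whereas the integrals along the line do not
  depend on the box. What is left contradicts the touching Gaussian when \<open>N\<close>
  grows.\<close>

lemma no_local_touching:
  fixes H :: "complex^'n::finite \<Rightarrow> complex^'r \<Rightarrow> complex^'r \<Rightarrow> complex" and s :: "complex^'n \<Rightarrow> complex^'r"
  assumes R: "R > 0" and \<delta>0: "\<delta>0 > 0" and b: "0 < b" "b < R\<^sup>2" and \<epsilon>0: "\<epsilon>0 > 0"
    and opt: "\<And>\<delta>. 0 < \<delta> \<Longrightarrow> \<delta> \<le> \<delta>0 \<Longrightarrow> L2_optimal_triple (vbox j R \<delta>) H"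
    and ip: "\<And>z. z \<in> vbox j R \<delta>0 \<Longrightarrow> hermitian_ip (H z)"
    and cH: "\<And>v w. continuous_on (vbox j R \<delta>0) (\<lambda>z. H z v w)"
    and s: "continuous_on (vbox j R \<delta>0) s" "\<And>z v. z \<in> vbox j R \<delta>0 \<Longrightarrow> H z v (s z) = v $ i0"
    and pos: "Re (s 0 $ i0) > 0"
    and touch: "\<And>\<zeta>. (cmod \<zeta>)\<^sup>2 \<le> b \<Longrightarrow> Re (s (axis j \<zeta>) $ i0) \<le> Re (s 0 $ i0) * exp (- \<epsilon>0 * (cmod \<zeta>)\<^sup>2)"
  shows False
proof -
  define a where "a = b / 2"
  have ab: "0 < a" "a < b" "b < R\<^sup>2" using b by (auto simp: a_def)
  obtain B' where B': "\<And>t. (cutoff a b has_real_derivative B' t) (at t)" "continuous_on UNIV B'"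
      "\<And>t. t \<le> a \<Longrightarrow> B' t = 0" "\<And>t. t \<ge> b \<Longrightarrow> B' t = 0"
    using cutoff_deriv[OF ab(2)] by blast
  \<comment> \<open>Composition with the nearest-point projection to the disc extends the data from
    the disc to continuous functions on the whole plane without changing them on the disc.\<close>
  define cl where "cl = closest_point (cball (0::complex) (sqrt b))"
  have ne: "cball (0::complex) (sqrt b) \<noteq> {}" using b by simp
  have ccl: "continuous_on UNIV cl" unfolding cl_def by (rule continuous_on_closest_point[OF convex_cball closed_cball ne])
  have cl_in: "cmod (cl \<zeta>) \<le> sqrt b" for \<zeta> using closest_point_in_set[OF closed_cball ne, of \<zeta>] by (simp add: cl_def)
  have cl_id: "cl \<zeta> = \<zeta>" if "(cmod \<zeta>)\<^sup>2 \<le> b" for \<zeta>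
    unfolding cl_def by (rule closest_point_self) (use that in \<open>simp add: real_le_rsqrt\<close>)
  have rb: "sqrt b < R" using ab R by (simp add: real_less_lsqrt)
  have ax: "axis j \<zeta> \<in> vbox j R \<delta>" if "cmod \<zeta> \<le> sqrt b" "\<delta> > 0" for \<zeta> \<delta>
    using that rb abs_Re_le_cmod[of \<zeta>] abs_Im_le_cmod[of \<zeta>] by (auto simp: vbox_def axis_def)
  define S where "S \<zeta> = s (axis j (cl \<zeta>))" for \<zeta>
  define W where "W \<zeta> = Re (S \<zeta> $ i0)" for \<zeta>
  have cax: "continuous_on UNIV (\<lambda>\<zeta>. axis j (cl \<zeta>) :: complex^'n)"
  proof -
    have eq: "(\<lambda>\<zeta>. axis j (cl \<zeta>) :: complex^'n) = (\<lambda>\<zeta>. \<chi> k. if k = j then cl \<zeta> else 0)"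
      by (auto simp: axis_def fun_eq_iff)
    have "continuous_on UNIV (\<lambda>\<zeta>. if k = j then cl \<zeta> else 0)" for k using ccl by (cases "k = j") auto
    then show ?thesis unfolding eq by (rule continuous_on_vec_lambda)
  qed
  have cS: "continuous_on UNIV S" unfolding S_def
    by (rule continuous_on_compose2[OF s(1) cax]) (use ax[OF cl_in \<delta>0] in auto)
  have cW: "continuous_on UNIV W" unfolding W_def by (intro continuous_intros cS)
  have HS: "s z $ i0 = H z (s z) (s z)" if "z \<in> vbox j R \<delta>0" for z using s(2)[OF that] by simp
  have sre: "s z $ i0 = of_real (Re (s z $ i0))" "Re (s z $ i0) \<ge> 0" if "z \<in> vbox j R \<delta>0" for z
    using hermitian_ip_simps(13,14)[OF ip[OF that], of "s z"] HS[OF that] by (simp_all add: complex_eq_iff)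
  have SW': "S \<zeta> $ i0 = of_real (W \<zeta>)" and W0: "W \<zeta> \<ge> 0" for \<zeta>
    using sre[OF ax[OF cl_in \<delta>0]] by (simp_all add: S_def W_def)
  have Wb: "W \<zeta> = Re (s (axis j \<zeta>) $ i0)" if "(cmod \<zeta>)\<^sup>2 \<le> b" for \<zeta>
    using cl_id[OF that] by (simp add: W_def S_def)
  define K where "K = {z :: complex^'n. (cmod (z $ j))\<^sup>2 \<le> b \<and> (\<forall>k. k \<noteq> j \<longrightarrow> \<bar>Re (z $ k)\<bar> \<le> \<delta>0 / 2 \<and> \<bar>Im (z $ k)\<bar> \<le> \<delta>0 / 2)}"
  have K: "compact K" unfolding K_def by (rule compact_vbox_core)
  have Kv: "K \<subseteq> vbox j R \<delta>0"
  proof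
    fix z assume z: "z \<in> K"
    have "cmod (z $ j) \<le> sqrt b" using z by (intro real_le_rsqrt) (simp add: K_def)
    then show "z \<in> vbox j R \<delta>0" using z rb \<delta>0 abs_Re_le_cmod[of "z $ j"] abs_Im_le_cmod[of "z $ j"]
      by (force simp: vbox_def K_def)
  qed
  \<comment> \<open>On a compact core of the box, uniform continuity compares \<open>z\<close> with
    its projection \<open>axis j (z $ j)\<close> to the line, where both quantities equal
    \<open>W (z $ j)\<close>.\<close>
  have near: "\<exists>\<delta>1>0. \<delta>1 \<le> \<delta>0 \<and> (\<forall>z\<in>vbox j R \<delta>1. (cmod (z $ j))\<^sup>2 \<le> b \<longrightarrow>
      Re (H z (S (z $ j)) (S (z $ j))) \<le> W (z $ j) + \<epsilon> \<and> Re (s z $ i0) \<le> W (z $ j) + \<epsilon>)" if \<epsilon>: "\<epsilon> > 0" for \<epsilon>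
  proof -
    have cSj: "continuous_on K (\<lambda>z. S (z $ j))"
      by (rule continuous_on_compose2[OF cS]) (auto intro!: continuous_intros)
    have "continuous_on K (\<lambda>z. H z (S (z $ j)) (S (z $ j)))"
      by (rule continuous_on_hermitian[where D = K and H = H and x = "\<lambda>z. S (z $ j)" and y = "\<lambda>z. S (z $ j)", OF ip continuous_on_subset[OF cH Kv] cSj cSj])
        (use Kv in auto)
    from continuous_on_Re[OF this] have c1: "continuous_on K (\<lambda>z. Re (H z (S (z $ j)) (S (z $ j))))" .
    have c2: "continuous_on K (\<lambda>z. Re (s z $ i0))"
      by (intro continuous_intros continuous_on_subset[OF s(1) Kv])
    have "uniformly_continuous_on K (\<lambda>z. Re (H z (S (z $ j)) (S (z $ j))))" "uniformly_continuous_on K (\<lambda>z. Re (s z $ i0))"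
      by (rule compact_uniformly_continuous[OF c1 K] compact_uniformly_continuous[OF c2 K])+
    then obtain d1 d2 where d: "d1 > 0" "d2 > 0"
      "\<And>z z'. z \<in> K \<Longrightarrow> z' \<in> K \<Longrightarrow> dist z' z < d1 \<Longrightarrow> dist (Re (H z' (S (z' $ j)) (S (z' $ j)))) (Re (H z (S (z $ j)) (S (z $ j)))) < \<epsilon>"
      "\<And>z z'. z \<in> K \<Longrightarrow> z' \<in> K \<Longrightarrow> dist z' z < d2 \<Longrightarrow> dist (Re (s z' $ i0)) (Re (s z $ i0)) < \<epsilon>"
      unfolding uniformly_continuous_on_def using \<epsilon> by metis
    define n where "n = real CARD('n)"
    have n: "n > 0" by (simp add: n_def)
    \<comment> \<open>In a box of transversal width \<open>\<delta>1\<close> the distance to the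
      line is at most \<open>2 * n * \<delta>1\<close>; the factor \<open>4 * n\<close> makes this
      strictly smaller than \<open>d1\<close> and \<open>d2\<close>.\<close>
    define \<delta>1 where "\<delta>1 = min (\<delta>0 / 2) (min d1 d2 / (4 * n))"
    have \<delta>1: "\<delta>1 > 0" "\<delta>1 \<le> \<delta>0 / 2" "2 * n * \<delta>1 < d1" "2 * n * \<delta>1 < d2"
    proof -
      have "\<delta>1 \<le> min d1 d2 / (4 * n)" by (simp add: \<delta>1_def)
      then have "4 * n * \<delta>1 \<le> min d1 d2" using n by (simp add: field_simps)
      moreover have p: "\<delta>1 > 0" using \<delta>0 d n by (simp add: \<delta>1_def)
      moreover have "n * \<delta>1 > 0" using n p by simp
      ultimately show "2 * n * \<delta>1 < d1" "2 * n * \<delta>1 < d2" by linarith+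
      show "\<delta>1 > 0" "\<delta>1 \<le> \<delta>0 / 2" using p by (auto simp: \<delta>1_def)
    qed
    have "Re (H z (S (z $ j)) (S (z $ j))) \<le> W (z $ j) + \<epsilon> \<and> Re (s z $ i0) \<le> W (z $ j) + \<epsilon>"
      if z: "z \<in> vbox j R \<delta>1" "(cmod (z $ j))\<^sup>2 \<le> b" for z
    proof -
      let ?z = "axis j (z $ j) :: complex^'n"
      have zK: "z \<in> K" using z \<delta>1 by (force simp: K_def vbox_def)
      have zK': "?z \<in> K" using z \<delta>0 by (auto simp: K_def axis_def)
      have "norm (z - ?z) \<le> (\<Sum>k\<in>UNIV. cmod ((z - ?z) $ k))" by (rule norm_le_sum_vec)
      also have "\<dots> \<le> (\<Sum>k\<in>(UNIV :: 'n set). 2 * \<delta>1)"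
      proof (rule sum_mono)
        fix k
        show "cmod ((z - ?z) $ k) \<le> 2 * \<delta>1"
        proof (cases "k = j")
          case False
          then have "\<bar>Re (z $ k)\<bar> < \<delta>1" "\<bar>Im (z $ k)\<bar> < \<delta>1" using z(1) by (auto simp: vbox_def)
          then show ?thesis using cmod_le[of "z $ k"] False by (simp add: axis_def)
        qed (use \<delta>1 in simp)
      qed
      also have "\<dots> = 2 * n * \<delta>1" by (simp add: n_def)
      finally have "dist z ?z < d1" "dist z ?z < d2" using \<delta>1 by (auto simp: dist_norm)
      moreover have e: "S (?z $ j) = s ?z" using cl_id[OF z(2)] by (simp add: S_def)
      moreover have "Re (s ?z $ i0) = W (z $ j)" using Wb[OF z(2)] by simp
      ultimately have "Re (H z (S (z $ j)) (S (z $ j))) < Re (H ?z (s ?z) (s ?z)) + \<epsilon>" "Re (s z $ i0) < W (z $ j) + \<epsilon>"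
        using d(3)[OF zK' zK] d(4)[OF zK' zK] by (auto simp: dist_real_def)
      then show ?thesis using HS[of ?z] zK' Kv \<open>Re (s ?z $ i0) = W (z $ j)\<close> by auto
    qed
    then show ?thesis using \<delta>1 \<delta>0 by (intro exI[of _ \<delta>1]) auto
  qed
  define T where "T \<zeta> = (cmod \<zeta>)\<^sup>2" for \<zeta>
  define Bc where "Bc \<zeta> = cutoff a b (T \<zeta>)" for \<zeta>
  have cT: "continuous_on UNIV T" unfolding T_def by (intro continuous_intros)
  have "continuous_on UNIV (cutoff a b)" using B'(1) by (intro continuous_at_imp_continuous_on ballI DERIV_isCont)
  from continuous_on_compose2[OF this cT] have cB: "continuous_on UNIV Bc" by (simp add: Bc_def[abs_def])
  have cB': "continuous_on UNIV (\<lambda>\<zeta>. B' (T \<zeta>))" using continuous_on_compose2[OF B'(2) cT] by simp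
  have B0: "Bc \<zeta> = 0" "B' (T \<zeta>) = 0" if "(cmod \<zeta>)\<^sup>2 \<ge> b" for \<zeta>
    using cutoff_0[OF ab(2)] B'(4) that by (simp_all add: Bc_def T_def)
  have key: "0 \<le> (LINT \<zeta>|lborel. W \<zeta> * (exp (- N * T \<zeta>) * (T \<zeta> * (B' (T \<zeta>) - N * Bc \<zeta>)\<^sup>2 - N * (Bc \<zeta>)\<^sup>2)))" if N: "N > 0" for N
  proof -
    define fX where "fX \<zeta> = N * exp (- N * T \<zeta>) * (Bc \<zeta>)\<^sup>2" for \<zeta>
    define fY where "fY \<zeta> = T \<zeta> * exp (- N * T \<zeta>) * (B' (T \<zeta>) - N * Bc \<zeta>)\<^sup>2" for \<zeta>
    have cf: "continuous_on UNIV fX" "continuous_on UNIV fY"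
      unfolding fX_def fY_def by (intro continuous_intros cT cB cB')+
    have i: "integrable lborel fX" "integrable lborel fY" "integrable lborel (\<lambda>\<zeta>. fX \<zeta> * W \<zeta>)" "integrable lborel (\<lambda>\<zeta>. fY \<zeta> * W \<zeta>)"
      by (rule radial_integrable[where b = b]; (intro continuous_intros cf cW)?; simp add: fX_def fY_def B0)+
    define X Y X1 Y1 where "X = (LINT \<zeta>|lborel. fX \<zeta> * W \<zeta>)" and "Y = (LINT \<zeta>|lborel. fY \<zeta> * W \<zeta>)"
      and "X1 = integral\<^sup>L lborel fX" and "Y1 = integral\<^sup>L lborel fY"
    have spl: "(LINT \<zeta>|lborel. fX \<zeta> * (W \<zeta> + \<epsilon>)) = X + X1 * \<epsilon>" "(LINT \<zeta>|lborel. fY \<zeta> * (W \<zeta> + \<epsilon>)) = Y + Y1 * \<epsilon>" for \<epsilon>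
      using i by (simp_all add: distrib_left X_def Y_def X1_def Y1_def)
    let ?n = "real CARD('n)" and ?m = "2 * (CARD('n) - 1)"
    have e1: "\<kappa> ^ ?m * X \<le> 1 / 2 * exp (2 * N * ?n * \<delta>\<^sup>2) * (Y + Y1 * \<epsilon>) + 1 / 2 * (X + X1 * \<epsilon>)"
      if \<kappa>: "0 < \<kappa>" "\<kappa> < 1" and \<epsilon>: "\<epsilon> > 0" and \<delta>: "0 < \<delta>" "\<delta> \<le> \<delta>0"
        and nb: "\<forall>z\<in>vbox j R \<delta>. (cmod (z $ j))\<^sup>2 \<le> b \<longrightarrow>
      Re (H z (S (z $ j)) (S (z $ j))) \<le> W (z $ j) + \<epsilon> \<and> Re (s z $ i0) \<le> W (z $ j) + \<epsilon>" for \<kappa> \<epsilon> \<delta>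
    proof -
      note sub = vbox_mono[OF \<delta>(2), of j R]
      have near2: "(cmod (v $ i0))\<^sup>2 \<le> Re (H z v v) * (W (z $ j) + \<epsilon>)" if z: "z \<in> vbox j R \<delta>" "(cmod (z $ j))\<^sup>2 \<le> b" for z v
      proof -
        have z0: "z \<in> vbox j R \<delta>0" using z(1) sub by auto
        have "(cmod (v $ i0))\<^sup>2 \<le> Re (H z v v) * Re (s z $ i0)"
          using hermitian_ip_CS[OF ip[OF z0], of v "s z"] s(2)[OF z0] by simp
        also have "\<dots> \<le> Re (H z v v) * (W (z $ j) + \<epsilon>)"
          using nb z hermitian_ip_simps(14)[OF ip[OF z0]] by (intro mult_left_mono) auto
        finally show ?thesis .
      qed
      have "\<kappa> ^ ?m * (LINT \<zeta>|lborel. fX \<zeta> * W \<zeta>) \<le> 1 / 2 * exp (2 * N * ?n * \<delta>\<^sup>2) * (LINT \<zeta>|lborel. fY \<zeta> * (W \<zeta> + \<epsilon>))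
          + 1 / 2 * (LINT \<zeta>|lborel. fX \<zeta> * (W \<zeta> + \<epsilon>))"
        unfolding fX_def fY_def T_def Bc_def
        by (rule local_estimate_fixed[where H = H and S = S and ?i0.0 = i0 and j = j and R = R, OF R \<delta>(1) ab N \<kappa> less_imp_le[OF \<epsilon>] opt[OF \<delta>]
           ip continuous_on_subset[OF cH sub] cS cW W0 SW' _ near2 B'(1,2,4)]) (use sub nb in auto)
      then show ?thesis by (simp only: spl X_def[symmetric])
    qed
    \<comment> \<open>With \<open>\<epsilon>\<close> fixed, boxes smaller than
      \<open>\<delta>1\<close> are all admissible, and letting \<open>\<delta>\<close> tend to 0
      removes the transversal part of the weight. Then \<open>\<epsilon>\<close> and
      \<open>\<kappa>\<close> go to their limits.\<close>
    have e2: "\<kappa> ^ ?m * X \<le> 1 / 2 * (Y + Y1 * \<epsilon>) + 1 / 2 * (X + X1 * \<epsilon>)" if \<kappa>: "0 < \<kappa>" "\<kappa> < 1" and \<epsilon>: "\<epsilon> > 0" for \<kappa> \<epsilon>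
    proof -
      obtain \<delta>1 where d1: "\<delta>1 > 0" "\<delta>1 \<le> \<delta>0" "\<forall>z\<in>vbox j R \<delta>1. (cmod (z $ j))\<^sup>2 \<le> b \<longrightarrow>
      Re (H z (S (z $ j)) (S (z $ j))) \<le> W (z $ j) + \<epsilon> \<and> Re (s z $ i0) \<le> W (z $ j) + \<epsilon>" using near[OF \<epsilon>] by blast
      have "((\<lambda>\<delta>. 1 / 2 * exp (2 * N * ?n * \<delta>\<^sup>2) * (Y + Y1 * \<epsilon>) + 1 / 2 * (X + X1 * \<epsilon>)) \<longlongrightarrow>
          1 / 2 * exp (2 * N * ?n * 0\<^sup>2) * (Y + Y1 * \<epsilon>) + 1 / 2 * (X + X1 * \<epsilon>)) (at_right 0)" by (intro tendsto_intros)
      then have "\<kappa> ^ ?m * X \<le> 1 / 2 * exp (2 * N * ?n * 0\<^sup>2) * (Y + Y1 * \<epsilon>) + 1 / 2 * (X + X1 * \<epsilon>)"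
      proof (rule tendsto_lowerbound)
        show "\<forall>\<^sub>F \<delta> in at_right 0. \<kappa> ^ ?m * X \<le> 1 / 2 * exp (2 * N * ?n * \<delta>\<^sup>2) * (Y + Y1 * \<epsilon>) + 1 / 2 * (X + X1 * \<epsilon>)"
          unfolding eventually_at_right_field
        proof (intro exI[of _ \<delta>1] conjI d1 allI impI)
          fix \<delta> assume "0 < \<delta>" "\<delta> < \<delta>1"
          then show "\<kappa> ^ ?m * X \<le> 1 / 2 * exp (2 * N * ?n * \<delta>\<^sup>2) * (Y + Y1 * \<epsilon>) + 1 / 2 * (X + X1 * \<epsilon>)"
            using d1 vbox_mono[of \<delta> \<delta>1 j R] by (intro e1[OF \<kappa> \<epsilon>]) auto
        qed
      qed simp
      then show ?thesis by simp
    qed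
    have e3: "\<kappa> ^ ?m * X \<le> 1 / 2 * Y + 1 / 2 * X" if \<kappa>: "0 < \<kappa>" "\<kappa> < 1" for \<kappa>
    proof -
      have "((\<lambda>\<epsilon>. 1 / 2 * (Y + Y1 * \<epsilon>) + 1 / 2 * (X + X1 * \<epsilon>)) \<longlongrightarrow> 1 / 2 * (Y + Y1 * 0) + 1 / 2 * (X + X1 * 0)) (at_right 0)"
        by (intro tendsto_intros)
      then have "\<kappa> ^ ?m * X \<le> 1 / 2 * (Y + Y1 * 0) + 1 / 2 * (X + X1 * 0)"
      proof (rule tendsto_lowerbound)
        show "\<forall>\<^sub>F \<epsilon> in at_right 0. \<kappa> ^ ?m * X \<le> 1 / 2 * (Y + Y1 * \<epsilon>) + 1 / 2 * (X + X1 * \<epsilon>)"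
          unfolding eventually_at_right_field by (intro exI[of _ 1] conjI zero_less_one allI impI) (rule e2[OF \<kappa>])
      qed simp
      then show ?thesis by simp
    qed
    have "((\<lambda>\<kappa>. \<kappa> ^ ?m * X) \<longlongrightarrow> 1 ^ ?m * X) (at_left 1)" by (intro tendsto_intros)
    then have "1 ^ ?m * X \<le> 1 / 2 * Y + 1 / 2 * X"
    proof (rule tendsto_upperbound)
      show "\<forall>\<^sub>F \<kappa> in at_left 1. \<kappa> ^ ?m * X \<le> 1 / 2 * Y + 1 / 2 * X"
        unfolding eventually_at_left_field by (intro exI[of _ 0] conjI zero_less_one allI impI) (rule e3)
    qed simp
    \<comment> \<open>Half of \<open>X\<close> on the right is absorbed by the left-hand side. This
      is the point where the constant 1 of the optimal estimate is needed.\<close>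
    then have "0 \<le> Y - X" by simp
    also have "Y - X = (LINT \<zeta>|lborel. fY \<zeta> * W \<zeta> - fX \<zeta> * W \<zeta>)" unfolding X_def Y_def using i by simp
    also have "\<dots> = (LINT \<zeta>|lborel. W \<zeta> * (exp (- N * T \<zeta>) * (T \<zeta> * (B' (T \<zeta>) - N * Bc \<zeta>)\<^sup>2 - N * (Bc \<zeta>)\<^sup>2)))"
      by (intro Bochner_Integration.integral_cong refl) (simp add: fX_def fY_def algebra_simps)
    finally show ?thesis .
  qed
  have key2: "0 \<le> integral (sq_box R) (\<lambda>z. W z * (exp (- N * (cmod z)\<^sup>2) *
        ((cmod z)\<^sup>2 * (B' ((cmod z)\<^sup>2) - N * cutoff a b ((cmod z)\<^sup>2))\<^sup>2 - N * (cutoff a b ((cmod z)\<^sup>2))\<^sup>2)))" if N: "N \<ge> 1" for N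
  proof -
    let ?f = "\<lambda>\<zeta>. W \<zeta> * (exp (- N * T \<zeta>) * (T \<zeta> * (B' (T \<zeta>) - N * Bc \<zeta>)\<^sup>2 - N * (Bc \<zeta>)\<^sup>2))"
    have "integrable lborel ?f"
      by (rule radial_integrable[where b = b]; (intro continuous_intros cW cT cB cB')?; simp add: B0)
    then have ib: "integral\<^sup>L lborel ?f = integral UNIV ?f" by (rule integral_lborel[symmetric])
    have fe: "?f = (\<lambda>\<zeta>. if \<zeta> \<in> sq_box R then ?f \<zeta> else 0)"
    proof
      fix \<zeta>
      have "(cmod \<zeta>)\<^sup>2 \<ge> b" if "\<zeta> \<notin> sq_box R"
      proof (rule ccontr)
        assume "\<not> (cmod \<zeta>)\<^sup>2 \<ge> b"
        then have "cmod \<zeta> \<le> sqrt b" by (intro real_le_rsqrt) simp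
        then show False using that rb abs_Re_le_cmod[of \<zeta>] abs_Im_le_cmod[of \<zeta>] by (auto simp: mem_sq_box)
      qed
      then show "?f \<zeta> = (if \<zeta> \<in> sq_box R then ?f \<zeta> else 0)" using B0[of \<zeta>] by auto
    qed
    have "integral UNIV ?f = integral (sq_box R) ?f" by (rule integral_restrict_UNIV[of "sq_box R" ?f, folded fe])
    then have "0 \<le> integral (sq_box R) ?f" using key[of N] N ib by simp
    then show ?thesis by (simp only: T_def Bc_def)
  qed
  have W00: "W 0 = Re (s 0 $ i0)"
  proof -
    have ax0: "axis j (0::complex) = (0 :: complex^'n)" by (simp add: vec_eq_iff axis_def)
    have "W 0 = Re (s (axis j 0) $ i0)" by (rule Wb) (use b in simp)
    then show ?thesis unfolding ax0 .
  qed
  show False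
  proof (rule gaussian_touching_contradiction[where w = W and B = "cutoff a b" and B' = B' and a = a and b = b and R = R and \<epsilon> = \<epsilon>0])
    show "W z \<le> W 0 * exp (- \<epsilon>0 * (cmod z)\<^sup>2)" if "(cmod z)\<^sup>2 \<le> b" for z
      using touch[OF that] Wb[OF that] W00 by simp
    show "0 < W 0" using W00 pos by simp
  qed (use cW W0 \<epsilon>0 ab R B' key2 cutoff_1[OF ab(2)] cutoff_0[OF ab(2)] cutoff_bounds[OF ab(2)] in auto)
qed

section \<open>Holomorphic functions and charts\<close>

lemma bounded_linear_axis: "bounded_linear (\<lambda>c :: complex. axis k c :: complex^'n::finite)"
  by (rule linear_conv_bounded_linear[THEN iffD1]) (auto simp: linear_iff vec_eq_iff axis_def)

lemma mholomorphic_on_const: "mholomorphic_on (\<lambda>_. c) D"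
  unfolding mholomorphic_on_def by (auto intro!: exI[of _ "\<lambda>_. 0"])

lemma mholomorphic_on_nth: "mholomorphic_on (\<lambda>z :: complex^'n::finite. z $ k) D"
  unfolding mholomorphic_on_def
  by (auto intro!: exI[of _ "\<lambda>v. v $ k"] bounded_linear.has_derivative[OF bounded_linear_vec_nth] has_derivative_ident)

lemma mholomorphic_on_add:
  assumes "mholomorphic_on f D" "mholomorphic_on g D"
  shows "mholomorphic_on (\<lambda>z. f z + g z) D"
  unfolding mholomorphic_on_def
proof
  fix z assume "z \<in> D"
  then obtain f' g' where *: "(f has_derivative f') (at z)" "\<And>c v. f' (c *s v) = c * f' v"
    "(g has_derivative g') (at z)" "\<And>c v. g' (c *s v) = c * g' v"
    using assms unfolding mholomorphic_on_def by blast
  show "\<exists>h'. ((\<lambda>z. f z + g z) has_derivative h') (at z) \<and> (\<forall>c v. h' (c *s v) = c * h' v)"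
    by (intro exI[of _ "\<lambda>v. f' v + g' v"] conjI has_derivative_add *) (simp add: * distrib_left)
qed

lemma mholomorphic_on_mult:
  assumes "mholomorphic_on f D" "mholomorphic_on g D"
  shows "mholomorphic_on (\<lambda>z. f z * g z) D"
  unfolding mholomorphic_on_def
proof
  fix z assume "z \<in> D"
  then obtain f' g' where *: "(f has_derivative f') (at z)" "\<And>c v. f' (c *s v) = c * f' v"
    "(g has_derivative g') (at z)" "\<And>c v. g' (c *s v) = c * g' v"
    using assms unfolding mholomorphic_on_def by blast
  show "\<exists>h'. ((\<lambda>z. f z * g z) has_derivative h') (at z) \<and> (\<forall>c v. h' (c *s v) = c * h' v)"
    by (intro exI[of _ "\<lambda>v. f z * g' v + f' v * g z"] conjI has_derivative_mult *) (simp add: * algebra_simps)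
qed

lemma mholomorphic_on_field_comp:
  assumes f: "mholomorphic_on f D" and h: "\<And>z. z \<in> D \<Longrightarrow> h field_differentiable (at (f z))"
  shows "mholomorphic_on (\<lambda>z. h (f z)) D"
  unfolding mholomorphic_on_def
proof
  fix z assume z: "z \<in> D"
  obtain f' where *: "(f has_derivative f') (at z)" "\<And>c v. f' (c *s v) = c * f' v"
    using f z unfolding mholomorphic_on_def by blast
  obtain d where d: "(h has_derivative (*) d) (at (f z))"
    using h[OF z] by (auto simp: field_differentiable_def has_field_derivative_def)
  show "\<exists>h'. ((\<lambda>z. h (f z)) has_derivative h') (at z) \<and> (\<forall>c v. h' (c *s v) = c * h' v)"
    by (intro exI[of _ "\<lambda>v. d * f' v"] conjI has_derivative_compose[OF *(1) d]) (simp add: *)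
qed

lemma mholomorphic_on_inverse:
  "mholomorphic_on f D \<Longrightarrow> (\<And>z. z \<in> D \<Longrightarrow> f z \<noteq> 0) \<Longrightarrow> mholomorphic_on (\<lambda>z. inverse (f z)) D"
  by (rule mholomorphic_on_field_comp[where h = inverse])
    (auto simp: field_differentiable_def intro!: exI DERIV_inverse)

lemma mholomorphic_on_subset: "mholomorphic_on f T \<Longrightarrow> D \<subseteq> T \<Longrightarrow> mholomorphic_on f D"
  unfolding mholomorphic_on_def by blast

lemma mholomorphic_on_transform:
  assumes f: "mholomorphic_on f D" and D: "open D" and eq: "\<And>z. z \<in> D \<Longrightarrow> f z = g z"
  shows "mholomorphic_on g D"
  unfolding mholomorphic_on_def
proof
  fix z assume z: "z \<in> D"
  then obtain f' where *: "(f has_derivative f') (at z)" "\<forall>c v. f' (c *s v) = c * f' v"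
    using f unfolding mholomorphic_on_def by blast
  then show "\<exists>h'. (g has_derivative h') (at z) \<and> (\<forall>c v. h' (c *s v) = c * h' v)"
    using has_derivative_transform_within_open[OF *(1) D z eq] by blast
qed

lemma mholomorphic_on_compose:
  fixes F :: "complex^'m::finite \<Rightarrow> complex^'n::finite"
  assumes F: "\<And>k. mholomorphic_on (\<lambda>z. F z $ k) D" and f: "mholomorphic_on f T" and FT: "F ` D \<subseteq> T"
  shows "mholomorphic_on (\<lambda>z. f (F z)) D"
  unfolding mholomorphic_on_def
proof
  fix z assume z: "z \<in> D"
  have "\<exists>F'. \<forall>k. ((\<lambda>z. F z $ k) has_derivative F' k) (at z) \<and> (\<forall>c v. F' k (c *s v) = c * F' k v)"
    using F z unfolding mholomorphic_on_def by (intro choice) blast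
  then obtain F' where F': "\<And>k. ((\<lambda>z. F z $ k) has_derivative F' k) (at z)" "\<And>k c v. F' k (c *s v) = c * F' k v" by blast
  have e: "(\<Sum>k\<in>UNIV. axis k (x $ k)) = x" for x :: "complex^'n"
    by (simp add: vec_eq_iff axis_def if_distrib sum.If_cases cong del: if_weak_cong)
  have "((\<lambda>z. \<Sum>k\<in>UNIV. axis k (F z $ k) :: complex^'n) has_derivative (\<lambda>v. \<Sum>k\<in>UNIV. axis k (F' k v))) (at z)"
    by (intro has_derivative_sum bounded_linear.has_derivative[OF bounded_linear_axis] F')
  then have dF: "(F has_derivative (\<lambda>v. \<Sum>k\<in>UNIV. axis k (F' k v))) (at z)" unfolding e .
  obtain f' where f': "(f has_derivative f') (at (F z))" "\<And>c v. f' (c *s v) = c * f' v"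
    using f FT z unfolding mholomorphic_on_def by blast
  have "(\<Sum>k\<in>UNIV. axis k (F' k (c *s v))) = c *s (\<Sum>k\<in>UNIV. axis k (F' k v) :: complex^'n)" for c v
    unfolding F'(2) by (auto simp: vec_eq_iff sum_distrib_left axis_def intro!: sum.cong)
  then show "\<exists>h'. ((\<lambda>z. f (F z)) has_derivative h') (at z) \<and> (\<forall>c v. h' (c *s v) = c * h' v)"
    using has_derivative_compose[OF dF f'(1)] f'(2) by (intro exI[of _ "\<lambda>v. f' (\<Sum>k\<in>UNIV. axis k (F' k v))"]) auto
qed

lemma mholomorphic_on_continuous: "mholomorphic_on f D \<Longrightarrow> continuous_on D f"
  unfolding mholomorphic_on_def
  by (intro continuous_at_imp_continuous_on ballI) (blast intro: has_derivative_continuous)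

lemma continuous_on_nth_iff: "continuous_on D F \<longleftrightarrow> (\<forall>k. continuous_on D (\<lambda>z. F z $ k))"
  for F :: "_ \<Rightarrow> complex^'n::finite"
proof
  assume "\<forall>k. continuous_on D (\<lambda>z. F z $ k)"
  then have "continuous_on D (\<lambda>z. \<chi> k. F z $ k)" by (intro continuous_on_vec_lambda) auto
  then show "continuous_on D F" by simp
qed (auto intro: continuous_intros)

section \<open>Charts of the manifold and boxes inside them\<close>

lemma chart_inj: "is_chart X (V, \<phi>) \<Longrightarrow> inj_on \<phi> V"
  using openin_subset[of X V]
  by (auto simp: is_chart_def homeomorphic_eq_everything_map topspace_subtopology Int_absorb1)

lemma chart_open_image:
  assumes c: "is_chart X (V, \<phi>)" and W: "openin X W"
  shows "open (\<phi> ` (W \<inter> V))"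
proof -
  have "open_map (subtopology X V) (top_of_set (\<phi> ` V)) \<phi>" "open (\<phi> ` V)"
    using c by (auto simp: is_chart_def homeomorphic_eq_everything_map)
  moreover have "openin (subtopology X V) (W \<inter> V)" using W by (auto simp: openin_subtopology)
  ultimately show ?thesis unfolding open_map_def using openin_open_trans by blast
qed

lemma chart_continuous:
  assumes "is_chart X (V, \<phi>)"
  shows "continuous_map (subtopology X V) euclidean \<phi>"
  using assms by (auto simp: is_chart_def homeomorphic_eq_everything_map continuous_map_in_subtopology)

lemma chart_open_preimage:
  assumes c: "is_chart X (V, \<phi>)" and T: "open T"
  shows "openin X {x \<in> V. \<phi> x \<in> T}"
proof -
  have V: "openin X V" using c by (simp add: is_chart_def)
  have "openin (subtopology X V) {x \<in> topspace (subtopology X V). \<phi> x \<in> T}"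
    by (rule openin_continuous_map_preimage[OF chart_continuous[OF c]]) (use T in simp)
  moreover have "topspace (subtopology X V) = V" using openin_subset[OF V] by (simp add: topspace_subtopology Int_absorb1)
  ultimately show ?thesis using openin_trans_full V by metis
qed

lemma chart_inv_continuous:
  assumes c: "is_chart X (V, \<phi>)"
  shows "continuous_map (top_of_set (\<phi> ` V)) (subtopology X V) (inv_into V \<phi>)"
proof -
  have V: "V \<subseteq> topspace X" using c openin_subset by (auto simp: is_chart_def)
  obtain g where g: "homeomorphic_maps (subtopology X V) (top_of_set (\<phi> ` V)) \<phi> g"
    using c by (auto simp: is_chart_def homeomorphic_map_maps)
  then have "continuous_map (top_of_set (\<phi> ` V)) (subtopology X V) g" "\<And>x. x \<in> V \<Longrightarrow> g (\<phi> x) = x"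
    using V by (auto simp: homeomorphic_maps_def topspace_subtopology Int_absorb1)
  moreover have "inv_into V \<phi> z = g z" if "z \<in> \<phi> ` V" for z
    using that calculation(2) chart_inj[OF c] by auto
  ultimately show ?thesis by (auto intro: continuous_map_eq)
qed

lemma continuous_on_chart:
  assumes c: "is_chart X (V, \<phi>)" and f: "continuous_map (subtopology X T) euclidean f" and D: "D \<subseteq> \<phi> ` (T \<inter> V)"
  shows "continuous_on D (\<lambda>z. f (inv_into V \<phi> z))"
proof -
  have i: "inv_into V \<phi> z \<in> T \<inter> V" if "z \<in> D" for z using that D chart_inj[OF c] by auto
  have "continuous_map (top_of_set (\<phi> ` V)) X (inv_into V \<phi>)"
    using chart_inv_continuous[OF c] by (simp add: continuous_map_in_subtopology)
  then have "continuous_map (subtopology (top_of_set (\<phi> ` V)) D) X (inv_into V \<phi>)" by (rule continuous_map_from_subtopology)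
  moreover have "subtopology (top_of_set (\<phi> ` V)) D = top_of_set D"
    using D by (auto simp: subtopology_subtopology intro!: arg_cong2[where f = subtopology])
  ultimately have "continuous_map (top_of_set D) (subtopology X T) (inv_into V \<phi>)"
    using i by (intro continuous_map_into_subtopology) auto
  from continuous_map_compose[OF this f] show ?thesis by (simp add: o_def)
qed

text \<open>Optimality is available on Stein coordinate neighbourhoods only. The locale cuts such a
  neighbourhood out of a chart of \<open>A\<close>: \<open>L\<close> is a holomorphic change of
  coordinates with inverse \<open>S\<close>, which will straighten a complex line, and the domain is
  the preimage of a box in the new coordinates.\<close>

locale box_chart =
  fixes X :: "'a topology" and A :: "('a, 'n::finite) chart set" and V :: "'a set" and \<phi> :: "'a \<Rightarrow> complex^'n"
    and L S :: "complex^'n \<Rightarrow> complex^'n" and \<rho> :: "'n \<Rightarrow> real"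
  assumes man: "complex_manifold X A" and VA: "(V, \<phi>) \<in> A"
    and LS: "L (S z) = z" "S (L z) = z"
    and mL: "mholomorphic_on (\<lambda>z. L z $ k) UNIV" and mS: "mholomorphic_on (\<lambda>z. S z $ k) UNIV"
    and \<rho>: "\<rho> k > 0"
    and sub: "S ` {z. \<forall>k. \<bar>Re (z $ k)\<bar> < \<rho> k \<and> \<bar>Im (z $ k)\<bar> < \<rho> k} \<subseteq> \<phi> ` V"
begin

definition "P = {z :: complex^'n. \<forall>k. \<bar>Re (z $ k)\<bar> < \<rho> k \<and> \<bar>Im (z $ k)\<bar> < \<rho> k}"
definition "cdom = {x \<in> V. L (\<phi> x) \<in> P}"
definition "\<psi> x = L (\<phi> x)"
definition "inv\<psi> z = inv_into V \<phi> (S z)"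

lemma charts: "c \<in> A \<Longrightarrow> is_chart X c" "c \<in> A \<Longrightarrow> c' \<in> A \<Longrightarrow> charts_compatible c c'"
  using man by (auto simp: complex_manifold_def)

lemma ch: "is_chart X (V, \<phi>)" using charts VA by blast

lemma cL: "continuous_on UNIV L" and cS: "continuous_on UNIV S"
  using mholomorphic_on_continuous[OF mL] mholomorphic_on_continuous[OF mS] by (simp_all add: continuous_on_nth_iff)

lemma open_P: "open P"
proof -
  have "P = (\<Inter>k\<in>UNIV. {z. \<bar>Re (z $ k)\<bar> < \<rho> k} \<inter> {z. \<bar>Im (z $ k)\<bar> < \<rho> k})" by (auto simp: P_def)
  then show ?thesis by (auto intro!: open_INT open_Int open_Collect_less continuous_intros)
qed

lemma connected_P: "connected P"
proof (rule convex_connected, rule convexI)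
  fix x y :: "complex^'n" and u v :: real assume *: "x \<in> P" "y \<in> P" "0 \<le> u" "0 \<le> v" "u + v = 1"
  have b: "\<bar>u * a + v * c\<bar> < r" if "\<bar>a\<bar> < r" "\<bar>c\<bar> < r" for a c r
    using convex_bound_lt[of a r c u v] convex_bound_lt[of "- a" r "- c" u v] that * by (auto simp: abs_less_iff)
  show "u *\<^sub>R x + v *\<^sub>R y \<in> P"
    using * b unfolding P_def by (simp only: mem_Collect_eq vector_add_component vector_scaleR_component
      plus_complex.sel scaleR_complex.sel) blast
qed

lemma inv\<psi>_in: "z \<in> P \<Longrightarrow> inv\<psi> z \<in> cdom" "z \<in> P \<Longrightarrow> \<psi> (inv\<psi> z) = z" "z \<in> P \<Longrightarrow> \<phi> (inv\<psi> z) = S z"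
  and inv\<psi>_\<psi>: "x \<in> cdom \<Longrightarrow> inv\<psi> (\<psi> x) = x" and \<psi>_in: "x \<in> cdom \<Longrightarrow> \<psi> x \<in> P" and cdomV: "cdom \<subseteq> V"
proof -
  have "S z \<in> \<phi> ` V" if "z \<in> P" for z using that sub by (auto simp: P_def)
  then have *: "inv\<psi> z \<in> V" "\<phi> (inv\<psi> z) = S z" if "z \<in> P" for z
    using that by (auto simp: inv\<psi>_def f_inv_into_f inv_into_into)
  then show "z \<in> P \<Longrightarrow> inv\<psi> z \<in> cdom" "z \<in> P \<Longrightarrow> \<psi> (inv\<psi> z) = z" "z \<in> P \<Longrightarrow> \<phi> (inv\<psi> z) = S z"
    by (auto simp: cdom_def \<psi>_def LS)
  show "x \<in> cdom \<Longrightarrow> inv\<psi> (\<psi> x) = x" "x \<in> cdom \<Longrightarrow> \<psi> x \<in> P" "cdom \<subseteq> V"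
    using chart_inj[OF ch] by (auto simp: cdom_def \<psi>_def inv\<psi>_def LS)
qed

lemma \<psi>_image: "\<psi> ` cdom = P" using inv\<psi>_in(1,2) \<psi>_in by (intro equalityI subsetI) (auto, metis imageI)

lemma inv\<psi>_image: "inv\<psi> ` P = cdom" using inv\<psi>_in(1) inv\<psi>_\<psi> \<psi>_in by (intro equalityI subsetI) (auto, metis imageI)

lemma inv_into_\<psi>: "z \<in> P \<Longrightarrow> inv_into cdom \<psi> z = inv\<psi> z"
  by (rule inv_into_f_eq[OF inj_on_inverseI[of cdom inv\<psi> \<psi>]]) (auto simp: inv\<psi>_in inv\<psi>_\<psi>)

lemma openin_cdom: "openin X cdom"
proof -
  have "open (L -` P)" using continuous_open_preimage[OF cL open_UNIV open_P] by simp
  from chart_open_preimage[OF ch this] show ?thesis by (simp add: cdom_def)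
qed

lemma inv\<psi>_continuous: "continuous_map (top_of_set P) X inv\<psi>"
proof -
  have "continuous_map (top_of_set P) (top_of_set (\<phi> ` V)) S"
    using continuous_on_subset[OF cS subset_UNIV] sub
    by (intro continuous_map_into_subtopology) (auto simp: P_def[symmetric])
  from continuous_map_compose[OF this chart_inv_continuous[OF ch]]
  show ?thesis by (simp add: continuous_map_in_subtopology o_def inv\<psi>_def[abs_def])
qed

lemma is_chart: "is_chart X (cdom, \<psi>)"
proof -
  have top: "topspace (subtopology X cdom) = cdom" using openin_subset[OF openin_cdom] by (simp add: topspace_subtopology Int_absorb1)
  have "continuous_map (subtopology X V) euclidean \<psi>"
    using continuous_map_compose[OF chart_continuous[OF ch], of euclidean L] cL by (simp add: o_def \<psi>_def[abs_def])
  then have "continuous_map (subtopology X cdom) euclidean \<psi>"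
    by (rule continuous_map_from_subtopology_mono) (rule cdomV)
  then have "homeomorphic_maps (subtopology X cdom) (top_of_set P) \<psi> inv\<psi>"
    unfolding homeomorphic_maps_def using inv\<psi>_continuous inv\<psi>_in inv\<psi>_\<psi> \<psi>_in top
    by (auto simp: continuous_map_in_subtopology)
  then show ?thesis using openin_cdom open_P homeomorphic_maps_imp_map
    unfolding is_chart_def by (auto simp: \<psi>_image)
qed

lemma hol_pull:
  assumes f: "mholomorphic_on f T" and W: "W \<subseteq> V" "\<phi> ` W \<subseteq> T"
  shows "hol_function_on A W (\<lambda>x. f (\<phi> x))"
  unfolding hol_function_on_def
proof clarify
  fix V' \<phi>' assume c: "(V', \<phi>') \<in> A"
  have m: "mholomorphic_on (\<lambda>z. \<phi> (inv_into V' \<phi>' z) $ k) (\<phi>' ` (V \<inter> V'))" for k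
    using charts(2)[OF VA c] by (auto simp: charts_compatible_def)
  show "mholomorphic_on (\<lambda>z. f (\<phi> (inv_into V' \<phi>' z))) (\<phi>' ` (W \<inter> V'))"
    by (rule mholomorphic_on_compose[OF mholomorphic_on_subset[OF m] f])
      (use W chart_inj[OF charts(1)[OF c]] in auto)
qed

lemma hol_pull_\<psi>:
  assumes f: "mholomorphic_on f UNIV"
  shows "hol_function_on A cdom (\<lambda>x. f (\<psi> x))"
  unfolding \<psi>_def by (rule hol_pull[where T = UNIV, OF mholomorphic_on_compose[OF mL f]]) (auto simp: cdomV)

lemma hol_push:
  assumes f: "hol_function_on A cdom f"
  shows "mholomorphic_on (\<lambda>z. f (inv\<psi> z)) P"
proof -
  have "mholomorphic_on (\<lambda>z. f (inv_into V \<phi> z)) (\<phi> ` (cdom \<inter> V))" using f VA by (auto simp: hol_function_on_def)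
  from mholomorphic_on_compose[OF mholomorphic_on_subset[OF mS] this, of P]
  show ?thesis using inv\<psi>_in(1,3) cdomV unfolding inv\<psi>_def by (force simp: image_subset_iff)
qed

lemma holomorphic_chart: "holomorphic_chart X A (cdom, \<psi>)"
  unfolding holomorphic_chart_def
proof (intro conjI is_chart ballI)
  fix c assume c: "c \<in> A"
  obtain V' \<phi>' where cc: "c = (V', \<phi>')" by (cases c)
  have V': "openin X V'" using charts(1)[OF c] by (simp add: is_chart_def cc)
  show "charts_compatible (cdom, \<psi>) c" unfolding cc charts_compatible_def prod.case
  proof (intro conjI allI)
    fix k
    let ?D = "\<psi> ` (cdom \<inter> V')"
    have m: "mholomorphic_on (\<lambda>z. \<phi>' (inv_into V \<phi> z) $ k) (\<phi> ` (V \<inter> V'))"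
      using charts(2)[OF VA c] by (auto simp: charts_compatible_def cc)
    have DP: "?D \<subseteq> P" using \<psi>_in by auto
    have "S ` ?D \<subseteq> \<phi> ` (V \<inter> V')" using cdomV by (auto simp: \<psi>_def LS)
    from mholomorphic_on_compose[OF mholomorphic_on_subset[OF mS] m this]
    have "mholomorphic_on (\<lambda>z. \<phi>' (inv\<psi> z) $ k) ?D" by (simp add: inv\<psi>_def)
    moreover have "open ?D" using chart_open_image[OF is_chart V'] by (simp add: Int_commute)
    ultimately show "mholomorphic_on (\<lambda>z. \<phi>' (inv_into cdom \<psi> z) $ k) ?D"
      by (rule mholomorphic_on_transform) (use DP inv_into_\<psi> in auto)
    show "mholomorphic_on (\<lambda>z. \<psi> (inv_into V' \<phi>' z) $ k) (\<phi>' ` (cdom \<inter> V'))"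
      using hol_pull_\<psi>[OF mholomorphic_on_nth[of k]] c by (auto simp: hol_function_on_def cc)
  qed
qed

lemma cdom_nonempty: "cdom \<noteq> {}"
proof -
  have "0 \<in> P" using \<rho> by (simp add: P_def)
  then show ?thesis using inv\<psi>_in(1) by blast
qed

lemma connectedin_cdom: "connectedin X cdom"
proof -
  have "connectedin (top_of_set P) P" using connected_P by (simp add: connectedin_subtopology)
  from connectedin_continuous_map_image[OF inv\<psi>_continuous this] show ?thesis by (simp add: inv\<psi>_image)
qed

text \<open>The hull of a compact set stays in a smaller closed box, since the moduli of
  \<open>exp(\<plusminus>\<psi>\<^sub>k)\<close> and \<open>exp(\<plusminus>i\<psi>\<^sub>k)\<close> control the real and imaginary parts of \<open>\<psi>\<^sub>k\<close>.\<close>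

lemma stein_cdom: "stein_open X A cdom"
  unfolding stein_open_def
proof (intro conjI allI impI ballI openin_cdom)
  fix x y assume xy: "x \<in> cdom" "y \<in> cdom" "x \<noteq> y"
  then have "\<psi> x \<noteq> \<psi> y" using inv\<psi>_\<psi> by metis
  then obtain k where "\<psi> x $ k \<noteq> \<psi> y $ k" by (auto simp: vec_eq_iff)
  then show "\<exists>f. hol_function_on A cdom f \<and> f x \<noteq> f y" using hol_pull_\<psi>[OF mholomorphic_on_nth[of k]] by blast
next
  fix K assume K: "compactin X K \<and> K \<subseteq> cdom"
  define K1 where "K1 = \<psi> ` K"
  have "continuous_map (subtopology X cdom) euclidean \<psi>" by (rule chart_continuous[OF is_chart])
  moreover have "compactin (subtopology X cdom) K" using K by (simp add: compactin_subtopology)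
  ultimately have K1: "compact K1" unfolding K1_def using image_compactin by fastforce
  have K1P: "K1 \<subseteq> P" using K \<psi>_in by (auto simp: K1_def)
  have "\<exists>r<\<rho> k. \<forall>z\<in>K1. \<bar>Re (z $ k)\<bar> \<le> r \<and> \<bar>Im (z $ k)\<bar> \<le> r" for k
  proof (cases "K1 = {}")
    case True
    then show ?thesis by (auto intro: lt_ex)
  next
    case False
    have "continuous_on K1 (\<lambda>z. max \<bar>Re (z $ k)\<bar> \<bar>Im (z $ k)\<bar>)" by (intro continuous_intros)
    from continuous_attains_sup[OF K1 False this] obtain z where z: "z \<in> K1"
      "\<And>y. y \<in> K1 \<Longrightarrow> max \<bar>Re (y $ k)\<bar> \<bar>Im (y $ k)\<bar> \<le> max \<bar>Re (z $ k)\<bar> \<bar>Im (z $ k)\<bar>" by blast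
    then show ?thesis using K1P by (intro exI[of _ "max \<bar>Re (z $ k)\<bar> \<bar>Im (z $ k)\<bar>"]) (fastforce simp: P_def)
  qed
  then obtain r where r: "\<And>k. r k < \<rho> k" "\<And>k z. z \<in> K1 \<Longrightarrow> \<bar>Re (z $ k)\<bar> \<le> r k \<and> \<bar>Im (z $ k)\<bar> \<le> r k" by metis
  define Q where "Q = {z :: complex^'n. \<forall>k. \<bar>Re (z $ k)\<bar> \<le> r k \<and> \<bar>Im (z $ k)\<bar> \<le> r k}"
  have QP: "Q \<subseteq> P" unfolding Q_def P_def using r(1) le_less_trans by blast
  have cQ: "closed Q"
  proof -
    have "Q = (\<Inter>k\<in>UNIV. {z. \<bar>Re (z $ k)\<bar> \<le> r k} \<inter> {z. \<bar>Im (z $ k)\<bar> \<le> r k})" by (auto simp: Q_def)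
    then show ?thesis by (auto intro!: closed_INT closed_Int closed_Collect_le continuous_intros)
  qed
  have bQ: "bounded Q"
  proof -
    have "norm z \<le> (\<Sum>k\<in>UNIV. 2 * r k)" if "z \<in> Q" for z
    proof (rule order.trans[OF norm_le_sum_vec sum_mono])
      fix k
      have "\<bar>Re (z $ k)\<bar> \<le> r k" "\<bar>Im (z $ k)\<bar> \<le> r k" using that by (auto simp: Q_def)
      then show "cmod (z $ k) \<le> 2 * r k" using cmod_le[of "z $ k"] by linarith
    qed
    then show ?thesis by (auto simp: bounded_iff)
  qed
  \<comment> \<open>The constraints that define the hull. Transported by the chart, each is a closed
    condition on the compact box \<open>Q\<close>, so the hull is the continuous image of the
    compact set \<open>C\<close>.\<close>
  define G where "G = {(f, M). hol_function_on A cdom f \<and> (\<forall>y\<in>K. cmod (f y) \<le> M)}"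
  define C where "C = Q \<inter> (\<Inter>p\<in>G. {z \<in> Q. cmod (fst p (inv\<psi> z)) \<le> snd p})"
  have "closed {z \<in> Q. cmod (fst p (inv\<psi> z)) \<le> snd p}" if "p \<in> G" for p
    using that continuous_on_subset[OF mholomorphic_on_continuous[OF hol_push] QP] cQ
    by (auto simp: G_def intro!: continuous_on_closed_Collect_le continuous_intros)
  then have "closed C" unfolding C_def using cQ by (intro closed_Int closed_INT) auto
  moreover have "bounded C" by (rule bounded_subset[OF bQ]) (auto simp: C_def)
  ultimately have C: "compact C" by (simp add: compact_eq_bounded_closed)
  have inQ: "\<psi> x \<in> Q" if x: "x \<in> hol_hull A cdom K" for x
  proof -
    have bd: "Re (c * \<psi> x $ k) \<le> r k" if c: "c \<in> {1, -1, \<i>, -\<i>}" for c k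
    proof -
      have m: "mholomorphic_on (\<lambda>z :: complex^'n. exp (c * z $ k)) UNIV"
        by (intro mholomorphic_on_field_comp[where h = exp] mholomorphic_on_mult mholomorphic_on_const mholomorphic_on_nth
          field_differentiable_within_exp)
      have le: "cmod (exp (c * \<psi> y $ k)) \<le> exp (r k)" if "y \<in> K" for y
        using r(2)[of "\<psi> y" k] that c by (auto simp: K1_def)
      have hull: "hol_function_on A cdom f \<Longrightarrow> \<forall>y\<in>K. cmod (f y) \<le> M \<Longrightarrow> cmod (f x) \<le> M" for f M
        using x by (simp add: hol_hull_def)
      have "cmod (exp (c * \<psi> x $ k)) \<le> exp (r k)"
        by (rule hull[of "\<lambda>x. exp (c * \<psi> x $ k)" "exp (r k)"]) (use hol_pull_\<psi>[OF m] le in auto)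
      then show ?thesis by simp
    qed
    have "\<bar>Re (\<psi> x $ k)\<bar> \<le> r k \<and> \<bar>Im (\<psi> x $ k)\<bar> \<le> r k" for k
      using bd[of 1 k] bd[of "-1" k] bd[of \<i> k] bd[of "-\<i>" k] by (simp add: abs_le_iff)
    then show ?thesis by (simp add: Q_def)
  qed
  have "hol_hull A cdom K = inv\<psi> ` C"
  proof
    show "hol_hull A cdom K \<subseteq> inv\<psi> ` C"
    proof
      fix x assume x: "x \<in> hol_hull A cdom K"
      then have xd: "x \<in> cdom" by (simp add: hol_hull_def)
      have "\<psi> x \<in> C" unfolding C_def using inQ[OF x] x inv\<psi>_\<psi>[OF xd] by (auto simp: G_def hol_hull_def)
      then show "x \<in> inv\<psi> ` C" using inv\<psi>_\<psi>[OF xd] by (metis imageI)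
    qed
    show "inv\<psi> ` C \<subseteq> hol_hull A cdom K"
    proof clarify
      fix z assume z: "z \<in> C"
      then have "inv\<psi> z \<in> cdom" using QP inv\<psi>_in(1) by (auto simp: C_def)
      moreover have "cmod (f (inv\<psi> z)) \<le> M" if "hol_function_on A cdom f" "\<forall>y\<in>K. cmod (f y) \<le> M" for f M
      proof -
        have "(f, M) \<in> G" using that by (simp add: G_def)
        then have "z \<in> {z \<in> Q. cmod (fst (f, M) (inv\<psi> z)) \<le> snd (f, M)}" using z unfolding C_def by blast
        then show ?thesis by simp
      qed
      ultimately show "inv\<psi> z \<in> hol_hull A cdom K" by (simp add: hol_hull_def)
    qed
  qed
  moreover have "compactin (top_of_set P) C" using C QP by (auto simp: compactin_subtopology C_def)
  ultimately show "compactin X (hol_hull A cdom K)" using image_compactin inv\<psi>_continuous by metis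
qed

end

section \<open>Dual norms and trivializations\<close>

lemma complex_linear_expand:
  fixes m :: "complex^'r::finite \<Rightarrow> complex"
  assumes "\<And>a b. m (a + b) = m a + m b" "\<And>c a. m (c *s a) = c * m a"
  shows "m v = (\<Sum>k\<in>UNIV. v $ k * m (axis k 1))"
proof -
  have m0: "m 0 = 0" using assms(2)[of 0 0] by simp
  have s: "m (\<Sum>k\<in>I. F k) = (\<Sum>k\<in>I. m (F k))" for I and F :: "'r \<Rightarrow> complex^'r"
    by (induction I rule: infinite_finite_induct) (auto simp: m0 assms(1))
  have "m v = m (\<Sum>k\<in>UNIV. v $ k *s axis k 1)" by (simp only: basis_expansion)
  then show ?thesis by (simp only: s assms(2))
qed

definition gram :: "(complex^'r \<Rightarrow> complex^'r \<Rightarrow> complex) \<Rightarrow> complex^'r^'r::finite" where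
  "gram H = (\<chi> k l. H (axis k 1) (axis l 1))"

text \<open>The vector representing the functional \<open>v \<mapsto> \<Sum>\<^sub>k v\<^sub>k a\<^sub>k\<close>, by Cramer's rule; the formula makes
  its continuous dependence on the data visible.\<close>

definition riesz :: "(complex^'r \<Rightarrow> complex^'r \<Rightarrow> complex) \<Rightarrow> complex^'r \<Rightarrow> complex^'r::finite" where
  "riesz H a = (\<chi> k. cnj (det (\<chi> i j. if j = k then a $ i else gram H $ i $ j) / det (gram H)))"

lemma gram_mult:
  assumes h: "hermitian_ip H"
  shows "H v s = (\<Sum>k\<in>UNIV. v $ k * (gram H *v (\<chi> l. cnj (s $ l))) $ k)"
  unfolding hermitian_ip_expand[OF h, of v s]
  by (simp add: gram_def matrix_vector_mult_def sum_distrib_left mult_ac)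

lemma det_gram:
  assumes h: "hermitian_ip H"
  shows "det (gram H) \<noteq> 0"
proof -
  have "c = 0" if c: "gram H *v c = 0" for c
  proof -
    define s where "s = (\<chi> l. cnj (c $ l))"
    have "(\<chi> l. cnj (s $ l)) = c" by (simp add: s_def vec_eq_iff)
    then have "H s s = 0" using gram_mult[OF h, of s s] c by simp
    then have "s = 0" using hermitian_ip_simps(15)[OF h, of s] by simp
    then show "c = 0" by (simp add: s_def vec_eq_iff)
  qed
  then show ?thesis using matrix_left_invertible_ker[of "gram H"] by (simp add: invertible_left_inverse invertible_det_nz[symmetric])
qed

lemma riesz:
  assumes h: "hermitian_ip H"
  shows "H v (riesz H a) = (\<Sum>k\<in>UNIV. v $ k * a $ k)"
proof -
  have "gram H *v (\<chi> l. cnj (riesz H a $ l)) = a"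
    using cramer[OF det_gram[OF h], of "\<chi> l. cnj (riesz H a $ l)" a] by (simp add: riesz_def)
  then show ?thesis using gram_mult[OF h, of v "riesz H a"] by simp
qed

lemma continuous_on_det:
  assumes "\<And>i j. continuous_on D (\<lambda>z. M z $ i $ j)"
  shows "continuous_on D (\<lambda>z. det (M z :: complex^'r^'r::finite))"
  unfolding det_def by (intro continuous_intros continuous_on_prod assms)

lemma continuous_on_riesz:
  assumes ip: "\<And>z. z \<in> D \<Longrightarrow> hermitian_ip (H z)" and H: "\<And>v w. continuous_on D (\<lambda>z. H z v w)"
    and a: "continuous_on D a"
  shows "continuous_on D (\<lambda>z. riesz (H z) (a z))"
  unfolding riesz_def
proof (intro continuous_on_vec_lambda continuous_on_cnj continuous_on_divide continuous_on_det ballI det_gram ip)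
  fix i j k
  show "continuous_on D (\<lambda>z. (\<chi> i j. if j = k then a z $ i else gram (H z) $ i $ j) $ i $ j)"
    by (cases "j = k") (auto simp: gram_def intro!: continuous_intros a H)
  show "continuous_on D (\<lambda>z. gram (H z) $ i $ j)" by (simp add: gram_def H)
qed

text \<open>The metric enters only through integrals over \<open>D\<close>. This allows
  \<open>inv_into\<close> of a box chart to be replaced by the explicit inverse.\<close>

lemma L2_optimal_triple_cong:
  assumes eq: "\<And>z. z \<in> D \<Longrightarrow> H z = H' z" and opt: "L2_optimal_triple D H"
  shows "L2_optimal_triple D H'"
proof -
  have c: "(\<integral>\<^sup>+z. F (H z) z \<partial>lebesgue_on D) = (\<integral>\<^sup>+z. F (H' z) z \<partial>lebesgue_on D)" for F
    using eq by (intro nn_integral_cong) (simp add: space_restrict_space)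
  note c1 = c[of "\<lambda>h z. ennreal (Re (form_inner (\<omega> z) h (CARD('a) + 1) (B_inv (\<omega> z) h (i_ddbar \<phi> z) (f z)) (f z)) * exp (- \<phi> z) * vol_density (\<omega> z))" for \<omega> \<phi> f]
  note c2 = c[of "\<lambda>h z. ennreal (Re (form_inner (\<omega> z) h CARD('a) (u z) (u z)) * exp (- \<phi> z) * vol_density (\<omega> z))" for \<omega> \<phi> u]
  show ?thesis using opt unfolding L2_optimal_triple_def c1 c2 .
qed

section \<open>The metric and the dual norm in a trivialization\<close>

lemma triv_point_simps:
  assumes t: "is_triv X E (T, \<theta>)" and x: "x \<in> T"
  shows "triv_point E \<theta> x v \<in> fibre E x" "\<theta> (triv_point E \<theta> x v) = v" "proj E (triv_point E \<theta> x v) = x"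
    "e \<in> fibre E x \<Longrightarrow> triv_point E \<theta> x (\<theta> e) = e"
    "triv_point E \<theta> x (v + w) = fadd E (triv_point E \<theta> x v) (triv_point E \<theta> x w)"
    "triv_point E \<theta> x (c *s v) = fscale E c (triv_point E \<theta> x v)"
proof -
  have b: "bij_betw \<theta> (fibre E x) UNIV" using t x by (auto simp: is_triv_def)
  show i: "triv_point E \<theta> x v \<in> fibre E x" "\<theta> (triv_point E \<theta> x v) = v" for v
    using b unfolding triv_point_def bij_betw_def by (auto intro: inv_into_into f_inv_into_f)
  then show "proj E (triv_point E \<theta> x v) = x" by (auto simp: fibre_def)
  show inv: "triv_point E \<theta> x (\<theta> e) = e" if "e \<in> fibre E x" for e
    using b that unfolding triv_point_def bij_betw_def by simp
  have l: "fadd E a b \<in> fibre E x" "\<theta> (fadd E a b) = \<theta> a + \<theta> b" "fscale E c a \<in> fibre E x" "\<theta> (fscale E c a) = c *s \<theta> a"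
    if "a \<in> fibre E x" "b \<in> fibre E x" for a b c using t x that unfolding is_triv_def by auto
  show "triv_point E \<theta> x (v + w) = fadd E (triv_point E \<theta> x v) (triv_point E \<theta> x w)"
    using inv[OF l(1)[OF i(1) i(1)], of v w] l(2)[OF i(1) i(1), of v w] by (simp add: i(2))
  show "triv_point E \<theta> x (c *s v) = fscale E c (triv_point E \<theta> x v)"
    using inv[OF l(3)[OF i(1) i(1)], of c v] l(4)[OF i(1) i(1), of c v] by (simp add: i(2))
qed

lemma hermitian_ip_triv:
  assumes t: "is_triv X E (T, \<theta>)" and x: "x \<in> T" and h: "hermitian_metric X E h"
  shows "hermitian_ip (\<lambda>v w. h (triv_point E \<theta> x v) (triv_point E \<theta> x w))"
proof -
  have "x \<in> topspace X" using t x openin_subset by (auto simp: is_triv_def)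
  with h have h1: "\<And>a b e. a \<in> fibre E x \<Longrightarrow> b \<in> fibre E x \<Longrightarrow> e \<in> fibre E x \<Longrightarrow> h (fadd E a b) e = h a e + h b e"
    "\<And>c a e. a \<in> fibre E x \<Longrightarrow> e \<in> fibre E x \<Longrightarrow> h (fscale E c a) e = c * h a e"
    "\<And>a b. a \<in> fibre E x \<Longrightarrow> b \<in> fibre E x \<Longrightarrow> h b a = cnj (h a b)"
    "\<And>e. e \<in> fibre E x \<Longrightarrow> e \<noteq> fscale E 0 e \<Longrightarrow> Re (h e e) > 0"
    unfolding hermitian_metric_def by blast+
  note tp = triv_point_simps[OF t x]
  have "triv_point E \<theta> x v \<noteq> fscale E 0 (triv_point E \<theta> x v)" if "v \<noteq> 0" for v
    using tp(2)[of v] tp(2)[of "0 *s v"] that by (auto simp: tp(6)[symmetric])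
  then show ?thesis unfolding hermitian_ip_def tp(5,6) by (auto intro: h1 tp(1))
qed

lemma dual_norm_riesz:
  assumes t: "is_triv X E (T, \<theta>)" and x: "x \<in> T" and h: "hermitian_metric X E h"
  defines "H \<equiv> \<lambda>v w. h (triv_point E \<theta> x v) (triv_point E \<theta> x w)"
  assumes l: "\<And>v. l (triv_point E \<theta> x v) = H v s"
  shows "dual_norm E h x l = sqrt (Re (H s s))"
proof -
  note tp = triv_point_simps[OF t x]
  have ip: "hermitian_ip H" unfolding H_def by (rule hermitian_ip_triv[OF t x h])
  note hs = hermitian_ip_simps[OF ip]
  define q where "q = sqrt (Re (H s s))"
  have q: "q \<ge> 0" "q\<^sup>2 = Re (H s s)" using hs(14)[of s] by (auto simp: q_def)
  have Hs: "H s s = of_real (q\<^sup>2)" using hs(13)[of s] q by (simp add: complex_eq_iff)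
  show ?thesis unfolding dual_norm_def q_def[symmetric]
  proof (rule cSup_eq_maximum)
    \<comment> \<open>The supremum is attained at the normalized representing vector; if that vector
      has norm 0, the zero vector serves.\<close>
    define v where "v = (if q = 0 then 0 else complex_of_real (1 / q) *s s)"
    have "Re (H v v) \<le> 1" "cmod (H v s) = q"
      using q(1) by (auto simp: v_def hs Hs power2_eq_square norm_divide norm_mult)
    then show "q \<in> (\<lambda>e. cmod (l e)) ` {e \<in> fibre E x. Re (h e e) \<le> 1}"
      using tp(1)[of v] l[of v] by (intro image_eqI[of _ _ "triv_point E \<theta> x v"]) (auto simp: H_def)
  next
    fix y assume "y \<in> (\<lambda>e. cmod (l e)) ` {e \<in> fibre E x. Re (h e e) \<le> 1}"
    then obtain e where e: "e \<in> fibre E x" "Re (h e e) \<le> 1" "y = cmod (l e)" by auto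
    define v where "v = \<theta> e"
    have ev: "triv_point E \<theta> x v = e" using tp(4)[OF e(1)] by (simp add: v_def)
    have "y\<^sup>2 = (cmod (H v s))\<^sup>2" using e(3) l[of v] by (simp add: ev)
    also have "\<dots> \<le> Re (H v v) * Re (H s s)" by (rule hermitian_ip_CS[OF ip])
    also have "\<dots> \<le> 1 * Re (H s s)" using e(2) hs(14) by (intro mult_right_mono) (auto simp: H_def ev)
    finally show "y \<le> q" using q by (intro power2_le_imp_le[of y q]) auto
  qed
qed

section \<open>Holomorphic functions on the manifold and adapted trivializations\<close>

lemma hol_function_on_subset: "hol_function_on A W f \<Longrightarrow> W' \<subseteq> W \<Longrightarrow> hol_function_on A W' f"
  unfolding hol_function_on_def by (blast intro: mholomorphic_on_subset)

lemma hol_function_on_const: "hol_function_on A W (\<lambda>_. c)"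
  and hol_function_on_add: "hol_function_on A W f \<Longrightarrow> hol_function_on A W g \<Longrightarrow> hol_function_on A W (\<lambda>x. f x + g x)"
  and hol_function_on_mult: "hol_function_on A W f \<Longrightarrow> hol_function_on A W g \<Longrightarrow> hol_function_on A W (\<lambda>x. f x * g x)"
  unfolding hol_function_on_def
  by (auto intro: mholomorphic_on_const mholomorphic_on_add mholomorphic_on_mult)

lemma hol_function_on_sum:
  "(\<And>i. i \<in> I \<Longrightarrow> hol_function_on A W (F i)) \<Longrightarrow> hol_function_on A W (\<lambda>x. \<Sum>i\<in>I. F i x)"
  by (induction I rule: infinite_finite_induct) (auto intro: hol_function_on_const hol_function_on_add)

lemma manifold_charts: "complex_manifold X A \<Longrightarrow> c \<in> A \<Longrightarrow> is_chart X c"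
  by (auto simp: complex_manifold_def)

lemma chart_inv_image:
  assumes c: "is_chart X (V, \<phi>)" and z: "z \<in> \<phi> ` (W \<inter> V)"
  shows "inv_into V \<phi> z \<in> W \<inter> V \<and> \<phi> (inv_into V \<phi> z) = z"
  using z inv_into_f_f[OF chart_inj[OF c]] by auto

lemma hol_function_on_inverse:
  assumes "complex_manifold X A" "hol_function_on A W f" "\<And>x. x \<in> W \<Longrightarrow> f x \<noteq> 0"
  shows "hol_function_on A W (\<lambda>x. inverse (f x))"
  unfolding hol_function_on_def
proof clarify
  fix V \<phi> assume c: "(V, \<phi>) \<in> A"
  show "mholomorphic_on (\<lambda>z. inverse (f (inv_into V \<phi> z))) (\<phi> ` (W \<inter> V))"
    by (rule mholomorphic_on_inverse)
      (use assms c chart_inv_image[OF manifold_charts[OF assms(1) c], of _ W] in \<open>auto simp: hol_function_on_def\<close>)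
qed

lemma hol_function_on_cong:
  assumes m: "complex_manifold X A" and W: "openin X W" and f: "hol_function_on A W f" and eq: "\<And>x. x \<in> W \<Longrightarrow> f x = g x"
  shows "hol_function_on A W g"
  unfolding hol_function_on_def
proof clarify
  fix V \<phi> assume c: "(V, \<phi>) \<in> A"
  note ch = manifold_charts[OF m c]
  have "mholomorphic_on (\<lambda>z. f (inv_into V \<phi> z)) (\<phi> ` (W \<inter> V))" using f c by (auto simp: hol_function_on_def)
  then show "mholomorphic_on (\<lambda>z. g (inv_into V \<phi> z)) (\<phi> ` (W \<inter> V))"
    by (rule mholomorphic_on_transform[OF _ chart_open_image[OF ch W]]) (use eq chart_inv_image[OF ch, of _ W] in auto)
qed

text \<open>A nowhere vanishing section of the dual bundle becomes a coordinate of a trivialization, so that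
  its squared dual norm is a coordinate of the vector that represents it.\<close>

definition put_functional :: "'r \<Rightarrow> complex^'r \<Rightarrow> complex^'r \<Rightarrow> complex^'r::finite" where
  "put_functional i0 b v = (\<chi> i. if i = i0 then \<Sum>k\<in>UNIV. v $ k * b $ k else v $ i)"

text \<open>The inverse of \<open>put_functional\<close> in \<open>v\<close>. Difference and
  quotient are spelled with \<open>- 1\<close> and \<open>inverse\<close> so that the closure rules
  for sums, products and inverses of holomorphic functions apply.\<close>

definition solve_functional :: "'r \<Rightarrow> complex^'r \<Rightarrow> complex^'r \<Rightarrow> complex^'r::finite" where
  "solve_functional i0 b w =
     (\<chi> i. if i = i0 then (w $ i0 + (- 1) * (\<Sum>k\<in>UNIV - {i0}. w $ k * b $ k)) * inverse (b $ i0) else w $ i)"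

lemma put_solve_functional:
  assumes "b $ i0 \<noteq> 0"
  shows "put_functional i0 b (solve_functional i0 b w) = w" "solve_functional i0 b (put_functional i0 b v) = v"
  using assms by (auto simp: vec_eq_iff put_functional_def solve_functional_def sum.remove[of UNIV i0] mult.assoc)

definition frame_with :: "('a, 'e, 'r::finite) vbundle \<Rightarrow> ('e \<Rightarrow> complex^'r) \<Rightarrow> ('a \<Rightarrow> complex^'r) \<Rightarrow> 'r \<Rightarrow> 'e \<Rightarrow> complex^'r" where
  "frame_with E \<theta> a i0 e = put_functional i0 (a (proj E e)) (\<theta> e)"

lemma hol_solve_functional:
  assumes m: "complex_manifold X A" and a: "\<And>k. hol_function_on A W (\<lambda>x. a x $ k)" and nz: "\<And>x. x \<in> W \<Longrightarrow> a x $ i0 \<noteq> 0"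
  shows "hol_function_on A W (\<lambda>x. solve_functional i0 (a x) v $ k)"
proof (cases "k = i0")
  case True
  have "hol_function_on A W (\<lambda>x. (v $ i0 + (- 1) * (\<Sum>k\<in>UNIV - {i0}. v $ k * a x $ k)) * inverse (a x $ i0))"
    by (intro hol_function_on_mult hol_function_on_add hol_function_on_sum hol_function_on_const a hol_function_on_inverse[OF m] nz)
  then show ?thesis using True by (simp add: solve_functional_def)
qed (simp add: solve_functional_def hol_function_on_const)

text \<open>On each fibre the old coordinates are changed by a matrix with holomorphic entries that
  alters only the coordinate \<open>i0\<close>. It is invertible because \<open>a x $ i0\<close> has
  no zeros, and its inverse is again holomorphic.\<close>

lemma frame_with:
  assumes m: "complex_manifold X A" and vb: "holomorphic_vector_bundle X A E" and T: "(T, \<theta>) \<in> trivs E"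
    and W: "openin X W" "W \<subseteq> T" and a: "\<And>k. hol_function_on A W (\<lambda>x. a x $ k)" and nz: "\<And>x. x \<in> W \<Longrightarrow> a x $ i0 \<noteq> 0"
  defines "\<theta>' \<equiv> frame_with E \<theta> a i0"
  shows "is_triv X E (W, \<theta>')" and "x \<in> W \<Longrightarrow> triv_point E \<theta>' x v = triv_point E \<theta> x (solve_functional i0 (a x) v)"
    and "holomorphic_triv X A E (W, \<theta>')"
proof -
  have tr: "is_triv X E t" if "t \<in> trivs E" for t using vb that by (auto simp: holomorphic_vector_bundle_def)
  note tp = triv_point_simps[OF tr[OF T]]
  have th: "\<theta>' e = put_functional i0 (a x) (\<theta> e)" if "e \<in> fibre E x" for e x
    using that by (simp add: \<theta>'_def frame_with_def fibre_def)
  show t': "is_triv X E (W, \<theta>')" unfolding is_triv_def prod.case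
  proof (intro conjI W(1) ballI allI)
    fix x assume x: "x \<in> W"
    then have xT: "x \<in> T" using W by auto
    have f: "fadd E e e' \<in> fibre E x" "\<theta> (fadd E e e') = \<theta> e + \<theta> e'" "fscale E c e \<in> fibre E x" "\<theta> (fscale E c e) = c *s \<theta> e"
      if "e \<in> fibre E x" "e' \<in> fibre E x" for c e e'
      using tr[OF T] xT that unfolding is_triv_def by auto
    show "bij_betw \<theta>' (fibre E x) UNIV"
      by (rule bij_betw_byWitness[where f' = "\<lambda>v. triv_point E \<theta> x (solve_functional i0 (a x) v)"])
        (auto simp: th[where x = x] tp[OF xT] put_solve_functional[of "a x" i0] nz[OF x])
    fix e e' c assume e: "e \<in> fibre E x"
    show "fscale E c e \<in> fibre E x" using f(3)[OF e e] .
    show "\<theta>' (fscale E c e) = c *s \<theta>' e" unfolding th[OF f(3)[OF e e]] th[OF e] f(4)[OF e e]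
      by (auto simp: put_functional_def vec_eq_iff sum_distrib_left mult_ac)
    assume e': "e' \<in> fibre E x"
    show "fadd E e e' \<in> fibre E x" using f(1)[OF e e'] .
    show "\<theta>' (fadd E e e') = \<theta>' e + \<theta>' e'" unfolding th[OF f(1)[OF e e']] th[OF e] th[OF e'] f(2)[OF e e']
      by (auto simp: put_functional_def vec_eq_iff sum.distrib[symmetric] distrib_right)
  qed
  show tp': "triv_point E \<theta>' x v = triv_point E \<theta> x (solve_functional i0 (a x) v)" if x: "x \<in> W" for x v
  proof -
    have xT: "x \<in> T" using x W by auto
    let ?e = "triv_point E \<theta> x (solve_functional i0 (a x) v)"
    have "\<theta>' ?e = v" unfolding th[OF tp(1)[OF xT]] by (simp add: tp(2)[OF xT] put_solve_functional nz[OF x])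
    then show ?thesis using triv_point_simps(4)[OF t' x tp(1)[OF xT]] by metis
  qed
  show "holomorphic_triv X A E (W, \<theta>')" unfolding holomorphic_triv_def
  proof (intro conjI t' ballI)
    fix t' assume t': "t' \<in> trivs E"
    obtain T' \<tau> where tt: "t' = (T', \<tau>)" by (cases t')
    note trT = tr[OF t', unfolded tt]
    note tq = triv_point_simps[OF trT]
    have o: "openin X (W \<inter> T')" using W trT by (auto simp: is_triv_def)
    have "trivs_compatible A E (T, \<theta>) (T', \<tau>)" using vb T t' unfolding holomorphic_vector_bundle_def tt by blast
    then have cc: "hol_function_on A (T \<inter> T') (\<lambda>x. \<tau> (triv_point E \<theta> x v) $ j)"
        "hol_function_on A (T \<inter> T') (\<lambda>x. \<theta> (triv_point E \<tau> x v) $ j)" for v j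
      by (auto simp: trivs_compatible_def)
    have sub: "W \<inter> T' \<subseteq> T \<inter> T'" using W(2) by auto
    note c = hol_function_on_subset[OF cc(1) sub] hol_function_on_subset[OF cc(2) sub]
    have aW: "hol_function_on A (W \<inter> T') (\<lambda>x. a x $ k)" for k by (rule hol_function_on_subset[OF a]) auto
    show "trivs_compatible A E (W, \<theta>') t'" unfolding tt trivs_compatible_def prod.case
    proof (intro allI conjI)
      fix v j
      show "hol_function_on A (W \<inter> T') (\<lambda>x. \<tau> (triv_point E \<theta>' x v) $ j)"
      proof (rule hol_function_on_cong[OF m o])
        show "hol_function_on A (W \<inter> T') (\<lambda>x. \<Sum>k\<in>UNIV. solve_functional i0 (a x) v $ k * \<tau> (triv_point E \<theta> x (axis k 1)) $ j)"
          by (intro hol_function_on_sum hol_function_on_mult c hol_solve_functional[OF m aW] nz) auto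
        fix x assume x: "x \<in> W \<inter> T'"
        then have xT: "x \<in> T" using W by auto
        have "\<And>e e'. e \<in> fibre E x \<Longrightarrow> e' \<in> fibre E x \<Longrightarrow> \<tau> (fadd E e e') = \<tau> e + \<tau> e'"
          "\<And>c e. e \<in> fibre E x \<Longrightarrow> \<tau> (fscale E c e) = c *s \<tau> e"
          using trT x unfolding is_triv_def by auto
        \<comment> \<open>Compatibility of trivializations speaks of constant vectors, while the
          vector \<open>solve_functional i0 (a x) v\<close> varies with \<open>x\<close>; linearity
          of \<open>\<tau>\<close> on the fibres reduces the latter to the former.\<close>
        then have ex: "\<tau> (triv_point E \<theta> x w) $ j = (\<Sum>k\<in>UNIV. w $ k * \<tau> (triv_point E \<theta> x (axis k 1)) $ j)" for w
          using tp(1)[OF xT] by (intro complex_linear_expand[where m = "\<lambda>w. \<tau> (triv_point E \<theta> x w) $ j"]) (simp_all add: tp(5,6)[OF xT])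
        show "(\<Sum>k\<in>UNIV. solve_functional i0 (a x) v $ k * \<tau> (triv_point E \<theta> x (axis k 1)) $ j) = \<tau> (triv_point E \<theta>' x v) $ j"
          by (simp only: tp'[OF IntD1[OF x]] ex[of "solve_functional i0 (a x) v"])
      qed
      show "hol_function_on A (W \<inter> T') (\<lambda>x. \<theta>' (triv_point E \<tau> x v) $ j)"
      proof (rule hol_function_on_cong[OF m o])
        show "hol_function_on A (W \<inter> T') (\<lambda>x. if j = i0 then \<Sum>k\<in>UNIV. \<theta> (triv_point E \<tau> x v) $ k * a x $ k else \<theta> (triv_point E \<tau> x v) $ j)"
          using c(2) aW by (cases "j = i0") (auto intro!: hol_function_on_sum hol_function_on_mult)
        show "(if j = i0 then \<Sum>k\<in>UNIV. \<theta> (triv_point E \<tau> x v) $ k * a x $ k else \<theta> (triv_point E \<tau> x v) $ j) = \<theta>' (triv_point E \<tau> x v) $ j"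
          if "x \<in> W \<inter> T'" for x
          using th[OF tq(1)] that by (auto simp: put_functional_def)
      qed
    qed
  qed
qed

section \<open>From optimality to the mean value inequality\<close>

locale optimal_bundle =
  fixes X :: "'a topology" and A :: "('a, 'n::finite) chart set" and E :: "('a, 'e, 'r::finite) vbundle" and h :: "'e \<Rightarrow> 'e \<Rightarrow> complex"
  assumes man: "complex_manifold X A" and vb: "holomorphic_vector_bundle X A E" and hm: "hermitian_metric X E h"
    and cm: "continuous_metric X E h" and l2: "L2_optimal_metric X A E h"
begin

lemma trivs: "t \<in> trivs E \<Longrightarrow> is_triv X E t" and triv_at: "x \<in> topspace X \<Longrightarrow> \<exists>T \<theta>. (T, \<theta>) \<in> trivs E \<and> x \<in> T"
  using vb by (auto simp: holomorphic_vector_bundle_def) (metis UN_E fst_conv surj_pair)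

lemma metric_continuous:
  assumes VA: "(V, \<phi>) \<in> A" and T: "(T, \<theta>) \<in> trivs E" and D: "D \<subseteq> \<phi> ` (T \<inter> V)"
  shows "continuous_on D (\<lambda>z. h (triv_point E \<theta> (inv_into V \<phi> z) v) (triv_point E \<theta> (inv_into V \<phi> z) w))"
  by (rule continuous_on_chart[OF manifold_charts[OF man VA] _ D]) (use cm T in \<open>auto simp: continuous_metric_def\<close>)

definition coeffs :: "('a \<Rightarrow> 'e \<Rightarrow> complex) \<Rightarrow> ('e \<Rightarrow> complex^'r) \<Rightarrow> 'a \<Rightarrow> complex^'r" where
  "coeffs u \<theta> x = (\<chi> k. u x (triv_point E \<theta> x (axis k 1)))"

lemma section_expand:
  assumes sec: "hol_dual_section A E U u" and T: "(T, \<theta>) \<in> trivs E" and x: "x \<in> U" "x \<in> T"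
  shows "u x (triv_point E \<theta> x v) = (\<Sum>k\<in>UNIV. v $ k * coeffs u \<theta> x $ k)"
proof -
  note tp = triv_point_simps[OF trivs[OF T] x(2)]
  have "\<And>a b. a \<in> fibre E x \<Longrightarrow> b \<in> fibre E x \<Longrightarrow> u x (fadd E a b) = u x a + u x b"
    "\<And>a c. a \<in> fibre E x \<Longrightarrow> u x (fscale E c a) = c * u x a"
    using sec x by (auto simp: hol_dual_section_def)
  then show ?thesis using tp(1)
    by (subst complex_linear_expand[where m = "\<lambda>v. u x (triv_point E \<theta> x v)"]) (simp_all add: tp(5,6) coeffs_def)
qed

lemma coeffs_hol:
  assumes sec: "hol_dual_section A E U u" and T: "(T, \<theta>) \<in> trivs E"
  shows "hol_function_on A (U \<inter> T) (\<lambda>x. coeffs u \<theta> x $ k)"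
  using sec T by (auto simp: hol_dual_section_def coeffs_def)

lemma dual_norm_section:
  assumes sec: "hol_dual_section A E U u" and T: "(T, \<theta>) \<in> trivs E" and x: "x \<in> U" "x \<in> T"
  defines "H \<equiv> \<lambda>v w. h (triv_point E \<theta> x v) (triv_point E \<theta> x w)"
  shows "dual_norm E h x (u x) = sqrt (Re (H (riesz H (coeffs u \<theta> x)) (riesz H (coeffs u \<theta> x))))"
proof -
  have "hermitian_ip H" unfolding H_def by (rule hermitian_ip_triv[OF trivs[OF T] x(2) hm])
  from riesz[OF this] show ?thesis unfolding H_def
    by (intro dual_norm_riesz[OF trivs[OF T] x(2) hm]) (simp add: section_expand[OF sec T x])
qed

text \<open>Continuity is local, and over a trivialization the dual norm is the norm of the Riesz
  vector, which depends continuously on the metric and on the coefficients of the section.\<close>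

lemma dual_norm_continuous:
  assumes VA: "(V, \<phi>) \<in> A" and U: "openin X U" and sec: "hol_dual_section A E U u"
  shows "continuous_on (\<phi> ` (U \<inter> V)) (\<lambda>z. dual_norm E h (inv_into V \<phi> z) (u (inv_into V \<phi> z)))"
proof (intro continuous_at_imp_continuous_on ballI)
  fix z0 assume z0: "z0 \<in> \<phi> ` (U \<inter> V)"
  note ch = manifold_charts[OF man VA]
  have "inv_into V \<phi> z0 \<in> topspace X" using chart_inv_image[OF ch z0] openin_subset[OF U] by auto
  then obtain T \<theta> where T: "(T, \<theta>) \<in> trivs E" "inv_into V \<phi> z0 \<in> T" using triv_at by blast
  define D where "D = \<phi> ` ((U \<inter> T) \<inter> V)"
  have oT: "openin X T" using trivs[OF T(1)] by (simp add: is_triv_def)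
  have oD: "open D" unfolding D_def by (rule chart_open_image[OF ch openin_Int[OF U oT]])
  have zD: "z0 \<in> D" using chart_inv_image[OF ch z0] T(2) unfolding D_def by (metis IntD1 IntD2 IntI image_eqI)
  have inD: "inv_into V \<phi> z \<in> U" "inv_into V \<phi> z \<in> T" if "z \<in> D" for z
    using chart_inv_image[OF ch that[unfolded D_def]] by auto
  define H where "H z = (\<lambda>v w. h (triv_point E \<theta> (inv_into V \<phi> z) v) (triv_point E \<theta> (inv_into V \<phi> z) w))" for z
  define s where "s z = riesz (H z) (coeffs u \<theta> (inv_into V \<phi> z))" for z
  have ip: "hermitian_ip (H z)" if "z \<in> D" for z
    unfolding H_def by (rule hermitian_ip_triv[OF trivs[OF T(1)] inD(2)[OF that] hm])
  have cH: "continuous_on D (\<lambda>z. H z v w)" for v w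
    unfolding H_def by (rule metric_continuous[OF VA T(1)]) (auto simp: D_def)
  have ca: "continuous_on D (\<lambda>z. coeffs u \<theta> (inv_into V \<phi> z))" unfolding continuous_on_nth_iff
    using coeffs_hol[OF sec T(1)] VA by (auto simp: hol_function_on_def D_def intro!: mholomorphic_on_continuous)
  have cs: "continuous_on D s" unfolding s_def by (rule continuous_on_riesz[OF ip cH ca])
  have "continuous_on D (\<lambda>z. H z (s z) (s z))"
    by (rule continuous_on_hermitian[where D = D and H = H and x = s and y = s, OF ip cH cs cs])
  from continuous_on_real_sqrt[OF continuous_on_Re[OF this]]
  have "continuous_on D (\<lambda>z. dual_norm E h (inv_into V \<phi> z) (u (inv_into V \<phi> z)))"
    by (rule continuous_on_eq) (simp add: dual_norm_section[OF sec T(1) inD] H_def s_def)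
  then show "isCont (\<lambda>z. dual_norm E h (inv_into V \<phi> z) (u (inv_into V \<phi> z))) z0"
    using continuous_on_eq_continuous_at[OF oD] zD by blast
qed

end

context optimal_bundle
begin

text \<open>The line is straightened to a coordinate axis, and the section is multiplied by a
  holomorphic function of the coordinate along the line whose modulus cancels the harmonic term of
  \<open>touch\<close>. In a trivialization that has this new section as its coordinate
  \<open>i0\<close>, the squared norm is touched by a pure Gaussian, which
  \<open>no_local_touching\<close> excludes.\<close>

lemma no_touching_disc:
  fixes c w :: "complex^'n" and q :: "complex poly"
  assumes VA: "(V, \<phi>) \<in> A" and U: "openin X U" and sec: "hol_dual_section A E U u"
  defines "g \<equiv> \<lambda>z. dual_norm E h (inv_into V \<phi> z) (u (inv_into V \<phi> z))"
  assumes w: "w \<noteq> 0" and r: "r > 0" and \<epsilon>: "\<epsilon> > 0" and c: "c \<in> \<phi> ` (U \<inter> V)" and pos: "g c > 0"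
    and touch: "\<And>\<zeta>. cmod \<zeta> \<le> r \<Longrightarrow> g (c + \<zeta> *s w) \<le> g c * exp (Re (poly q \<zeta>) - Re (poly q 0) - \<epsilon> * (cmod \<zeta>)\<^sup>2)"
  shows False
proof -
  let ?i = "inv_into V \<phi>"
  note ch = manifold_charts[OF man VA]
  obtain j where j: "w $ j \<noteq> 0" using w by (auto simp: vec_eq_iff)
  \<comment> \<open>\<open>S\<close>, defined below, carries the axis \<open>j\<close> to the line
    through \<open>c\<close> in the direction \<open>w\<close>. \<open>L\<close> is its inverse,
    found by solving for the coordinate \<open>j\<close>, where \<open>w\<close> does not vanish.
    Both are affine.\<close>
  define L :: "complex^'n \<Rightarrow> complex^'n" where "L z = (\<chi> k. if k = j then (z $ j + (- c $ j)) * inverse (w $ j)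
      else (z $ k + (- c $ k)) + (- w $ k) * ((z $ j + (- c $ j)) * inverse (w $ j)))" for z
  define S :: "complex^'n \<Rightarrow> complex^'n" where "S z = (\<chi> k. c $ k + (if k = j then z $ j * w $ j else z $ k + z $ j * w $ k))" for z
  have LS: "L (S z) = z" "S (L z) = z" for z using j by (auto simp: L_def S_def vec_eq_iff mult.assoc)
  have mL: "mholomorphic_on (\<lambda>z. L z $ k) UNIV" for k
    unfolding L_def vec_lambda_beta
    by (cases "k = j"; simp only: if_True if_False simp_thms;
      intro mholomorphic_on_add mholomorphic_on_mult mholomorphic_on_const mholomorphic_on_nth)
  have mS: "mholomorphic_on (\<lambda>z. S z $ k) UNIV" for k
    unfolding S_def vec_lambda_beta
    by (cases "k = j"; simp only: if_True if_False simp_thms;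
      intro mholomorphic_on_add mholomorphic_on_mult mholomorphic_on_const mholomorphic_on_nth)
  have Sax: "S (axis j \<zeta>) = c + \<zeta> *s w" for \<zeta> by (auto simp: S_def vec_eq_iff axis_def)
  have ax0: "axis j (0::complex) = (0 :: complex^'n)" by (simp add: vec_eq_iff axis_def)
  have S0: "S 0 = c" using Sax[of 0] ax0 by (simp add: vec_eq_iff)
  have cS: "continuous_on UNIV S" using mholomorphic_on_continuous[OF mS] by (simp add: continuous_on_nth_iff)
  have ic: "?i c \<in> U" "?i c \<in> V" "\<phi> (?i c) = c" using chart_inv_image[OF ch c] by auto
  obtain T \<theta> where T: "(T, \<theta>) \<in> trivs E" "?i c \<in> T" using triv_at[of "?i c"] ic(1) openin_subset[OF U] by blast
  note tr = trivs[OF T(1)]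
  have oUT: "openin X (U \<inter> T)" using U tr by (auto simp: is_triv_def)
  define a where "a = coeffs u \<theta>"
  \<comment> \<open>A positive dual norm at \<open>c\<close> means a nonzero functional, so some
    coefficient can be divided by near \<open>c\<close>; it determines which coordinate is
    exchanged.\<close>
  have "\<exists>i0. a (?i c) $ i0 \<noteq> 0"
  proof (rule ccontr)
    assume "\<not> ?thesis"
    then have "a (?i c) = 0" by (simp add: vec_eq_iff)
    then have u0: "u (?i c) (triv_point E \<theta> (?i c) v) = 0" for v
      using section_expand[OF sec T(1) ic(1) T(2), of v] by (simp add: a_def)
    note ip = hermitian_ip_simps[OF hermitian_ip_triv[OF tr T(2) hm]]
    have "g c = 0" unfolding g_def
      by (subst dual_norm_riesz[OF tr T(2) hm, of _ 0]) (simp_all add: u0 ip)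
    then show False using pos by simp
  qed
  then obtain i0 where i0: "a (?i c) $ i0 \<noteq> 0" by blast
  define \<Omega>0 where "\<Omega>0 = \<phi> ` ((U \<inter> T) \<inter> V)"
  have \<Omega>0: "open \<Omega>0" unfolding \<Omega>0_def by (rule chart_open_image[OF ch oUT])
  have ca: "continuous_on \<Omega>0 (\<lambda>z. a (?i z) $ i0)"
    using coeffs_hol[OF sec T(1), of i0] VA by (auto simp: a_def \<Omega>0_def hol_function_on_def intro!: mholomorphic_on_continuous)
  define \<Omega> where "\<Omega> = \<Omega>0 \<inter> (\<lambda>z. a (?i z) $ i0) -` (- {0})"
  have "open \<Omega>" unfolding \<Omega>_def by (rule continuous_open_preimage[OF ca \<Omega>0]) auto
  then have "open (S -` \<Omega>)" using continuous_open_preimage[OF cS open_UNIV] by simp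
  moreover have "c \<in> \<Omega>0" unfolding \<Omega>0_def using ic T(2) by (metis IntI image_eqI)
  then have "0 \<in> S -` \<Omega>" using i0 by (simp add: \<Omega>_def S0)
  ultimately obtain \<rho>1 where \<rho>1: "\<rho>1 > 0" "ball 0 \<rho>1 \<subseteq> S -` \<Omega>" using open_contains_ball by blast
  have \<Omega>d: "?i z \<in> U" "?i z \<in> T" "?i z \<in> V" "\<phi> (?i z) = z" "a (?i z) $ i0 \<noteq> 0" if "z \<in> \<Omega>" for z
    using that chart_inv_image[OF ch, of z "U \<inter> T"] by (auto simp: \<Omega>_def \<Omega>0_def)
  define n where "n = real CARD('n)"
  have n: "n \<ge> 1" by (simp add: n_def Suc_le_eq)
  \<comment> \<open>The norm of a point in the box of half-width \<open>R\<close> is at most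
    \<open>2 * n * R\<close>, so the box fits into the ball of radius \<open>\<rho>1\<close>;
    moreover \<open>R \<le> r\<close>.\<close>
  define R where "R = min r \<rho>1 / (4 * n)"
  have R: "R > 0" using r \<rho>1 n by (simp add: R_def)
  have "4 * n * R = min r \<rho>1" using n by (simp add: R_def)
  moreover have "R \<le> n * R" using n R by simp
  ultimately have R': "R \<le> r" "2 * n * R < \<rho>1" using R by linarith+
  have Sbox: "S z \<in> \<Omega>" if z: "z \<in> vbox j R R" for z
  proof -
    have "norm z \<le> (\<Sum>k\<in>(UNIV :: 'n set). 2 * R)"
    proof (rule order.trans[OF norm_le_sum_vec sum_mono])
      fix k
      have "\<bar>Re (z $ k)\<bar> < R" "\<bar>Im (z $ k)\<bar> < R" using z by (cases "k = j"; auto simp: vbox_def)+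
      then show "cmod (z $ k) \<le> 2 * R" using cmod_le[of "z $ k"] by linarith
    qed
    also have "\<dots> = 2 * n * R" by (simp add: n_def)
    finally have "z \<in> ball 0 \<rho>1" using R' by simp
    then show ?thesis using \<rho>1 by auto
  qed
  define \<rho> where "\<rho> \<delta> k = (if k = j then R else \<delta>)" for \<delta> k
  have vbox: "vbox j R \<delta> = {z. \<forall>k. \<bar>Re (z $ k)\<bar> < \<rho> \<delta> k \<and> \<bar>Im (z $ k)\<bar> < \<rho> \<delta> k}" for \<delta>
  proof (intro set_eqI iffI)
    fix z assume z: "z \<in> {z. \<forall>k. \<bar>Re (z $ k)\<bar> < \<rho> \<delta> k \<and> \<bar>Im (z $ k)\<bar> < \<rho> \<delta> k}"
    then have p: "\<bar>Re (z $ k)\<bar> < \<rho> \<delta> k \<and> \<bar>Im (z $ k)\<bar> < \<rho> \<delta> k" for k by blast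
    have "\<bar>Re (z $ k)\<bar> < \<delta> \<and> \<bar>Im (z $ k)\<bar> < \<delta>" if "k \<noteq> j" for k using p[of k] that by (simp add: \<rho>_def)
    then show "z \<in> vbox j R \<delta>" using p[of j] by (simp add: vbox_def \<rho>_def)
  qed (auto simp: vbox_def \<rho>_def)
  have bc: "box_chart X A V \<phi> L S (\<rho> \<delta>)" if "0 < \<delta>" "\<delta> \<le> R" for \<delta>
  proof
    show "S ` {z. \<forall>k. \<bar>Re (z $ k)\<bar> < \<rho> \<delta> k \<and> \<bar>Im (z $ k)\<bar> < \<rho> \<delta> k} \<subseteq> \<phi> ` V"
      unfolding vbox[symmetric] using vbox_mono[OF that(2), of j R] Sbox by (force simp: \<Omega>_def \<Omega>0_def)
  qed (use man VA LS mL mS R that in \<open>auto simp: \<rho>_def\<close>)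
  \<comment> \<open>Normalized by \<open>e 0 = 1\<close>, which leaves the section unchanged at
    \<open>c\<close>; its modulus is the reciprocal of the harmonic factor in
    \<open>touch\<close>.\<close>
  define e where "e \<zeta> = exp (- (poly q \<zeta> - poly q 0))" for \<zeta>
  have e0: "e \<zeta> \<noteq> 0" "cmod (e \<zeta>) = exp (- (Re (poly q \<zeta>) - Re (poly q 0)))" for \<zeta> by (simp_all add: e_def)
  have fd: "e field_differentiable (at \<zeta>)" for \<zeta>
    unfolding e_def[abs_def] field_differentiable_def
    by (rule exI, rule DERIV_chain2[OF DERIV_exp DERIV_minus[OF DERIV_diff[OF poly_DERIV DERIV_const]]])
  have me: "mholomorphic_on (\<lambda>z :: complex^'n. e (z $ j)) UNIV"
    by (rule mholomorphic_on_field_comp[where h = e], rule mholomorphic_on_nth, rule fd)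
  define a' where "a' x = (\<chi> k. e (L (\<phi> x) $ j) * a x $ k)" for x
  define \<theta>' where "\<theta>' = frame_with E \<theta> a' i0"
  define Ud where "Ud \<delta> = box_chart.cdom V \<phi> L (\<rho> \<delta>)" for \<delta>
  \<comment> \<open>The map \<open>\<theta>'\<close> is the same for all \<open>\<delta>\<close>;
    only the domain \<open>Ud \<delta>\<close> shrinks. Hence one metric \<open>H\<close> can be
    used on all boxes.\<close>
  have frame: "is_triv X E (Ud \<delta>, \<theta>')" "holomorphic_triv X A E (Ud \<delta>, \<theta>')"
    "\<And>x v. x \<in> Ud \<delta> \<Longrightarrow> triv_point E \<theta>' x v = triv_point E \<theta> x (solve_functional i0 (a' x) v)"
    "\<And>v k. hol_function_on A (Ud \<delta>) (\<lambda>x. solve_functional i0 (a' x) v $ k)"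
    "\<And>z. z \<in> vbox j R \<delta> \<Longrightarrow> ?i (S z) \<in> Ud \<delta>"
    "L2_optimal_triple (vbox j R \<delta>) (\<lambda>z v w. h (triv_point E \<theta>' (?i (S z)) v) (triv_point E \<theta>' (?i (S z)) w))"
    "\<And>f. hol_function_on A (Ud \<delta>) f \<Longrightarrow> mholomorphic_on (\<lambda>z. f (?i (S z))) (vbox j R \<delta>)"
    if \<delta>: "0 < \<delta>" "\<delta> \<le> R" for \<delta>
  proof -
    interpret B: box_chart X A V \<phi> L S "\<rho> \<delta>" by (rule bc[OF \<delta>])
    have P: "B.P = vbox j R \<delta>" unfolding B.P_def vbox ..
    have dom: "x \<in> U" "x \<in> T" "a x $ i0 \<noteq> 0" if x: "x \<in> B.cdom" for x
    proof -
      have "S (L (\<phi> x)) \<in> \<Omega>" using x vbox_mono[OF \<delta>(2), of j R] Sbox by (auto simp: B.cdom_def P)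
      moreover have "?i (\<phi> x) = x" using x B.cdomV chart_inj[OF ch] by (auto intro: inv_into_f_f)
      ultimately show "x \<in> U" "x \<in> T" "a x $ i0 \<noteq> 0" using \<Omega>d[of "\<phi> x"] by (simp_all add: LS)
    qed
    have dom': "B.cdom \<subseteq> T" "B.cdom \<subseteq> U \<inter> T" using dom by auto
    have ha: "hol_function_on A B.cdom (\<lambda>x. a' x $ k)" for k
      using hol_function_on_mult[OF B.hol_pull_\<psi>[OF me] hol_function_on_subset[OF coeffs_hol[OF sec T(1), of k] dom'(2)]]
      by (simp add: a'_def a_def B.\<psi>_def)
    have nz: "a' x $ i0 \<noteq> 0" if "x \<in> B.cdom" for x using dom[OF that] e0 by (simp add: a'_def)
    note fr = frame_with[OF man vb T(1) B.openin_cdom dom'(1) ha nz, folded \<theta>'_def]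
    show "is_triv X E (Ud \<delta>, \<theta>')" "holomorphic_triv X A E (Ud \<delta>, \<theta>')"
      "\<And>x v. x \<in> Ud \<delta> \<Longrightarrow> triv_point E \<theta>' x v = triv_point E \<theta> x (solve_functional i0 (a' x) v)"
      "\<And>v k. hol_function_on A (Ud \<delta>) (\<lambda>x. solve_functional i0 (a' x) v $ k)"
      using fr hol_solve_functional[OF man ha nz] by (auto simp: Ud_def)
    show "?i (S z) \<in> Ud \<delta>" if "z \<in> vbox j R \<delta>" for z
      using B.inv\<psi>_in(1) that unfolding Ud_def B.inv\<psi>_def P by simp
    show "mholomorphic_on (\<lambda>z. f (?i (S z))) (vbox j R \<delta>)" if "hol_function_on A (Ud \<delta>) f" for f
      using B.hol_push that unfolding Ud_def B.inv\<psi>_def P by simp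
    have "L2_optimal_triple (B.\<psi> ` B.cdom)
        (\<lambda>z v w. h (triv_point E \<theta>' (inv_into B.cdom B.\<psi> z) v) (triv_point E \<theta>' (inv_into B.cdom B.\<psi> z) w))"
      using l2 B.holomorphic_chart B.cdom_nonempty B.connectedin_cdom B.stein_cdom fr(3)
      unfolding L2_optimal_metric_def by blast
    then show "L2_optimal_triple (vbox j R \<delta>) (\<lambda>z v w. h (triv_point E \<theta>' (?i (S z)) v) (triv_point E \<theta>' (?i (S z)) w))"
      unfolding B.\<psi>_image P
      by (rule L2_optimal_triple_cong[rotated]) (simp add: B.inv_into_\<psi>[unfolded P] B.inv\<psi>_def)
  qed
  note fR = frame[OF R order_refl]
  define H where "H z = (\<lambda>v w. h (triv_point E \<theta>' (?i (S z)) v) (triv_point E \<theta>' (?i (S z)) w))" for z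
  define H0 where "H0 z = (\<lambda>v w. h (triv_point E \<theta> (?i (S z)) v) (triv_point E \<theta> (?i (S z)) w))" for z
  define s where "s z = riesz (H z) (axis i0 1)" for z
  have ip: "hermitian_ip (H z)" if "z \<in> vbox j R R" for z
    unfolding H_def by (rule hermitian_ip_triv[OF fR(1) fR(5)[OF that] hm])
  have ip0: "hermitian_ip (H0 z)" if "z \<in> vbox j R R" for z
    unfolding H0_def by (rule hermitian_ip_triv[OF tr \<Omega>d(2)[OF Sbox[OF that]] hm])
  have cH0: "continuous_on (vbox j R R) (\<lambda>z. H0 z v w)" for v w
    unfolding H0_def
    by (rule continuous_on_compose2[OF metric_continuous[OF VA T(1), of \<Omega> v w] continuous_on_subset[OF cS subset_UNIV]])
      (use Sbox in \<open>auto simp: \<Omega>_def \<Omega>0_def\<close>)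
  have cG: "continuous_on (vbox j R R) (\<lambda>z. solve_functional i0 (a' (?i (S z))) v)" for v
    unfolding continuous_on_nth_iff by (intro allI mholomorphic_on_continuous[OF fR(7)[OF fR(4)]])
  \<comment> \<open>\<open>continuous_metric\<close> concerns the trivializations of the bundle, so
    continuity in the new frame is obtained from \<open>H0\<close> through the holomorphic change of
    frame.\<close>
  have cH: "continuous_on (vbox j R R) (\<lambda>z. H z v w)" for v w
  proof (rule continuous_on_eq)
    show "continuous_on (vbox j R R) (\<lambda>z. H0 z (solve_functional i0 (a' (?i (S z))) v) (solve_functional i0 (a' (?i (S z))) w))"
      by (rule continuous_on_hermitian[where H = H0, OF ip0 cH0 cG cG])
    show "H0 z (solve_functional i0 (a' (?i (S z))) v) (solve_functional i0 (a' (?i (S z))) w) = H z v w" if "z \<in> vbox j R R" for z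
      unfolding H0_def H_def using fR(3)[OF fR(5)[OF that]] by simp
  qed
  have cs: "continuous_on (vbox j R R) s" unfolding s_def by (rule continuous_on_riesz[OF ip cH]) auto
  have Hs: "H z v (s z) = v $ i0" if "z \<in> vbox j R R" for z v
    unfolding s_def riesz[OF ip[OF that]] by (simp add: axis_def if_distrib sum.If_cases cong del: if_weak_cong)
  \<comment> \<open>By construction the functional \<open>v \<mapsto> v $ i0\<close> is
    \<open>e\<close> times the section. So the section is represented by \<open>s z\<close> divided
    by the conjugate of \<open>e\<close>, and comparing squared norms gives the factor
    \<open>|e|^2\<close>.\<close>
  have key: "Re (s z $ i0) = (cmod (e (z $ j)))\<^sup>2 * (g (S z))\<^sup>2" if z: "z \<in> vbox j R R" for z
  proof -
    let ?x = "?i (S z)" and ?k = "inverse (e (z $ j))"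
    note od = \<Omega>d[OF Sbox[OF z]]
    note hs = hermitian_ip_simps[OF ip[OF z]]
    note tp' = triv_point_simps[OF fR(1) fR(5)[OF z]]
    have ez: "L (\<phi> ?x) $ j = z $ j" by (simp add: od(4) LS)
    have "u ?x (triv_point E \<theta>' ?x v) = H z v (cnj ?k *s s z)" for v
    proof -
      let ?b = "triv_point E \<theta>' ?x v"
      have "v $ i0 = \<theta>' ?b $ i0" by (simp add: tp'(2))
      also have "\<dots> = (\<Sum>k\<in>UNIV. \<theta> ?b $ k * (e (z $ j) * a ?x $ k))"
        by (simp add: \<theta>'_def frame_with_def put_functional_def tp'(3)[unfolded \<theta>'_def] a'_def ez)
      also have "\<dots> = e (z $ j) * u ?x (triv_point E \<theta> ?x (\<theta> ?b))"
        unfolding section_expand[OF sec T(1) od(1,2)] by (simp add: a_def sum_distrib_left mult_ac)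
      also have "triv_point E \<theta> ?x (\<theta> ?b) = ?b" by (rule triv_point_simps(4)[OF tr od(2) tp'(1)])
      finally show ?thesis using e0 by (simp add: hs(6) Hs[OF z])
    qed
    then have "g (S z) = sqrt (Re (H z (cnj ?k *s s z) (cnj ?k *s s z)))"
      unfolding g_def H_def by (rule dual_norm_riesz[OF fR(1) fR(5)[OF z] hm])
    also have "H z (cnj ?k *s s z) (cnj ?k *s s z) = of_real ((cmod ?k)\<^sup>2) * (s z $ i0)"
      unfolding hs(2) hs(6) Hs[OF z] complex_norm_square by (simp add: mult_ac)
    also have "Re (of_real ((cmod ?k)\<^sup>2) * (s z $ i0)) = (cmod ?k)\<^sup>2 * Re (s z $ i0)" by simp
    finally have gs: "(g (S z))\<^sup>2 = (cmod ?k)\<^sup>2 * Re (s z $ i0)"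
      using hs(14)[of "s z"] by (simp add: Hs[OF z])
    have "(cmod (e (z $ j)))\<^sup>2 * (cmod ?k)\<^sup>2 = 1"
      unfolding power_mult_distrib[symmetric] norm_mult[symmetric] using e0(1)[of "z $ j"] by simp
    then show ?thesis by (simp only: gs mult.assoc[symmetric] mult_1_left)
  qed
  \<comment> \<open>The disc of radius \<open>R / 2\<close>, well inside the box.\<close>
  define b where "b = R\<^sup>2 / 4"
  have b: "0 < b" "b < R\<^sup>2" using R by (auto simp: b_def)
  have small: "cmod \<zeta> < R" if "(cmod \<zeta>)\<^sup>2 \<le> b" for \<zeta>
    using power2_less_imp_less[of "cmod \<zeta>" R] that b R by auto
  have axin: "axis j \<zeta> \<in> vbox j R R" if "cmod \<zeta> < R" for \<zeta>
    using that abs_Re_le_cmod[of \<zeta>] abs_Im_le_cmod[of \<zeta>] R by (auto simp: vbox_def axis_def)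
  have s0: "Re (s 0 $ i0) = (g c)\<^sup>2"
    using key[OF axin[of 0]] R unfolding ax0 by (simp add: S0 e0)
  show False
  \<comment> \<open>The quantity that is touched is the square of the dual norm, hence
    \<open>2 * \<epsilon>\<close>.\<close>
  proof (rule no_local_touching[where H = H and s = s and R = R and ?\<delta>0.0 = R and b = b and ?\<epsilon>0.0 = "2 * \<epsilon>" and j = j and ?i0.0 = i0])
    show "L2_optimal_triple (vbox j R \<delta>) H" if "0 < \<delta>" "\<delta> \<le> R" for \<delta> unfolding H_def[abs_def] by (rule frame(6)[OF that])
    show "0 < Re (s 0 $ i0)" using s0 pos by simp
    fix \<zeta> assume z: "(cmod \<zeta>)\<^sup>2 \<le> b"
    define d where "d = Re (poly q \<zeta>) - Re (poly q 0)"
    have gp: "0 \<le> g (c + \<zeta> *s w)"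
      using dual_norm_section[OF sec T(1) \<Omega>d(1,2)[OF Sbox[OF axin[OF small[OF z]]]]]
        hermitian_ip_simps(14)[OF ip0[OF axin[OF small[OF z]]]]
      unfolding g_def Sax[symmetric] H0_def by simp
    have "Re (s (axis j \<zeta>) $ i0) = (exp (- d) * g (c + \<zeta> *s w))\<^sup>2"
      using key[OF axin[OF small[OF z]]] by (simp add: Sax e0 d_def power_mult_distrib)
    also have "\<dots> \<le> (exp (- d) * (g c * exp (d - \<epsilon> * (cmod \<zeta>)\<^sup>2)))\<^sup>2"
      using touch[of \<zeta>] small[OF z] R' gp by (intro power_mono mult_left_mono) (auto simp: d_def)
    also have "\<dots> = Re (s 0 $ i0) * exp (- (2 * \<epsilon>) * (cmod \<zeta>)\<^sup>2)"
      unfolding s0 by (simp add: power_mult_distrib power2_eq_square mult_ac flip: exp_add)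
    finally show "Re (s (axis j \<zeta>) $ i0) \<le> Re (s 0 $ i0) * exp (- (2 * \<epsilon>) * (cmod \<zeta>)\<^sup>2)" .
  qed (use R b \<epsilon> ip cH cs Hs in auto)
qed

text \<open>Sublevel sets are open since the norm is continuous. If the mean value inequality failed
  on a disc, \<open>submean_or_touching\<close> would give a touching point inside it, and
  \<open>no_touching_disc\<close> applies to a smaller disc around that point.\<close>

lemma psh_log_dual_norm:
  assumes VA: "(V, \<phi>) \<in> A" and U: "openin X U" and sec: "hol_dual_section A E U u"
  shows "psh_on (\<phi> ` (U \<inter> V)) (\<lambda>z. log_ereal (dual_norm E h (inv_into V \<phi> z) (u (inv_into V \<phi> z))))"
proof -
  define g where "g z = dual_norm E h (inv_into V \<phi> z) (u (inv_into V \<phi> z))" for z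
  define D where "D = \<phi> ` (U \<inter> V)"
  note ch = manifold_charts[OF man VA]
  have D: "open D" unfolding D_def by (rule chart_open_image[OF ch U])
  have cg: "continuous_on D g" unfolding D_def g_def by (rule dual_norm_continuous[OF VA U sec])
  have g0: "g z \<ge> 0" if "z \<in> D" for z
  proof -
    have z: "inv_into V \<phi> z \<in> U" using chart_inv_image[OF ch that[unfolded D_def]] by auto
    then obtain T \<theta> where T: "(T, \<theta>) \<in> trivs E" "inv_into V \<phi> z \<in> T"
      using triv_at[of "inv_into V \<phi> z"] openin_subset[OF U] by blast
    show ?thesis unfolding g_def dual_norm_section[OF sec T(1) z T(2)]
      using hermitian_ip_simps(14)[OF hermitian_ip_triv[OF trivs[OF T(1)] T(2) hm]] by simp
  qed
  have "open {z \<in> D. log_ereal (g z) < c}" for c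
  proof (cases c)
    case (real r)
    have "{z \<in> D. log_ereal (g z) < c} = D \<inter> g -` {..<exp r}"
    proof (rule set_eqI)
      fix z
      have "(log_ereal x < c) = (x < exp r)" if "x \<ge> 0" for x
        using that real ln_less_cancel_iff[of x "exp r"] by (cases "x = 0") (auto simp: log_ereal_def)
      then show "z \<in> {z \<in> D. log_ereal (g z) < c} \<longleftrightarrow> z \<in> D \<inter> g -` {..<exp r}" using g0 by auto
    qed
    then show ?thesis using continuous_open_preimage[OF cg D open_lessThan] by simp
  next
    case PInf
    then have "{z \<in> D. log_ereal (g z) < c} = D" by (auto simp: log_ereal_def)
    then show ?thesis using D by simp
  qed auto
  moreover have "log_ereal (g z) \<le> circle_mean (\<lambda>\<zeta>. log_ereal (g (z + \<zeta> *s w)))"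
    if disc: "\<And>\<zeta>. cmod \<zeta> \<le> 1 \<Longrightarrow> z + \<zeta> *s w \<in> D" for z w
  proof (rule ccontr)
    assume fail: "\<not> log_ereal (g z) \<le> circle_mean (\<lambda>\<zeta>. log_ereal (g (z + \<zeta> *s w)))"
    \<comment> \<open>Extended by 0 outside the closed disc, because
      \<open>submean_or_touching\<close> asks for a function that is nonnegative everywhere, whereas
      \<open>g\<close> is known to be so on \<open>D\<close> only.\<close>
    define f where "f \<zeta> = (if cmod \<zeta> \<le> 1 then g (z + \<zeta> *s w) else 0)" for \<zeta>
    have zD: "z \<in> D" using disc[of 0] by simp
    have f0: "f 0 = g z" by (simp add: f_def)
    have cl: "continuous_on (cball 0 1) (\<lambda>\<zeta>. z + \<zeta> *s w)"
      by (intro continuous_intros continuous_on_smult_vec)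
    have "continuous_on (cball 0 1) (\<lambda>\<zeta>. g (z + \<zeta> *s w))"
      by (rule continuous_on_compose2[OF cg cl]) (use disc in auto)
    then have cf: "continuous_on (cball 0 1) f" by (rule continuous_on_eq) (simp add: f_def)
    have f_nonneg: "f \<zeta> \<ge> 0" for \<zeta> using disc g0 by (auto simp: f_def)
    have "circle_mean (\<lambda>\<zeta>. log_ereal (f \<zeta>)) = circle_mean (\<lambda>\<zeta>. log_ereal (g (z + \<zeta> *s w)))"
      by (simp add: circle_mean_def f_def)
    with fail have "\<not> log_ereal (f 0) \<le> circle_mean (\<lambda>\<zeta>. log_ereal (f \<zeta>))" by (simp add: f0)
    from submean_or_touching[OF cf f_nonneg this] obtain z0 p \<epsilon> where t: "cmod z0 < 1" "\<epsilon> > 0" "f z0 > 0"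
      "\<And>\<zeta>. cmod \<zeta> \<le> 1 \<Longrightarrow> f \<zeta> \<le> f z0 * exp (Re (poly p \<zeta>) - Re (poly p z0) - \<epsilon> * (cmod (\<zeta> - z0))\<^sup>2)" by metis
    \<comment> \<open>A constant disc gives no complex line to straighten, so \<open>w = 0\<close>
      is refuted directly, since the mean of a constant is that constant.\<close>
    show False
    proof (cases "w = 0")
      case True
      have fc: "f \<zeta> = g z" if "cmod \<zeta> \<le> 1" for \<zeta> using that True by (simp add: f_def)
      then have gz: "g z > 0" using t(1,3) by simp
      have "ereal (ln (g z)) \<le> circle_mean (\<lambda>\<zeta>. log_ereal (f \<zeta>))"
      proof (rule circle_mean_lower[OF cf f_nonneg])
        fix m :: nat assume "m \<ge> 1"
        have "ln (g z) \<le> ln (max (g z) (1 / real m))" using gz by (subst ln_le_cancel_iff) auto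
        then show "2 * pi * ln (g z) \<le> integral {0..2 * pi} (\<lambda>t. ln (max (f (cis t)) (1 / real m)))" by (simp add: fc)
      qed
      then show False using \<open>\<not> log_ereal (f 0) \<le> circle_mean (\<lambda>\<zeta>. log_ereal (f \<zeta>))\<close> gz by (simp add: f0 log_ereal_def)
    next
      case False
      define c where "c = z + z0 *s w"
      have sh: "c + \<zeta> *s w = z + (z0 + \<zeta>) *s w" for \<zeta> by (simp add: c_def vec_eq_iff algebra_simps)
      have fz0: "f z0 = g c" using t(1) by (simp add: f_def c_def)
      show False
      \<comment> \<open>The disc is recentred at the touching point; the radius
        \<open>1 - cmod z0\<close> keeps it inside the original one, and the polynomial is shifted
        accordingly.\<close>
      proof (rule no_touching_disc[OF VA U sec False _ t(2), of "1 - cmod z0" c "p \<circ>\<^sub>p [:z0, 1:]"], fold g_def)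
        show "0 < 1 - cmod z0" using t by simp
        show "c \<in> \<phi> ` (U \<inter> V)" using disc[of z0] t(1) by (simp add: c_def D_def)
        show "0 < g c" using t(3) fz0 by simp
        fix \<zeta> assume "cmod \<zeta> \<le> 1 - cmod z0"
        then have le: "cmod (z0 + \<zeta>) \<le> 1" using norm_triangle_ineq[of z0 \<zeta>] by linarith
        show "g (c + \<zeta> *s w) \<le> g c * exp (Re (poly (p \<circ>\<^sub>p [:z0, 1:]) \<zeta>) - Re (poly (p \<circ>\<^sub>p [:z0, 1:]) 0) - \<epsilon> * (cmod \<zeta>)\<^sup>2)"
          using t(4)[OF le] le unfolding fz0 sh by (simp add: f_def poly_pcompose)
      qed
    qed
  qed
  ultimately show ?thesis unfolding psh_on_def g_def[symmetric] D_def[symmetric]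
    by (auto simp: log_ereal_def)
qed

end

theorem theorem1p5:
  fixes X :: "'a topology"
    and A :: "('a, 'n::finite) chart set"
    and E :: "('a, 'e, 'r::finite) vbundle"
    and h :: "'e \<Rightarrow> 'e \<Rightarrow> complex"
  assumes "complex_manifold X A"
    and "holomorphic_vector_bundle X A E"
    and "hermitian_metric X E h"
    and "continuous_metric X E h"
    and "L2_optimal_metric X A E h"
  shows "griffiths_semipositive X A E h"
proof -
  interpret optimal_bundle X A E h by (rule optimal_bundle.intro) fact+
  show ?thesis unfolding griffiths_semipositive_def psh_function_on_def
    by (auto intro: psh_log_dual_norm)
qed

end
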